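(* Let $f:(\mathbb{C},0)\to(\mathbb{C}^2,0)$ be a corank 1 finitely determined holomorphic map germ. Let $f_s$ be a stabilisation of $f$, with disentanglement $X_s$ (the image of $f_s$, $s\neq 0$ small), stratified by stable types. Let $p:\mathbb{C}^2\to\mathbb{C}$ be a generic linear projection. Then $$\#\Sigma(p|_{X_s})=\mu_I(f)+m_0(f)-1,$$ where $\#\Sigma(p|_{X_s})$ is the number of critical points of $p|_{X_s}$ as a stratified Morse function, $\mu_I(f)$ is the image Milnor number of $f$, and $m_0(f)$ is the multiplicity of $f$.
   Context: All maps are holomorphic. A germ $f:(\mathbb{C}^n,0)\to(\mathbb{C}^{n+1},0)$ has corank 1 if its differential at $0$ has rank $n-1$; here $n=1$. Finitely determined means finitely determined for $\mathcal{A}$-equivalence (holomorphic changes of coordinates in source and target). Stabilisation and disentanglement. A stabilisation of $f$ is a 1-parameter unfolding $F(x,s)=(f_s(x),s)$ of $f$ (so $f_0=f$) such that, for a suitable representative on a sufficiently small neighbourhood of the origin (with target a small ball $B_\epsilon$), $f_s$ is a locally stable map for all $0<|s|\ll\epsilon$. The disentanglement $X_s$ is the image of this representative of $f_s$ (inside $B_\epsilon$), for $s\neq0$ sufficiently small. By a theorem of Mond, $X_s$ has the homotopy type of a bouquet of $n$-spheres, and the number of these spheres is the image Milnor number $\mu_I(f)=\dim_{\mathbb{Q}}H_n(X_s,\mathbb{Q})$. Stratification. For $n=1$, $f_s$ ($s\ne0$) is an immersion whose only singularities are transverse double points. $X_s$ is stratified by the 0-dimensional stratum $M^2(f_s,(1,1))$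 consisting of the transverse double points, and the 1-dimensional stratum $M^1(f_s,(1))$ consisting of the smooth points of $X_s$. Genericity and critical points. The linear projection $p$ is taken generic, so that $p^{-1}(0)$ is a generic hyperplane (line) through the origin and $p|_{X_s}:X_s\to\mathbb{C}$ is a stratified Morse function in the sense of Goresky–MacPherson; in particular its restriction to each stratum is a Morse function. A critical point of $p|_{X_s}$ is a critical point of the restriction of $p$ to some stratum, every point of a 0-dimensional stratum being critical. $\#\Sigma(p|_{X_s})$ is the total number of such points. Multiplicity. $m_0(f)$ is the multiplicity at $0$ of the plane curve parametrized by $f$, i.e. the minimum of the orders of vanishing at $0$ of the components of $f$. *)

theory Defs
  imports "HOL-Complex_Analysis.Complex_Analysis" "HOL-Homology.Homology"
    "HOL-Library.Extended_Nat"
begin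

section \<open>Holomorphic maps between the spaces \<open>\<complex>\<^sup>k\<close>\<close>

text \<open>
  \<open>\<complex>\<^sup>2\<close> is \<open>complex \<times> complex\<close>, whose norm is the Euclidean one. A map between
  complex normed spaces is holomorphic when it has a complex linear Frechet derivative.
\<close>

class complex_normed_vector = real_normed_vector +
  fixes scaleC :: "complex \<Rightarrow> 'a \<Rightarrow> 'a"
  assumes scaleC_add_right: "scaleC c (x + y) = scaleC c x + scaleC c y"
    and scaleC_add_left: "scaleC (c + d) x = scaleC c x + scaleC d x"
    and scaleC_scaleC: "scaleC c (scaleC d x) = scaleC (c * d) x"
    and scaleC_of_real: "scaleC (of_real r) x = r *\<^sub>R x"

instantiation complex :: complex_normed_vector
begin
definition scaleC_complex :: "complex \<Rightarrow> complex \<Rightarrow> complex"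
  where "scaleC_complex c x = c * x"
instance
  by standard (simp_all add: scaleC_complex_def algebra_simps scaleR_conv_of_real)
end

instantiation prod :: (complex_normed_vector, complex_normed_vector) complex_normed_vector
begin
definition scaleC_prod :: "complex \<Rightarrow> 'a \<times> 'b \<Rightarrow> 'a \<times> 'b"
  where "scaleC_prod c z = (scaleC c (fst z), scaleC c (snd z))"
instance
  by standard
    (simp_all add: scaleC_prod_def scaleC_add_right scaleC_add_left scaleC_scaleC
      scaleC_of_real scaleR_prod_def)
end

definition holomorphic_map_on ::
    "('a::complex_normed_vector \<Rightarrow> 'b::complex_normed_vector) \<Rightarrow> 'a set \<Rightarrow> bool"
  where "holomorphic_map_on f U \<longleftrightarrow>
    (\<forall>z\<in>U. \<exists>D. (f has_derivative D) (at z) \<and> (\<forall>c v. D (scaleC c v) = scaleC c (D v)))"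

lemma holomorphic_map_on_complex:
  fixes f :: "complex \<Rightarrow> complex"
  assumes "open U"
  shows "holomorphic_map_on f U \<longleftrightarrow> f holomorphic_on U"
proof -
  have "(\<exists>D. (f has_derivative D) (at z) \<and> (\<forall>c v. D (scaleC c v) = scaleC c (D v))) \<longleftrightarrow>
      (\<exists>d. (f has_field_derivative d) (at z))" for z
  proof
    assume "\<exists>D. (f has_derivative D) (at z) \<and> (\<forall>c v. D (scaleC c v) = scaleC c (D v))"
    then obtain D where D: "(f has_derivative D) (at z)" "\<And>c v. D (c * v) = c * D v"
      unfolding scaleC_complex_def by blast
    have "D = (*) (D 1)"
    proof
      fix v show "D v = D 1 * v" using D(2)[of v 1] by simp
    qed
    then have "(f has_field_derivative D 1) (at z)"
      using D(1) unfolding has_field_derivative_def by metis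
    then show "\<exists>d. (f has_field_derivative d) (at z)" ..
  next
    assume "\<exists>d. (f has_field_derivative d) (at z)"
    then obtain d where "(f has_derivative (*) d) (at z)"
      unfolding has_field_derivative_def by blast
    then show "\<exists>D. (f has_derivative D) (at z) \<and> (\<forall>c v. D (scaleC c v) = scaleC c (D v))"
      unfolding scaleC_complex_def by (intro exI[of _ "(*) d"]) (simp add: mult.left_commute)
  qed
  then show ?thesis
    unfolding holomorphic_map_on_def holomorphic_on_open[OF assms] by (rule ball_cong[OF refl])
qed

definition holomorphic_near ::
    "('a::complex_normed_vector \<Rightarrow> 'b::complex_normed_vector) \<Rightarrow> 'a set \<Rightarrow> bool"
  where "holomorphic_near f A \<longleftrightarrow> (\<exists>U. open U \<and> A \<subseteq> U \<and> holomorphic_map_on f U)"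

definition curve_deriv :: "(complex \<Rightarrow> complex \<times> complex) \<Rightarrow> complex \<Rightarrow> complex \<times> complex"
  where "curve_deriv f t = (deriv (fst \<circ> f) t, deriv (snd \<circ> f) t)"


section \<open>Germs and \<open>\<A>\<close>-equivalence\<close>

text \<open>Germs are given by representatives; values far from the base point are irrelevant.\<close>

definition map_germ :: "(complex \<Rightarrow> complex \<times> complex) \<Rightarrow> bool"
  where "map_germ f \<longleftrightarrow> f 0 = 0 \<and> holomorphic_near f {0}"

text \<open>The differential at 0 is \<open>v \<mapsto> scaleC v (curve_deriv f 0)\<close>; its rank has to be \<open>n - 1 = 0\<close>.\<close>

definition corank_one :: "(complex \<Rightarrow> complex \<times> complex) \<Rightarrow> bool"
  where "corank_one f \<longleftrightarrow> curve_deriv f 0 = 0"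

definition vanishing_order :: "(complex \<Rightarrow> complex) \<Rightarrow> enat"
  where "vanishing_order g = (INF k\<in>{k. (deriv ^^ k) g 0 \<noteq> 0}. enat k)"

definition multiplicity_germ :: "(complex \<Rightarrow> complex \<times> complex) \<Rightarrow> nat"
  where "multiplicity_germ f =
    the_enat (min (vanishing_order (fst \<circ> f)) (vanishing_order (snd \<circ> f)))"

definition biholomorphic_germ :: "('a::complex_normed_vector \<Rightarrow> 'a) \<Rightarrow> bool"
  where "biholomorphic_germ \<phi> \<longleftrightarrow> \<phi> 0 = 0 \<and> holomorphic_near \<phi> {0} \<and>
    (\<exists>\<psi>. \<psi> 0 = 0 \<and> holomorphic_near \<psi> {0} \<and>
      (\<forall>\<^sub>F z in nhds 0. \<psi> (\<phi> z) = z) \<and> (\<forall>\<^sub>F z in nhds 0. \<phi> (\<psi> z) = z))"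

definition A_equivalent ::
    "(complex \<Rightarrow> complex \<times> complex) \<Rightarrow> (complex \<Rightarrow> complex \<times> complex) \<Rightarrow> bool"
  where "A_equivalent f g \<longleftrightarrow>
    (\<exists>\<phi> \<psi>. biholomorphic_germ \<phi> \<and> biholomorphic_germ \<psi> \<and>
      (\<forall>\<^sub>F t in nhds 0. \<psi> (f t) = g (\<phi> t)))"

definition same_jet ::
    "nat \<Rightarrow> (complex \<Rightarrow> complex \<times> complex) \<Rightarrow> (complex \<Rightarrow> complex \<times> complex) \<Rightarrow> bool"
  where "same_jet k f g \<longleftrightarrow>
    (\<forall>i\<le>k. (deriv ^^ i) (fst \<circ> f) 0 = (deriv ^^ i) (fst \<circ> g) 0 \<and>
           (deriv ^^ i) (snd \<circ> f) 0 = (deriv ^^ i) (snd \<circ> g) 0)"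

definition finitely_determined :: "(complex \<Rightarrow> complex \<times> complex) \<Rightarrow> bool"
  where "finitely_determined f \<longleftrightarrow>
    (\<exists>k. \<forall>g. map_germ g \<and> same_jet k f g \<longrightarrow> A_equivalent f g)"


section \<open>Stable maps\<close>

text \<open>
  The multi-germ of \<open>f\<close> at the finite set \<open>S\<close>, with \<open>f\<close> constantly \<open>y\<close> on \<open>S\<close>, is stable when every
  unfolding is trivial. An unfolding is written \<open>(x, l) \<mapsto> (\<phi> (x, l), l)\<close>; triviality means that it
  becomes \<open>f \<times> id\<close> after composition with unfoldings \<open>h\<close> and \<open>H\<close> of the two identity germs, which
  need not fix the base points for \<open>l \<noteq> 0\<close>. One unfolding parameter suffices: differentiating the
  trivialisation of \<open>f + l \<xi>\<close> at \<open>l = 0\<close> gives infinitesimal stability, which by Mather's theorem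
  implies that unfoldings with any number of parameters are trivial.
\<close>

definition trivial_unfolding ::
    "(complex \<Rightarrow> complex \<times> complex) \<Rightarrow> complex set \<Rightarrow> complex \<times> complex \<Rightarrow>
     (complex \<times> complex \<Rightarrow> complex \<times> complex) \<Rightarrow> bool"
  where "trivial_unfolding f S y \<phi> \<longleftrightarrow>
    (\<exists>(h :: complex \<times> complex \<Rightarrow> complex)
      (H :: (complex \<times> complex) \<times> complex \<Rightarrow> complex \<times> complex).
       holomorphic_near h (S \<times> {0}) \<and> (\<forall>x0\<in>S. \<forall>\<^sub>F x in nhds x0. h (x, 0) = x) \<and>
       holomorphic_near H {(y, 0)} \<and> (\<forall>\<^sub>F z in nhds y. H (z, 0) = z) \<and>
       (\<forall>x0\<in>S. \<forall>\<^sub>F (x, l) in nhds (x0, 0). \<phi> (h (x, l), l) = H (f x, l)))"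

definition stable_multigerm ::
    "(complex \<Rightarrow> complex \<times> complex) \<Rightarrow> complex set \<Rightarrow> complex \<times> complex \<Rightarrow> bool"
  where "stable_multigerm f S y \<longleftrightarrow>
    (\<forall>\<phi>. holomorphic_near \<phi> (S \<times> {0}) \<and> (\<forall>x0\<in>S. \<forall>\<^sub>F x in nhds x0. \<phi> (x, 0) = f x) \<longrightarrow>
      trivial_unfolding f S y \<phi>)"

definition locally_stable_on :: "(complex \<Rightarrow> complex \<times> complex) \<Rightarrow> complex set \<Rightarrow> bool"
  where "locally_stable_on f D \<longleftrightarrow> holomorphic_map_on f D \<and>
    (\<forall>S y. finite S \<and> S \<noteq> {} \<and> S \<subseteq> D \<and> f ` S = {y} \<longrightarrow> stable_multigerm f S y)"


section \<open>Stabilisations and disentanglements\<close>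

text \<open>
  A one-parameter unfolding \<open>(x, s) \<mapsto> (f\<^sub>s x, s)\<close> is given by \<open>F (x, s) = f\<^sub>s x\<close>. Its representative
  has source \<open>source_dom F r \<epsilon> s\<close> (the part of the disc of radius \<open>r\<close> that \<open>f\<^sub>s\<close> maps into the target
  ball of radius \<open>\<epsilon>\<close>).
\<close>

definition source_dom ::
    "(complex \<times> complex \<Rightarrow> complex \<times> complex) \<Rightarrow> real \<Rightarrow> real \<Rightarrow> complex \<Rightarrow> complex set"
  where "source_dom F r \<epsilon> s = {x \<in> ball 0 r. F (x, s) \<in> ball 0 \<epsilon>}"

definition disentanglement ::
    "(complex \<times> complex \<Rightarrow> complex \<times> complex) \<Rightarrow> real \<Rightarrow> real \<Rightarrow> complex \<Rightarrow> (complex \<times> complex) set"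
  where "disentanglement F r \<epsilon> s = (\<lambda>x. F (x, s)) ` source_dom F r \<epsilon> s"

definition stabilisation ::
    "(complex \<Rightarrow> complex \<times> complex) \<Rightarrow> (complex \<times> complex \<Rightarrow> complex \<times> complex) \<Rightarrow> bool"
  where "stabilisation f F \<longleftrightarrow> holomorphic_near F {0} \<and> (\<forall>\<^sub>F x in nhds 0. F (x, 0) = f x) \<and>
    (\<exists>r>0. \<exists>\<epsilon>>0. \<exists>\<delta>>0. \<forall>s. 0 < norm s \<and> norm s < \<delta> \<longrightarrow>
      locally_stable_on (\<lambda>x. F (x, s)) (source_dom F r \<epsilon> s))"

text \<open>
  The choices are made in the order \<open>r\<close>, \<open>\<epsilon>\<close>, \<open>s\<close>, each small in terms of the previous ones;
  the filter \<open>at 0\<close> excludes \<open>s = 0\<close>.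
\<close>

definition for_small :: "(real \<Rightarrow> real \<Rightarrow> complex \<Rightarrow> bool) \<Rightarrow> bool"
  where "for_small P \<longleftrightarrow>
    (\<forall>\<^sub>F r in at_right 0. \<forall>\<^sub>F \<epsilon> in at_right 0. \<forall>\<^sub>F s in at 0. P r \<epsilon> s)"


section \<open>Rational homology and the image Milnor number\<close>

type_synonym 'a rat_chain = "((nat \<Rightarrow> real) \<Rightarrow> 'a) \<Rightarrow>\<^sub>0 rat"

definition rat_scale :: "rat \<Rightarrow> ('b \<Rightarrow>\<^sub>0 rat) \<Rightarrow> ('b \<Rightarrow>\<^sub>0 rat)"
  where "rat_scale q c = Poly_Mapping.map ((*) q) c"

definition rat_chains :: "nat \<Rightarrow> 'a topology \<Rightarrow> 'a rat_chain set"
  where "rat_chains n X = {c. Poly_Mapping.keys c \<subseteq> singular_simplex_set n X}"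

text \<open>The \<open>\<rat>\<close>-linear extension of the integral boundary operator.\<close>

definition rat_boundary :: "nat \<Rightarrow> 'a rat_chain \<Rightarrow> 'a rat_chain"
  where "rat_boundary n c =
    (\<Sum>\<sigma>\<in>Poly_Mapping.keys c. rat_scale (Poly_Mapping.lookup c \<sigma>)
       (Poly_Mapping.map of_int (chain_boundary n (frag_of \<sigma>))))"

definition rat_cycles :: "nat \<Rightarrow> 'a topology \<Rightarrow> 'a rat_chain set"
  where "rat_cycles n X = {c \<in> rat_chains n X. rat_boundary n c = 0}"

definition rat_boundaries :: "nat \<Rightarrow> 'a topology \<Rightarrow> 'a rat_chain set"
  where "rat_boundaries n X = rat_boundary (Suc n) ` rat_chains (Suc n) X"

text \<open>
  \<open>dim\<^sub>\<rat> H\<^sub>n(X;\<rat>) = d\<close>: there are \<open>d\<close> cycles whose classes form a basis of cycles modulo boundaries.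
\<close>

definition rat_homology_dim :: "nat \<Rightarrow> 'a topology \<Rightarrow> nat \<Rightarrow> bool"
  where "rat_homology_dim n X d \<longleftrightarrow>
    (\<exists>B. finite B \<and> card B = d \<and> B \<subseteq> rat_cycles n X \<and>
      (\<forall>z\<in>rat_cycles n X. \<exists>!q. (\<forall>b. b \<notin> B \<longrightarrow> q b = 0) \<and>
         z - (\<Sum>b\<in>B. rat_scale (q b) b) \<in> rat_boundaries n X))"

text \<open>The common value of \<open>dim\<^sub>\<rat> H\<^sub>1(X\<^sub>s;\<rat>)\<close> for all stabilisations (well defined by Mond's theorem).\<close>

definition image_milnor_number :: "(complex \<Rightarrow> complex \<times> complex) \<Rightarrow> nat"
  where "image_milnor_number f =
    (THE \<mu>. \<forall>F. stabilisation f F \<longrightarrow>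
       for_small (\<lambda>r \<epsilon> s. rat_homology_dim 1 (top_of_set (disentanglement F r \<epsilon> s)) \<mu>))"


section \<open>Stratified Morse theory on the disentanglement\<close>

text \<open>
  Below, \<open>g\<close> is \<open>f\<^sub>s\<close> on the source \<open>D\<close> of the representative, and the strata lie in \<open>X\<^sub>s = g ` D\<close>.
\<close>

definition double_point_stratum ::
    "(complex \<Rightarrow> complex \<times> complex) \<Rightarrow> complex set \<Rightarrow> (complex \<times> complex) set"
  where "double_point_stratum g D =
    {y. \<exists>t u. t \<noteq> u \<and> {x \<in> D. g x = y} = {t, u} \<and>
       (\<forall>a b. scaleC a (curve_deriv g t) + scaleC b (curve_deriv g u) = 0 \<longrightarrow> a = 0 \<and> b = 0)}"

definition smooth_stratum ::
    "(complex \<Rightarrow> complex \<times> complex) \<Rightarrow> complex set \<Rightarrow> (complex \<times> complex) set"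
  where "smooth_stratum g D =
    {y. \<exists>t. {x \<in> D. g x = y} = {t} \<and> curve_deriv g t \<noteq> 0}"

text \<open>
  The map \<open>g\<close> parametrises the 1-dimensional stratum as a complex curve, so there the critical
  points of the restriction of \<open>p\<close> are those of \<open>p \<circ> g\<close>.
\<close>

definition smooth_critical_params ::
    "(complex \<times> complex \<Rightarrow> complex) \<Rightarrow> (complex \<Rightarrow> complex \<times> complex) \<Rightarrow> complex set \<Rightarrow> complex set"
  where "smooth_critical_params p g D =
    {t \<in> D. g t \<in> smooth_stratum g D \<and> deriv (p \<circ> g) t = 0}"

definition stratified_critical_points ::
    "(complex \<times> complex \<Rightarrow> complex) \<Rightarrow> (complex \<Rightarrow> complex \<times> complex) \<Rightarrow> complex set \<Rightarrow>
     (complex \<times> complex) set"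
  where "stratified_critical_points p g D =
    double_point_stratum g D \<union> g ` smooth_critical_params p g D"

text \<open>
  The conditions of Goresky and MacPherson: critical points on strata are nondegenerate; at a point
  of the 0-dimensional stratum, \<open>p\<close> does not vanish on a generalised tangent space (these are the
  tangent lines of the two branches); critical values are distinct. Their requirement
  that \<open>p\<close> be proper concerns the behaviour at the boundary of the ball and is not imposed here.
\<close>

definition stratified_morse ::
    "(complex \<times> complex \<Rightarrow> complex) \<Rightarrow> (complex \<Rightarrow> complex \<times> complex) \<Rightarrow> complex set \<Rightarrow> bool"
  where "stratified_morse p g D \<longleftrightarrow>
    (\<forall>t\<in>smooth_critical_params p g D. deriv (deriv (p \<circ> g)) t \<noteq> 0) \<and>
    (\<forall>t\<in>D. g t \<in> double_point_stratum g D \<longrightarrow> p (curve_deriv g t) \<noteq> 0) \<and>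
    inj_on p (stratified_critical_points p g D)"

definition linear_projection :: "(complex \<times> complex \<Rightarrow> complex) \<Rightarrow> bool"
  where "linear_projection p \<longleftrightarrow> (\<exists>a b. (a, b) \<noteq> (0, 0) \<and> p = (\<lambda>z. a * fst z + b * snd z))"

text \<open>Limits of complex multiples of points of the image of \<open>f\<close> that tend to the origin.\<close>

definition tangent_cone :: "(complex \<Rightarrow> complex \<times> complex) \<Rightarrow> (complex \<times> complex) set"
  where "tangent_cone f =
    {v. \<exists>t c. t \<longlonglongrightarrow> 0 \<and> (\<lambda>k::nat. scaleC (c k) (f (t k))) \<longlonglongrightarrow> v}"

text \<open>
  The line \<open>p\<^sup>-\<^sup>1(0)\<close> is generic with respect to the germ \<open>f\<close>: it meets the tangent cone of the image
  only in 0. The other part of genericity, that \<open>p\<close> is a stratified Morse function on \<open>X\<^sub>s\<close>, depends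
  on \<open>s\<close> and is required separately.
\<close>

definition generic_kernel ::
    "(complex \<Rightarrow> complex \<times> complex) \<Rightarrow> (complex \<times> complex \<Rightarrow> complex) \<Rightarrow> bool"
  where "generic_kernel f p \<longleftrightarrow> (\<forall>v\<in>tangent_cone f. p v = 0 \<longrightarrow> v = 0)"

end

theory Submission
  imports Defs
begin

text \<open>
  The stable map \<open>f\<^sub>s\<close> is an immersion with transverse double points and no triple points. On a source
  disc that is star-shaped, because the norm of \<open>f\<^sub>s\<close> grows along rays away from 0, the image \<open>X\<^sub>s\<close> is a
  contractible set with \<open>k\<close> pairs of points glued, where \<open>k\<close> is the number of double points; hence
  \<open>dim H\<^sub>1(X\<^sub>s; \<rat>) = k\<close>: paths joining the two points of a pair become loops, and winding numbers of
  functions that descend to \<open>X\<^sub>s\<close> show that they are independent.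

  The number \<open>k\<close> does not depend on the stabilisation. Finite determinacy makes \<open>f\<close> injective, and in
  the source coordinate in which \<open>p \<circ> f\<close> is \<open>z ^ m\<close> it becomes \<open>(z ^ m, \<phi> z)\<close>. The parameters of
  double points of \<open>f\<^sub>s = (a, b)\<close> are the zeros of the function that multiplies the divided differences
  of \<open>b\<close> at \<open>(t, u)\<close> over the solutions \<open>u \<noteq> t\<close> of \<open>a u = a t\<close>. It is close to the product of the divided
  differences of \<open>\<phi>\<close> at \<open>(t, \<omega> t)\<close> over the roots of unity \<open>\<omega> \<noteq> 1\<close> of order \<open>m\<close>, so by Rouche's
  theorem \<open>2 k\<close> is the order of the latter product at 0.

  Genericity of \<open>p\<close> means that \<open>p \<circ> f\<close> vanishes at 0 to order \<open>m = m\<^sub>0(f)\<close>, so that, again by Rouche's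
  theorem, the derivative of \<open>p \<circ> f\<^sub>s\<close> has \<open>m - 1\<close> zeros, which are simple by the Morse condition.
\<close>

section \<open>Consequences of stability\<close>

text \<open>Inside the disc a fibre of \<open>a\<close> may ramify, so the product over the other
  sheets is used only where the fibre is unramified and is continued across the finitely many
  remaining points by boundedness. The comparison with the model takes place on a circle, where the
  sheets stay close to the well separated points \<open>\<omega> * t\<close>. That a zero is simple
  is read off from a local inverse of \<open>a\<close> at the partner point, which does not exist at
  a vertical tangent. Replacing \<open>a\<close> by \<open>a + l * b\<close> with a small generic
  \<open>l\<close> removes vertical tangents at double points and moves no double point.

  \<open>image_milnor_number\<close> is a definite description over all stabilisations. Hence two
  stabilisations are placed in one polydisc and compared with the same unperturbed branch.

  Determinacy yields injectivity because terms beyond the determining jet may be added until the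
  germ becomes injective, and \<open>\<A>\<close>-equivalence carries this back to \<open>f\<close>.

  The radius \<open>\<epsilon>\<close> stays below half the size of \<open>f\<close> on an outer
  annulus. This confines the source to a smaller compact disc and makes \<open>f\<^sub>s\<close> a
  closed map onto its image.\<close>

lemma has_field_derivative_along:
  fixes G :: "'a::complex_normed_vector \<Rightarrow> complex"
  assumes G: "(G has_derivative D) (at (\<gamma> t0))" and D: "\<And>c v. D (scaleC c v) = c * D v"
    and \<gamma>: "(\<gamma> has_derivative (\<lambda>t. scaleC t v)) (at t0)"
  shows "((\<lambda>t. G (\<gamma> t)) has_field_derivative D v) (at t0)"
proof -
  have "((\<lambda>t. G (\<gamma> t)) has_derivative (\<lambda>t. D (scaleC t v))) (at t0)"
    by (rule has_derivative_compose[OF \<gamma> G])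
  moreover have "(\<lambda>t. D (scaleC t v)) = (*) (D v)"
    by (simp add: D fun_eq_iff)
  ultimately show ?thesis
    by (simp add: has_field_derivative_def)
qed

section \<open>Components and one-variable slices of holomorphic maps\<close>

lemma holomorphic_map_on_fst:
  fixes F :: "'a::complex_normed_vector \<Rightarrow> complex \<times> complex"
  assumes "holomorphic_map_on F U"
  shows "holomorphic_map_on (\<lambda>z. fst (F z)) U"
  unfolding holomorphic_map_on_def
proof
  fix z assume "z \<in> U"
  then obtain D where D: "(F has_derivative D) (at z)" "\<forall>c v. D (scaleC c v) = scaleC c (D v)"
    using assms unfolding holomorphic_map_on_def by blast
  show "\<exists>D. ((\<lambda>z. fst (F z)) has_derivative D) (at z) \<and> (\<forall>c v. D (scaleC c v) = scaleC c (D v))"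
    by (rule exI[of _ "\<lambda>v. fst (D v)"])
      (use D in \<open>auto intro!: derivative_eq_intros simp: scaleC_prod_def\<close>)
qed

lemma holomorphic_map_on_snd:
  fixes F :: "'a::complex_normed_vector \<Rightarrow> complex \<times> complex"
  assumes "holomorphic_map_on F U"
  shows "holomorphic_map_on (\<lambda>z. snd (F z)) U"
  unfolding holomorphic_map_on_def
proof
  fix z assume "z \<in> U"
  then obtain D where D: "(F has_derivative D) (at z)" "\<forall>c v. D (scaleC c v) = scaleC c (D v)"
    using assms unfolding holomorphic_map_on_def by blast
  show "\<exists>D. ((\<lambda>z. snd (F z)) has_derivative D) (at z) \<and> (\<forall>c v. D (scaleC c v) = scaleC c (D v))"
    by (rule exI[of _ "\<lambda>v. snd (D v)"])
      (use D in \<open>auto intro!: derivative_eq_intros simp: scaleC_prod_def\<close>)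
qed

lemma holomorphic_map_on_Pair:
  fixes F :: "'a::complex_normed_vector \<Rightarrow> complex" and G :: "'a \<Rightarrow> complex"
  assumes "holomorphic_map_on F U" "holomorphic_map_on G U"
  shows "holomorphic_map_on (\<lambda>z. (F z, G z)) U"
  unfolding holomorphic_map_on_def
proof
  fix z assume "z \<in> U"
  then obtain D E where D: "(F has_derivative D) (at z)" "\<forall>c v. D (scaleC c v) = scaleC c (D v)"
    and E: "(G has_derivative E) (at z)" "\<forall>c v. E (scaleC c v) = scaleC c (E v)"
    using assms unfolding holomorphic_map_on_def by meson
  show "\<exists>D. ((\<lambda>z. (F z, G z)) has_derivative D) (at z) \<and> (\<forall>c v. D (scaleC c v) = scaleC c (D v))"
    by (rule exI[of _ "\<lambda>v. (D v, E v)"])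
      (use D E in \<open>auto intro!: derivative_eq_intros simp: scaleC_prod_def\<close>)
qed

lemma holomorphic_map_on_curve_iff:
  fixes f :: "complex \<Rightarrow> complex \<times> complex"
  assumes "open U"
  shows "holomorphic_map_on f U \<longleftrightarrow> (fst \<circ> f) holomorphic_on U \<and> (snd \<circ> f) holomorphic_on U"
  using holomorphic_map_on_fst[of f U] holomorphic_map_on_snd[of f U]
    holomorphic_map_on_Pair[of "fst \<circ> f" U "snd \<circ> f"]
  by (auto simp: holomorphic_map_on_complex[OF assms, symmetric] comp_def)

lemma holomorphic_map_on_slice1:
  fixes G :: "complex \<times> complex \<Rightarrow> complex"
  assumes "holomorphic_map_on G U" "\<And>x. x \<in> V \<Longrightarrow> (x, s) \<in> U" "open V"
  shows "(\<lambda>x. G (x, s)) holomorphic_on V"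
  unfolding holomorphic_on_open[OF \<open>open V\<close>]
proof
  fix x assume "x \<in> V"
  then obtain D where D: "(G has_derivative D) (at (x, s))" "\<forall>c v. D (scaleC c v) = scaleC c (D v)"
    using assms unfolding holomorphic_map_on_def by blast
  have "((\<lambda>x. G (x, s)) has_field_derivative D (1, 0)) (at x)"
    by (rule has_field_derivative_along[where \<gamma>="\<lambda>x. (x, s)", OF D(1)])
      (use D(2) in \<open>auto intro!: derivative_eq_intros simp: scaleC_complex_def scaleC_prod_def\<close>)
  then show "\<exists>f'. ((\<lambda>x. G (x, s)) has_field_derivative f') (at x)" ..
qed

lemma holomorphic_map_on_slice2:
  fixes G :: "'a::complex_normed_vector \<times> complex \<Rightarrow> complex"
  assumes "holomorphic_map_on G U" "(z, s) \<in> U"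
  shows "(\<lambda>l. G (z, l)) field_differentiable (at s)"
proof -
  obtain D where D: "(G has_derivative D) (at (z, s))" "\<forall>c v. D (scaleC c v) = scaleC c (D v)"
    using assms unfolding holomorphic_map_on_def by blast
  \<comment> \<open>The class axioms say nothing about zero; the increment \<open>(0, l)\<close> has
    to be recognised as \<open>scaleC l (0, 1)\<close>.\<close>
  have "scaleC 0 (0::'a) = 0"
    using scaleC_of_real[of 0 "0::'a"] by simp
  moreover have "scaleC c (0::'a) = 0" for c
    using scaleC_add_right[of c "0::'a" 0] by simp
  ultimately have "((\<lambda>l. G (z, l)) has_field_derivative D (0, 1)) (at s)"
    by (intro has_field_derivative_along[where \<gamma>="\<lambda>l. (z, l)", OF D(1)])
      (use D(2) in \<open>auto intro!: derivative_eq_intros simp: scaleC_complex_def scaleC_prod_def\<close>)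
  then show ?thesis
    unfolding field_differentiable_def ..
qed

lemma holomorphic_map_on_imp_continuous_on:
  assumes "holomorphic_map_on F U"
  shows "continuous_on U F"
  using assms unfolding holomorphic_map_on_def continuous_on_eq_continuous_within
  by (meson continuous_at_imp_continuous_at_within has_derivative_continuous)

lemma holomorphic_map_on_subset:
  "holomorphic_map_on F U \<Longrightarrow> V \<subseteq> U \<Longrightarrow> holomorphic_map_on F V"
  unfolding holomorphic_map_on_def by blast

text \<open>
  One direction of Mather's infinitesimal criterion: differentiating a trivialisation of
  \<open>f + l \<xi>\<close> at \<open>l = 0\<close>. The third claim is the reason why stable maps are immersions: at a zero
  \<open>x0\<close> of the derivative of \<open>f\<close>, the derivative of \<open>f + l \<xi>\<close> vanishes at \<open>h (x0, l)\<close>.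
\<close>

lemma stable_multigerm_trivialise:
  assumes stable: "stable_multigerm f S y" and "finite S" and y: "\<And>x. x \<in> S \<Longrightarrow> f x = y"
    and U: "open U" "S \<subseteq> U" "holomorphic_map_on f U"
    and \<xi>: "(fst \<circ> \<xi>) holomorphic_on U" "(snd \<circ> \<xi>) holomorphic_on U"
  obtains \<eta> a where
    "\<And>x. x \<in> S \<Longrightarrow> scaleC (a x) (curve_deriv f x) + \<xi> x = \<eta>"
    "\<And>x. x \<in> S \<Longrightarrow> curve_deriv f x = 0 \<Longrightarrow>
      scaleC (a x) (deriv (deriv (fst \<circ> f)) x, deriv (deriv (snd \<circ> f)) x) + curve_deriv \<xi> x = 0"
proof -
  define \<phi> where "\<phi> = (\<lambda>(x, l). f x + scaleC l (\<xi> x))"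
  have f12: "(fst \<circ> f) holomorphic_on U" "(snd \<circ> f) holomorphic_on U"
    using U holomorphic_map_on_curve_iff by auto
  have lin: "holomorphic_map_on (\<lambda>(x, l). a x + l * b x) (U \<times> UNIV)"
    if ab: "a holomorphic_on U" "b holomorphic_on U" for a b :: "complex \<Rightarrow> complex"
    unfolding holomorphic_map_on_def
  proof clarify
    fix x l :: complex assume "x \<in> U"
    have dfst: "(fst has_derivative fst) (at (x, l))"
      by (intro has_derivative_fst[OF has_derivative_ident])
    have da: "(a has_derivative (*) (deriv a x)) (at (fst (x, l)))"
      using holomorphic_derivI[OF ab(1) U(1) \<open>x \<in> U\<close>] by (simp add: has_field_derivative_def)
    have db: "(b has_derivative (*) (deriv b x)) (at (fst (x, l)))"
      using holomorphic_derivI[OF ab(2) U(1) \<open>x \<in> U\<close>] by (simp add: has_field_derivative_def)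
    note da' = has_derivative_compose[OF dfst da] and db' = has_derivative_compose[OF dfst db]
    have "((\<lambda>z. a (fst z) + snd z * b (fst z)) has_derivative
        (\<lambda>v. deriv a x * fst v + (l * (deriv b x * fst v) + snd v * b x))) (at (x, l))"
      by (rule derivative_eq_intros da' db' refl)+ simp
    then show "\<exists>D. ((\<lambda>(x, l). a x + l * b x) has_derivative D) (at (x, l)) \<and>
        (\<forall>c v. D (scaleC c v) = scaleC c (D v))"
      unfolding case_prod_unfold
      by (intro exI conjI, assumption) (simp add: scaleC_prod_def scaleC_complex_def algebra_simps)
  qed
  have "holomorphic_map_on \<phi> (U \<times> UNIV)"
    using holomorphic_map_on_Pair[OF lin[OF f12(1) \<xi>(1)] lin[OF f12(2) \<xi>(2)]]
    by (simp add: \<phi>_def case_prod_unfold scaleC_prod_def scaleC_complex_def plus_prod_def)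
  then have "holomorphic_near \<phi> (S \<times> {0})"
    unfolding holomorphic_near_def using U open_Times[OF U(1) open_UNIV] by (intro exI[of _ "U \<times> UNIV"]) auto
  moreover have "\<phi> (x, 0) = f x" for x
    by (simp add: \<phi>_def scaleC_prod_def scaleC_complex_def prod_eq_iff)
  ultimately have "trivial_unfolding f S y \<phi>"
    using stable unfolding stable_multigerm_def by auto
  then obtain h H where h: "holomorphic_near h (S \<times> {0})"
    "\<And>x0. x0 \<in> S \<Longrightarrow> \<forall>\<^sub>F x in nhds x0. h (x, 0) = x"
    and H: "holomorphic_near H {(y, 0)}" "\<forall>\<^sub>F z in nhds y. H (z, 0) = z"
    and eq: "\<And>x0. x0 \<in> S \<Longrightarrow> \<forall>\<^sub>F (x, l) in nhds (x0, 0). \<phi> (h (x, l), l) = H (f x, l)"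
    unfolding trivial_unfolding_def by blast
  obtain Vh where Vh: "open Vh" "S \<times> {0} \<subseteq> Vh" "holomorphic_map_on h Vh"
    using h unfolding holomorphic_near_def by blast
  obtain VH where VH: "open VH" "(y, 0) \<in> VH" "holomorphic_map_on H VH"
    using H unfolding holomorphic_near_def by blast
  \<comment> \<open>\<open>a\<close> is the velocity of the source trivialisation at the points of
    \<open>S\<close>, and \<open>\<eta>\<close> that of the target trivialisation at
    \<open>y\<close>. All branches share \<open>\<eta>\<close>, which is what couples them.\<close>
  define a where "a = (\<lambda>x. deriv (\<lambda>l. h (x, l)) 0)"
  define \<eta> where "\<eta> = (deriv (\<lambda>l. fst (H (y, l))) 0, deriv (\<lambda>l. snd (H (y, l))) 0)"
  show ?thesis
  proof
    fix x0 assume x0: "x0 \<in> S"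
    have h0: "h (x0, 0) = x0"
      using h(2)[OF x0] by (rule eventually_nhds_x_imp_x)
    have da: "((\<lambda>l. h (x0, l)) has_field_derivative a x0) (at 0)"
      using holomorphic_map_on_slice2[OF Vh(3)] Vh(2) x0 unfolding a_def
      by (intro field_differentiable_derivI) auto
    \<comment> \<open>Splitting the product neighbourhood leaves, for each small \<open>l\<close>,
      an identity of germs in \<open>x\<close>; this permits differentiation in \<open>x\<close>
      before differentiation in \<open>l\<close>.\<close>
    have ev2: "\<forall>\<^sub>F l in nhds 0. \<forall>\<^sub>F x in nhds x0. f (h (x, l)) + scaleC l (\<xi> (h (x, l))) = H (f x, l)"
    proof -
      obtain P Q where "eventually P (nhds x0)" "eventually Q (nhds 0)"
        "\<And>x l. P x \<Longrightarrow> Q l \<Longrightarrow> \<phi> (h (x, l), l) = H (f x, l)"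
        using eq[OF x0] unfolding nhds_prod eventually_prod_filter by auto
      then show ?thesis unfolding \<phi>_def
        by (auto elim!: eventually_mono)
    qed
    have "\<forall>\<^sub>F l in nhds 0. f (h (x0, l)) + scaleC l (\<xi> (h (x0, l))) = H (f x0, l)"
      using ev2 by (rule eventually_mono) (rule eventually_nhds_x_imp_x)
    then have ev: "\<forall>\<^sub>F l in nhds 0. f (h (x0, l)) + scaleC l (\<xi> (h (x0, l))) = H (y, l)"
      by (simp add: \<phi>_def y[OF x0])
    have key: "deriv c x0 * a x0 + e x0 = deriv (\<lambda>l. K (y, l)) 0"
      if c: "c holomorphic_on U" and e: "e holomorphic_on U" and K: "holomorphic_map_on K VH"
        and ev: "\<forall>\<^sub>F l in nhds 0. c (h (x0, l)) + l * e (h (x0, l)) = K (y, l)"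
      for c e :: "complex \<Rightarrow> complex" and K
    proof -
      have dc: "(c has_field_derivative deriv c x0) (at (h (x0, 0)))"
        using holomorphic_derivI[OF c U(1)] U(2) x0 h0 by auto
      have de: "(e has_field_derivative deriv e x0) (at (h (x0, 0)))"
        using holomorphic_derivI[OF e U(1)] U(2) x0 h0 by auto
      have 1: "((\<lambda>l. c (h (x0, l)) + l * e (h (x0, l))) has_field_derivative
          (deriv c x0 * a x0 + e x0)) (at 0)"
        by (rule derivative_eq_intros DERIV_chain2[OF dc da] DERIV_chain2[OF de da] refl)+ (simp add: h0)
      have 2: "((\<lambda>l. K (y, l)) has_field_derivative deriv (\<lambda>l. K (y, l)) 0) (at 0)"
        using holomorphic_map_on_slice2[OF K VH(2)] by (intro field_differentiable_derivI)
      show ?thesis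
        by (rule DERIV_unique[OF 1]) (use 2 DERIV_cong_ev[OF refl ev refl] in blast)
    qed
    have "deriv (fst \<circ> f) x0 * a x0 + (fst \<circ> \<xi>) x0 = fst \<eta>" unfolding \<eta>_def fst_conv
      by (rule key[OF f12(1) \<xi>(1) holomorphic_map_on_fst[OF VH(3)]])
        (rule eventually_mono[OF ev], auto simp: prod_eq_iff scaleC_prod_def scaleC_complex_def)
    moreover have "deriv (snd \<circ> f) x0 * a x0 + (snd \<circ> \<xi>) x0 = snd \<eta>" unfolding \<eta>_def snd_conv
      by (rule key[OF f12(2) \<xi>(2) holomorphic_map_on_snd[OF VH(3)]])
        (rule eventually_mono[OF ev], auto simp: prod_eq_iff scaleC_prod_def scaleC_complex_def)
    ultimately show "scaleC (a x0) (curve_deriv f x0) + \<xi> x0 = \<eta>"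
      by (simp add: prod_eq_iff scaleC_prod_def scaleC_complex_def curve_deriv_def mult.commute)
    assume crit: "curve_deriv f x0 = 0"
    define \<delta>' where "\<delta>' = (\<lambda>l. deriv (\<lambda>x. h (x, l)) x0)"
    \<comment> \<open>Since \<open>h (x, 0) = x\<close>, uniform continuity keeps
      \<open>h (x, l)\<close> within \<open>\<rho> / 2\<close> of \<open>x\<close> on the disc of
      radius \<open>\<rho>\<close>. Cauchy's inequality then keeps the derivative in
      \<open>x\<close> within 1/2 of 1.\<close>
    have nz: "\<forall>\<^sub>F l in nhds 0. deriv (\<lambda>x. h (x, l)) x0 \<noteq> 0 \<and> (\<lambda>x. h (x, l)) field_differentiable at x0"
    proof -
      have "(x0, 0) \<in> Vh" using Vh(2) x0 by auto
      then obtain A B where AB': "open A" "open B" "(x0, 0) \<in> A \<times> B" "A \<times> B \<subseteq> Vh"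
        using open_prod_elim[OF Vh(1)] by metis
      then have AB: "open A" "open B" "x0 \<in> A" "0 \<in> B" "A \<times> B \<subseteq> Vh" by auto
      obtain C where C: "open C" "x0 \<in> C" "\<And>x. x \<in> C \<Longrightarrow> h (x, 0) = x"
        using h(2)[OF x0] unfolding eventually_nhds by blast
      obtain \<rho> where \<rho>: "\<rho> > 0" "cball x0 \<rho> \<subseteq> A \<inter> C"
        by (metis AB(1,3) C(1,2) IntI open_Int open_contains_cball)
      obtain \<sigma> where \<sigma>: "\<sigma> > 0" "cball 0 \<sigma> \<subseteq> B"
        using open_contains_cball[of B] AB by auto
      have sub: "cball x0 \<rho> \<times> cball 0 \<sigma> \<subseteq> Vh"
        using \<rho> \<sigma> AB by blast
      have "uniformly_continuous_on (cball x0 \<rho> \<times> cball 0 \<sigma>) h"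
        by (rule compact_uniformly_continuous)
          (use sub holomorphic_map_on_imp_continuous_on[OF Vh(3)] in
            \<open>auto intro: continuous_on_subset compact_Times\<close>)
      then obtain d where d: "d > 0" "\<And>z w. z \<in> cball x0 \<rho> \<times> cball 0 \<sigma> \<Longrightarrow>
          w \<in> cball x0 \<rho> \<times> cball 0 \<sigma> \<Longrightarrow> dist w z < d \<Longrightarrow> dist (h w) (h z) < \<rho> / 2"
        unfolding uniformly_continuous_on_def using \<rho>(1) by (metis half_gt_zero)
      have "deriv (\<lambda>x. h (x, l)) x0 \<noteq> 0 \<and> (\<lambda>x. h (x, l)) field_differentiable at x0"
        if l: "dist l 0 < min d \<sigma>" for l
      proof -
        have "l \<in> B" using \<sigma>(2) l by (auto simp: subset_iff)
        then have hol: "(\<lambda>x. h (x, l)) holomorphic_on A"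
          by (intro holomorphic_map_on_slice1[OF Vh(3)]) (use AB in auto)
        have hol': "(\<lambda>x. h (x, l) - x) holomorphic_on A"
          using hol by (intro holomorphic_intros)
        have bd: "norm (h (x, l) - x) \<le> \<rho> / 2" if x: "x \<in> cball x0 \<rho>" for x
        proof -
          have "dist (h (x, l)) (h (x, 0)) < \<rho> / 2"
            by (rule d(2)) (use x l \<sigma> in \<open>auto simp: dist_Pair_Pair dist_norm\<close>)
          then show ?thesis using C(3)[of x] \<rho> x by (auto simp: dist_norm)
        qed
        have sb: "ball x0 \<rho> \<subseteq> A" using \<rho>(2) ball_subset_cball[of x0 \<rho>] by blast
        have "norm ((deriv ^^ 1) (\<lambda>x. h (x, l) - x) x0) \<le> fact 1 * (\<rho> / 2) / \<rho> ^ 1"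
          by (rule Cauchy_inequality)
            (use holomorphic_on_subset[OF hol', of "ball x0 \<rho>"]
              holomorphic_on_imp_continuous_on[OF holomorphic_on_subset[OF hol', of "cball x0 \<rho>"]] \<rho> bd
              sb in \<open>auto simp: dist_norm norm_minus_commute\<close>)
        moreover have fd: "(\<lambda>x. h (x, l)) field_differentiable at x0"
          using hol AB by (simp add: holomorphic_on_imp_differentiable_at)
        moreover have "deriv (\<lambda>x. h (x, l) - x) x0 = deriv (\<lambda>x. h (x, l)) x0 - 1"
          using fd by (simp add: field_differentiable_ident)
        ultimately have "norm (deriv (\<lambda>x. h (x, l)) x0 - 1) \<le> 1 / 2"
          using \<rho>(1) by simp
        then show ?thesis using fd by (auto simp: )
      qed
      then show ?thesis
        unfolding eventually_nhds_metric using d(1) \<sigma>(1)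
        by (intro exI[of _ "min d \<sigma>"]) auto
    qed
    have in_U: "\<forall>\<^sub>F l in nhds 0. h (x0, l) \<in> U"
    proof -
      have "isCont (\<lambda>l. h (x0, l)) 0" using da DERIV_isCont by blast
      then have "((\<lambda>l. h (x0, l)) \<longlongrightarrow> x0) (nhds 0)"
        using h0 by (simp add: isCont_def tendsto_nhds_iff)
      then show ?thesis
        using U x0 by (auto intro: topological_tendstoD)
    qed
    have in_VH: "\<forall>\<^sub>F l in nhds 0. (y, l) \<in> VH"
    proof -
      have "((\<lambda>l. (y, l)) \<longlongrightarrow> (y, 0)) (nhds 0)" by (intro tendsto_intros filterlim_ident)
      then show ?thesis using VH by (auto intro: topological_tendstoD)
    qed
    have mult_0: "(*) (0 :: complex) = (\<lambda>v. 0)" by auto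
    have key2: "deriv (deriv c) x0 * a x0 + deriv e x0 = 0"
      if c: "c holomorphic_on U" and e: "e holomorphic_on U" and K: "holomorphic_map_on K VH"
        and ev: "\<forall>\<^sub>F l in nhds 0. \<forall>\<^sub>F x in nhds x0. c (h (x, l)) + l * e (h (x, l)) = K (f x, l)"
      for c e :: "complex \<Rightarrow> complex" and K :: "(complex \<times> complex) \<times> complex \<Rightarrow> complex"
    proof -
      \<comment> \<open>At the critical point the right side has derivative 0 in \<open>x\<close>.
        On the left the chain rule splits off the derivative of \<open>h\<close> in
        \<open>x\<close>, which is not 0. The remaining factor is afterwards differentiated in
        \<open>l\<close>.\<close>
      have z: "\<forall>\<^sub>F l in nhds 0. deriv c (h (x0, l)) + l * deriv e (h (x0, l)) = 0"
        using ev nz in_U in_VH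
      proof eventually_elim
        case (elim l)
        obtain D where D: "(K has_derivative D) (at (f x0, l))"
          using elim(4) K y[OF x0] unfolding holomorphic_map_on_def by auto
        have f1: "((fst \<circ> f) has_derivative (\<lambda>v. 0)) (at x0)"
          using holomorphic_derivI[OF f12(1) U(1), of x0] U(2) x0 crit
          by (auto simp: curve_deriv_def has_field_derivative_def zero_prod_def mult_0)
        have f2: "((snd \<circ> f) has_derivative (\<lambda>v. 0)) (at x0)"
          using holomorphic_derivI[OF f12(2) U(1), of x0] U(2) x0 crit
          by (auto simp: curve_deriv_def has_field_derivative_def zero_prod_def mult_0)
        have "((\<lambda>x. (((fst \<circ> f) x, (snd \<circ> f) x), l)) has_derivative (\<lambda>v. ((0, 0), 0))) (at x0)"
          by (intro derivative_intros f1 f2)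
        then have fl: "((\<lambda>x. (f x, l)) has_derivative (\<lambda>v. 0)) (at x0)"
          by (simp add: zero_prod_def)
        have "((\<lambda>x. K (f x, l)) has_derivative (\<lambda>v. D 0)) (at x0)"
          by (rule has_derivative_compose[OF fl D])
        moreover have "D 0 = 0"
          using D has_derivative_linear linear_0 by blast
        ultimately have R: "((\<lambda>x. K (f x, l)) has_field_derivative 0) (at x0)"
          by (simp add: has_field_derivative_def mult_0)
        have dh: "((\<lambda>x. h (x, l)) has_field_derivative \<delta>' l) (at x0)"
          using elim(2) unfolding \<delta>'_def by (intro field_differentiable_derivI) auto
        have dc: "(c has_field_derivative deriv c (h (x0, l))) (at (h (x0, l)))"
          using holomorphic_derivI[OF c U(1) elim(3)] .
        have de: "(e has_field_derivative deriv e (h (x0, l))) (at (h (x0, l)))"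
          using holomorphic_derivI[OF e U(1) elim(3)] .
        have "((\<lambda>x. c (h (x, l)) + l * e (h (x, l))) has_field_derivative
            (deriv c (h (x0, l)) * \<delta>' l + l * (deriv e (h (x0, l)) * \<delta>' l))) (at x0)"
          by (rule derivative_eq_intros DERIV_chain2[OF dc dh] DERIV_chain2[OF de dh] refl)+ simp
        then have "deriv c (h (x0, l)) * \<delta>' l + l * (deriv e (h (x0, l)) * \<delta>' l) = 0"
          using R DERIV_cong_ev[OF refl elim(1) refl] DERIV_unique by blast
        then have "\<delta>' l * (deriv c (h (x0, l)) + l * deriv e (h (x0, l))) = 0"
          by (simp add: algebra_simps)
        then show ?case using elim(2) by (simp add: \<delta>'_def)
      qed
      have dc: "(deriv c has_field_derivative deriv (deriv c) x0) (at (h (x0, 0)))"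
        using holomorphic_derivI[OF holomorphic_deriv[OF c U(1)] U(1)] U(2) x0 h0 by auto
      have de: "(deriv e has_field_derivative deriv (deriv e) x0) (at (h (x0, 0)))"
        using holomorphic_derivI[OF holomorphic_deriv[OF e U(1)] U(1)] U(2) x0 h0 by auto
      have "((\<lambda>l. deriv c (h (x0, l)) + l * deriv e (h (x0, l))) has_field_derivative
          (deriv (deriv c) x0 * a x0 + deriv e x0)) (at 0)"
        by (rule derivative_eq_intros DERIV_chain2[OF dc da] DERIV_chain2[OF de da] refl)+ (simp add: h0)
      then have "((\<lambda>l. 0) has_field_derivative (deriv (deriv c) x0 * a x0 + deriv e x0)) (at 0)"
        using DERIV_cong_ev[OF refl z refl] by blast
      then show ?thesis
        using DERIV_unique DERIV_const by blast
    qed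
    have "deriv (deriv (fst \<circ> f)) x0 * a x0 + deriv (fst \<circ> \<xi>) x0 = 0"
      by (rule key2[OF f12(1) \<xi>(1) holomorphic_map_on_fst[OF VH(3)]])
        (use ev2 in \<open>auto simp: prod_eq_iff scaleC_prod_def scaleC_complex_def elim!: eventually_mono\<close>)
    moreover have "deriv (deriv (snd \<circ> f)) x0 * a x0 + deriv (snd \<circ> \<xi>) x0 = 0"
      by (rule key2[OF f12(2) \<xi>(2) holomorphic_map_on_snd[OF VH(3)]])
        (use ev2 in \<open>auto simp: prod_eq_iff scaleC_prod_def scaleC_complex_def elim!: eventually_mono\<close>)
    ultimately show "scaleC (a x0) (deriv (deriv (fst \<circ> f)) x0, deriv (deriv (snd \<circ> f)) x0)
        + curve_deriv \<xi> x0 = 0"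
      by (simp add: prod_eq_iff scaleC_prod_def scaleC_complex_def curve_deriv_def mult.commute)
  qed
qed

text \<open>The Hermitian orthogonal \<open>(- cnj q, cnj p)\<close> of \<open>v = (p, q)\<close> is
  a multiple of \<open>v\<close> only if \<open>v = 0\<close>. Each consequence of stability below
  perturbs in such a direction \<open>c\<close>, which no trivialisation can reach.\<close>

lemma not_all_scaleC: "\<exists>c. \<forall>a. scaleC a (v :: complex \<times> complex) \<noteq> c"
proof (cases "v = 0")
  case True
  then show ?thesis
    by (intro exI[of _ "(1, 1)"]) (simp add: scaleC_prod_def scaleC_complex_def)
next
  case False
  obtain p q where v: "v = (p, q)" by fastforce
  have "scaleC a v \<noteq> (- cnj q, cnj p)" for a
  proof
    assume "scaleC a v = (- cnj q, cnj p)"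
    then have "a * p = - cnj q" "a * q = cnj p"
      by (auto simp: v scaleC_prod_def scaleC_complex_def)
    then have "a * p * q = - cnj q * q" "a * q * p = cnj p * p" by simp_all
    then have "p * cnj p + q * cnj q = 0"
      by (metis ab_left_minus add.commute minus_mult_left mult.assoc mult.commute)
    then have "complex_of_real ((norm p)\<^sup>2 + (norm q)\<^sup>2) = 0"
      by (simp only: complex_norm_square of_real_add)
    then have "(norm p)\<^sup>2 + (norm q)\<^sup>2 = 0"
      using of_real_eq_0_iff by blast
    then have "p = 0 \<and> q = 0"
      by (simp add: add_nonneg_eq_0_iff)
    then show False using False v by (simp add: zero_prod_def)
  qed
  then show ?thesis by blast
qed

lemma scaleC_pair_simps:
  "scaleC c (a, b) = (c * a, c * b)" for a b :: complex
  by (simp add: scaleC_prod_def scaleC_complex_def)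

section \<open>Immersion, transversality and the absence of triple points\<close>

lemma locally_stable_on_multigerm:
  "locally_stable_on f D \<Longrightarrow> finite S \<Longrightarrow> S \<noteq> {} \<Longrightarrow> S \<subseteq> D \<Longrightarrow> f ` S = {y} \<Longrightarrow> stable_multigerm f S y"
  unfolding locally_stable_on_def by blast

text \<open>The perturbation \<open>(x - t) * c\<close> has derivative \<open>c\<close> at
  \<open>t\<close>. At a critical point its trivialisation would make \<open>c\<close> a multiple of
  the second derivative of \<open>f\<close>.\<close>

lemma stable_imp_immersion:
  assumes st: "locally_stable_on f D" and "open D" "t \<in> D"
  shows "curve_deriv f t \<noteq> 0"
proof
  assume crit: "curve_deriv f t = 0"
  obtain c where c: "\<And>a. scaleC a (deriv (deriv (fst \<circ> f)) t, deriv (deriv (snd \<circ> f)) t) \<noteq> c"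
    using not_all_scaleC by metis
  define \<xi> where "\<xi> = (\<lambda>x. ((x - t) * fst c, (x - t) * snd c))"
  have "stable_multigerm f {t} (f t)"
    by (rule locally_stable_on_multigerm[OF st]) (use \<open>t \<in> D\<close> in auto)
  then obtain a where "scaleC (a t) (deriv (deriv (fst \<circ> f)) t, deriv (deriv (snd \<circ> f)) t)
      + curve_deriv \<xi> t = 0"
    by (rule stable_multigerm_trivialise[where U = D and \<xi> = \<xi>])
      (use st assms crit in \<open>auto simp: \<xi>_def locally_stable_on_def comp_def intro!: holomorphic_intros\<close>)
  moreover have "curve_deriv \<xi> t = c"
  proof -
    have "deriv (\<lambda>x. (x - t) * b) t = b" for b
      by (rule DERIV_imp_deriv) (auto intro!: derivative_eq_intros)
    then show ?thesis
      by (simp add: curve_deriv_def \<xi>_def comp_def)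
  qed
  ultimately have "scaleC (- a t) (deriv (deriv (fst \<circ> f)) t, deriv (deriv (snd \<circ> f)) t) = c"
    by (cases c) (auto simp: scaleC_pair_simps zero_prod_def neg_eq_iff_add_eq_0 add.commute)
  then show False using c by blast
qed

text \<open>The perturbation takes the values \<open>c\<close> at \<open>t\<close> and 0 at
  \<open>u\<close>. Subtracting the two trivialisation equations puts \<open>c\<close> into the span
  of the two tangent vectors, which is at most a line if they are dependent.\<close>

lemma stable_imp_transverse:
  assumes st: "locally_stable_on f D" and "open D" "t \<in> D" "u \<in> D" "t \<noteq> u" "f t = f u"
    and dep: "scaleC \<alpha> (curve_deriv f t) + scaleC \<beta> (curve_deriv f u) = 0"
  shows "\<alpha> = 0 \<and> \<beta> = 0"
proof (rule ccontr)
  obtain p1 q1 where v: "curve_deriv f t = (p1, q1)" by fastforce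
  obtain p2 q2 where w: "curve_deriv f u = (p2, q2)" by fastforce
  assume nz: "\<not> (\<alpha> = 0 \<and> \<beta> = 0)"
  have "\<exists>v. \<forall>a b. \<exists>e. scaleC a (curve_deriv f t) + scaleC b (curve_deriv f u) = scaleC e v"
  proof (cases "\<alpha> = 0")
    case True
    then have "\<beta> \<noteq> 0" using nz by simp
    then have "p2 = 0" "q2 = 0" using dep True by (auto simp: v w scaleC_pair_simps zero_prod_def)
    then show ?thesis
      by (intro exI[of _ "(p1, q1)"] allI, rule_tac x = a in exI) (simp add: v w scaleC_pair_simps)
  next
    case False
    then have "p1 = - (\<beta> / \<alpha>) * p2" "q1 = - (\<beta> / \<alpha>) * q2"
      using dep by (auto simp: v w scaleC_pair_simps zero_prod_def field_simps add_eq_0_iff)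
    then show ?thesis
      by (intro exI[of _ "(p2, q2)"] allI, rule_tac x = "b - a * (\<beta> / \<alpha>)" in exI)
        (simp add: v w scaleC_pair_simps algebra_simps)
  qed
  then obtain x where x: "\<And>a b. \<exists>e. scaleC a (curve_deriv f t) + scaleC b (curve_deriv f u) = scaleC e x"
    by blast
  obtain c where c: "\<And>a. scaleC a x \<noteq> c" using not_all_scaleC by metis
  define \<xi> where "\<xi> = (\<lambda>x. ((x - u) / (t - u) * fst c, (x - u) / (t - u) * snd c))"
  have "stable_multigerm f {t, u} (f t)"
    by (rule locally_stable_on_multigerm[OF st]) (use assms in auto)
  then obtain \<eta> a where
    "\<And>x. x \<in> {t, u} \<Longrightarrow> scaleC (a x) (curve_deriv f x) + \<xi> x = \<eta>"
    by (rule stable_multigerm_trivialise[where U = D and \<xi> = \<xi>])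
      (use st assms in \<open>auto simp: \<xi>_def locally_stable_on_def comp_def intro!: holomorphic_intros\<close>)
  moreover have "\<xi> t = c" "\<xi> u = 0"
    using \<open>t \<noteq> u\<close> by (auto simp: \<xi>_def zero_prod_def)
  ultimately have "scaleC (a t) (curve_deriv f t) + c = scaleC (a u) (curve_deriv f u)"
    by (metis add.right_neutral insertCI)
  then have "scaleC (- a t) (curve_deriv f t) + scaleC (a u) (curve_deriv f u) = c"
    by (cases c) (auto simp: v w scaleC_pair_simps algebra_simps)
  then show False using x c by metis
qed

text \<open>The Lagrange polynomial makes \<open>\<xi>\<close> vanish at \<open>t\<close> and
  \<open>u\<close> and equal \<open>c\<close> at \<open>w\<close>. Transversality of the first two
  branches forces \<open>\<eta> = 0\<close>, so that \<open>c\<close> would be tangent to the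
  third.\<close>

lemma stable_imp_no_triple_point:
  assumes st: "locally_stable_on f D" and D: "open D" "t \<in> D" "u \<in> D" "w \<in> D"
    and eq: "f t = f u" "f t = f w" and "t \<noteq> u"
  shows "w = t \<or> w = u"
proof (rule ccontr)
  assume neq: "\<not> (w = t \<or> w = u)"
  obtain c where c: "\<And>a. scaleC a (curve_deriv f w) \<noteq> c" using not_all_scaleC by metis
  define \<xi> where "\<xi> = (\<lambda>x. ((x - u) * (x - t) / ((w - u) * (w - t)) * fst c,
    (x - u) * (x - t) / ((w - u) * (w - t)) * snd c))"
  have "stable_multigerm f {t, u, w} (f t)"
    by (rule locally_stable_on_multigerm[OF st]) (use D eq in auto)
  then obtain \<eta> a where \<eta>:
    "\<And>x. x \<in> {t, u, w} \<Longrightarrow> scaleC (a x) (curve_deriv f x) + \<xi> x = \<eta>"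
    by (rule stable_multigerm_trivialise[where U = D and \<xi> = \<xi>])
      (use st D eq neq in \<open>auto simp: \<xi>_def locally_stable_on_def comp_def intro!: holomorphic_intros\<close>)
  have \<xi>: "\<xi> t = 0" "\<xi> u = 0" "\<xi> w = c"
    using neq by (auto simp: \<xi>_def zero_prod_def)
  have e: "scaleC (a t) (curve_deriv f t) = \<eta>" "scaleC (a u) (curve_deriv f u) = \<eta>"
    using \<eta>[of t] \<eta>[of u] \<xi> by auto
  then have "scaleC (a t) (curve_deriv f t) + scaleC (- a u) (curve_deriv f u) = 0"
    by (cases "curve_deriv f t"; cases "curve_deriv f u") (auto simp: scaleC_pair_simps zero_prod_def)
  then have "a t = 0"
    using stable_imp_transverse[OF st D(1-3) \<open>t \<noteq> u\<close> eq(1)] by blast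
  then have "\<eta> = 0"
    using e by (cases "curve_deriv f t") (auto simp: scaleC_pair_simps zero_prod_def)
  then have "scaleC (- a w) (curve_deriv f w) = c"
    using \<eta>[of w] \<xi> by (cases "curve_deriv f w"; cases c)
      (auto simp: scaleC_pair_simps zero_prod_def neg_eq_iff_add_eq_0 add.commute)
  then show False using c by blast
qed

section \<open>Double points of a sheeted plane curve\<close>

text \<open>The value on the diagonal makes the quotient continuous. A common zero of the quotients
  of both components of a curve is a double point off the diagonal and a failure of immersion on it,
  so one compactness argument treats both.\<close>

definition diff_quot :: "(complex \<Rightarrow> complex) \<Rightarrow> complex \<Rightarrow> complex \<Rightarrow> complex"
  where "diff_quot g t u = (if t = u then deriv g t else (g t - g u) / (t - u))"

text \<open>Mean value inequality for \<open>g z - d * z\<close>. The centre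
  \<open>d = deriv g t\<close> gives continuity at the diagonal; \<open>d = 0\<close>, applied to a
  difference of functions, compares their quotients.\<close>

lemma diff_quot_bound:
  assumes g: "g holomorphic_on S" "open S" and C: "convex C" "C \<subseteq> S"
    and bd: "\<And>z. z \<in> C \<Longrightarrow> norm (deriv g z - d) \<le> B" and tu: "t \<in> C" "u \<in> C"
  shows "norm (diff_quot g t u - d) \<le> B"
proof (cases "t = u")
  case True
  then show ?thesis using bd tu by (simp add: diff_quot_def)
next
  case False
  have "norm ((g t - d * t) - (g u - d * u)) \<le> B * norm (t - u)"
  proof (rule field_differentiable_bound[OF C(1) _ _ tu])
    fix z assume z: "z \<in> C"
    then have "(g has_field_derivative deriv g z) (at z)"
      using holomorphic_derivI[OF g] C by blast
    then have "((\<lambda>z. g z - d * z) has_field_derivative (deriv g z - d)) (at z)"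
      by (auto intro!: derivative_eq_intros)
    then show "((\<lambda>z. g z - d * z) has_field_derivative (deriv g z - d)) (at z within C)"
      by (rule has_field_derivative_at_within)
    show "norm (deriv g z - d) \<le> B" by (rule bd[OF z])
  qed
  moreover have eq: "diff_quot g t u - d = ((g t - d * t) - (g u - d * u)) / (t - u)"
    using False by (simp add: diff_quot_def field_simps)
  ultimately show ?thesis
    unfolding eq norm_divide using False by (simp add: pos_divide_le_eq)
qed

lemma diff_quot_diff:
  assumes "g holomorphic_on S" "h holomorphic_on S" "open S" "t \<in> S" "u \<in> S"
  shows "diff_quot (\<lambda>z. g z - h z) t u = diff_quot g t u - diff_quot h t u"
proof (cases "t = u")
  case True
  then show ?thesis
    using assms by (auto simp: diff_quot_def holomorphic_on_imp_differentiable_at)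
next
  case False
  then show ?thesis by (simp add: diff_quot_def diff_divide_distrib[symmetric])
qed

lemma continuous_on_diff_quot:
  assumes g: "g holomorphic_on S" "open S"
  shows "continuous_on (S \<times> S) (\<lambda>(t, u). diff_quot g t u)"
  unfolding continuous_on_eq_continuous_at[OF open_Times[OF g(2) g(2)]]
proof clarify
  fix t u assume tu: "t \<in> S" "u \<in> S"
  show "isCont (\<lambda>(t, u). diff_quot g t u) (t, u)"
  proof (cases "t = u")
    case False
    have "continuous_on S g" using g holomorphic_on_imp_continuous_on by blast
    then have c: "isCont g t" "isCont g u"
      using tu g(2) by (auto simp: continuous_on_eq_continuous_at)
    have "isCont (\<lambda>z. (g (fst z) - g (snd z)) / (fst z - snd z)) (t, u)"
      using False c by (intro continuous_intros isCont_o2[where f = fst and g = g] isCont_o2[where f = snd and g = g]) auto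
    moreover have "\<forall>\<^sub>F z in nhds (t, u). z \<in> {z. fst z \<noteq> snd z}"
      by (rule eventually_nhds_in_open) (auto simp: False intro!: open_Collect_neq continuous_intros)
    then have "\<forall>\<^sub>F z in nhds (t, u). (\<lambda>(t, u). diff_quot g t u) z = (g (fst z) - g (snd z)) / (fst z - snd z)"
      by eventually_elim (auto simp: diff_quot_def)
    ultimately show ?thesis
      using isCont_cong by fast
  next
    case True
    show ?thesis
      unfolding continuous_at_eps_delta
    proof (intro allI impI)
      fix e :: real assume "e > 0"
      have "continuous_on S (deriv g)"
        using g by (intro holomorphic_on_imp_continuous_on holomorphic_deriv)
      then have "isCont (deriv g) t"
        using tu g(2) by (auto simp: continuous_on_eq_continuous_at)
      then obtain d where d: "d > 0" "\<And>z. dist z t < d \<Longrightarrow> dist (deriv g z) (deriv g t) < e / 2"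
        unfolding continuous_at_eps_delta using \<open>e > 0\<close> half_gt_zero by blast
      obtain d' where d': "d' > 0" "ball t d' \<subseteq> S"
        using g(2) tu openE by blast
      have "dist (diff_quot g x y) (diff_quot g t u) < e" if "dist (x, y) (t, u) < min d d'" for x y
      proof -
        have xy: "dist x t < min d d'" "dist y t < min d d'"
          using that dist_fst_le[of "(x, y)" "(t, u)"] dist_snd_le[of "(x, y)" "(t, u)"] True by auto
        have "norm (diff_quot g x y - deriv g t) \<le> e / 2"
          by (rule diff_quot_bound[OF g, of "ball t (min d d')"])
            (use xy d d' in \<open>auto simp: dist_norm norm_minus_commute subset_iff intro: less_imp_le\<close>)
        then show ?thesis using True \<open>e > 0\<close> by (simp add: diff_quot_def dist_norm)
      qed
      then show "\<exists>d>0. \<forall>z. dist z (t, u) < d \<longrightarrow>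
          dist (case z of (t, u) \<Rightarrow> diff_quot g t u) (case (t, u) of (t, u) \<Rightarrow> diff_quot g t u) < e"
        using d(1) d'(1) by (intro exI[of _ "min d d'"]) auto
    qed
  qed
qed

text \<open>The sum of the two norms has a positive minimum on the compact slice over
  \<open>t0\<close> and stays above half of it nearby. Where \<open>p\<close> vanishes,
  \<open>q\<close> alone has to account for this.\<close>

lemma no_common_zero_bound:
  fixes p q :: "complex \<Rightarrow> complex \<Rightarrow> complex"
  assumes cont: "continuous_on (S \<times> T) (\<lambda>(t, u). p t u)" "continuous_on (S \<times> T) (\<lambda>(t, u). q t u)"
    and S: "open S" "t0 \<in> S" and C: "compact C" "C \<subseteq> T"
    and nz: "\<And>u. u \<in> C \<Longrightarrow> p t0 u = 0 \<Longrightarrow> q t0 u \<noteq> 0"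
  shows "\<exists>e>0. \<exists>c>0. ball t0 e \<subseteq> S \<and> (\<forall>t\<in>ball t0 e. \<forall>u\<in>C. p t u = 0 \<longrightarrow> norm (q t u) \<ge> c)"
proof (cases "C = {}")
  case True
  obtain e where "e > 0" "ball t0 e \<subseteq> S" using S openE by blast
  then show ?thesis using True by (intro exI[of _ e] exI[of _ "1::real"]) auto
next
  case False
  obtain e0 where e0: "e0 > 0" "cball t0 e0 \<subseteq> S" using S open_contains_cball by blast
  define D where "D = (\<lambda>(t, u). norm (p t u) + norm (q t u))"
  have contD: "continuous_on (S \<times> T) D"
    unfolding D_def case_prod_unfold
    using cont by (intro continuous_intros) (auto simp: case_prod_unfold)
  have "compact ({t0} \<times> C)" "{t0} \<times> C \<noteq> {}" using C False by (auto intro: compact_Times)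
  moreover have "continuous_on ({t0} \<times> C) D"
    by (rule continuous_on_subset[OF contD]) (use S C in auto)
  ultimately obtain z where z: "z \<in> {t0} \<times> C" "\<And>w. w \<in> {t0} \<times> C \<Longrightarrow> D z \<le> D w"
    using continuous_attains_inf by metis
  define c where "c = D z / 2"
  have "D z > 0"
    using z(1) nz by (auto simp: D_def add_nonneg_pos add_pos_nonneg dest!: bspec) (metis add_nonneg_pos add_pos_nonneg norm_ge_zero zero_less_norm_iff)
  then have "c > 0" by (simp add: c_def)
  have "uniformly_continuous_on (cball t0 e0 \<times> C) D"
    by (rule compact_uniformly_continuous)
      (use e0 C in \<open>auto intro!: continuous_on_subset[OF contD] compact_Times\<close>)
  then obtain d where d: "d > 0" "\<And>x y. x \<in> cball t0 e0 \<times> C \<Longrightarrow> y \<in> cball t0 e0 \<times> C \<Longrightarrow>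
      dist y x < d \<Longrightarrow> dist (D y) (D x) < c"
    unfolding uniformly_continuous_on_def using \<open>c > 0\<close> by metis
  have "ball t0 (min e0 d) \<subseteq> S \<and> (\<forall>t\<in>ball t0 (min e0 d). \<forall>u\<in>C. p t u = 0 \<longrightarrow> norm (q t u) \<ge> c)"
  proof (intro conjI ballI impI)
    show "ball t0 (min e0 d) \<subseteq> S" using e0 by (auto simp: subset_iff)
    fix t u assume t: "t \<in> ball t0 (min e0 d)" and u: "u \<in> C" and "p t u = 0"
    have "dist (D (t, u)) (D (t0, u)) < c"
      using t u e0 by (intro d(2)) (auto simp: dist_Pair_Pair dist_commute)
    moreover have "D (t0, u) \<ge> 2 * c" using z(2)[of "(t0, u)"] u by (simp add: c_def)
    ultimately have "D (t, u) \<ge> c" by (simp add: dist_real_def abs_if split: if_splits)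
    then show "norm (q t u) \<ge> c" using \<open>p t u = 0\<close> by (simp add: D_def)
  qed
  then show ?thesis using e0(1) d(1) \<open>c > 0\<close> by (intro exI[of _ "min e0 d"] exI[of _ c]) auto
qed

text \<open>With \<open>c \<le> 1\<close> missing factors can only help, so one bound serves fibres
  of any size up to \<open>m\<close>.\<close>

lemma norm_prod_ge_min_power:
  fixes q :: "'a \<Rightarrow> complex"
  assumes "finite A" "card A \<le> m" "\<And>u. u \<in> A \<Longrightarrow> norm (q u) \<ge> c" "0 < c" "c \<le> 1"
  shows "norm (prod q A) \<ge> c ^ m"
proof -
  have "c ^ m \<le> c ^ card A" using assms by (intro power_decreasing) auto
  also have "\<dots> = (\<Prod>u\<in>A. c)" by simp
  also have "\<dots> \<le> (\<Prod>u\<in>A. norm (q u))" using assms by (intro prod_mono) auto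
  also have "\<dots> = norm (prod q A)" by (rule prod_norm)
  finally show ?thesis .
qed

lemma norm_prod_le_max_power:
  fixes q :: "'a \<Rightarrow> complex"
  assumes "finite A" "card A \<le> m" "\<And>u. u \<in> A \<Longrightarrow> norm (q u) \<le> B" "1 \<le> B"
  shows "norm (prod q A) \<le> B ^ m"
proof -
  have "norm (prod q A) = (\<Prod>u\<in>A. norm (q u))" by (rule prod_norm[symmetric])
  also have "\<dots> \<le> (\<Prod>u\<in>A. B)" using assms by (intro prod_mono) auto
  also have "\<dots> = B ^ card A" by simp
  also have "\<dots> \<le> B ^ m" using assms by (intro power_increasing) auto
  finally show ?thesis .
qed

text \<open>
  The plane curve \<open>(a, b)\<close>, seen over the disc of radius \<open>2r\<close> through the fibres in the disc of
  radius \<open>3r\<close> of its first component \<open>a\<close>, which has at most \<open>m\<close> sheets there.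
\<close>

locale sheeted_curve =
  fixes a b :: "complex \<Rightarrow> complex" and m :: nat and r :: real
  assumes r: "r > 0"
    and hol: "a holomorphic_on ball 0 (4 * r)" "b holomorphic_on ball 0 (4 * r)"
    and sheets: "\<And>t. t \<in> ball 0 (2 * r) \<Longrightarrow> finite {u \<in> ball 0 (3 * r). a u = a t} \<and>
      card {u \<in> ball 0 (3 * r). a u = a t} \<le> m"
    and boundary: "\<And>t u. t \<in> ball 0 (2 * r) \<Longrightarrow> norm u = 3 * r \<Longrightarrow> a u \<noteq> a t"
    and immersed: "\<And>t. t \<in> cball 0 (3 * r) \<Longrightarrow> deriv a t \<noteq> 0 \<or> deriv b t \<noteq> 0"
    and no_triple: "\<And>t u w. t \<in> cball 0 (3 * r) \<Longrightarrow> u \<in> cball 0 (3 * r) \<Longrightarrow> w \<in> cball 0 (3 * r) \<Longrightarrow>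
      t \<noteq> u \<Longrightarrow> a t = a u \<Longrightarrow> b t = b u \<Longrightarrow> a w = a t \<Longrightarrow> b w = b t \<Longrightarrow> w = t \<or> w = u"
begin

section \<open>Fibres, branch points and the product over the other sheets\<close>

definition fibre :: "complex \<Rightarrow> complex set"
  where "fibre t = {u \<in> ball 0 (3 * r). a u = a t}"

definition branch_points :: "complex set"
  where "branch_points = {t \<in> ball 0 (2 * r). \<exists>u\<in>fibre t. deriv a u = 0}"

text \<open>A resultant in disguise: \<open>u\<close> is eliminated from the divided differences of
  \<open>a\<close> and \<open>b\<close>. As the product runs over a set, multiplicities are lost at
  branch points and its values there are not the right ones.\<close>

definition sheet_product :: "complex \<Rightarrow> complex"
  where "sheet_product t = (\<Prod>u\<in>fibre t - {t}. diff_quot b t u)"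

definition special :: "complex \<Rightarrow> complex \<Rightarrow> bool"
  where "special t u \<longleftrightarrow> t \<in> ball 0 (2 * r) \<and> u \<in> ball 0 (3 * r) \<and> u \<noteq> t \<and> a u = a t \<and> b u = b t"

lemma disc_mono:
  "ball 0 (2 * r) \<subseteq> ball (0::complex) (3 * r)" "ball 0 (3 * r) \<subseteq> cball (0::complex) (3 * r)"
  "cball 0 (3 * r) \<subseteq> ball (0::complex) (4 * r)" "ball 0 (2 * r) \<subseteq> ball (0::complex) (4 * r)"
  using r by auto

lemma fibre_finite: "t \<in> ball 0 (2 * r) \<Longrightarrow> finite (fibre t) \<and> card (fibre t) \<le> m"
  unfolding fibre_def by (rule sheets)

lemma fibre_self: "t \<in> ball 0 (2 * r) \<Longrightarrow> t \<in> fibre t"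
  using disc_mono by (auto simp: fibre_def)

lemma not_constant: "\<not> a constant_on ball 0 (4 * r)"
proof
  assume "a constant_on ball 0 (4 * r)"
  then obtain c where "\<And>z. z \<in> ball 0 (4 * r) \<Longrightarrow> a z = c"
    unfolding constant_on_def by blast
  then have "a (of_real (3 * r)) = a 0"
    using r by auto
  then show False using boundary[of 0 "of_real (3 * r)"] r by simp
qed

lemma finite_critical: "finite {u \<in> ball 0 (3 * r). deriv a u = 0}"
proof (rule finite_subset)
  show "finite {z \<in> cball 0 (3 * r). deriv a z = 0}"
  proof (cases "deriv a constant_on ball 0 (4 * r)")
    case True
    then obtain c where c: "\<And>z. z \<in> ball 0 (4 * r) \<Longrightarrow> deriv a z = c"
      unfolding constant_on_def by blast
    have "c \<noteq> 0"
    proof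
      assume "c = 0"
      then have "a constant_on ball 0 (4 * r)"
        using hol(1) has_field_derivative_0_imp_constant_on[of "ball 0 (4 * r)" a] c
          holomorphic_derivI[OF hol(1) open_ball] by (metis connected_ball open_ball)
      then show False using not_constant by blast
    qed
    then have "{z \<in> cball 0 (3 * r). deriv a z = 0} = {}"
      using c disc_mono(3) by blast
    then show ?thesis by (metis finite.emptyI)
  next
    case False
    have "deriv a holomorphic_on ball 0 (4 * r)" by (intro holomorphic_deriv hol open_ball)
    then show ?thesis
      by (rule holomorphic_compact_finite_zeros[where S = "ball 0 (4 * r)"])
        (use False disc_mono in auto)
  qed
qed auto

lemma finite_branch_points: "finite branch_points"
proof -
  have "branch_points \<subseteq> (\<Union>u\<in>{u \<in> ball 0 (3 * r). deriv a u = 0}. {t \<in> ball 0 (2 * r). a t = a u})"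
    by (auto simp: branch_points_def fibre_def)
  moreover have "finite {t \<in> ball 0 (2 * r). a t = a u}" for u
  proof (cases "\<exists>s \<in> ball 0 (2 * r). a s = a u")
    case True
    then obtain s where "s \<in> ball 0 (2 * r)" "a s = a u" by blast
    then show ?thesis
      using fibre_finite[of s] disc_mono(1)
      by (intro finite_subset[where A = "{t \<in> ball 0 (2 * r). a t = a u}" and B = "fibre s"])
        (auto simp: fibre_def)
  next
    case False
    then have "{t \<in> ball 0 (2 * r). a t = a u} = {}" by blast
    then show ?thesis by (metis finite.emptyI)
  qed
  ultimately show ?thesis
    using finite_critical by (meson finite_UN_I finite_subset)
qed

lemma open_regular: "open (ball 0 (2 * r) - branch_points)"
  using finite_branch_points by (intro open_Diff finite_imp_closed) auto

lemma cont_quot: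
  "continuous_on (ball 0 (4 * r) \<times> ball 0 (4 * r)) (\<lambda>(t, u). diff_quot a t u)"
  "continuous_on (ball 0 (4 * r) \<times> ball 0 (4 * r)) (\<lambda>(t, u). diff_quot b t u)"
  by (intro continuous_on_diff_quot hol open_ball)+

lemma quot_bounded:
  obtains B where "B \<ge> 1"
    "\<And>t u. t \<in> ball 0 (2 * r) \<Longrightarrow> u \<in> ball 0 (3 * r) \<Longrightarrow> norm (diff_quot b t u) \<le> B"
proof -
  have "compact ((\<lambda>(t, u). diff_quot b t u) ` (cball 0 (2 * r) \<times> cball 0 (3 * r)))"
    by (rule compact_continuous_image[OF continuous_on_subset[OF cont_quot(2)]])
      (use r in \<open>auto intro!: compact_Times\<close>)
  then obtain B where B: "\<forall>z\<in>(\<lambda>(t, u). diff_quot b t u) ` (cball 0 (2 * r) \<times> cball 0 (3 * r)). norm z \<le> B"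
    using compact_imp_bounded bounded_iff by blast
  show ?thesis
  proof (rule that[of "max B 1"])
    fix t u :: complex assume "t \<in> ball 0 (2 * r)" "u \<in> ball 0 (3 * r)"
    then have "(t, u) \<in> cball 0 (2 * r) \<times> cball 0 (3 * r)" by auto
    then have "norm (diff_quot b t u) \<le> B" using B by force
    then show "norm (diff_quot b t u) \<le> max B 1" by simp
  qed auto
qed

text \<open>All radii up to \<open>e0\<close> are offered, so that one radius can be shared by the
  points of a whole fibre.\<close>

lemma local_inverse:
  assumes "u \<in> ball 0 (3 * r)" "deriv a u \<noteq> 0"
  obtains e0 where "e0 > 0" "\<And>e. 0 < e \<Longrightarrow> e \<le> e0 \<Longrightarrow> ball u e \<subseteq> ball 0 (3 * r) \<and> inj_on a (ball u e) \<and>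
     open (a ` ball u e) \<and> (\<exists>\<psi>. \<psi> holomorphic_on a ` ball u e \<and> (\<forall>z\<in>ball u e. \<psi> (a z) = z \<and> deriv a z * deriv \<psi> (a z) = 1))"
proof -
  have hol3: "a holomorphic_on ball 0 (3 * r)"
    using hol(1) disc_mono holomorphic_on_subset by (meson subset_trans)
  obtain e0 where e0: "e0 > 0" "ball u e0 \<subseteq> ball 0 (3 * r)" "inj_on a (ball u e0)"
    using has_complex_derivative_locally_injective[OF hol3 assms(1) open_ball assms(2)] by metis
  show ?thesis
  proof (rule that[OF e0(1)])
    fix e assume e: "0 < e" "e \<le> e0"
    have sub: "ball u e \<subseteq> ball u e0" using e by auto
    have h: "a holomorphic_on ball u e" using hol3 sub e0(2) holomorphic_on_subset by (meson subset_trans)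
    have i: "inj_on a (ball u e)" using e0(3) sub inj_on_subset by blast
    obtain \<psi> where "\<psi> holomorphic_on a ` ball u e" "\<And>z. z \<in> ball u e \<Longrightarrow> \<psi> (a z) = z"
        "\<And>z. z \<in> ball u e \<Longrightarrow> deriv a z * deriv \<psi> (a z) = 1"
      using holomorphic_has_inverse[OF h open_ball i] by metis
    then show "ball u e \<subseteq> ball 0 (3 * r) \<and> inj_on a (ball u e) \<and>
     open (a ` ball u e) \<and> (\<exists>\<psi>. \<psi> holomorphic_on a ` ball u e \<and> (\<forall>z\<in>ball u e. \<psi> (a z) = z \<and> deriv a z * deriv \<psi> (a z) = 1))"
      using sub e0 i open_mapping_thm3[OF h open_ball i] by blast
  qed
qed

lemma tendsto_preimage_open:
  assumes "t0 \<in> ball 0 (2 * r)" "open W" "a t0 \<in> W"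
  shows "\<forall>\<^sub>F t in nhds t0. t \<in> ball 0 (2 * r) \<and> a t \<in> W"
proof -
  have "continuous_on (ball 0 (2 * r)) a"
    using hol(1) disc_mono(4) holomorphic_on_subset holomorphic_on_imp_continuous_on by blast
  then have "open (a -` W \<inter> ball 0 (2 * r))"
    using continuous_open_vimage assms(2) by (simp add: continuous_on_open_vimage)
  then have "\<forall>\<^sub>F t in nhds t0. t \<in> a -` W \<inter> ball 0 (2 * r)"
    by (rule eventually_nhds_in_open) (use assms in auto)
  then show ?thesis by (rule eventually_mono) auto
qed

text \<open>Over an unramified fibre the sheets are \<open>\<psi> u (a t)\<close> with local
  inverses \<open>\<psi> u\<close> of \<open>a\<close>, and no further sheet can enter near
  \<open>t0\<close>. The product is then one of finitely many holomorphic factors.\<close>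

lemma sheet_product_holomorphic_near:
  assumes t0: "t0 \<in> ball 0 (2 * r) - branch_points"
  shows "\<exists>g U. open U \<and> t0 \<in> U \<and> g holomorphic_on U \<and> (\<forall>t\<in>U. sheet_product t = g t)"
proof -
  define Z where "Z = fibre t0"
  have Z: "finite Z" "t0 \<in> Z" "\<And>u. u \<in> Z \<Longrightarrow> u \<in> ball 0 (3 * r) \<and> a u = a t0 \<and> deriv a u \<noteq> 0"
    using t0 fibre_finite[of t0] fibre_self[of t0] by (auto simp: Z_def branch_points_def fibre_def)
  have "\<forall>u\<in>Z. \<exists>e0>0. \<forall>e. 0 < e \<and> e \<le> e0 \<longrightarrow> ball u e \<subseteq> ball 0 (3 * r) \<and> inj_on a (ball u e) \<and>
     open (a ` ball u e) \<and> (\<exists>\<psi>. \<psi> holomorphic_on a ` ball u e \<and> (\<forall>z\<in>ball u e. \<psi> (a z) = z \<and> deriv a z * deriv \<psi> (a z) = 1))"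
    using local_inverse Z(3) by metis
  then obtain e0 where e0: "\<And>u. u \<in> Z \<Longrightarrow> e0 u > 0" "\<And>u e. u \<in> Z \<Longrightarrow> 0 < e \<Longrightarrow> e \<le> e0 u \<Longrightarrow>
     ball u e \<subseteq> ball 0 (3 * r) \<and> inj_on a (ball u e) \<and>
     open (a ` ball u e) \<and> (\<exists>\<psi>. \<psi> holomorphic_on a ` ball u e \<and> (\<forall>z\<in>ball u e. \<psi> (a z) = z \<and> deriv a z * deriv \<psi> (a z) = 1))"
    by metis
  obtain d where d: "d > 0" "\<And>u w. u \<in> Z \<Longrightarrow> w \<in> Z \<Longrightarrow> u \<noteq> w \<Longrightarrow> d \<le> dist u w"
  proof -
    have "\<forall>u. \<exists>d>0. \<forall>w\<in>Z. w \<noteq> u \<longrightarrow> d \<le> dist u w"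
      using finite_set_avoid[OF Z(1)] by blast
    then obtain d' where d': "\<And>u. d' u > 0" "\<And>u w. w \<in> Z \<Longrightarrow> w \<noteq> u \<Longrightarrow> d' u \<le> dist u w"
      by metis
    show ?thesis
    proof (rule that[of "Min (d' ` Z)"])
      show "Min (d' ` Z) > 0" using Z(1,2) d'(1) by (subst Min_gr_iff) auto
      fix u w assume uw: "u \<in> Z" "w \<in> Z" "u \<noteq> w"
      then have "Min (d' ` Z) \<le> d' u" using Z(1) by auto
      also have "\<dots> \<le> dist u w" using d'(2)[of w u] uw by auto
      finally show "Min (d' ` Z) \<le> dist u w" .
    qed
  qed
  \<comment> \<open>Half the minimal distance \<open>d\<close> makes the discs around the points of
    the fibre disjoint.\<close>
  define e where "e = Min (insert (d / 2) (e0 ` Z))"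
  have e: "e > 0" "e \<le> d / 2" "\<And>u. u \<in> Z \<Longrightarrow> e \<le> e0 u"
  proof -
    show "e > 0" unfolding e_def using Z(1) d(1) e0(1) by (subst Min_gr_iff) auto
    show "e \<le> d / 2" unfolding e_def by (rule Min_le) (use Z(1) in auto)
    show "e \<le> e0 u" if "u \<in> Z" for u unfolding e_def by (rule Min_le) (use Z(1) that in auto)
  qed
  have disj: "u = w" if "u \<in> Z" "w \<in> Z" "x \<in> ball u e" "x \<in> ball w e" for u w x
  proof (rule ccontr)
    assume "u \<noteq> w"
    then have "d \<le> dist u w" using d that by blast
    also have "\<dots> \<le> dist u x + dist w x" by (metis dist_commute dist_triangle)
    also have "\<dots> < d" using that e by auto
    finally show False by simp
  qed
  obtain \<psi> where \<psi>: "\<And>u. u \<in> Z \<Longrightarrow> \<psi> u holomorphic_on a ` ball u e"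
      "\<And>u z. u \<in> Z \<Longrightarrow> z \<in> ball u e \<Longrightarrow> \<psi> u (a z) = z"
    using e0(2)[OF _ e(1) e(3)] by metis
  have op: "open (a ` ball u e)" and sub: "ball u e \<subseteq> ball 0 (3 * r)" if "u \<in> Z" for u
    using e0(2)[OF _ e(1) e(3)] that by auto
  \<comment> \<open>The value \<open>a t0\<close> is not attained on this compact set: on the
    boundary circle by \<open>boundary\<close>, inside because such a point would belong to the
    fibre. A neighbourhood of \<open>a t0\<close> is thus missed and no sheet comes from
    \<open>C\<close>.\<close>
  define C where "C = cball 0 (3 * r) - (\<Union>u\<in>Z. ball u e)"
  have "compact C" unfolding C_def by (intro compact_diff compact_cball open_UN) auto
  have "closed (a ` C)"
  proof (intro compact_imp_closed compact_continuous_image \<open>compact C\<close>)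
    show "continuous_on C a"
      using hol(1) disc_mono(3) unfolding C_def
      by (meson Diff_subset continuous_on_subset holomorphic_on_imp_continuous_on)
  qed
  moreover have "a t0 \<notin> a ` C"
  proof
    assume "a t0 \<in> a ` C"
    then obtain u where u: "u \<in> C" "a u = a t0" by (metis imageE)
    then have "norm u \<noteq> 3 * r" using boundary t0 by blast
    then have "u \<in> Z" using u by (auto simp: Z_def fibre_def C_def)
    then show False using u(1) e(1) by (auto simp: C_def)
  qed
  moreover have "open (\<Inter>u\<in>Z. a ` ball u e)" using Z(1) op by (intro open_INT) auto
  moreover have "a t0 \<in> (\<Inter>u\<in>Z. a ` ball u e)"
  proof
    fix u assume "u \<in> Z"
    then show "a t0 \<in> a ` ball u e"
      using Z(3) e(1) by (metis centre_in_ball image_eqI)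
  qed
  ultimately have "open ((\<Inter>u\<in>Z. a ` ball u e) - a ` C)" "a t0 \<in> (\<Inter>u\<in>Z. a ` ball u e) - a ` C"
    by (simp_all only: open_Diff Diff_iff not_False_eq_True simp_thms)
  then have "\<forall>\<^sub>F t in nhds t0. (t \<in> ball 0 (2 * r) \<and> a t \<in> (\<Inter>u\<in>Z. a ` ball u e) - a ` C)"
    using tendsto_preimage_open t0 by blast
  moreover have "\<forall>\<^sub>F t in nhds t0. t \<in> ball t0 e"
    using e(1) by (intro eventually_nhds_in_open) auto
  ultimately have "\<forall>\<^sub>F t in nhds t0. t \<in> ball 0 (2 * r) \<and> a t \<in> (\<Inter>u\<in>Z. a ` ball u e) - a ` C \<and> t \<in> ball t0 e"
    by eventually_elim auto
  then obtain U where U: "open U" "t0 \<in> U"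
    "\<And>t. t \<in> U \<Longrightarrow> t \<in> ball 0 (2 * r) \<and> a t \<in> (\<Inter>u\<in>Z. a ` ball u e) - a ` C \<and> t \<in> ball t0 e"
    unfolding eventually_nhds by blast
  have root: "\<psi> u (a t) \<in> ball u e \<and> a (\<psi> u (a t)) = a t" if tU: "t \<in> U" and uZ: "u \<in> Z" for t u
  proof -
    obtain z where z: "z \<in> ball u e" "a t = a z" using U(3)[OF tU] uZ by blast
    then show ?thesis using \<psi>(2)[OF uZ, of z] by simp
  qed
  have self: "\<psi> t0 (a t) = t" if "t \<in> U" for t
    using \<psi>(2) U(3)[OF that] Z(2) by blast
  have inj: "inj_on (\<lambda>u. \<psi> u (a t)) Z" if t: "t \<in> U" for t
  proof (rule inj_onI)
    fix u w assume uw: "u \<in> Z" "w \<in> Z" "\<psi> u (a t) = \<psi> w (a t)"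
    show "u = w"
      by (rule disj[OF uw(1,2), of "\<psi> u (a t)"]) (use root[OF t uw(1)] root[OF t uw(2)] uw(3) in auto)
  qed
  have fib: "fibre t = (\<lambda>u. \<psi> u (a t)) ` Z" if t: "t \<in> U" for t
  proof
    show "(\<lambda>u. \<psi> u (a t)) ` Z \<subseteq> fibre t"
    proof (rule image_subsetI)
      fix u assume "u \<in> Z"
      then show "\<psi> u (a t) \<in> fibre t"
        unfolding fibre_def using root[OF t] sub by blast
    qed
    show "fibre t \<subseteq> (\<lambda>u. \<psi> u (a t)) ` Z"
    proof
      fix w assume w: "w \<in> fibre t"
      have "w \<notin> C"
      proof
        assume "w \<in> C"
        then have "a w \<in> a ` C" by (rule imageI)
        then show False using U(3)[OF t] w by (simp add: fibre_def)
      qed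
      then obtain u where u: "u \<in> Z" "w \<in> ball u e" using w by (auto simp: fibre_def C_def)
      then have "\<psi> u (a t) = w" using \<psi>(2)[OF u] w by (simp add: fibre_def)
      then show "w \<in> (\<lambda>u. \<psi> u (a t)) ` Z" using u by blast
    qed
  qed
  \<comment> \<open>Another sheet never passes through \<open>t\<close> itself, so only the
    off-diagonal case of \<open>diff_quot\<close> occurs and the factors are visibly
    holomorphic.\<close>
  define g where "g = (\<lambda>t. \<Prod>u\<in>Z - {t0}. (b t - b (\<psi> u (a t))) / (t - \<psi> u (a t)))"
  have "sheet_product t = g t" if t: "t \<in> U" for t
  proof -
    have "fibre t - {t} = (\<lambda>u. \<psi> u (a t)) ` (Z - {t0})"
      using inj_on_image_set_diff[OF inj[OF t], of Z "{t0}"] fib[OF t] self[OF t] Z(2) by simp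
    moreover have "inj_on (\<lambda>u. \<psi> u (a t)) (Z - {t0})" using inj[OF t] inj_on_subset by blast
    moreover have "t \<noteq> \<psi> u (a t)" if "u \<in> Z - {t0}" for u
      using inj[OF t] self[OF t] Z(2) that by (metis Diff_iff inj_on_contraD singletonI)
    ultimately show ?thesis
      unfolding sheet_product_def g_def by (simp add: prod.reindex diff_quot_def)
  qed
  moreover have "g holomorphic_on U"
    unfolding g_def
  proof (rule holomorphic_on_prod)
    fix u assume u: "u \<in> Z - {t0}"
    have UU: "U \<subseteq> ball 0 (4 * r)" using U(3) disc_mono(4) by blast
    have hU: "a holomorphic_on U" "b holomorphic_on U"
      by (intro holomorphic_on_subset[OF hol(1) UU] holomorphic_on_subset[OF hol(2) UU])+
    have h1: "(\<lambda>t. \<psi> u (a t)) holomorphic_on U"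
      using holomorphic_on_compose_gen[OF hU(1) \<psi>(1)[of u]] U(3) u by (auto simp: comp_def)
    have "(\<lambda>t. \<psi> u (a t)) ` U \<subseteq> ball 0 (4 * r)"
    proof (rule image_subsetI)
      fix t assume "t \<in> U"
      then have "\<psi> u (a t) \<in> ball u e" using root u by blast
      then have "\<psi> u (a t) \<in> ball 0 (3 * r)" using sub u by blast
      then show "\<psi> u (a t) \<in> ball 0 (4 * r)" using disc_mono by blast
    qed
    then have h2: "(\<lambda>t. b (\<psi> u (a t))) holomorphic_on U"
      using holomorphic_on_compose_gen[OF h1 hol(2)] by (simp add: comp_def)
    have nz: "t - \<psi> u (a t) \<noteq> 0" if t: "t \<in> U" for t
      using inj[OF t] self[OF t] Z(2) u by (metis Diff_iff inj_on_contraD singletonI right_minus_eq)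
    show "(\<lambda>t. (b t - b (\<psi> u (a t))) / (t - \<psi> u (a t))) holomorphic_on U"
      by (intro holomorphic_on_divide holomorphic_on_diff hU h1 h2 holomorphic_on_ident nz)
  qed
  ultimately show ?thesis using U by blast
qed

lemma holomorphic_sheet_product: "sheet_product holomorphic_on ball 0 (2 * r) - branch_points"
  unfolding holomorphic_on_open[OF open_regular]
proof
  fix t0 assume "t0 \<in> ball 0 (2 * r) - branch_points"
  then obtain g U where g: "open U" "t0 \<in> U" "g holomorphic_on U" "\<And>t. t \<in> U \<Longrightarrow> sheet_product t = g t"
    using sheet_product_holomorphic_near by metis
  then have "(sheet_product has_field_derivative deriv g t0) (at t0)"
    by (intro has_field_derivative_transform_within_open[OF holomorphic_derivI[OF g(3,1,2)] g(1,2)]) auto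
  then show "\<exists>f'. (sheet_product has_field_derivative f') (at t0)" ..
qed

lemma fibre_bounds: "t \<in> ball 0 (2 * r) \<Longrightarrow> finite (fibre t - A) \<and> card (fibre t - A) \<le> m"
  using fibre_finite[of t] card_mono[of "fibre t" "fibre t - A"] by force

lemma sheet_product_bounded:
  obtains B where "B \<ge> 1"
    "\<And>t A. t \<in> ball 0 (2 * r) \<Longrightarrow> norm (\<Prod>u\<in>fibre t - A. diff_quot b t u) \<le> B"
proof -
  obtain B where B: "B \<ge> 1"
    "\<And>t u. t \<in> ball 0 (2 * r) \<Longrightarrow> u \<in> ball 0 (3 * r) \<Longrightarrow> norm (diff_quot b t u) \<le> B"
    using quot_bounded by blast
  have "norm (\<Prod>u\<in>fibre t - A. diff_quot b t u) \<le> B ^ m" if t: "t \<in> ball 0 (2 * r)" for t A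
  proof (rule norm_prod_le_max_power)
    show "norm (diff_quot b t u) \<le> B" if "u \<in> fibre t - A" for u
      using that B(2) t by (auto simp: fibre_def)
  qed (use fibre_bounds[OF t, of A] B(1) in blast)+
  then show ?thesis using that[of "B ^ m"] B(1) by simp
qed

text \<open>Riemann's removable singularity theorem: the branch points are finite in number, and at
  most \<open>m\<close> bounded factors occur near each of them.\<close>

lemma ex_holomorphic_sheet_product:
  "\<exists>N. N holomorphic_on ball 0 (2 * r) \<and> (\<forall>t\<in>ball 0 (2 * r) - branch_points. N t = sheet_product t)"
proof (rule removable_singularities[OF finite_branch_points _ holomorphic_sheet_product])
  obtain B where B: "B \<ge> 1"
    "\<And>t A. t \<in> ball 0 (2 * r) \<Longrightarrow> norm (\<Prod>u\<in>fibre t - A. diff_quot b t u) \<le> B"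
    using sheet_product_bounded by blast
  show "branch_points \<subseteq> interior (ball 0 (2 * r))" by (auto simp: branch_points_def)
  fix z assume "z \<in> branch_points"
  then have "\<forall>\<^sub>F t in at z. t \<in> ball 0 (2 * r)"
    by (intro eventually_at_in_open') (auto simp: branch_points_def)
  then have "\<forall>\<^sub>F t in at z. norm (sheet_product t) \<le> B * norm (1 :: complex)"
    by (rule eventually_mono) (use B(2) in \<open>simp add: sheet_product_def\<close>)
  then show "sheet_product \<in> O[at z](\<lambda>_. 1)" by (rule bigoI)
qed

definition double_function :: "complex \<Rightarrow> complex"
  where "double_function = (SOME N. N holomorphic_on ball 0 (2 * r) \<and>
    (\<forall>t\<in>ball 0 (2 * r) - branch_points. N t = sheet_product t))"

lemma holomorphic_double_function: "double_function holomorphic_on ball 0 (2 * r)"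
  and double_function_eq: "t \<in> ball 0 (2 * r) - branch_points \<Longrightarrow> double_function t = sheet_product t"
  using someI_ex[OF ex_holomorphic_sheet_product] unfolding double_function_def by auto

section \<open>Zeros of the double function\<close>

lemma eventually_regular:
  assumes "t0 \<in> ball 0 (2 * r)"
  shows "\<forall>\<^sub>F t in at t0. t \<in> ball 0 (2 * r) - branch_points"
proof -
  have "\<forall>\<^sub>F t in at t0. t \<in> ball 0 (2 * r) - (branch_points - {t0})"
    using assms finite_branch_points by (intro eventually_at_in_open' open_Diff finite_imp_closed) auto
  moreover have "\<forall>\<^sub>F t in at t0. t \<noteq> t0" by (simp add: eventually_at_filter)
  ultimately show ?thesis by eventually_elim auto
qed

lemma tendsto_double_function:
  assumes "t0 \<in> ball 0 (2 * r)"
  shows "(double_function \<longlongrightarrow> double_function t0) (at t0)"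
  using holomorphic_on_imp_continuous_on[OF holomorphic_double_function] assms
  by (simp add: continuous_on_eq_continuous_at isCont_def)

text \<open>Without a partner for \<open>t0\<close>, the two divided differences have no common zero
  over \<open>t0\<close>; immersion covers the diagonal. All factors near \<open>t0\<close> then
  stay away from 0, and so does the limit, even if \<open>t0\<close> is a branch point.\<close>

lemma double_function_nonzero:
  assumes t0: "t0 \<in> ball 0 (2 * r)" and ns: "\<And>u. \<not> special t0 u"
  shows "double_function t0 \<noteq> 0"
proof
  assume "double_function t0 = 0"
  have "\<exists>e>0. \<exists>c>0. ball t0 e \<subseteq> ball 0 (4 * r) \<and>
    (\<forall>t\<in>ball t0 e. \<forall>u\<in>cball 0 (3 * r). diff_quot a t u = 0 \<longrightarrow> norm (diff_quot b t u) \<ge> c)"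
  proof (rule no_common_zero_bound[OF cont_quot open_ball _ compact_cball])
    show "t0 \<in> ball 0 (4 * r)" "cball 0 (3 * r) \<subseteq> ball (0::complex) (4 * r)"
      using t0 disc_mono by auto
    fix u :: complex assume u: "u \<in> cball 0 (3 * r)" "diff_quot a t0 u = 0"
    show "diff_quot b t0 u \<noteq> 0"
    proof (cases "u = t0")
      case True
      then show ?thesis using immersed[OF u(1)] u(2) by (simp add: diff_quot_def)
    next
      case False
      then have "a u = a t0" using u(2) by (auto simp: diff_quot_def)
      then have "norm u \<noteq> 3 * r" using boundary t0 by blast
      then show ?thesis using ns[of u] u(1) \<open>a u = a t0\<close> False t0 by (auto simp: special_def diff_quot_def)
    qed
  qed
  then obtain e c where ec: "e > 0" "c > 0" "ball t0 e \<subseteq> ball 0 (4 * r)"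
    "\<And>t u. t \<in> ball t0 e \<Longrightarrow> u \<in> cball 0 (3 * r) \<Longrightarrow> diff_quot a t u = 0 \<Longrightarrow> norm (diff_quot b t u) \<ge> c"
    by blast
  define d where "d = (min c 1) ^ m"
  have "d > 0" using ec by (simp add: d_def)
  have "\<forall>\<^sub>F t in at t0. norm (double_function t) < d"
    using tendstoD[OF tendsto_double_function[OF t0] \<open>d > 0\<close>] \<open>double_function t0 = 0\<close> by simp
  moreover have "\<forall>\<^sub>F t in at t0. t \<in> ball t0 e"
    using ec by (intro eventually_at_in_open') auto
  ultimately have "\<forall>\<^sub>F t in at t0. False"
    using eventually_regular[OF t0]
  proof eventually_elim
    case (elim t)
    have "norm (sheet_product t) \<ge> d"
      unfolding sheet_product_def d_def
    proof (rule norm_prod_ge_min_power)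
      fix u assume u: "u \<in> fibre t - {t}"
      then have "c \<le> norm (diff_quot b t u)"
        using ec(4)[of t u] elim(2) by (auto simp: fibre_def diff_quot_def)
      then show "min c 1 \<le> norm (diff_quot b t u)" by simp
    qed (use fibre_bounds[of t "{t}"] elim(3) ec(2) in auto)
    then show False using elim double_function_eq[of t] by auto
  qed
  then show False using eventually_happens'[OF at_neq_bot] by fastforce
qed

text \<open>A sheet near the partner \<open>u0\<close> contributes an arbitrarily small factor,
  while the others are bounded. The open mapping theorem supplies this sheet, also where
  \<open>a\<close> is ramified at \<open>u0\<close>.\<close>

lemma double_function_zero:
  assumes sp: "special t0 u0"
  shows "double_function t0 = 0"
proof -
  obtain B where B: "B \<ge> 1"
    "\<And>t A. t \<in> ball 0 (2 * r) \<Longrightarrow> norm (\<Prod>u\<in>fibre t - A. diff_quot b t u) \<le> B"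
    using sheet_product_bounded by blast
  have t0: "t0 \<in> ball 0 (2 * r)" and u0: "u0 \<in> ball 0 (3 * r)" "u0 \<noteq> t0" "a u0 = a t0" "b u0 = b t0"
    using sp by (auto simp: special_def)
  have "norm (double_function t0) \<le> \<epsilon> * B" if "\<epsilon> > 0" for \<epsilon>
  proof -
    have "isCont (\<lambda>(t, u). diff_quot b t u) (t0, u0)"
    proof -
      have "(t0, u0) \<in> ball 0 (4 * r) \<times> ball 0 (4 * r)" using t0 u0 disc_mono by blast
      then show ?thesis
        using cont_quot(2) continuous_on_eq_continuous_at[OF open_Times[OF open_ball open_ball]] by blast
    qed
    then obtain d where d: "d > 0" "\<And>z. dist z (t0, u0) < d \<Longrightarrow>
        dist (case z of (t, u) \<Rightarrow> diff_quot b t u) (diff_quot b t0 u0) < \<epsilon>"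
      unfolding continuous_at_eps_delta using \<open>\<epsilon> > 0\<close> by force
    \<comment> \<open>Half the distance from \<open>t0\<close> to \<open>u0\<close> keeps the nearby
      sheet distinct from \<open>t\<close>; \<open>d / 2\<close> keeps the pair within the range of
      continuity.\<close>
    define \<kappa> where "\<kappa> = min (d / 2) (dist t0 u0 / 2)"
    have \<kappa>: "\<kappa> > 0" using d(1) u0(2) by (simp add: \<kappa>_def)
    have "open (a ` (ball u0 \<kappa> \<inter> ball 0 (3 * r)))"
      by (rule open_mapping_thm[OF hol(1) open_ball connected_ball _ _ not_constant]) (use r in auto)
    then have "\<forall>\<^sub>F t in nhds t0. t \<in> ball 0 (2 * r) \<and> a t \<in> a ` (ball u0 \<kappa> \<inter> ball 0 (3 * r))"
      by (rule tendsto_preimage_open[OF t0]) (use u0 \<kappa> in \<open>auto intro!: image_eqI[of _ _ u0]\<close>)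
    then have "\<forall>\<^sub>F t in at t0. t \<in> ball 0 (2 * r) \<and> a t \<in> a ` (ball u0 \<kappa> \<inter> ball 0 (3 * r))"
      by (auto simp: eventually_at_filter elim: eventually_mono)
    moreover have "\<forall>\<^sub>F t in at t0. t \<in> ball t0 \<kappa>"
      using \<kappa> by (intro eventually_at_in_open') auto
    ultimately have "\<forall>\<^sub>F t in at t0. norm (double_function t) \<le> \<epsilon> * B"
      using eventually_regular[OF t0]
    proof eventually_elim
      case (elim t)
      then have "a t \<in> a ` (ball u0 \<kappa> \<inter> ball 0 (3 * r))" by blast
      then obtain u where "a t = a u" "u \<in> ball u0 \<kappa> \<inter> ball 0 (3 * r)" by (metis imageE)
      then have u: "u \<in> ball u0 \<kappa>" "u \<in> ball 0 (3 * r)" "a u = a t" by auto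
      have "u \<noteq> t"
      proof
        assume "u = t"
        then have "dist t0 u0 < dist t0 u0"
          using dist_triangle[of t0 u0 t] elim(2) u(1) by (auto simp: \<kappa>_def dist_commute)
        then show False by simp
      qed
      have "dist (t, u) (t0, u0) \<le> dist t t0 + dist u u0"
        by (simp add: dist_Pair_Pair sqrt_sum_squares_le_sum)
      also have "\<dots> < d" using elim(2) u(1) by (auto simp: \<kappa>_def dist_commute)
      finally have q: "norm (diff_quot b t u) \<le> \<epsilon>"
        using d(2)[of "(t, u)"] u0 by (auto simp: diff_quot_def[of b t0 u0] split: if_splits)
      have "fibre t - {t} = insert u (fibre t - {t, u})"
        using u \<open>u \<noteq> t\<close> by (auto simp: fibre_def)
      then have "sheet_product t = diff_quot b t u * (\<Prod>w\<in>fibre t - {t, u}. diff_quot b t w)"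
        unfolding sheet_product_def using fibre_bounds[of t "{t, u}"] elim(3) by simp
      then have "norm (sheet_product t) \<le> \<epsilon> * B"
        using q B elim(3) \<open>\<epsilon> > 0\<close> by (auto simp: norm_mult intro!: mult_mono)
      then show ?case using double_function_eq elim by simp
    qed
    then show ?thesis
      by (intro tendsto_upperbound[OF tendsto_norm[OF tendsto_double_function[OF t0]]]) auto
  qed
  then have "norm (double_function t0) / B \<le> \<epsilon>" if "\<epsilon> > 0" for \<epsilon>
    using that B by (simp add: divide_le_eq)
  then have "norm (double_function t0) / B \<le> 0"
    using dense_ge by blast
  then show ?thesis using B by (simp add: divide_le_0_iff)
qed

text \<open>Only the sheet through \<open>u0\<close> contributes a small factor. Its numerator
  \<open>b t - b (\<psi> (a t))\<close> has a nonzero derivative at \<open>t0\<close> by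
  transversality, so the function is bounded below by a multiple of
  \<open>norm (t - t0)\<close>.\<close>

lemma double_function_simple_zero:
  assumes sp: "special t0 u0" and nz: "deriv a u0 \<noteq> 0"
    and trans: "deriv a t0 * deriv b u0 \<noteq> deriv a u0 * deriv b t0"
  shows "deriv double_function t0 \<noteq> 0"
proof
  assume d0: "deriv double_function t0 = 0"
  have t0: "t0 \<in> ball 0 (2 * r)" and u0: "u0 \<in> ball 0 (3 * r)" "u0 \<noteq> t0" "a u0 = a t0" "b u0 = b t0"
    using sp by (auto simp: special_def)
  obtain e0 where e0: "e0 > 0" "\<And>e. 0 < e \<Longrightarrow> e \<le> e0 \<Longrightarrow> ball u0 e \<subseteq> ball 0 (3 * r) \<and> inj_on a (ball u0 e) \<and>
     open (a ` ball u0 e) \<and> (\<exists>\<psi>. \<psi> holomorphic_on a ` ball u0 e \<and>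
       (\<forall>z\<in>ball u0 e. \<psi> (a z) = z \<and> deriv a z * deriv \<psi> (a z) = 1))"
    using local_inverse[OF u0(1) nz] by metis
  define \<kappa> where "\<kappa> = min e0 (dist t0 u0 / 2)"
  have \<kappa>: "0 < \<kappa>" "\<kappa> \<le> e0" using e0(1) u0(2) by (auto simp: \<kappa>_def)
  obtain \<psi> where \<psi>: "\<psi> holomorphic_on a ` ball u0 \<kappa>" "\<And>z. z \<in> ball u0 \<kappa> \<Longrightarrow> \<psi> (a z) = z"
      "\<And>z. z \<in> ball u0 \<kappa> \<Longrightarrow> deriv a z * deriv \<psi> (a z) = 1"
    and op: "open (a ` ball u0 \<kappa>)" and sub: "ball u0 \<kappa> \<subseteq> ball 0 (3 * r)" and inj: "inj_on a (ball u0 \<kappa>)"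
    using e0(2)[OF \<kappa>] by metis
  have at0: "a t0 \<in> a ` ball u0 \<kappa>" using u0 \<kappa> by (metis centre_in_ball image_eqI)
  have \<psi>0: "\<psi> (a t0) = u0" using \<psi>(2)[of u0] u0 \<kappa> by simp
  \<comment> \<open>With the disc around the partner removed, \<open>no_triple\<close> excludes any
    further common zero, which bounds the other factors from below.\<close>
  define C where "C = cball 0 (3 * r) - ball u0 \<kappa>"
  have "\<exists>e>0. \<exists>c>0. ball t0 e \<subseteq> ball 0 (4 * r) \<and>
    (\<forall>t\<in>ball t0 e. \<forall>u\<in>C. diff_quot a t u = 0 \<longrightarrow> norm (diff_quot b t u) \<ge> c)"
  proof (rule no_common_zero_bound[OF cont_quot open_ball])
    show "t0 \<in> ball 0 (4 * r)" "C \<subseteq> ball (0::complex) (4 * r)" "compact C"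
      using t0 disc_mono by (auto simp: C_def intro!: compact_diff)
    fix u :: complex assume u: "u \<in> C" "diff_quot a t0 u = 0"
    show "diff_quot b t0 u \<noteq> 0"
    proof (cases "u = t0")
      case True
      then show ?thesis using immersed[of t0] u(2) t0 disc_mono by (auto simp: diff_quot_def)
    next
      case False
      then have "a u = a t0" using u(2) by (auto simp: diff_quot_def)
      moreover have "b u \<noteq> b t0"
      proof
        assume "b u = b t0"
        then have "u = t0 \<or> u = u0"
          using no_triple[of t0 u0 u] t0 u0 u(1) disc_mono \<open>a u = a t0\<close> by (auto simp: C_def)
        then show False using False u(1) \<kappa> by (auto simp: C_def)
      qed
      ultimately show ?thesis using False by (auto simp: diff_quot_def)
    qed
  qed
  then obtain e c where ec: "e > 0" "c > 0" "ball t0 e \<subseteq> ball 0 (4 * r)"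
    "\<And>t u. t \<in> ball t0 e \<Longrightarrow> u \<in> C \<Longrightarrow> diff_quot a t u = 0 \<Longrightarrow> norm (diff_quot b t u) \<ge> c"
    by blast
  define k where "k = (\<lambda>t. b t - b (\<psi> (a t)))"
  define k' where "k' = deriv b t0 - deriv b u0 * (deriv \<psi> (a t0) * deriv a t0)"
  have "deriv \<psi> (a t0) = 1 / deriv a u0"
    using \<psi>(3)[of u0] u0 \<kappa> nz by (simp add: field_simps)
  then have k'nz: "k' \<noteq> 0" using trans nz by (auto simp: k'_def field_simps)
  have da: "(a has_field_derivative deriv a t0) (at t0)"
    using holomorphic_derivI[OF hol(1) open_ball] t0 disc_mono by blast
  have db: "(b has_field_derivative deriv b t0) (at t0)"
    using holomorphic_derivI[OF hol(2) open_ball] t0 disc_mono by blast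
  have db': "(b has_field_derivative deriv b u0) (at (\<psi> (a t0)))"
    unfolding \<psi>0 using holomorphic_derivI[OF hol(2) open_ball] u0 disc_mono by blast
  have d\<psi>: "(\<psi> has_field_derivative deriv \<psi> (a t0)) (at (a t0))"
    by (rule holomorphic_derivI[OF \<psi>(1) op at0])
  have "(k has_field_derivative k') (at t0)"
    unfolding k_def k'_def
    by (intro DERIV_diff db DERIV_chain2[where g = "\<lambda>t. \<psi> (a t)" and x = t0, OF db']
        DERIV_chain2[where g = a and x = t0, OF d\<psi>] da)
  then have "((\<lambda>t. (k t - k t0) / (t - t0)) \<longlongrightarrow> k') (at t0)"
    by (simp add: has_field_derivative_iff)
  moreover have "k t0 = 0" by (simp add: k_def \<psi>0 u0)
  ultimately have "((\<lambda>t. norm (k t / (t - t0))) \<longlongrightarrow> norm k') (at t0)"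
    by (intro tendsto_norm) simp
  then have ev1: "\<forall>\<^sub>F t in at t0. norm (k t / (t - t0)) > norm k' / 2"
    by (rule order_tendstoD(1)) (use k'nz in simp)
  \<comment> \<open>Half of \<open>norm k'\<close> comes from the difference quotient of
    \<open>k\<close>, \<open>6 * r\<close> bounds \<open>norm (t - u)\<close>, and the power bounds
    the remaining sheets.\<close>
  define d where "d = norm k' / 2 / (6 * r) * (min c 1) ^ m"
  have "d > 0" using k'nz r ec(2) by (simp add: d_def)
  have N0: "double_function t0 = 0" by (rule double_function_zero[OF sp])
  have "(double_function has_field_derivative 0) (at t0)"
    using holomorphic_derivI[OF holomorphic_double_function open_ball t0] d0 by simp
  then have "((\<lambda>t. double_function t / (t - t0)) \<longlongrightarrow> 0) (at t0)"
    using N0 by (simp add: has_field_derivative_iff)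
  then have ev2: "\<forall>\<^sub>F t in at t0. norm (double_function t / (t - t0)) < d"
    using tendstoD[OF _ \<open>d > 0\<close>] by fastforce
  have "\<forall>\<^sub>F t in nhds t0. t \<in> ball 0 (2 * r) \<and> a t \<in> a ` ball u0 \<kappa>"
    by (rule tendsto_preimage_open[OF t0 op at0])
  then have ev3: "\<forall>\<^sub>F t in at t0. t \<in> ball 0 (2 * r) \<and> a t \<in> a ` ball u0 \<kappa>"
    by (auto simp: eventually_at_filter elim: eventually_mono)
  have ev4: "\<forall>\<^sub>F t in at t0. t \<in> ball t0 (min e \<kappa>)"
    using \<kappa> ec(1) by (intro eventually_at_in_open') auto
  have ev5: "\<forall>\<^sub>F t in at t0. t \<noteq> t0" by (simp add: eventually_at_filter)
  have "\<forall>\<^sub>F t in at t0. False"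
    using ev1 ev2 ev3 ev4 ev5 eventually_regular[OF t0]
  proof eventually_elim
    case (elim t)
    then obtain u where u: "u \<in> ball u0 \<kappa>" "a u = a t" by (metis imageE)
    then have \<psi>t: "\<psi> (a t) = u" using \<psi>(2)[of u] by simp
    have "u \<noteq> t"
    proof
      assume "u = t"
      then have "dist t0 u0 < dist t0 u0"
        using dist_triangle[of t0 u0 t] elim(4) u(1) by (auto simp: \<kappa>_def dist_commute)
      then show False by simp
    qed
    have u3: "u \<in> ball 0 (3 * r)" using u sub by blast
    have tu: "norm (t - u) \<le> 6 * r"
      using norm_triangle_ineq4[of t u] u3 elim(3) r by simp
    have "fibre t - {t} = insert u (fibre t - {t, u})"
      using u u3 \<open>u \<noteq> t\<close> by (auto simp: fibre_def)
    then have eq: "sheet_product t = diff_quot b t u * (\<Prod>w\<in>fibre t - {t, u}. diff_quot b t w)"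
      unfolding sheet_product_def using fibre_bounds[of t "{t, u}"] elim(3) by simp
    have P: "norm (\<Prod>w\<in>fibre t - {t, u}. diff_quot b t w) \<ge> (min c 1) ^ m"
    proof (rule norm_prod_ge_min_power)
      fix w assume w: "w \<in> fibre t - {t, u}"
      have "w \<notin> ball u0 \<kappa>"
        using inj_onD[OF inj, of w u] u w by (auto simp: fibre_def)
      then have "w \<in> C" using w by (auto simp: fibre_def C_def)
      then have "c \<le> norm (diff_quot b t w)"
        using ec(4)[of t w] elim(4) w by (auto simp: fibre_def diff_quot_def)
      then show "min c 1 \<le> norm (diff_quot b t w)" by simp
    qed (use fibre_bounds[of t "{t, u}"] elim(3) ec(2) in auto)
    have "norm (diff_quot b t u) = norm (k t) / norm (t - u)"
      using \<open>u \<noteq> t\<close> by (auto simp: diff_quot_def k_def \<psi>t norm_divide)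
    also have "\<dots> \<ge> norm (k t) / (6 * r)"
      using tu \<open>u \<noteq> t\<close> r by (intro divide_left_mono) auto
    finally have "norm (diff_quot b t u) \<ge> norm (k t) / (6 * r)" .
    moreover have "norm (k t) / (6 * r) \<ge> norm k' / 2 * norm (t - t0) / (6 * r)"
      using elim(1,5) r by (intro divide_right_mono) (auto simp: norm_divide field_simps)
    ultimately have Q: "norm (diff_quot b t u) \<ge> norm k' / 2 * norm (t - t0) / (6 * r)" by linarith
    have "norm (sheet_product t) \<ge> norm k' / 2 * norm (t - t0) / (6 * r) * (min c 1) ^ m"
      unfolding eq norm_mult by (rule mult_mono[OF Q P]) (use r ec(2) in auto)
    then have "norm (double_function t) \<ge> d * norm (t - t0)"
      using double_function_eq[OF elim(6)] by (simp add: d_def mult_ac)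
    then show False using elim(2,5) by (simp add: norm_divide divide_less_eq)
  qed
  then show False using eventually_happens'[OF at_neq_bot] by fastforce
qed

end

section \<open>Perturbations of an injective branch\<close>

text \<open>Rouche's theorem in counting form. It is applied on a disc of intermediate radius
  \<open>R'\<close>, where the zeros are finite in number; zeros outside the circle drop out because
  their winding number is 0. \<open>F\<close> is the model and \<open>G\<close> the
  perturbation.\<close>

lemma zero_order_sum_eq:
  assumes hol: "F holomorphic_on ball c R" "G holomorphic_on ball c R" and \<rho>: "0 < \<rho>" "\<rho> < R"
    and less: "\<And>z. dist c z = \<rho> \<Longrightarrow> norm (F z - G z) < norm (F z)"
  shows "finite {z \<in> ball c \<rho>. F z = 0}" "finite {z \<in> ball c \<rho>. G z = 0}"
    "(\<Sum>p\<in>{z \<in> ball c \<rho>. F z = 0}. zorder F p) = (\<Sum>p\<in>{z \<in> ball c \<rho>. G z = 0}. zorder G p)"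
    "\<And>p. p \<in> ball c \<rho> \<Longrightarrow> F p = 0 \<Longrightarrow> zorder F p \<ge> 1"
    "\<And>p. p \<in> ball c \<rho> \<Longrightarrow> G p = 0 \<Longrightarrow> zorder G p \<ge> 1"
proof -
  define R' where "R' = (\<rho> + R) / 2"
  have R': "\<rho> < R'" "R' < R" using \<rho> by (auto simp: R'_def)
  have sub: "ball c R' \<subseteq> ball c R" using R' by auto
  have nzF: "F z \<noteq> 0" if "dist c z = \<rho>" for z using less[OF that] by auto
  have nzG: "G z \<noteq> 0" if "dist c z = \<rho>" for z using less[OF that] by auto
  define z0 where "z0 = c + of_real \<rho>"
  have z0: "dist c z0 = \<rho>" using \<rho> by (simp add: z0_def dist_norm)
  have fin: "finite {z \<in> ball c R'. H z = 0}"
    if H: "H holomorphic_on ball c R" "H z0 \<noteq> 0" for H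
  proof (cases "H constant_on ball c R")
    case True
    then have "H z \<noteq> 0" if "z \<in> ball c R" for z
      using H(2) z0 \<rho> that unfolding constant_on_def by force
    then have "{z \<in> ball c R'. H z = 0} = {}" using sub by blast
    then show ?thesis by (metis finite.emptyI)
  next
    case False
    have "finite {z \<in> cball c R'. H z = 0}"
      by (rule holomorphic_compact_finite_zeros[OF H(1)]) (use False R' in auto)
    then show ?thesis by (rule finite_subset[rotated]) auto
  qed
  have finF: "finite {z \<in> ball c R'. F z = 0}" using fin[OF hol(1)] nzF z0 by blast
  have finG: "finite {z \<in> ball c R'. G z = 0}" using fin[OF hol(2)] nzG z0 by blast
  have ss: "{z \<in> ball c \<rho>. H z = 0} \<subseteq> {z \<in> ball c R'. H z = 0}" for H :: "complex \<Rightarrow> complex"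
    using R' by auto
  show "finite {z \<in> ball c \<rho>. F z = 0}" by (rule finite_subset[OF ss finF])
  show "finite {z \<in> ball c \<rho>. G z = 0}" by (rule finite_subset[OF ss finG])
  have wsum: "(\<Sum>p\<in>{p \<in> ball c R'. H p = 0}. winding_number (circlepath c \<rho>) p * zorder H p)
      = of_int (\<Sum>p\<in>{z \<in> ball c \<rho>. H z = 0}. zorder H p)"
    if fin: "finite {p \<in> ball c R'. H p = 0}" and nz: "\<And>z. dist c z = \<rho> \<Longrightarrow> H z \<noteq> 0" for H
  proof -
    have "(\<Sum>p\<in>{p \<in> ball c R'. H p = 0}. winding_number (circlepath c \<rho>) p * zorder H p)
        = (\<Sum>p\<in>{z \<in> ball c \<rho>. H z = 0}. winding_number (circlepath c \<rho>) p * zorder H p)"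
    proof (rule sum.mono_neutral_right[OF fin ss], rule ballI)
      fix p assume p: "p \<in> {p \<in> ball c R'. H p = 0} - {z \<in> ball c \<rho>. H z = 0}"
      then have "dist c p \<noteq> \<rho>" using nz by auto
      then have "p \<notin> cball c \<rho>" using p by auto
      then have "winding_number (circlepath c \<rho>) p = 0"
        using \<rho> by (intro winding_number_zero_outside[where s = "cball c \<rho>"]) (auto simp: sphere_def)
      then show "winding_number (circlepath c \<rho>) p * zorder H p = 0" by simp
    qed
    also have "\<dots> = (\<Sum>p\<in>{z \<in> ball c \<rho>. H z = 0}. of_int (zorder H p))"
      by (rule sum.cong) (auto simp: winding_number_circlepath dist_norm norm_minus_commute)
    finally show ?thesis by simp
  qed
  have "(\<Sum>p\<in>{p \<in> ball c R'. (\<lambda>p. F p + (G p - F p)) p = 0}. winding_number (circlepath c \<rho>) p *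
        zorder (\<lambda>p. F p + (G p - F p)) p)
      = (\<Sum>p\<in>{p \<in> ball c R'. F p = 0}. winding_number (circlepath c \<rho>) p * zorder F p)"
  proof (rule Rouche_theorem)
    show "finite {p \<in> ball c R'. (\<lambda>p. F p + (G p - F p)) p = 0}" using finG by simp
    show "F holomorphic_on ball c R'" using hol(1) sub by (rule holomorphic_on_subset)
    show "(\<lambda>p. G p - F p) holomorphic_on ball c R'"
      using hol sub by (intro holomorphic_intros) (auto intro: holomorphic_on_subset)
    show "path_image (circlepath c \<rho>) \<subseteq> ball c R'" using \<rho> R' by (auto simp: sphere_def)
    show "\<forall>z\<in>path_image (circlepath c \<rho>). cmod (G z - F z) < cmod (F z)"
      using less \<rho> by (auto simp: sphere_def norm_minus_commute)
    show "\<forall>z. z \<notin> ball c R' \<longrightarrow> winding_number (circlepath c \<rho>) z = 0"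
      using \<rho> R' by (intro allI impI winding_number_zero_outside[where s = "ball c R'"]) (auto simp: sphere_def)
  qed (use finF in auto)
  then have "of_int (\<Sum>p\<in>{z \<in> ball c \<rho>. G z = 0}. zorder G p) = (of_int (\<Sum>p\<in>{z \<in> ball c \<rho>. F z = 0}. zorder F p) :: complex)"
    using wsum[OF finF nzF] wsum[OF finG nzG] by simp
  then show "(\<Sum>p\<in>{z \<in> ball c \<rho>. F z = 0}. zorder F p) = (\<Sum>p\<in>{z \<in> ball c \<rho>. G z = 0}. zorder G p)"
    by (simp only: of_int_eq_iff)
  have pos: "zorder H p \<ge> 1" if H: "H holomorphic_on ball c R" "H z0 \<noteq> 0" and p: "p \<in> ball c \<rho>" "H p = 0" for H p
  proof -
    have "\<exists>w\<in>ball c R. H w \<noteq> 0" using H(2) z0 \<rho> by auto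
    then show ?thesis
      using zorder_exist_zero[OF H(1) open_ball connected_ball, of p] p \<rho> by auto
  qed
  show "\<And>p. p \<in> ball c \<rho> \<Longrightarrow> F p = 0 \<Longrightarrow> zorder F p \<ge> 1"
    using pos[OF hol(1)] nzF z0 by blast
  show "\<And>p. p \<in> ball c \<rho> \<Longrightarrow> G p = 0 \<Longrightarrow> zorder G p \<ge> 1"
    using pos[OF hol(2)] nzG z0 by blast
qed

lemma zorder_simple_zero:
  assumes "f holomorphic_on S" "open S" "z \<in> S" "f z = 0" "deriv f z \<noteq> 0"
  shows "zorder f z = 1"
  by (rule zorder_zero_eqI[OF assms(1-3)]) (use assms in auto)

lemma zorder_power_at_0: "zorder (\<lambda>u::complex. u ^ m) 0 = int m"
  by (rule zorder_eqI[of UNIV _ "\<lambda>_. 1"]) auto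

text \<open>One factor is exchanged at a time. The constant is generous so that the induction closes
  without case distinctions.\<close>

lemma norm_prod_diff_le:
  fixes z w :: "'a \<Rightarrow> complex"
  assumes "finite I" "\<And>i. i \<in> I \<Longrightarrow> norm (z i) \<le> B" "\<And>i. i \<in> I \<Longrightarrow> norm (w i) \<le> B"
    "\<And>i. i \<in> I \<Longrightarrow> norm (z i - w i) \<le> \<epsilon>" "1 \<le> B"
  shows "norm (prod z I - prod w I) \<le> real (card I) * B ^ card I * \<epsilon>"
  using assms
proof (induction I rule: finite_induct)
  case (insert i I)
  have e0: "0 \<le> \<epsilon>" using insert.prems(3)[of i] norm_ge_zero order_trans by blast
  have pw: "norm (prod w I) \<le> B ^ card I"
    using insert by (intro norm_prod_le_max_power) auto
  have IH: "norm (prod z I - prod w I) \<le> real (card I) * B ^ card I * \<epsilon>"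
    using insert by auto
  have "prod z (insert i I) - prod w (insert i I) = z i * (prod z I - prod w I) + (z i - w i) * prod w I"
    using insert.hyps by (simp add: algebra_simps)
  then have "norm (prod z (insert i I) - prod w (insert i I)) \<le>
      norm (z i) * norm (prod z I - prod w I) + norm (z i - w i) * norm (prod w I)"
    by (metis norm_mult norm_triangle_ineq)
  also have "\<dots> \<le> B * (real (card I) * B ^ card I * \<epsilon>) + \<epsilon> * B ^ card I"
    using insert.prems IH pw e0 by (intro add_mono mult_mono mult_nonneg_nonneg) auto
  also have "\<epsilon> * B ^ card I \<le> \<epsilon> * B ^ Suc (card I)"
    using e0 insert.prems(4) by (intro mult_left_mono power_increasing) auto
  finally show ?case using insert.hyps by (simp add: algebra_simps)
qed simp

text \<open>
  The germ to be perturbed is \<open>z \<mapsto> (z ^ m, \<phi> z)\<close>; \<open>primitive\<close> says that it is injective.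
\<close>

locale model_branch =
  fixes \<phi> :: "complex \<Rightarrow> complex" and m :: nat and r :: real
  assumes m: "m \<ge> 1" and r: "r > 0" and hol_\<phi>: "\<phi> holomorphic_on ball 0 (5 * r)"
    and primitive: "\<And>z \<omega>. z \<in> cball 0 (3 * r) \<Longrightarrow> z \<noteq> 0 \<Longrightarrow> \<omega> ^ m = 1 \<Longrightarrow> \<omega> \<noteq> 1 \<Longrightarrow> \<phi> (\<omega> * z) \<noteq> \<phi> z"
begin

text \<open>Closeness of the derivatives is included because it controls divided differences
  uniformly up to the diagonal.\<close>

definition near :: "real \<Rightarrow> (complex \<Rightarrow> complex) \<Rightarrow> (complex \<Rightarrow> complex) \<Rightarrow> bool"
  where "near \<epsilon> a b \<longleftrightarrow> a holomorphic_on ball 0 (4 * r) \<and> b holomorphic_on ball 0 (4 * r) \<and>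
    (\<forall>z\<in>ball 0 (4 * r). norm (a z - z ^ m) \<le> \<epsilon> \<and> norm (b z - \<phi> z) \<le> \<epsilon> \<and>
      norm (deriv a z - deriv (\<lambda>z. z ^ m) z) \<le> \<epsilon> \<and> norm (deriv b z - deriv \<phi> z) \<le> \<epsilon>)"

lemma near_mono: "near \<epsilon> a b \<Longrightarrow> \<epsilon> \<le> \<epsilon>' \<Longrightarrow> near \<epsilon>' a b"
  unfolding near_def by (meson order_trans)

lemma hol_\<phi>4: "\<phi> holomorphic_on ball 0 (4 * r)"
  using hol_\<phi> r by (auto elim!: holomorphic_on_subset)

lemma near_diff_quot:
  assumes "near \<epsilon> a b" "t \<in> ball 0 (4 * r)" "u \<in> ball 0 (4 * r)"
  shows "norm (diff_quot a t u - diff_quot (\<lambda>z. z ^ m) t u) \<le> \<epsilon>"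
    and "norm (diff_quot b t u - diff_quot \<phi> t u) \<le> \<epsilon>"
proof -
  have *: "norm (diff_quot g t u - diff_quot h t u) \<le> \<epsilon>"
    if g: "g holomorphic_on ball 0 (4 * r)" and h: "h holomorphic_on ball 0 (4 * r)"
      and le: "\<And>z. z \<in> ball 0 (4 * r) \<Longrightarrow> norm (deriv g z - deriv h z) \<le> \<epsilon>" for g h
  proof -
    have gh: "(\<lambda>z. g z - h z) holomorphic_on ball 0 (4 * r)" using g h by (intro holomorphic_intros)
    have d: "deriv (\<lambda>z. g z - h z) z = deriv g z - deriv h z" if "z \<in> ball 0 (4 * r)" for z
      using g h that by (intro deriv_diff) (auto simp: holomorphic_on_imp_differentiable_at)
    have "norm (diff_quot (\<lambda>z. g z - h z) t u - 0) \<le> \<epsilon>"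
      by (rule diff_quot_bound[OF gh open_ball convex_ball subset_refl]) (use assms d le in auto)
    then show ?thesis using diff_quot_diff[OF g h open_ball assms(2,3)] by simp
  qed
  show "norm (diff_quot a t u - diff_quot (\<lambda>z. z ^ m) t u) \<le> \<epsilon>"
    by (rule *) (use assms(1) in \<open>auto simp: near_def intro!: holomorphic_intros\<close>)
  show "norm (diff_quot b t u - diff_quot \<phi> t u) \<le> \<epsilon>"
    by (rule *) (use assms(1) hol_\<phi>4 in \<open>auto simp: near_def\<close>)
qed

text \<open>On the circle of radius \<open>3 * r\<close> the power \<open>u ^ m\<close> dominates
  the value at any \<open>t\<close> of norm below \<open>2 * r\<close>. So \<open>a u - a t\<close>
  has as many zeros as \<open>u ^ m\<close>, counted with multiplicity.\<close>

lemma near_sheets: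
  obtains \<epsilon> where "\<epsilon> > 0"
    "\<And>a b t. near \<epsilon> a b \<Longrightarrow> t \<in> ball 0 (2 * r) \<Longrightarrow> finite {u \<in> ball 0 (3 * r). a u = a t} \<and>
      card {u \<in> ball 0 (3 * r). a u = a t} \<le> m"
    "\<And>a b t u. near \<epsilon> a b \<Longrightarrow> t \<in> ball 0 (2 * r) \<Longrightarrow> norm u = 3 * r \<Longrightarrow> a u \<noteq> a t"
proof -
  \<comment> \<open>The errors at \<open>u\<close> and at \<open>t\<close> together use up half of
    the gap between the two powers.\<close>
  define \<epsilon> where "\<epsilon> = ((3 * r) ^ m - (2 * r) ^ m) / 4"
  have "(2 * r) ^ m < (3 * r) ^ m" using r m by (intro power_strict_mono) auto
  then have \<epsilon>: "\<epsilon> > 0" by (simp add: \<epsilon>_def)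
  have key: "norm (u ^ m - (a u - a t)) < norm (u ^ m)"
    if near: "near \<epsilon> a b" and t: "t \<in> ball 0 (2 * r)" and u: "norm u = 3 * r" for a b t u
  proof -
    have 1: "norm (a u - u ^ m) \<le> \<epsilon>" "norm (a t - t ^ m) \<le> \<epsilon>"
      using near t u r by (auto simp: near_def)
    have "u ^ m - (a u - a t) = - (a u - u ^ m) + ((a t - t ^ m) + t ^ m)" by simp
    then have "norm (u ^ m - (a u - a t)) = norm (- (a u - u ^ m) + ((a t - t ^ m) + t ^ m))"
      by (rule arg_cong)
    also have "\<dots> \<le> norm (a u - u ^ m) + (norm (a t - t ^ m) + norm (t ^ m))"
      using norm_triangle_ineq[of "- (a u - u ^ m)" "(a t - t ^ m) + t ^ m"]
        norm_triangle_ineq[of "a t - t ^ m" "t ^ m"] by (simp only: norm_minus_cancel)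
    also have "\<dots> \<le> \<epsilon> + (\<epsilon> + (2 * r) ^ m)"
    proof -
      have "norm (t ^ m) \<le> (2 * r) ^ m"
        unfolding norm_power by (rule power_mono) (use t in auto)
      then show ?thesis using 1 by simp
    qed
    also have "\<dots> < (3 * r) ^ m" using \<epsilon> by (simp add: \<epsilon>_def field_simps)
    finally show ?thesis using u by (simp add: norm_power)
  qed
  show ?thesis
  proof (rule that[OF \<epsilon>])
    fix a b and t :: complex assume near: "near \<epsilon> a b" and t: "t \<in> ball 0 (2 * r)"
    have G: "(\<lambda>u. a u - a t) holomorphic_on ball 0 (4 * r)"
      using near by (auto simp: near_def intro!: holomorphic_intros)
    have F: "(\<lambda>u. u ^ m) holomorphic_on ball 0 (4 * r)" by (intro holomorphic_intros)
    have less: "norm (z ^ m - (a z - a t)) < norm (z ^ m)" if "dist 0 z = 3 * r" for z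
      using key[OF near t, of z] that by simp
    have r3: "0 < 3 * r" "3 * r < 4 * r" using r by auto
    note ZO = zero_order_sum_eq[OF F G r3 less]
    have eq: "{u \<in> ball 0 (3 * r). a u = a t} = {u \<in> ball 0 (3 * r). a u - a t = 0}" by auto
    have "int (card {u \<in> ball 0 (3 * r). a u - a t = 0}) = (\<Sum>p\<in>{u \<in> ball 0 (3 * r). a u - a t = 0}. 1)" by simp
    also have "\<dots> \<le> (\<Sum>p\<in>{u \<in> ball 0 (3 * r). a u - a t = 0}. zorder (\<lambda>u. a u - a t) p)"
      using ZO(5) by (intro sum_mono) auto
    also have "\<dots> = (\<Sum>p\<in>{u \<in> ball 0 (3 * r). u ^ m = 0}. zorder (\<lambda>u. u ^ m) p)"
      using ZO(3) by simp
    also have "{u \<in> ball 0 (3 * r). u ^ m = 0} = {0::complex}" using r m by auto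
    finally show "finite {u \<in> ball 0 (3 * r). a u = a t} \<and> card {u \<in> ball 0 (3 * r). a u = a t} \<le> m"
      unfolding eq using ZO(2) by (simp add: zorder_power_at_0)
  next
    fix a b and t u :: complex assume "near \<epsilon> a b" "t \<in> ball 0 (2 * r)" "norm u = 3 * r"
    then show "a u \<noteq> a t" using key[of a b t u] by auto
  qed
qed

section \<open>The unperturbed branch and its product\<close>

lemma cont_quot_model:
  "continuous_on (ball 0 (4 * r) \<times> ball 0 (4 * r)) (\<lambda>(t, u). diff_quot (\<lambda>z. z ^ m) t u)"
  "continuous_on (ball 0 (4 * r) \<times> ball 0 (4 * r)) (\<lambda>(t, u). diff_quot \<phi> t u)"
  by (intro continuous_on_diff_quot hol_\<phi>4 open_ball holomorphic_intros)+

text \<open>For the model the only common zero of both divided differences is the origin: on the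
  diagonal because of the derivative of \<open>z ^ m\<close>, off it by \<open>primitive\<close>.
  Away from the origin their norms sum to at least \<open>c\<close>, and an error of
  \<open>c / 3\<close> in each cannot cancel this.\<close>

lemma near_localised:
  assumes "\<rho> > 0"
  obtains \<epsilon> where "\<epsilon> > 0"
    "\<And>a b t u. near \<epsilon> a b \<Longrightarrow> t \<in> cball 0 (3 * r) \<Longrightarrow> u \<in> cball 0 (3 * r) \<Longrightarrow>
      diff_quot a t u = 0 \<Longrightarrow> diff_quot b t u = 0 \<Longrightarrow> t \<in> ball 0 \<rho> \<and> u \<in> ball 0 \<rho>"
proof -
  define K where "K = cball (0::complex) (3 * r) \<times> cball (0::complex) (3 * r) - ball 0 \<rho> \<times> ball 0 \<rho>"
  define D where "D = (\<lambda>(t, u). norm (diff_quot (\<lambda>z. z ^ m) t u) + norm (diff_quot \<phi> t u))"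
  have cK: "compact K" unfolding K_def by (intro compact_diff compact_Times compact_cball open_Times open_ball)
  have sub: "K \<subseteq> ball 0 (4 * r) \<times> ball 0 (4 * r)" using r by (auto simp: K_def)
  have "continuous_on (ball 0 (4 * r) \<times> ball 0 (4 * r)) D"
    unfolding D_def case_prod_unfold
    using cont_quot_model by (intro continuous_intros) (auto simp: case_prod_unfold)
  then have cD: "continuous_on K D" using sub continuous_on_subset by blast
  have pos: "D z > 0" if "z \<in> K" for z
  proof (rule ccontr)
    obtain t u where z: "z = (t, u)" by fastforce
    assume "\<not> D z > 0"
    then have "norm (diff_quot (\<lambda>z. z ^ m) t u) + norm (diff_quot \<phi> t u) \<le> 0"
      by (simp add: D_def z)
    then have 0: "diff_quot (\<lambda>z. z ^ m) t u = 0" "diff_quot \<phi> t u = 0"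
      by (smt (verit) norm_ge_zero norm_eq_zero)+
    show False
    proof (cases "t = u")
      case True
      have "deriv (\<lambda>z::complex. z ^ m) t = of_nat m * t ^ (m - 1)"
        by (rule DERIV_imp_deriv) (auto intro!: derivative_eq_intros)
      then have "t = 0" using 0(1) m True by (auto simp: diff_quot_def)
      then show False using that True z \<open>\<rho> > 0\<close> by (auto simp: K_def)
    next
      case False
      then have e: "t ^ m = u ^ m" "\<phi> t = \<phi> u" using 0 by (auto simp: diff_quot_def)
      have "t \<noteq> 0"
      proof
        assume "t = 0"
        have "u ^ m = t ^ m" using e(1) by simp
        also have "\<dots> = 0" using m \<open>t = 0\<close> by (simp add: power_0_left)
        finally have "u = 0" by simp
        then show False using False \<open>t = 0\<close> by simp
      qed
      have "(u / t) ^ m = t ^ m / t ^ m" by (simp only: power_divide e(1))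
      then have "(u / t) ^ m = 1" "u / t \<noteq> 1" "u / t * t = u"
        using \<open>t \<noteq> 0\<close> False by auto
      then show False using primitive[of t "u / t"] e(2) that z \<open>t \<noteq> 0\<close> by (auto simp: K_def)
    qed
  qed
  have "\<exists>c>0. \<forall>z\<in>K. D z \<ge> c"
  proof (cases "K = {}")
    case True
    then show ?thesis by (intro exI[of _ 1]) auto
  next
    case False
    then obtain z where "z \<in> K" "\<forall>w\<in>K. D z \<le> D w"
      using continuous_attains_inf[OF cK _ cD] by blast
    then show ?thesis using pos by (intro exI[of _ "D z"]) auto
  qed
  then obtain c where c: "c > 0" "\<And>z. z \<in> K \<Longrightarrow> D z \<ge> c" by blast
  show ?thesis
  proof (rule that[of "c / 3"])
    fix a b t u assume near: "near (c / 3) a b" and tu: "t \<in> cball 0 (3 * r)" "u \<in> cball 0 (3 * r)"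
      and 0: "diff_quot a t u = 0" "diff_quot b t u = 0"
    have t4: "t \<in> ball 0 (4 * r)" "u \<in> ball 0 (4 * r)" using tu r by auto
    have "norm (diff_quot (\<lambda>z. z ^ m) t u) \<le> c / 3" "norm (diff_quot \<phi> t u) \<le> c / 3"
      using near_diff_quot[OF near t4] 0 by auto
    then have "D (t, u) < c" using c(1) by (simp add: D_def)
    then have "(t, u) \<notin> K" using c(2) by force
    then show "t \<in> ball 0 \<rho> \<and> u \<in> ball 0 \<rho>" using tu by (auto simp: K_def)
  qed (use c(1) in simp)
qed

text \<open>This is the product over the other sheets for the unperturbed branch, whose sheets
  through \<open>t\<close> are the points \<open>\<omega> * t\<close>. Indexing by
  \<open>\<omega>\<close> keeps the number of factors constant also at 0, where all sheets
  coincide.\<close>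

definition model_product :: "complex \<Rightarrow> complex"
  where "model_product t = (\<Prod>\<omega>\<in>{\<omega>. \<omega> ^ m = 1} - {1}. diff_quot \<phi> t (\<omega> * t))"

lemma norm_root_of_unity: "\<omega> ^ m = 1 \<Longrightarrow> norm (\<omega> :: complex) = 1"
  using m by (metis norm_ge_zero norm_one norm_power power_eq_1_iff not_one_le_zero)

lemma finite_roots: "finite {\<omega>::complex. \<omega> ^ m = 1}"
  using m by (intro finite_roots_unity) auto

lemma holomorphic_model_product: "model_product holomorphic_on ball 0 (4 * r)"
  unfolding model_product_def[abs_def]
proof (rule holomorphic_on_prod)
  fix \<omega> :: complex assume \<omega>: "\<omega> \<in> {\<omega>. \<omega> ^ m = 1} - {1}"
  have "(\<lambda>t. \<phi> (\<omega> * t)) holomorphic_on ball 0 (4 * r)"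
    by (rule holomorphic_on_compose_gen[where g = \<phi> and f = "\<lambda>t. \<omega> * t", unfolded comp_def, OF _ hol_\<phi>4])
      (use norm_root_of_unity \<omega> in \<open>auto intro!: holomorphic_intros simp: norm_mult\<close>)
  then have hg: "(\<lambda>t. \<phi> t - \<phi> (\<omega> * t)) holomorphic_on ball 0 (4 * r)"
    by (intro holomorphic_on_diff hol_\<phi>4)
  have "(\<phi> has_field_derivative deriv \<phi> 0) (at 0)"
    using holomorphic_derivI[OF hol_\<phi>4 open_ball, of 0] r by simp
  then have d: "(\<phi> has_field_derivative deriv \<phi> 0) (at (\<omega> * 0))" by simp
  have "((\<lambda>t. \<phi> t - \<phi> (\<omega> * t)) has_field_derivative (deriv \<phi> 0 - deriv \<phi> 0 * \<omega>)) (at 0)"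
    by (rule DERIV_diff[OF _ DERIV_chain2[where g = "\<lambda>t. \<omega> * t" and x = 0, OF d]])
      (use d in \<open>auto intro!: derivative_eq_intros\<close>)
  then have dg: "deriv (\<lambda>t. \<phi> t - \<phi> (\<omega> * t)) 0 = deriv \<phi> 0 * (1 - \<omega>)"
    by (simp add: DERIV_imp_deriv algebra_simps)
  \<comment> \<open>Away from 0 this is \<open>(\<phi> t - \<phi> (\<omega> * t)) / t\<close>, and
    at 0 it is the derivative of the numerator, so the singularity is removable.\<close>
  have "(\<lambda>t. diff_quot \<phi> t (\<omega> * t) * (1 - \<omega>)) holomorphic_on ball 0 (4 * r)"
  proof (rule pole_theorem_open_0[OF hg open_ball, of 0])
    fix z assume "z \<in> ball 0 (4 * r) - {0::complex}"
    then have "z \<noteq> \<omega> * z" "z - \<omega> * z = z * (1 - \<omega>)" using \<omega> by (auto simp: algebra_simps)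
    then show "\<phi> z - \<phi> (\<omega> * z) = (z - 0) * (diff_quot \<phi> z (\<omega> * z) * (1 - \<omega>))"
      using \<open>z \<in> ball 0 (4 * r) - {0}\<close> \<omega> by (auto simp: diff_quot_def)
  qed (auto simp: dg diff_quot_def)
  then have "(\<lambda>t. diff_quot \<phi> t (\<omega> * t) * (1 - \<omega>) / (1 - \<omega>)) holomorphic_on ball 0 (4 * r)"
    using \<omega> by (intro holomorphic_on_divide holomorphic_on_const) auto
  then show "(\<lambda>t. diff_quot \<phi> t (\<omega> * t)) holomorphic_on ball 0 (4 * r)" using \<omega> by simp
qed

lemma model_product_nonzero:
  assumes "z \<in> cball 0 (3 * r)" "z \<noteq> 0"
  shows "model_product z \<noteq> 0"
proof -
  have "diff_quot \<phi> z (\<omega> * z) \<noteq> 0" if "\<omega> \<in> {\<omega>. \<omega> ^ m = 1} - {1}" for \<omega>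
    using primitive[OF assms, of \<omega>] that assms(2) by (auto simp: diff_quot_def)
  then show ?thesis unfolding model_product_def using finite_roots by simp
qed

end

context model_branch
begin

section \<open>Comparison with the model on the circle of radius \<open>r\<close>\<close>

lemma roots_separated:
  obtains d where "d > 0" "\<And>\<omega> \<omega>'. \<omega> ^ m = 1 \<Longrightarrow> \<omega>' ^ m = 1 \<Longrightarrow> \<omega> \<noteq> \<omega>' \<Longrightarrow> d \<le> norm (\<omega> - \<omega>' :: complex)"
proof -
  let ?\<Omega> = "{\<omega>::complex. \<omega> ^ m = 1}"
  have "\<forall>u. \<exists>d>0. \<forall>w\<in>?\<Omega>. w \<noteq> u \<longrightarrow> d \<le> dist u w"
    using finite_set_avoid[OF finite_roots] by blast
  then obtain d' where d': "\<And>u. d' u > 0" "\<And>u w. w \<in> ?\<Omega> \<Longrightarrow> w \<noteq> u \<Longrightarrow> d' u \<le> dist u w"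
    by metis
  have ne: "d' ` ?\<Omega> \<noteq> {}" by (auto intro!: exI[of _ 1])
  show ?thesis
  proof (rule that[of "Min (d' ` ?\<Omega>)"])
    show "Min (d' ` ?\<Omega>) > 0" using finite_roots ne d'(1) by (subst Min_gr_iff) auto
    fix \<omega> \<omega>' :: complex assume w: "\<omega> ^ m = 1" "\<omega>' ^ m = 1" "\<omega> \<noteq> \<omega>'"
    then have "Min (d' ` ?\<Omega>) \<le> d' \<omega>" using finite_roots by (intro Min_le) auto
    also have "\<dots> \<le> norm (\<omega> - \<omega>')" using d'(2)[of \<omega>' \<omega>] w by (auto simp: dist_norm)
    finally show "Min (d' ` ?\<Omega>) \<le> norm (\<omega> - \<omega>')" .
  qed
qed

lemma model_quot_bounded:
  obtains B where "B \<ge> 1"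
    "\<And>t u. t \<in> cball 0 (3 * r) \<Longrightarrow> u \<in> cball 0 (3 * r) \<Longrightarrow> norm (diff_quot \<phi> t u) \<le> B"
proof -
  have "compact ((\<lambda>(t, u). diff_quot \<phi> t u) ` (cball 0 (3 * r) \<times> cball 0 (3 * r)))"
    by (rule compact_continuous_image[OF continuous_on_subset[OF cont_quot_model(2)]])
      (use r in \<open>auto intro!: compact_Times\<close>)
  then obtain B where B: "\<forall>z\<in>(\<lambda>(t, u). diff_quot \<phi> t u) ` (cball 0 (3 * r) \<times> cball 0 (3 * r)). norm z \<le> B"
    using compact_imp_bounded bounded_iff by blast
  show ?thesis
  proof (rule that[of "max B 1"])
    fix t u :: complex assume "t \<in> cball 0 (3 * r)" "u \<in> cball 0 (3 * r)"
    then have "(t, u) \<in> cball 0 (3 * r) \<times> cball 0 (3 * r)" by auto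
    then have "norm (diff_quot \<phi> t u) \<le> B" using B by force
    then show "norm (diff_quot \<phi> t u) \<le> max B 1" by simp
  qed auto
qed

lemma model_quot_uniform:
  assumes "\<epsilon> > 0"
  obtains \<delta> where "\<delta> > 0" "\<And>t u u'. t \<in> cball 0 (3 * r) \<Longrightarrow> u \<in> cball 0 (3 * r) \<Longrightarrow> u' \<in> cball 0 (3 * r) \<Longrightarrow>
    norm (u - u') < \<delta> \<Longrightarrow> norm (diff_quot \<phi> t u - diff_quot \<phi> t u') < \<epsilon>"
proof -
  have "uniformly_continuous_on (cball 0 (3 * r) \<times> cball 0 (3 * r)) (\<lambda>(t, u). diff_quot \<phi> t u)"
    by (rule compact_uniformly_continuous[OF continuous_on_subset[OF cont_quot_model(2)]])
      (use r in \<open>auto intro!: compact_Times\<close>)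
  then obtain d where d: "d > 0" "\<And>x y. x \<in> cball 0 (3 * r) \<times> cball 0 (3 * r) \<Longrightarrow>
      y \<in> cball 0 (3 * r) \<times> cball 0 (3 * r) \<Longrightarrow> dist y x < d \<Longrightarrow>
      dist (case y of (t, u) \<Rightarrow> diff_quot \<phi> t u) (case x of (t, u) \<Rightarrow> diff_quot \<phi> t u) < \<epsilon>"
    unfolding uniformly_continuous_on_def using assms by metis
  show ?thesis
  proof (rule that[OF d(1)])
    fix t u u' :: complex assume "t \<in> cball 0 (3 * r)" "u \<in> cball 0 (3 * r)" "u' \<in> cball 0 (3 * r)" "norm (u - u') < d"
    then show "norm (diff_quot \<phi> t u - diff_quot \<phi> t u') < \<epsilon>"
      using d(2)[of "(t, u')" "(t, u)"] by (simp add: dist_Pair_Pair dist_norm)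
  qed
qed

text \<open>Compactness of the set of pairs in which \<open>u\<close> keeps the distance
  \<open>\<kappa>\<close> from every point \<open>\<omega> * t\<close>; the two powers agree only at
  these points.\<close>

lemma power_gap:
  assumes "\<kappa> > 0"
  obtains c where "c > 0" "\<And>t u :: complex. norm t = r \<Longrightarrow> norm u \<le> 3 * r \<Longrightarrow>
    (\<And>\<omega>. \<omega> ^ m = 1 \<Longrightarrow> \<kappa> \<le> norm (u - \<omega> * t)) \<Longrightarrow> c \<le> norm (u ^ m - t ^ m)"
proof -
  define K where "K = (sphere (0::complex) r \<times> cball (0::complex) (3 * r)) \<inter>
    (\<Inter>\<omega>\<in>{\<omega>. \<omega> ^ m = 1}. {z. \<kappa> \<le> norm (snd z - \<omega> * fst z)})"
  have "closed (\<Inter>\<omega>\<in>{\<omega>. \<omega> ^ m = 1}. {z :: complex \<times> complex. \<kappa> \<le> norm (snd z - \<omega> * fst z)})"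
    by (intro closed_INT ballI closed_Collect_le continuous_intros)
  then have cK: "compact K" unfolding K_def
    by (intro compact_Int_closed compact_Times compact_sphere compact_cball)
  define D where "D = (\<lambda>z :: complex \<times> complex. norm (snd z ^ m - fst z ^ m))"
  have cD: "continuous_on K D" unfolding D_def by (intro continuous_intros)
  have pos: "D z > 0" if z: "z \<in> K" for z
  proof (rule ccontr)
    obtain t u where tu: "z = (t, u)" by fastforce
    assume "\<not> D z > 0"
    then have e: "u ^ m = t ^ m" by (simp add: D_def tu)
    have "t \<noteq> 0" using z r by (auto simp: K_def tu)
    then have "(u / t) ^ m = 1" "u = (u / t) * t" using e by (auto simp: power_divide)
    then have "\<kappa> \<le> norm (u - (u / t) * t)" using z by (auto simp: K_def tu)
    then show False using \<open>u = (u / t) * t\<close> assms by simp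
  qed
  have "\<exists>c>0. \<forall>z\<in>K. D z \<ge> c"
  proof (cases "K = {}")
    case True
    then show ?thesis by (intro exI[of _ 1]) auto
  next
    case False
    then obtain z where "z \<in> K" "\<forall>w\<in>K. D z \<le> D w"
      using continuous_attains_inf[OF cK _ cD] by blast
    then show ?thesis using pos by (intro exI[of _ "D z"]) auto
  qed
  then obtain c where c: "c > 0" "\<And>z. z \<in> K \<Longrightarrow> D z \<ge> c" by blast
  show ?thesis
  proof (rule that[OF c(1)])
    fix t u :: complex assume "norm t = r" "norm u \<le> 3 * r" "\<And>\<omega>. \<omega> ^ m = 1 \<Longrightarrow> \<kappa> \<le> norm (u - \<omega> * t)"
    then have "(t, u) \<in> K" by (simp add: K_def)
    then show "c \<le> norm (u ^ m - t ^ m)" using c(2) by (force simp: D_def)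
  qed
qed

lemma deriv_pow: "deriv (\<lambda>z::complex. z ^ m) t = of_nat m * t ^ (m - 1)"
  by (rule DERIV_imp_deriv) (auto intro!: derivative_eq_intros)

text \<open>On this circle the fibre splits into exactly one point \<open>U \<omega>\<close> near
  each \<open>\<omega> * t\<close>. The sheets can therefore be indexed by roots of unity, and the
  two products are compared factor by factor.\<close>

lemma near_on_circle:
  obtains \<epsilon> where "\<epsilon> > 0" "\<And>a b t. near \<epsilon> a b \<Longrightarrow> sheeted_curve a b m r \<Longrightarrow> norm t = r \<Longrightarrow>
    norm (model_product t - sheeted_curve.double_function a b r t) < norm (model_product t)"
proof -
  let ?\<Omega> = "{\<omega>::complex. \<omega> ^ m = 1}"
  obtain d where d: "d > 0" "\<And>\<omega> \<omega>'. \<omega> ^ m = 1 \<Longrightarrow> \<omega>' ^ m = 1 \<Longrightarrow> \<omega> \<noteq> \<omega>' \<Longrightarrow> d \<le> norm (\<omega> - \<omega>' :: complex)"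
    using roots_separated by blast
  obtain B0 where B0: "B0 \<ge> 1"
    "\<And>t u. t \<in> cball 0 (3 * r) \<Longrightarrow> u \<in> cball 0 (3 * r) \<Longrightarrow> norm (diff_quot \<phi> t u) \<le> B0"
    using model_quot_bounded by blast
  define B where "B = B0 + 1"
  define k where "k = card (?\<Omega> - {1})"
  have cm: "continuous_on (sphere 0 r) model_product"
    using holomorphic_on_imp_continuous_on[OF holomorphic_model_product] r
    by (auto elim!: continuous_on_subset)
  have "sphere (0::complex) r \<noteq> {}" using r by simp
  then obtain z0 where z0: "z0 \<in> sphere 0 r" "\<And>z. z \<in> sphere 0 r \<Longrightarrow> norm (model_product z0) \<le> norm (model_product z)"
    using continuous_attains_inf[OF compact_sphere _ continuous_on_norm[OF cm]] by blast
  define c0 where "c0 = norm (model_product z0)"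
  have c0: "c0 > 0" using model_product_nonzero[of z0] z0(1) r by (auto simp: c0_def)
  \<comment> \<open>An error \<open>\<epsilon>'\<close> in each of \<open>k\<close> factors bounded
    by \<open>B\<close> changes the product by at most \<open>k * B ^ k * \<epsilon>'\<close>. This
    must stay below the minimum \<open>c0\<close> of the model product on the circle.\<close>
  define \<epsilon>' where "\<epsilon>' = min 1 (c0 / (2 * (real k + 1) * B ^ k))"
  have B1: "B \<ge> 1" using B0 by (simp add: B_def)
  then have \<epsilon>': "\<epsilon>' > 0" "\<epsilon>' \<le> 1" using c0 by (auto simp: \<epsilon>'_def)
  have "real k * B ^ k * \<epsilon>' \<le> real k * B ^ k * (c0 / (2 * (real k + 1) * B ^ k))"
    using B1 by (intro mult_left_mono) (auto simp: \<epsilon>'_def)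
  also have "\<dots> = c0 * (real k / (2 * (real k + 1))) * (B ^ k / B ^ k)"
    by (simp add: mult_ac)
  also have "B ^ k / B ^ k = 1" using B1 by simp
  also have "c0 * (real k / (2 * (real k + 1))) * 1 = c0 * (real k / (2 * (real k + 1)))" by simp
  also have "\<dots> < c0 * 1"
    using c0 by (intro mult_strict_left_mono) (auto simp: field_simps)
  finally have small: "real k * B ^ k * \<epsilon>' < c0" by simp
  obtain \<delta> where \<delta>: "\<delta> > 0" "\<And>t u u'. t \<in> cball 0 (3 * r) \<Longrightarrow> u \<in> cball 0 (3 * r) \<Longrightarrow> u' \<in> cball 0 (3 * r) \<Longrightarrow>
    norm (u - u') < \<delta> \<Longrightarrow> norm (diff_quot \<phi> t u - diff_quot \<phi> t u') < \<epsilon>' / 2"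
    using model_quot_uniform[of "\<epsilon>' / 2"] \<epsilon>' by auto
  \<comment> \<open>The three entries make the discs around the points \<open>\<omega> * t\<close>
    disjoint, keep them in the annulus from \<open>r / 2\<close> to \<open>3 * r / 2\<close>, and
    make the divided differences of \<open>\<phi>\<close> vary little on them.\<close>
  define \<kappa> where "\<kappa> = Min {d * r / 2, r / 2, \<delta>}"
  have \<kappa>: "\<kappa> > 0" "2 * \<kappa> \<le> d * r" "\<kappa> \<le> r / 2" "\<kappa> \<le> \<delta>"
    using d(1) r \<delta>(1) by (auto simp: \<kappa>_def)
  obtain c1 where c1: "c1 > 0" "\<And>t u :: complex. norm t = r \<Longrightarrow> norm u \<le> 3 * r \<Longrightarrow>
    (\<And>\<omega>. \<omega> ^ m = 1 \<Longrightarrow> \<kappa> \<le> norm (u - \<omega> * t)) \<Longrightarrow> c1 \<le> norm (u ^ m - t ^ m)"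
    using power_gap[OF \<kappa>(1)] by blast
  \<comment> \<open>The first entry controls the divided differences of \<open>b\<close>, the second
    serves Rouche's theorem, where the error is \<open>2 * \<epsilon>\<close>, and the third keeps
    \<open>deriv a\<close> nonzero on all sheets.\<close>
  define \<epsilon> where "\<epsilon> = Min {\<epsilon>' / 2, c1 / 4, real m * (r / 2) ^ (m - 1) / 2}"
  have \<epsilon>: "\<epsilon> > 0" "\<epsilon> \<le> \<epsilon>' / 2" "\<epsilon> \<le> c1 / 4" "\<epsilon> \<le> real m * (r / 2) ^ (m - 1) / 2"
    using \<epsilon>' c1(1) r m by (auto simp: \<epsilon>_def)
  show ?thesis
  proof (rule that[OF \<epsilon>(1)])
    fix a b and t :: complex assume near: "near \<epsilon> a b" and sc: "sheeted_curve a b m r" and t: "norm t = r"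
    interpret sheeted_curve a b m r by (rule sc)
    have t0: "t \<noteq> 0" using t r by auto
    have t2: "t \<in> ball 0 (2 * r)" "t \<in> ball 0 (4 * r)" "t \<in> cball 0 (3 * r)" using t r by auto
    have dist_roots: "2 * \<kappa> \<le> norm (\<omega> * t - \<omega>' * t)" if "\<omega> ^ m = 1" "\<omega>' ^ m = 1" "\<omega> \<noteq> \<omega>'" for \<omega> \<omega>'
    proof -
      have "2 * \<kappa> \<le> d * r" by (rule \<kappa>)
      also have "\<dots> \<le> norm (\<omega> - \<omega>') * r" using d(2)[OF that] r by (intro mult_right_mono) auto
      also have "\<dots> = norm (\<omega> * t - \<omega>' * t)" by (simp add: t norm_mult left_diff_distrib[symmetric])
      finally show ?thesis .
    qed
    define F where "F = (\<lambda>u. u ^ m - t ^ m)"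
    define G where "G = (\<lambda>u. a u - a t)"
    have FG: "norm (F u - G u) \<le> 2 * \<epsilon>" if "u \<in> ball 0 (4 * r)" for u
    proof -
      have "F u - G u = (a t - t ^ m) - (a u - u ^ m)" by (simp add: F_def G_def)
      also have "norm \<dots> \<le> norm (a t - t ^ m) + norm (a u - u ^ m)" by (rule norm_triangle_ineq4)
      also have "\<dots> \<le> \<epsilon> + \<epsilon>" using near that t2 by (intro add_mono) (auto simp: near_def)
      finally show ?thesis by simp
    qed
    have holF: "F holomorphic_on A" for A unfolding F_def by (intro holomorphic_intros)
    have holG: "G holomorphic_on ball 0 (4 * r)"
      using near by (auto simp: near_def G_def intro!: holomorphic_intros)
    have norm_in: "norm u \<le> 3 * r / 2" "norm u \<ge> r / 2"
      if "\<omega> ^ m = 1" "dist (\<omega> * t) u \<le> \<kappa>" for \<omega> u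
    proof -
      have n: "norm (\<omega> * t) = r" using norm_root_of_unity[OF that(1)] t by (simp add: norm_mult)
      have "norm u \<le> norm (\<omega> * t) + norm (u - \<omega> * t)" by (metis add.commute norm_triangle_sub)
      then show "norm u \<le> 3 * r / 2" using that(2) \<kappa>(3) n by (simp add: dist_norm norm_minus_commute)
      have "norm (\<omega> * t) \<le> norm u + norm (\<omega> * t - u)" by (rule norm_triangle_sub)
      then show "norm u \<ge> r / 2" using that(2) \<kappa>(3) n by (simp add: dist_norm)
    qed
    \<comment> \<open>In the disc of radius \<open>\<kappa>\<close> the model
      \<open>u ^ m - t ^ m\<close> has one simple zero. On its boundary every other root is also at
      distance at least \<open>\<kappa>\<close>, so \<open>power_gap\<close> gives the lower bound
      \<open>c1\<close> that beats the error.\<close>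
    have root: "\<exists>!u. u \<in> ball (\<omega> * t) \<kappa> \<and> a u = a t" if \<omega>: "\<omega> ^ m = 1" for \<omega>
    proof -
      have n: "norm (\<omega> * t) = r" using norm_root_of_unity[OF \<omega>] t by (simp add: norm_mult)
      have "ball (\<omega> * t) (2 * r) \<subseteq> ball 0 (4 * r)"
      proof
        fix u assume "u \<in> ball (\<omega> * t) (2 * r)"
        moreover have "norm u \<le> norm (\<omega> * t) + norm (u - \<omega> * t)" by (metis add.commute norm_triangle_sub)
        ultimately show "u \<in> ball 0 (4 * r)" using n r by (simp add: dist_norm norm_minus_commute)
      qed
      then have hG: "G holomorphic_on ball (\<omega> * t) (2 * r)" using holG holomorphic_on_subset by blast
      have less: "norm (F z - G z) < norm (F z)" if z: "dist (\<omega> * t) z = \<kappa>" for z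
      proof -
        have nz: "norm z \<le> 3 * r / 2" using norm_in(1)[OF \<omega>] z by simp
        have "c1 \<le> norm (z ^ m - t ^ m)"
        proof (rule c1(2)[OF t])
          fix \<omega>' :: complex assume w: "\<omega>' ^ m = 1"
          show "\<kappa> \<le> norm (z - \<omega>' * t)"
          proof (cases "\<omega>' = \<omega>")
            case True
            then show ?thesis using z by (simp add: dist_norm norm_minus_commute)
          next
            case False
            have "2 * \<kappa> \<le> norm (\<omega> * t - \<omega>' * t)" using dist_roots[OF \<omega> w] False by blast
            also have "\<dots> \<le> norm (\<omega> * t - z) + norm (z - \<omega>' * t)"
              using norm_triangle_ineq[of "\<omega> * t - z" "z - \<omega>' * t"] by simp
            finally show ?thesis using z by (simp add: dist_norm)
          qed
        qed (use nz r in simp)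
        moreover have "norm (F z - G z) \<le> 2 * \<epsilon>" using nz r by (intro FG) simp
        ultimately show ?thesis using \<epsilon>(3) c1(1) by (simp add: F_def)
      qed
      have \<kappa>r: "\<kappa> < 2 * r" using \<kappa>(3) r by simp
      note ZO = zero_order_sum_eq[OF holF hG \<kappa>(1) \<kappa>r less]
      have Fz: "{z \<in> ball (\<omega> * t) \<kappa>. F z = 0} = {\<omega> * t}"
      proof (intro equalityI subsetI)
        fix z assume z: "z \<in> {z \<in> ball (\<omega> * t) \<kappa>. F z = 0}"
        then have e: "(z / t) ^ m = 1" "z = (z / t) * t" using t0 by (auto simp: F_def power_divide)
        have "z / t = \<omega>"
        proof (rule ccontr)
          assume "z / t \<noteq> \<omega>"
          then have "2 * \<kappa> \<le> norm (\<omega> * t - (z / t) * t)" using dist_roots[OF \<omega> e(1)] by auto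
          then show False using z \<kappa>(1) e(2) by (auto simp: dist_norm)
        qed
        then show "z \<in> {\<omega> * t}" using e(2) by simp
      qed (use \<kappa>(1) \<omega> in \<open>auto simp: F_def power_mult_distrib\<close>)
      have dF: "deriv F (\<omega> * t) = of_nat m * (\<omega> * t) ^ (m - 1)"
        unfolding F_def by (rule DERIV_imp_deriv) (auto intro!: derivative_eq_intros)
      have "\<omega> \<noteq> 0" using \<omega> m by (auto simp: power_0_left split: if_splits)
      then have "zorder F (\<omega> * t) = 1"
        by (intro zorder_simple_zero[OF holF open_UNIV]) (use \<omega> t0 m dF in \<open>auto simp: F_def power_mult_distrib\<close>)
      then have S1: "(\<Sum>p\<in>{z \<in> ball (\<omega> * t) \<kappa>. G z = 0}. zorder G p) = 1"
        using ZO(3) Fz by simp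
      have "int (card {z \<in> ball (\<omega> * t) \<kappa>. G z = 0}) = (\<Sum>p\<in>{z \<in> ball (\<omega> * t) \<kappa>. G z = 0}. 1)" by simp
      also have "\<dots> \<le> (\<Sum>p\<in>{z \<in> ball (\<omega> * t) \<kappa>. G z = 0}. zorder G p)"
        using ZO(5) by (intro sum_mono) auto
      finally have "card {z \<in> ball (\<omega> * t) \<kappa>. G z = 0} \<le> 1" using S1 by simp
      moreover have "{z \<in> ball (\<omega> * t) \<kappa>. G z = 0} \<noteq> {}"
      proof
        assume "{z \<in> ball (\<omega> * t) \<kappa>. G z = 0} = {}"
        then have "(\<Sum>p\<in>{z \<in> ball (\<omega> * t) \<kappa>. G z = 0}. zorder G p) = 0" by (metis sum.empty)
        then show False using S1 by simp
      qed
      ultimately have "card {z \<in> ball (\<omega> * t) \<kappa>. G z = 0} = 1"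
        using ZO(2) by (metis One_nat_def card_gt_0_iff le_antisym less_eq_Suc_le)
      then obtain u where "{z \<in> ball (\<omega> * t) \<kappa>. G z = 0} = {u}" using card_1_singletonE by metis
      then have "z \<in> ball (\<omega> * t) \<kappa> \<and> a z = a t \<longleftrightarrow> z = u" for z by (auto simp: G_def set_eq_iff)
      then show ?thesis by metis
    qed
    define U where "U = (\<lambda>\<omega>. THE u. u \<in> ball (\<omega> * t) \<kappa> \<and> a u = a t)"
    have U: "U \<omega> \<in> ball (\<omega> * t) \<kappa>" "a (U \<omega>) = a t" if "\<omega> ^ m = 1" for \<omega>
      using theI'[OF root[OF that]] by (auto simp: U_def)
    have U_eq: "U \<omega> = u" if "\<omega> ^ m = 1" "u \<in> ball (\<omega> * t) \<kappa>" "a u = a t" for \<omega> u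
      using root[OF that(1)] U[OF that(1)] that by blast
    have U3: "U \<omega> \<in> ball 0 (3 * r)" "norm (U \<omega>) \<ge> r / 2" if "\<omega> ^ m = 1" for \<omega>
      using norm_in[OF that, of "U \<omega>"] U(1)[OF that] r by auto
    have fib: "fibre t = U ` ?\<Omega>"
    proof
      show "U ` ?\<Omega> \<subseteq> fibre t" using U(2) U3(1) by (auto simp: fibre_def)
      show "fibre t \<subseteq> U ` ?\<Omega>"
      proof
        fix u assume u: "u \<in> fibre t"
        then have u4: "u \<in> ball 0 (4 * r)" "norm u \<le> 3 * r" and G0: "G u = 0" using r by (auto simp: fibre_def G_def)
        have "norm (F u) \<le> 2 * \<epsilon>" using FG[OF u4(1)] G0 by simp
        then have "norm (u ^ m - t ^ m) < c1" using \<epsilon>(3) c1(1) by (simp add: F_def)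
        then obtain \<omega> where \<omega>: "\<omega> ^ m = 1" "norm (u - \<omega> * t) < \<kappa>" using c1(2)[OF t u4(2)] by force
        then have "U \<omega> = u" using u by (intro U_eq) (auto simp: fibre_def dist_norm norm_minus_commute)
        then show "u \<in> U ` ?\<Omega>" using \<omega>(1) by blast
      qed
    qed
    have U1: "U 1 = t" using \<kappa>(1) by (intro U_eq) auto
    have injU: "inj_on U ?\<Omega>"
    proof (rule inj_onI)
      fix \<omega> \<omega>' assume w: "\<omega> \<in> ?\<Omega>" "\<omega>' \<in> ?\<Omega>" "U \<omega> = U \<omega>'"
      show "\<omega> = \<omega>'"
      proof (rule ccontr)
        assume "\<omega> \<noteq> \<omega>'"
        then have "2 * \<kappa> \<le> dist (\<omega> * t) (\<omega>' * t)" using dist_roots[of \<omega> \<omega>'] w by (simp add: dist_norm)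
        also have "\<dots> \<le> dist (\<omega> * t) (U \<omega>) + dist (\<omega>' * t) (U \<omega>)" by (metis dist_commute dist_triangle)
        also have "\<dots> < \<kappa> + \<kappa>" using U(1)[of \<omega>] U(1)[of \<omega>'] w by (intro add_strict_mono) auto
        finally show False by simp
      qed
    qed
    have fib1: "fibre t - {t} = U ` (?\<Omega> - {1})"
      using inj_on_image_set_diff[OF injU, of ?\<Omega> "{1}"] fib U1 by simp
    \<comment> \<open>Every sheet has norm at least \<open>r / 2\<close>, where
      \<open>m * u ^ (m - 1)\<close> is larger than the error in the derivative; hence the fibre is
      unramified.\<close>
    have nb: "t \<notin> branch_points"
    proof
      assume "t \<in> branch_points"
      then obtain u where u: "u \<in> fibre t" "deriv a u = 0" by (auto simp: branch_points_def)
      then obtain \<omega> where w: "\<omega> ^ m = 1" "u = U \<omega>" using fib by auto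
      then have "norm u \<ge> r / 2" "u \<in> ball 0 (4 * r)" using U3[of \<omega>] r by auto
      then have "norm (deriv a u - of_nat m * u ^ (m - 1)) \<le> \<epsilon>"
        using near by (simp add: near_def deriv_pow)
      then have "norm (of_nat m * u ^ (m - 1)) \<le> \<epsilon>" using u(2) by simp
      moreover have "real m * (r / 2) ^ (m - 1) \<le> norm (of_nat m * u ^ (m - 1))"
        using \<open>norm u \<ge> r / 2\<close> r by (auto simp: norm_mult norm_power intro!: mult_left_mono power_mono)
      ultimately show False using \<epsilon>(4) r m by (smt (verit) \<epsilon>(1) field_sum_of_halves)
    qed
    have "double_function t = (\<Prod>u\<in>U ` (?\<Omega> - {1}). diff_quot b t u)"
      using double_function_eq[of t] nb t2 by (simp add: sheet_product_def fib1)
    also have "\<dots> = (\<Prod>\<omega>\<in>?\<Omega> - {1}. diff_quot b t (U \<omega>))"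
      by (rule prod.reindex[OF inj_on_subset[OF injU], unfolded comp_def]) auto
    finally have df: "double_function t = (\<Prod>\<omega>\<in>?\<Omega> - {1}. diff_quot b t (U \<omega>))" .
    have close: "norm (diff_quot \<phi> t (\<omega> * t) - diff_quot b t (U \<omega>)) \<le> \<epsilon>'" if w: "\<omega> ^ m = 1" for \<omega>
    proof -
      have n: "norm (\<omega> * t) = r" using norm_root_of_unity[OF w] t by (simp add: norm_mult)
      have 1: "norm (diff_quot \<phi> t (\<omega> * t) - diff_quot \<phi> t (U \<omega>)) < \<epsilon>' / 2"
        using U(1)[OF w] U3(1)[OF w] \<kappa>(4) n r t2 by (intro \<delta>(2)) (auto simp: dist_norm)
      have 2: "norm (diff_quot b t (U \<omega>) - diff_quot \<phi> t (U \<omega>)) \<le> \<epsilon>"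
        using U3(1)[OF w] r t2 by (intro near_diff_quot[OF near]) auto
      have "diff_quot \<phi> t (\<omega> * t) - diff_quot b t (U \<omega>) = (diff_quot \<phi> t (\<omega> * t) - diff_quot \<phi> t (U \<omega>))
          - (diff_quot b t (U \<omega>) - diff_quot \<phi> t (U \<omega>))" by simp
      also have "norm \<dots> \<le> norm (diff_quot \<phi> t (\<omega> * t) - diff_quot \<phi> t (U \<omega>))
          + norm (diff_quot b t (U \<omega>) - diff_quot \<phi> t (U \<omega>))" by (rule norm_triangle_ineq4)
      finally show ?thesis using 1 2 \<epsilon>(2) by simp
    qed
    have bd: "norm (diff_quot \<phi> t (\<omega> * t)) \<le> B0" if w: "\<omega> ^ m = 1" for \<omega>
      using norm_root_of_unity[OF w] t r by (intro B0(2)) (auto simp: norm_mult)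
    have "norm (model_product t - double_function t) \<le> real k * B ^ k * \<epsilon>'"
      unfolding df model_product_def k_def
    proof (rule norm_prod_diff_le)
      fix \<omega> :: complex assume w: "\<omega> \<in> ?\<Omega> - {1}"
      show "norm (diff_quot \<phi> t (\<omega> * t)) \<le> B" using bd[of \<omega>] w by (simp add: B_def)
      show "norm (diff_quot \<phi> t (\<omega> * t) - diff_quot b t (U \<omega>)) \<le> \<epsilon>'" using close w by blast
      have "norm (diff_quot b t (U \<omega>)) \<le> norm (diff_quot \<phi> t (\<omega> * t)) + norm (diff_quot \<phi> t (\<omega> * t) - diff_quot b t (U \<omega>))"
        by (metis norm_minus_commute norm_triangle_sub)
      then show "norm (diff_quot b t (U \<omega>)) \<le> B" using bd[of \<omega>] close[of \<omega>] w \<epsilon>' by (auto simp: B_def)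
    qed (use finite_roots B1 in auto)
    also have "\<dots> < c0" by (rule small)
    also have "\<dots> \<le> norm (model_product t)" using z0(2)[of t] t by (simp add: c0_def)
    finally show "norm (model_product t - double_function t) < norm (model_product t)" .
  qed
qed

section \<open>Counting the parameters of double points\<close>

definition self_meeting :: "(complex \<Rightarrow> complex) \<Rightarrow> (complex \<Rightarrow> complex) \<Rightarrow> complex set"
  where "self_meeting a b = {t \<in> cball 0 (3 * r). \<exists>u\<in>cball 0 (3 * r). u \<noteq> t \<and> a u = a t \<and> b u = b t}"

definition nodal :: "(complex \<Rightarrow> complex) \<Rightarrow> (complex \<Rightarrow> complex) \<Rightarrow> bool"
  where "nodal a b \<longleftrightarrow>
    (\<forall>t\<in>cball 0 (3 * r). deriv a t \<noteq> 0 \<or> deriv b t \<noteq> 0) \<and>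
    (\<forall>t\<in>cball 0 (3 * r). \<forall>u\<in>cball 0 (3 * r). t \<noteq> u \<and> a u = a t \<and> b u = b t \<longrightarrow>
      deriv a t * deriv b u \<noteq> deriv a u * deriv b t \<and>
      (\<forall>w\<in>cball 0 (3 * r). a w = a t \<and> b w = b t \<longrightarrow> w = t \<or> w = u))"

text \<open>\<open>model_product\<close> vanishes on this disc at most at 0, so the number is its
  order there. The sum is the form in which Rouche's theorem delivers it.\<close>

definition double_order :: nat
  where "double_order = nat (\<Sum>p\<in>{z \<in> ball 0 r. model_product z = 0}. zorder model_product p)"

text \<open>Localisation puts both parameters of a double point into the disc of radius
  \<open>r\<close>, so they are exactly the zeros of the double function there. These are simple
  because the partner of a parameter in \<open>self_meeting\<close> lies in
  \<open>self_meeting\<close> as well, where \<open>deriv a\<close> is not 0.\<close>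

lemma card_self_meeting_generic:
  obtains \<epsilon> where "\<epsilon> > 0" "\<And>a b. near \<epsilon> a b \<Longrightarrow> nodal a b \<Longrightarrow> finite (self_meeting a b)"
    "\<And>a b. near \<epsilon> a b \<Longrightarrow> nodal a b \<Longrightarrow> (\<And>t. t \<in> self_meeting a b \<Longrightarrow> deriv a t \<noteq> 0) \<Longrightarrow>
      card (self_meeting a b) = double_order"
proof -
  obtain \<epsilon>1 where \<epsilon>1: "\<epsilon>1 > 0"
    "\<And>a b t. near \<epsilon>1 a b \<Longrightarrow> t \<in> ball 0 (2 * r) \<Longrightarrow> finite {u \<in> ball 0 (3 * r). a u = a t} \<and>
      card {u \<in> ball 0 (3 * r). a u = a t} \<le> m"
    "\<And>a b t u. near \<epsilon>1 a b \<Longrightarrow> t \<in> ball 0 (2 * r) \<Longrightarrow> norm u = 3 * r \<Longrightarrow> a u \<noteq> a t"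
    using near_sheets by blast
  obtain \<epsilon>2 where \<epsilon>2: "\<epsilon>2 > 0" "\<And>a b t. near \<epsilon>2 a b \<Longrightarrow> sheeted_curve a b m r \<Longrightarrow> norm t = r \<Longrightarrow>
    norm (model_product t - sheeted_curve.double_function a b r t) < norm (model_product t)"
    using near_on_circle by blast
  obtain \<epsilon>3 where \<epsilon>3: "\<epsilon>3 > 0"
    "\<And>a b t u. near \<epsilon>3 a b \<Longrightarrow> t \<in> cball 0 (3 * r) \<Longrightarrow> u \<in> cball 0 (3 * r) \<Longrightarrow>
      diff_quot a t u = 0 \<Longrightarrow> diff_quot b t u = 0 \<Longrightarrow> t \<in> ball 0 r \<and> u \<in> ball 0 r"
    using near_localised[OF r] by blast
  define \<epsilon> where "\<epsilon> = Min {\<epsilon>1, \<epsilon>2, \<epsilon>3}"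
  have \<epsilon>: "\<epsilon> > 0" "\<epsilon> \<le> \<epsilon>1" "\<epsilon> \<le> \<epsilon>2" "\<epsilon> \<le> \<epsilon>3" using \<epsilon>1(1) \<epsilon>2(1) \<epsilon>3(1) by (auto simp: \<epsilon>_def)
  have sc: "sheeted_curve a b m r" if near: "near \<epsilon> a b" and nod: "nodal a b" for a b
  proof
    show "r > 0" by (rule r)
    show "a holomorphic_on ball 0 (4 * r)" "b holomorphic_on ball 0 (4 * r)" using near by (auto simp: near_def)
    show "finite {u \<in> ball 0 (3 * r). a u = a t} \<and> card {u \<in> ball 0 (3 * r). a u = a t} \<le> m"
      if "t \<in> ball 0 (2 * r)" for t using \<epsilon>1(2)[OF near_mono[OF near \<epsilon>(2)] that] .
    show "a u \<noteq> a t" if "t \<in> ball 0 (2 * r)" "cmod u = 3 * r" for t u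
      using \<epsilon>1(3)[OF near_mono[OF near \<epsilon>(2)] that] .
    show "deriv a t \<noteq> 0 \<or> deriv b t \<noteq> 0" if "t \<in> cball 0 (3 * r)" for t
      using nod that unfolding nodal_def by blast
    show "w = t \<or> w = u" if "t \<in> cball 0 (3 * r)" "u \<in> cball 0 (3 * r)" "w \<in> cball 0 (3 * r)"
      "t \<noteq> u" "a t = a u" "b t = b u" "a w = a t" "b w = b t" for t u w
      using nod that unfolding nodal_def by metis
  qed
  have localised: "u \<in> ball 0 r" "t \<in> ball 0 r" if near: "near \<epsilon> a b"
    and tu: "t \<in> cball 0 (3 * r)" "u \<in> cball 0 (3 * r)" "u \<noteq> t" "a u = a t" "b u = b t" for a b t u
    using \<epsilon>3(2)[OF near_mono[OF near \<epsilon>(4)] tu(1,2)] tu(3-) by (auto simp: diff_quot_def)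
  have zeros: "self_meeting a b = {z \<in> ball 0 r. sheeted_curve.double_function a b r z = 0}"
    if near: "near \<epsilon> a b" and nod: "nodal a b" for a b
  proof -
    interpret sheeted_curve a b m r by (rule sc[OF near nod])
    show ?thesis
    proof (intro equalityI subsetI)
      fix t assume "t \<in> self_meeting a b"
      then obtain u where u: "t \<in> cball 0 (3 * r)" "u \<in> cball 0 (3 * r)" "u \<noteq> t" "a u = a t" "b u = b t"
        by (auto simp: self_meeting_def)
      note l = localised[OF near u]
      then have "special t u" using u r by (auto simp: special_def)
      then show "t \<in> {z \<in> ball 0 r. double_function z = 0}" using double_function_zero l by auto
    next
      fix t assume t: "t \<in> {z \<in> ball 0 r. double_function z = 0}"
      then have "t \<in> ball 0 (2 * r)" using r by auto
      then obtain u where "special t u" using double_function_nonzero t by auto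
      then show "t \<in> self_meeting a b" using disc_mono by (auto simp: special_def self_meeting_def)
    qed
  qed
  have ZO: "finite {z \<in> ball 0 r. sheeted_curve.double_function a b r z = 0}"
     "(\<Sum>p\<in>{z \<in> ball 0 r. model_product z = 0}. zorder model_product p) =
      (\<Sum>p\<in>{z \<in> ball 0 r. sheeted_curve.double_function a b r z = 0}. zorder (sheeted_curve.double_function a b r) p)"
    if near: "near \<epsilon> a b" and nod: "nodal a b" for a b
  proof -
    interpret sheeted_curve a b m r by (rule sc[OF near nod])
    have hm: "model_product holomorphic_on ball 0 (2 * r)"
      using holomorphic_model_product by (rule holomorphic_on_subset) (use r in auto)
    have r2: "0 < r" "r < 2 * r" using r by auto
    have less: "norm (model_product z - double_function z) < norm (model_product z)" if "dist 0 z = r" for z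
      using \<epsilon>2(2)[OF near_mono[OF near \<epsilon>(3)] sc[OF near nod], of z] that by simp
    note Z = zero_order_sum_eq[OF hm holomorphic_double_function r2 less]
    show "finite {z \<in> ball 0 r. double_function z = 0}" by (rule Z(2))
    show "(\<Sum>p\<in>{z \<in> ball 0 r. model_product z = 0}. zorder model_product p) =
      (\<Sum>p\<in>{z \<in> ball 0 r. double_function z = 0}. zorder double_function p)" by (rule Z(3))
  qed
  show ?thesis
  proof (rule that[OF \<epsilon>(1)])
    fix a b assume near: "near \<epsilon> a b" and nod: "nodal a b"
    show "finite (self_meeting a b)" unfolding zeros[OF near nod] by (rule ZO[OF near nod])
    assume nv: "\<And>t. t \<in> self_meeting a b \<Longrightarrow> deriv a t \<noteq> 0"
    interpret sheeted_curve a b m r by (rule sc[OF near nod])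
    have "zorder double_function p = 1" if p: "p \<in> {z \<in> ball 0 r. double_function z = 0}" for p
    proof -
      have "p \<in> self_meeting a b" using p zeros[OF near nod] by blast
      then obtain u where u: "p \<in> cball 0 (3 * r)" "u \<in> cball 0 (3 * r)" "u \<noteq> p" "a u = a p" "b u = b p"
        by (auto simp: self_meeting_def)
      note l = localised[OF near u]
      then have sp: "special p u" using u r by (auto simp: special_def)
      have "u \<in> self_meeting a b" using u by (force simp: self_meeting_def)
      then have "deriv double_function p \<noteq> 0"
        using double_function_simple_zero[OF sp] nv nod u unfolding nodal_def by metis
      then show ?thesis
        using p r by (intro zorder_simple_zero[OF holomorphic_double_function open_ball]) auto
    qed
    then have "(\<Sum>p\<in>{z \<in> ball 0 r. double_function z = 0}. zorder double_function p) =
        int (card {z \<in> ball 0 r. double_function z = 0})" by simp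
    then show "card (self_meeting a b) = double_order"
      using ZO(2)[OF near nod] zeros[OF near nod] by (simp add: double_order_def)
  qed
qed

text \<open>Passing from \<open>a\<close> to \<open>a + l * b\<close> changes neither the double
  points nor the determinant of the tangent vectors at them. All but finitely many \<open>l\<close>
  make the first component unramified at these parameters.\<close>

lemma card_self_meeting:
  obtains \<epsilon> where "\<epsilon> > 0" "\<And>a b. near \<epsilon> a b \<Longrightarrow> nodal a b \<Longrightarrow>
    finite (self_meeting a b) \<and> card (self_meeting a b) = double_order"
proof -
  obtain \<epsilon> where \<epsilon>: "\<epsilon> > 0" "\<And>a b. near \<epsilon> a b \<Longrightarrow> nodal a b \<Longrightarrow> finite (self_meeting a b)"
    "\<And>a b. near \<epsilon> a b \<Longrightarrow> nodal a b \<Longrightarrow> (\<And>t. t \<in> self_meeting a b \<Longrightarrow> deriv a t \<noteq> 0) \<Longrightarrow>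
      card (self_meeting a b) = double_order"
    using card_self_meeting_generic by blast
  have "compact (\<phi> ` cball 0 (4 * r))" "compact (deriv \<phi> ` cball 0 (4 * r))"
    using hol_\<phi> holomorphic_deriv[OF hol_\<phi> open_ball] r
    by (auto intro!: compact_continuous_image elim!: continuous_on_subset[OF holomorphic_on_imp_continuous_on])
  then obtain M1 M2 where "\<forall>z\<in>\<phi> ` cball 0 (4 * r). norm z \<le> M1" "\<forall>z\<in>deriv \<phi> ` cball 0 (4 * r). norm z \<le> M2"
    using compact_imp_bounded bounded_iff by metis
  then have M12: "norm (\<phi> z) \<le> M1" "norm (deriv \<phi> z) \<le> M2" if "z \<in> ball 0 (4 * r)" for z
    using that by auto
  \<comment> \<open>A common bound for \<open>b\<close> and \<open>deriv b\<close>, so that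
    \<open>l\<close> of norm below \<open>\<epsilon> / (2 * M)\<close> moves \<open>a\<close> and
    \<open>deriv a\<close> by at most \<open>\<epsilon> / 2\<close>.\<close>
  define M where "M = \<bar>M1\<bar> + \<bar>M2\<bar> + \<epsilon> + 1"
  have M: "norm (\<phi> z) + \<epsilon> \<le> M" "norm (deriv \<phi> z) + \<epsilon> \<le> M" if "z \<in> ball 0 (4 * r)" for z
    using M12[OF that] by (auto simp: M_def)
  have Mpos: "M > 0" using \<epsilon>(1) by (simp add: M_def)
  have "finite (self_meeting a b) \<and> card (self_meeting a b) = double_order"
    if near: "near (\<epsilon> / 2) a b" and nod: "nodal a b" for a b
  proof -
    have near': "near \<epsilon> a b" using near_mono[OF near] \<epsilon>(1) by simp
    have fin: "finite (self_meeting a b)" by (rule \<epsilon>(2)[OF near' nod])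
    \<comment> \<open>The values of \<open>l\<close> for which the tilted derivative vanishes at a
      double point. Where \<open>deriv b t = 0\<close> the quotient is only the conventional 0, and
      immersion takes care of that case.\<close>
    define bad where "bad = (\<lambda>t. - deriv a t / deriv b t) ` self_meeting a b"
    have "infinite (ball (0::complex) (\<epsilon> / (2 * M)))"
      using \<epsilon>(1) Mpos by (intro uncountable_infinite uncountable_ball) simp
    then have "infinite (ball (0::complex) (\<epsilon> / (2 * M)) - bad)" using fin by (simp add: bad_def)
    then obtain l where l: "l \<in> ball 0 (\<epsilon> / (2 * M))" "l \<notin> bad" using not_finite_existsD by (metis Diff_iff infinite_imp_nonempty ex_in_conv)
    define a' where "a' = (\<lambda>z. a z + l * b z)"
    have hol: "a holomorphic_on ball 0 (4 * r)" "b holomorphic_on ball 0 (4 * r)"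
      using near by (auto simp: near_def)
    have da': "deriv a' z = deriv a z + l * deriv b z" if "z \<in> ball 0 (4 * r)" for z
      unfolding a'_def
      by (rule DERIV_imp_deriv)
        (use holomorphic_derivI[OF hol(1) open_ball that] holomorphic_derivI[OF hol(2) open_ball that] in
          \<open>auto intro!: derivative_eq_intros\<close>)
    have lM: "norm (l * x) \<le> \<epsilon> / 2" if "norm x \<le> M" for x
    proof -
      have "norm (l * x) \<le> \<epsilon> / (2 * M) * M"
        unfolding norm_mult using l(1) that Mpos \<epsilon>(1) by (intro mult_mono) auto
      then show ?thesis using Mpos by simp
    qed
    have near_a': "near \<epsilon> a' b"
      unfolding near_def
    proof (intro conjI ballI)
      show "a' holomorphic_on ball 0 (4 * r)" unfolding a'_def using hol by (intro holomorphic_intros)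
      fix z :: complex assume z: "z \<in> ball 0 (4 * r)"
      have n: "norm (a z - z ^ m) \<le> \<epsilon> / 2" "norm (b z - \<phi> z) \<le> \<epsilon> / 2"
        "norm (deriv a z - deriv (\<lambda>z. z ^ m) z) \<le> \<epsilon> / 2" "norm (deriv b z - deriv \<phi> z) \<le> \<epsilon> / 2"
        using near z by (auto simp: near_def)
      have "norm (b z) \<le> norm (\<phi> z) + norm (b z - \<phi> z)" by (metis norm_triangle_sub)
      then have "norm (b z) \<le> M" using M(1)[OF z] n \<epsilon>(1) by simp
      then have "norm (l * b z) \<le> \<epsilon> / 2" by (rule lM)
      moreover have "a' z - z ^ m = (a z - z ^ m) + l * b z" by (simp add: a'_def)
      then have "norm (a' z - z ^ m) \<le> norm (a z - z ^ m) + norm (l * b z)"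
        by (metis norm_triangle_ineq)
      ultimately show "norm (a' z - z ^ m) \<le> \<epsilon>" using n by linarith
      have "norm (deriv b z) \<le> norm (deriv \<phi> z) + norm (deriv b z - deriv \<phi> z)" by (metis norm_triangle_sub)
      then have "norm (deriv b z) \<le> M" using M(2)[OF z] n \<epsilon>(1) by simp
      then have "norm (l * deriv b z) \<le> \<epsilon> / 2" by (rule lM)
      moreover have "deriv a' z - deriv (\<lambda>z. z ^ m) z = (deriv a z - deriv (\<lambda>z. z ^ m) z) + l * deriv b z"
        by (simp add: da'[OF z])
      then have "norm (deriv a' z - deriv (\<lambda>z. z ^ m) z) \<le>
          norm (deriv a z - deriv (\<lambda>z. z ^ m) z) + norm (l * deriv b z)"
        by (metis norm_triangle_ineq)
      ultimately show "norm (deriv a' z - deriv (\<lambda>z. z ^ m) z) \<le> \<epsilon>" using n by linarith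
      show "norm (b z - \<phi> z) \<le> \<epsilon>" "norm (deriv b z - deriv \<phi> z) \<le> \<epsilon>" using n \<epsilon>(1) by auto
    qed (rule hol)
    have in4: "z \<in> ball 0 (4 * r)" if "z \<in> cball 0 (3 * r)" for z :: complex using that r by auto
    have same: "a' u = a' t \<and> b u = b t \<longleftrightarrow> a u = a t \<and> b u = b t" for t u by (auto simp: a'_def)
    have sm: "self_meeting a' b = self_meeting a b" by (simp add: self_meeting_def same)
    have nod': "nodal a' b"
      unfolding nodal_def same
    proof (intro conjI ballI impI)
      fix t :: complex assume t: "t \<in> cball 0 (3 * r)"
      have "deriv a t \<noteq> 0 \<or> deriv b t \<noteq> 0" using nod t by (auto simp: nodal_def)
      then show "deriv a' t \<noteq> 0 \<or> deriv b t \<noteq> 0" using da'[OF in4[OF t]] by auto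
      fix u :: complex assume u: "u \<in> cball 0 (3 * r)" "t \<noteq> u \<and> a u = a t \<and> b u = b t"
      have *: "deriv a t * deriv b u \<noteq> deriv a u * deriv b t"
        using nod t u unfolding nodal_def by blast
      have "deriv a' t * deriv b u - deriv a' u * deriv b t = deriv a t * deriv b u - deriv a u * deriv b t"
        using da'[OF in4[OF t]] da'[OF in4[OF u(1)]] by (simp add: algebra_simps)
      then show "deriv a' t * deriv b u \<noteq> deriv a' u * deriv b t" using * by auto
      fix w :: complex assume "w \<in> cball 0 (3 * r)" "a w = a t \<and> b w = b t"
      then show "w = t \<or> w = u" using nod t u unfolding nodal_def by blast
    qed
    have "deriv a' t \<noteq> 0" if t: "t \<in> self_meeting a' b" for t
    proof
      have t3: "t \<in> cball 0 (3 * r)" using t by (auto simp: self_meeting_def)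
      assume "deriv a' t = 0"
      then have 0: "deriv a t + l * deriv b t = 0" using da'[OF in4[OF t3]] by simp
      show False
      proof (cases "deriv b t = 0")
        case True
        then show False using 0 nod t3 by (auto simp: nodal_def)
      next
        case False
        then have "l = - deriv a t / deriv b t" using 0 by (simp add: field_simps add_eq_0_iff)
        then show False using l(2) t sm by (auto simp: bad_def)
      qed
    qed
    then have "card (self_meeting a' b) = double_order" by (rule \<epsilon>(3)[OF near_a' nod'])
    then show ?thesis using fin sm by simp
  qed
  then show ?thesis using that[of "\<epsilon> / 2"] \<epsilon>(1) by simp
qed

end

section \<open>Rational singular homology\<close>

definition rat_of_chain :: "'a chain \<Rightarrow> 'a rat_chain"
  where "rat_of_chain c = Poly_Mapping.map of_int c"

lemma lookup_rat_of_chain [simp]: "Poly_Mapping.lookup (rat_of_chain c) k = of_int (Poly_Mapping.lookup c k)"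
  by (simp add: rat_of_chain_def Poly_Mapping.map.rep_eq when_def)

lemma lookup_rat_scale [simp]: "Poly_Mapping.lookup (rat_scale q c) k = q * Poly_Mapping.lookup c k"
  by (simp add: rat_scale_def Poly_Mapping.map.rep_eq when_def)

lemma keys_rat_of_chain [simp]: "Poly_Mapping.keys (rat_of_chain c) = Poly_Mapping.keys c"
  by (auto simp: in_keys_iff)

lemma inj_rat_of_chain: "rat_of_chain c = rat_of_chain d \<Longrightarrow> c = d"
  by (metis lookup_rat_of_chain of_int_eq_iff poly_mapping_eqI)

lemma rat_of_chain_diff: "rat_of_chain (c - d) = rat_of_chain c - rat_of_chain d"
  by (rule poly_mapping_eqI) (simp add: lookup_minus)

lemma rat_of_chain_cmul: "rat_of_chain (frag_cmul n c) = rat_scale (of_int n) (rat_of_chain c)"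
  by (rule poly_mapping_eqI) simp

lemma rat_of_chain_sum: "rat_of_chain (sum f A) = (\<Sum>x\<in>A. rat_of_chain (f x))"
  by (rule poly_mapping_eqI) (simp add: lookup_sum)

lemma rat_scale_scale: "rat_scale p (rat_scale q c) = rat_scale (p * q) c"
  by (rule poly_mapping_eqI) simp

lemma rat_scale_one: "rat_scale 1 c = c"
  by (rule poly_mapping_eqI) simp

lemma rat_scale_diff: "rat_scale q (c - d) = rat_scale q c - rat_scale q d"
  by (rule poly_mapping_eqI) (simp add: lookup_minus algebra_simps)

lemma rat_scale_sum: "rat_scale q (sum f A) = (\<Sum>x\<in>A. rat_scale q (f x))"
  by (rule poly_mapping_eqI) (simp add: lookup_sum sum_distrib_left)

lemma lookup_rat_boundary:
  assumes "finite K" "Poly_Mapping.keys c \<subseteq> K"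
  shows "Poly_Mapping.lookup (rat_boundary n c) k =
    (\<Sum>\<sigma>\<in>K. Poly_Mapping.lookup c \<sigma> * of_int (Poly_Mapping.lookup (chain_boundary n (frag_of \<sigma>)) k))"
proof -
  have "Poly_Mapping.lookup (rat_boundary n c) k =
    (\<Sum>\<sigma>\<in>Poly_Mapping.keys c. Poly_Mapping.lookup c \<sigma> * of_int (Poly_Mapping.lookup (chain_boundary n (frag_of \<sigma>)) k))"
    by (simp add: rat_boundary_def lookup_sum rat_of_chain_def[symmetric])
  also have "\<dots> = (\<Sum>\<sigma>\<in>K. Poly_Mapping.lookup c \<sigma> * of_int (Poly_Mapping.lookup (chain_boundary n (frag_of \<sigma>)) k))"
    by (rule sum.mono_neutral_left) (use assms in \<open>auto simp: in_keys_iff\<close>)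
  finally show ?thesis .
qed

lemma rat_boundary_diff: "rat_boundary n (c - d) = rat_boundary n c - rat_boundary n d"
proof (rule poly_mapping_eqI)
  fix k
  let ?K = "Poly_Mapping.keys c \<union> Poly_Mapping.keys d"
  have K: "finite ?K" "Poly_Mapping.keys c \<subseteq> ?K" "Poly_Mapping.keys d \<subseteq> ?K" "Poly_Mapping.keys (c - d) \<subseteq> ?K"
    using keys_diff[of c d] by auto
  show "Poly_Mapping.lookup (rat_boundary n (c - d)) k = Poly_Mapping.lookup (rat_boundary n c - rat_boundary n d) k"
    by (simp add: lookup_minus lookup_rat_boundary[OF K(1,2)] lookup_rat_boundary[OF K(1,3)]
      lookup_rat_boundary[OF K(1,4)] left_diff_distrib sum_subtractf)
qed

lemma rat_boundary_scale: "rat_boundary n (rat_scale q c) = rat_scale q (rat_boundary n c)"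
proof (rule poly_mapping_eqI)
  fix k
  have K: "finite (Poly_Mapping.keys c)" "Poly_Mapping.keys (rat_scale q c) \<subseteq> Poly_Mapping.keys c"
    by (auto simp: in_keys_iff)
  show "Poly_Mapping.lookup (rat_boundary n (rat_scale q c)) k = Poly_Mapping.lookup (rat_scale q (rat_boundary n c)) k"
    by (simp add: lookup_rat_boundary[OF K] lookup_rat_boundary[OF K(1) subset_refl] sum_distrib_left mult.assoc)
qed

lemma rat_boundary_of_chain: "rat_boundary n (rat_of_chain c) = rat_of_chain (chain_boundary n c)"
proof (rule poly_mapping_eqI)
  fix k
  have "chain_boundary n c = frag_extend (\<lambda>\<sigma>. chain_boundary n (frag_of \<sigma>)) c"
    by (cases "n = 0") (simp_all add: chain_boundary_def frag_extend_def)
  then have "Poly_Mapping.lookup (chain_boundary n c) k =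
      (\<Sum>\<sigma>\<in>Poly_Mapping.keys c. Poly_Mapping.lookup c \<sigma> * Poly_Mapping.lookup (chain_boundary n (frag_of \<sigma>)) k)"
    by (simp add: frag_extend_def lookup_sum)
  then show "Poly_Mapping.lookup (rat_boundary n (rat_of_chain c)) k = Poly_Mapping.lookup (rat_of_chain (chain_boundary n c)) k"
    by (simp add: lookup_rat_boundary[OF finite_keys subset_refl])
qed

text \<open>The product of the denominators over the finite support suffices. Multiplication by it
  turns rational cycles into integral ones, to which singular homology over the integers
  applies.\<close>

lemma clear_denominators:
  fixes c :: "'a rat_chain"
  obtains N c' where "N > 0" "rat_scale (of_int N) c = rat_of_chain c'"
proof -
  define N where "N = (\<Prod>\<sigma>\<in>Poly_Mapping.keys c. snd (quotient_of (Poly_Mapping.lookup c \<sigma>)))"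
  have pos: "N > 0" unfolding N_def by (intro prod_pos) (auto simp: quotient_of_denom_pos')
  have int: "of_int N * Poly_Mapping.lookup c k \<in> \<int>" for k
  proof (cases "k \<in> Poly_Mapping.keys c")
    case True
    let ?q = "quotient_of (Poly_Mapping.lookup c k)"
    have "snd ?q dvd N" unfolding N_def using True by (intro dvd_prodI) auto
    then obtain M where M: "N = snd ?q * M" by blast
    have "Poly_Mapping.lookup c k = of_int (fst ?q) / of_int (snd ?q)"
      by (rule quotient_of_div) simp
    moreover have "of_int (snd ?q) \<noteq> (0 :: rat)" using quotient_of_denom_pos'[of "Poly_Mapping.lookup c k"] by simp
    ultimately have "of_int N * Poly_Mapping.lookup c k = of_int (M * fst ?q)"
      using M by (simp add: field_simps)
    then show ?thesis by (metis Ints_of_int)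
  next
    case False
    then show ?thesis by (simp add: in_keys_iff)
  qed
  define c' where "c' = Poly_Mapping.map (\<lambda>q. \<lfloor>of_int N * q\<rfloor>) c"
  have "rat_scale (of_int N) c = rat_of_chain c'"
  proof (rule poly_mapping_eqI)
    fix k
    have "Poly_Mapping.lookup c' k = \<lfloor>of_int N * Poly_Mapping.lookup c k\<rfloor>"
      by (simp add: c'_def Poly_Mapping.map.rep_eq when_def)
    then show "Poly_Mapping.lookup (rat_scale (of_int N) c) k = Poly_Mapping.lookup (rat_of_chain c') k"
      using int[of k] by (auto elim!: Ints_cases)
  qed
  then show ?thesis using that pos by blast
qed

text \<open>Functionals of this form that vanish on boundaries detect the independence of homology classes.\<close>

definition rat_functional :: "(((nat \<Rightarrow> real) \<Rightarrow> 'a) \<Rightarrow> complex) \<Rightarrow> 'a rat_chain \<Rightarrow> complex"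
  where "rat_functional \<theta> c = (\<Sum>\<sigma>\<in>Poly_Mapping.keys c. of_rat (Poly_Mapping.lookup c \<sigma>) * \<theta> \<sigma>)"

lemma rat_functional_superset:
  assumes "finite K" "Poly_Mapping.keys c \<subseteq> K"
  shows "rat_functional \<theta> c = (\<Sum>\<sigma>\<in>K. of_rat (Poly_Mapping.lookup c \<sigma>) * \<theta> \<sigma>)"
  unfolding rat_functional_def
  by (rule sum.mono_neutral_left) (use assms in \<open>auto simp: in_keys_iff\<close>)

lemma rat_functional_add: "rat_functional \<theta> (c + d) = rat_functional \<theta> c + rat_functional \<theta> d"
proof -
  let ?K = "Poly_Mapping.keys c \<union> Poly_Mapping.keys d"
  have K: "finite ?K" "Poly_Mapping.keys c \<subseteq> ?K" "Poly_Mapping.keys d \<subseteq> ?K" "Poly_Mapping.keys (c + d) \<subseteq> ?K"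
    using keys_add[of c d] by auto
  show ?thesis
    by (simp add: rat_functional_superset[OF K(1,2)] rat_functional_superset[OF K(1,3)]
      rat_functional_superset[OF K(1,4)] lookup_add of_rat_add distrib_right sum.distrib)
qed

lemma rat_functional_scale: "rat_functional \<theta> (rat_scale q c) = of_rat q * rat_functional \<theta> c"
proof -
  have K: "finite (Poly_Mapping.keys c)" "Poly_Mapping.keys (rat_scale q c) \<subseteq> Poly_Mapping.keys c"
    by (auto simp: in_keys_iff)
  show ?thesis
    by (simp add: rat_functional_superset[OF K] rat_functional_superset[OF K(1) subset_refl]
      sum_distrib_left of_rat_mult mult.assoc)
qed

lemma rat_functional_0 [simp]: "rat_functional \<theta> 0 = 0"
  by (simp add: rat_functional_def)

lemma rat_functional_sum: "rat_functional \<theta> (sum f A) = (\<Sum>x\<in>A. rat_functional \<theta> (f x))"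
  by (induction A rule: infinite_finite_induct) (simp_all add: rat_functional_add)

lemma rat_functional_uminus: "rat_functional \<theta> (- c) = - rat_functional \<theta> c"
  by (metis add.inverse_unique add.right_inverse rat_functional_0 rat_functional_add)

lemma rat_functional_diff: "rat_functional \<theta> (c - d) = rat_functional \<theta> c - rat_functional \<theta> d"
  using rat_functional_add[of \<theta> c "- d"] by (simp add: rat_functional_uminus)

lemma rat_functional_frag_of: "rat_functional \<theta> (rat_of_chain (frag_of \<sigma>)) = \<theta> \<sigma>"
  by (simp add: rat_functional_def)

lemma rat_functional_boundary:
  assumes "\<And>\<tau>. singular_simplex (Suc n) X \<tau> \<Longrightarrow>
      rat_functional \<theta> (rat_of_chain (chain_boundary (Suc n) (frag_of \<tau>))) = 0"
    and "b \<in> rat_boundaries n X"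
  shows "rat_functional \<theta> b = 0"
proof -
  obtain e where e: "e \<in> rat_chains (Suc n) X" "b = rat_boundary (Suc n) e"
    using assms(2) unfolding rat_boundaries_def by blast
  have "b = (\<Sum>\<tau>\<in>Poly_Mapping.keys e. rat_scale (Poly_Mapping.lookup e \<tau>)
       (rat_of_chain (chain_boundary (Suc n) (frag_of \<tau>))))"
    by (simp add: e(2) rat_boundary_def rat_of_chain_def)
  then show ?thesis
    using assms(1) e(1) by (auto simp: rat_functional_sum rat_functional_scale rat_chains_def intro!: sum.neutral)
qed

lemma singular_boundary_imp_rat_boundary:
  assumes "singular_relboundary n X {} b"
  shows "rat_scale q (rat_of_chain b) \<in> rat_boundaries n X"
proof -
  obtain d where d: "singular_chain (Suc n) X d" "chain_boundary (Suc n) d = b"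
    using assms singular_boundary by blast
  have "rat_scale q (rat_of_chain d) \<in> rat_chains (Suc n) X"
    using d(1) by (auto simp: rat_chains_def singular_chain_def in_keys_iff)
  moreover have "rat_boundary (Suc n) (rat_scale q (rat_of_chain d)) = rat_scale q (rat_of_chain b)"
    by (simp add: rat_boundary_scale rat_boundary_of_chain d(2))
  ultimately show ?thesis unfolding rat_boundaries_def by (metis image_eqI)
qed

text \<open>Spanning only has to be known integrally, since denominators can be cleared. Uniqueness
  of the coefficients comes from cochains \<open>\<theta>\<close> dual to the cycles: a coefficient
  is the value of a functional that ignores boundaries.\<close>

lemma rat_homology_dim_criterion:
  fixes \<gamma> :: "'i \<Rightarrow> 'a chain"
  assumes "finite I"
    and cyc: "\<And>i. i \<in> I \<Longrightarrow> singular_relcycle n X {} (\<gamma> i)"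
    and bdry: "\<And>i \<tau>. i \<in> I \<Longrightarrow> singular_simplex (Suc n) X \<tau> \<Longrightarrow>
      rat_functional (\<theta> i) (rat_of_chain (chain_boundary (Suc n) (frag_of \<tau>))) = 0"
    and dual: "\<And>i j. i \<in> I \<Longrightarrow> j \<in> I \<Longrightarrow> rat_functional (\<theta> i) (rat_of_chain (\<gamma> j)) = (if i = j then 1 else 0)"
    and gen: "\<And>z. singular_relcycle n X {} z \<Longrightarrow>
      \<exists>q. homologous_rel n X {} z (\<Sum>i\<in>I. frag_cmul (q i) (\<gamma> i))"
  shows "rat_homology_dim n X (card I)"
proof -
  let ?B = "(\<lambda>i. rat_of_chain (\<gamma> i)) ` I"
  have inj: "inj_on (\<lambda>i. rat_of_chain (\<gamma> i)) I"
    using dual by (intro inj_onI) (metis zero_neq_one)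
  have coeff: "rat_functional (\<theta> i) (\<Sum>b\<in>?B. rat_scale (q b) b) = of_rat (q (rat_of_chain (\<gamma> i)))"
    if "i \<in> I" for i q
  proof -
    have "rat_functional (\<theta> i) (\<Sum>b\<in>?B. rat_scale (q b) b) =
        (\<Sum>j\<in>I. of_rat (q (rat_of_chain (\<gamma> j))) * (if i = j then 1 else 0))"
      by (simp add: rat_functional_sum rat_functional_scale sum.reindex[OF inj] dual[OF that])
    then show ?thesis using that \<open>finite I\<close> by (simp add: if_distrib cong: if_cong)
  qed
  show ?thesis
    unfolding rat_homology_dim_def
  proof (intro exI[of _ ?B] conjI ballI)
    show "finite ?B" "card ?B = card I" using \<open>finite I\<close> inj by (auto simp: card_image)
    show "?B \<subseteq> rat_cycles n X"
    proof clarify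
      fix i assume "i \<in> I"
      then have "Poly_Mapping.keys (\<gamma> i) \<subseteq> singular_simplex_set n X" "chain_boundary n (\<gamma> i) = 0"
        using cyc[of i] by (simp_all add: singular_cycle singular_chain_def)
      moreover have "rat_of_chain 0 = 0" by (rule poly_mapping_eqI) simp
      ultimately show "rat_of_chain (\<gamma> i) \<in> rat_cycles n X"
        by (simp add: rat_cycles_def rat_chains_def rat_boundary_of_chain)
    qed
    fix z assume z: "z \<in> rat_cycles n X"
    obtain N z' where N: "N > 0" "rat_scale (of_int N) z = rat_of_chain z'"
      using clear_denominators by blast
    have "singular_chain n X z'"
    proof -
      have "Poly_Mapping.keys z' \<subseteq> Poly_Mapping.keys z"
        using N(2) by (metis keys_rat_of_chain in_keys_iff lookup_rat_scale mult_zero_right subsetI)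
      then show ?thesis using z by (auto simp: rat_cycles_def rat_chains_def singular_chain_def)
    qed
    moreover have "chain_boundary n z' = 0"
    proof (rule inj_rat_of_chain)
      have "rat_of_chain (chain_boundary n z') = rat_scale (of_int N) (rat_boundary n z)"
        by (metis N(2) rat_boundary_of_chain rat_boundary_scale)
      also have "\<dots> = rat_of_chain 0"
        using z by (intro poly_mapping_eqI) (simp add: rat_cycles_def)
      finally show "rat_of_chain (chain_boundary n z') = rat_of_chain 0" .
    qed
    ultimately have "singular_relcycle n X {} z'" by (simp add: singular_cycle)
    then obtain p where p: "homologous_rel n X {} z' (\<Sum>i\<in>I. frag_cmul (p i) (\<gamma> i))" using gen by blast
    \<comment> \<open>The definition of dimension indexes coefficients by chains, not by
      \<open>I\<close>, and requires the value 0 off the basis. Division by \<open>N\<close> undoes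
      the clearing of denominators.\<close>
    define q where "q = (\<lambda>b. if b \<in> ?B then of_int (p (the_inv_into I (\<lambda>i. rat_of_chain (\<gamma> i)) b)) / of_int N else (0::rat))"
    have q: "q (rat_of_chain (\<gamma> i)) = of_int (p i) / of_int N" if "i \<in> I" for i
      using that by (simp add: q_def the_inv_into_f_f[OF inj])
    have "rat_scale (1 / of_int N) (rat_of_chain (z' - (\<Sum>i\<in>I. frag_cmul (p i) (\<gamma> i)))) \<in> rat_boundaries n X"
      using p unfolding homologous_rel_def by (rule singular_boundary_imp_rat_boundary)
    also have "rat_scale (1 / of_int N) (rat_of_chain (z' - (\<Sum>i\<in>I. frag_cmul (p i) (\<gamma> i)))) =
        z - (\<Sum>i\<in>I. rat_scale (of_int (p i) / of_int N) (rat_of_chain (\<gamma> i)))"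
      using N(1) by (simp add: rat_of_chain_diff rat_of_chain_sum rat_of_chain_cmul rat_scale_diff rat_scale_sum
        rat_scale_scale rat_scale_one flip: N(2))
    also have "(\<Sum>i\<in>I. rat_scale (of_int (p i) / of_int N) (rat_of_chain (\<gamma> i))) = (\<Sum>b\<in>?B. rat_scale (q b) b)"
      by (simp add: sum.reindex[OF inj] q)
    finally have ex: "z - (\<Sum>b\<in>?B. rat_scale (q b) b) \<in> rat_boundaries n X" .
    show "\<exists>!q. (\<forall>b. b \<notin> ?B \<longrightarrow> q b = 0) \<and> z - (\<Sum>b\<in>?B. rat_scale (q b) b) \<in> rat_boundaries n X"
    proof (rule ex1I[of _ q])
      show "(\<forall>b. b \<notin> ?B \<longrightarrow> q b = 0) \<and> z - (\<Sum>b\<in>?B. rat_scale (q b) b) \<in> rat_boundaries n X"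
        using ex by (simp add: q_def)
      fix q' assume q': "(\<forall>b. b \<notin> ?B \<longrightarrow> q' b = 0) \<and> z - (\<Sum>b\<in>?B. rat_scale (q' b) b) \<in> rat_boundaries n X"
      have val: "rat_functional (\<theta> i) z = of_rat (p' (rat_of_chain (\<gamma> i)))"
        if "i \<in> I" and p': "z - (\<Sum>b\<in>?B. rat_scale (p' b) b) \<in> rat_boundaries n X" for i p'
        using rat_functional_boundary[OF bdry[OF \<open>i \<in> I\<close>] p'] coeff[OF \<open>i \<in> I\<close>, of p']
        by (simp add: rat_functional_diff)
      show "q' = q"
      proof
        fix b
        show "q' b = q b"
        proof (cases "b \<in> ?B")
          case True
          then obtain i where i: "i \<in> I" "b = rat_of_chain (\<gamma> i)" by blast
          have "(of_rat (q' b) :: complex) = of_rat (q b)"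
            using val[OF i(1), of q'] val[OF i(1), of q] q' ex i(2) by simp
          then show ?thesis by simp
        next
          case False
          then show ?thesis using q' by (simp add: q_def)
        qed
      qed
    qed
  qed
qed

section \<open>One-dimensional simplices, contractible spaces and winding numbers\<close>

lemma singular_simplex_top_of_set:
  fixes \<sigma> :: "(nat \<Rightarrow> real) \<Rightarrow> 'a::topological_space"
  shows "singular_simplex p (top_of_set S) \<sigma> \<longleftrightarrow> continuous_on (standard_simplex p) \<sigma> \<and>
    \<sigma> ` standard_simplex p \<subseteq> S \<and> \<sigma> \<in> extensional (standard_simplex p)"
  unfolding singular_simplex_def euclidean_product_topology
  by (auto simp: continuous_map_in_subtopology)

definition vertex :: "nat \<Rightarrow> nat \<Rightarrow> real"
  where "vertex k = (\<lambda>j. if j = k then 1 else 0)"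

definition point_simplex :: "'a \<Rightarrow> (nat \<Rightarrow> real) \<Rightarrow> 'a"
  where "point_simplex a = restrict (\<lambda>_. a) (standard_simplex 0)"

definition path_simplex :: "(real \<Rightarrow> 'a) \<Rightarrow> (nat \<Rightarrow> real) \<Rightarrow> 'a"
  where "path_simplex p = restrict (\<lambda>v. p (v 1)) (standard_simplex 1)"

definition edge :: "real \<Rightarrow> nat \<Rightarrow> real"
  where "edge s = (\<lambda>i. if i = 0 then 1 - s else if i = 1 then s else 0)"

lemma vertex_in_simplex: "k \<le> p \<Longrightarrow> vertex k \<in> standard_simplex p"
  by (auto simp: vertex_def standard_simplex_def)

lemma edge_in_simplex: "s \<in> {0..1} \<Longrightarrow> edge s \<in> standard_simplex 1"
  by (auto simp: edge_def standard_simplex_def)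

lemma simplex_1_coordinate: "v \<in> standard_simplex 1 \<Longrightarrow> v 1 \<in> {0..1}"
  by (auto simp: standard_simplex_def)

text \<open>Face \<open>k\<close> omits vertex \<open>k\<close>, which explains the crossed
  indices.\<close>

lemma singular_face_1:
  "singular_face 1 0 \<sigma> = point_simplex (\<sigma> (vertex 1))" "singular_face 1 1 \<sigma> = point_simplex (\<sigma> (vertex 0))"
proof -
  have "simplical_face 0 x = vertex 1" "simplical_face 1 x = vertex 0" if "x \<in> standard_simplex 0" for x
    using that by (auto simp: standard_simplex_0 simplical_face_def vertex_def fun_eq_iff)
  then show "singular_face 1 0 \<sigma> = point_simplex (\<sigma> (vertex 1))" "singular_face 1 1 \<sigma> = point_simplex (\<sigma> (vertex 0))"
    by (auto simp: singular_face_def point_simplex_def)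
qed

lemma chain_boundary_1:
  "chain_boundary 1 (frag_of \<sigma>) = frag_of (point_simplex (\<sigma> (vertex 1))) - frag_of (point_simplex (\<sigma> (vertex 0)))"
  using singular_face_1[of \<sigma>] by (simp add: chain_boundary_of)

lemma path_simplex_ends: "path_simplex p (vertex 1) = p 1" "path_simplex p (vertex 0) = p 0"
  using vertex_in_simplex[of 0 1] vertex_in_simplex[of 1 1] by (auto simp: path_simplex_def vertex_def)

lemma singular_path_simplex:
  fixes p :: "real \<Rightarrow> 'a::topological_space"
  assumes "continuous_on {0..1} p" "p ` {0..1} \<subseteq> S"
  shows "singular_simplex 1 (top_of_set S) (path_simplex p)"
proof -
  have "continuous_on (standard_simplex 1) (\<lambda>v. p (v 1))"
    by (rule continuous_on_compose2[OF assms(1) continuous_on_subset[OF continuous_on_product_coordinates]])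
      (auto dest: simplex_1_coordinate simp del: One_nat_def)
  then show ?thesis
    using assms(2) simplex_1_coordinate unfolding singular_simplex_top_of_set path_simplex_def
    by (auto simp: image_subset_iff cong: continuous_on_cong)
qed

lemma simplex_map_apply: "v \<in> standard_simplex p \<Longrightarrow> simplex_map p h \<sigma> v = h (\<sigma> v)"
  by (simp add: simplex_map_def)

text \<open>The identity is homotopic to a constant map, which factors through a one-point space,
  where every cycle of positive degree bounds.\<close>

lemma contractible_cycle_bounds:
  assumes S: "contractible_space S" and p: "p \<ge> 1" and c: "singular_relcycle p S {} c"
  shows "singular_relboundary p S {} c"
proof -
  obtain a where hom: "homotopic_with (\<lambda>x. True) S S id (\<lambda>x. a)"
    using S unfolding contractible_space_def by blast
  then have "homotopic_with (\<lambda>h. h \<in> {} \<rightarrow> {}) S S id (\<lambda>x. a)"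
    by (auto simp: homotopic_with_mono)
  then have "homologous_rel p S {} (chain_map p id c) (chain_map p (\<lambda>x. a) c)"
    using homotopic_imp_homologous_rel_chain_maps c by blast
  moreover have "chain_map p id c = c"
    using c by (intro chain_map_id_gen[of p S]) (auto simp: singular_cycle)
  moreover have "singular_relboundary p S {} (chain_map p (\<lambda>x. a) c)"
  proof (cases "topspace S = {}")
    \<comment> \<open>In the empty space the constant \<open>a\<close> is not a point of
      \<open>S\<close>, but the only chain is 0.\<close>
    case True
    then show ?thesis using c by (simp add: singular_cycle singular_chain_empty)
  next
    case False
    have cm: "continuous_map S S (\<lambda>x. a)" using hom homotopic_with_imp_continuous_maps by blast
    then have a: "a \<in> topspace S" using False by (auto simp: continuous_map_def)
    have "continuous_map S (subtopology S {a}) (\<lambda>x. a)"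
      using cm by (auto simp: continuous_map_in_subtopology)
    then have cyc: "singular_relcycle p (subtopology S {a}) {} (chain_map p (\<lambda>x. a) c)"
      using singular_relcycle_chain_map[OF c] by blast
    have tp: "topspace (subtopology S {a}) = {a}" using a by auto
    have "singular_relboundary p (subtopology S {a}) {} (chain_map p (\<lambda>x. a) c)"
      by (rule iffD2[OF singular_boundary_eq_cycle_singleton[OF tp p] cyc])
    then have "singular_relboundary p (subtopology S (topspace S)) {} (chain_map p (\<lambda>x. a) c)"
      by (rule singular_boundary_mono[rotated]) (use a in auto)
    then show ?thesis by simp
  qed
  ultimately show ?thesis
    unfolding homologous_rel_def using singular_relboundary_add[of p S "{}" "c - chain_map p (\<lambda>x. a) c"] by fastforce
qed

lemma homologous_rel_cmul:
  assumes "homologous_rel p X S a b"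
  shows "homologous_rel p X S (frag_cmul k a) (frag_cmul k b)"
proof -
  have "frag_cmul k a - frag_cmul k b = frag_cmul k (a - b)"
    by (rule poly_mapping_eqI) (simp add: lookup_minus algebra_simps)
  then show ?thesis
    using assms singular_relboundary_cmul[of p X S "a - b" k] by (simp add: homologous_rel_def)
qed

lemma homologous_rel_finite_sum:
  assumes "finite I" "\<And>i. i \<in> I \<Longrightarrow> homologous_rel p X S (f i) (h i)"
  shows "homologous_rel p X S (sum f I) (sum h I)"
  using assms by (induction I rule: finite_induct) (auto intro: homologous_rel_add)

text \<open>For a path that is not closed this is the change of a logarithm of \<open>\<phi>\<close>
  along the path divided by \<open>2 * pi * \<i>\<close>, hence a complex number and in general not
  an integer.\<close>

definition winding_cochain :: "('a \<Rightarrow> complex) \<Rightarrow> ((nat \<Rightarrow> real) \<Rightarrow> 'a) \<Rightarrow> complex"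
  where "winding_cochain \<phi> \<sigma> = winding_number (\<lambda>s. \<phi> (\<sigma> (edge s))) 0"

text \<open>A logarithm of \<open>\<phi>\<close> exists on the whole triangle because the triangle
  is convex. Its differences along the three edges cancel.\<close>

lemma winding_cochain_boundary:
  fixes \<phi> :: "'a::topological_space \<Rightarrow> complex"
  assumes \<phi>: "continuous_on X \<phi>" "\<And>x. x \<in> X \<Longrightarrow> \<phi> x \<noteq> 0"
    and \<tau>: "singular_simplex (Suc 1) (top_of_set X) \<tau>"
  shows "rat_functional (winding_cochain \<phi>) (rat_of_chain (chain_boundary (Suc 1) (frag_of \<tau>))) = 0"
proof -
  \<comment> \<open>Barycentric coordinates carry a plane triangle onto the standard simplex of
    functions, so the existence of logarithms can be used in the plane.\<close>
  define tri :: "real \<times> real \<Rightarrow> nat \<Rightarrow> real" where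
    "tri = (\<lambda>(x, y) i. if i = 0 then 1 - x - y else if i = 1 then x else if i = 2 then y else 0)"
  define T where "T = {z :: real \<times> real. 0 \<le> fst z \<and> 0 \<le> snd z \<and> fst z + snd z \<le> 1}"
  have tri_in: "tri z \<in> standard_simplex 2" if "z \<in> T" for z
    using that by (auto simp: T_def tri_def standard_simplex_def numeral_2_eq_2 case_prod_unfold)
  have cT: "convex T"
  proof -
    have "T = {z. inner (-1, 0) z \<le> 0} \<inter> {z. inner (0, -1) z \<le> 0} \<inter> {z. inner (1, 1) z \<le> 1}"
      by (auto simp: T_def inner_prod_def)
    then show ?thesis by (simp only: convex_Int convex_halfspace_le)
  qed
  have ctri: "continuous_on T tri"
  proof (rule continuous_on_coordinatewise_then_product)
    fix i show "continuous_on T (\<lambda>z. tri z i)"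
      unfolding tri_def case_prod_unfold by (cases "i = 0"; cases "i = 1"; cases "i = 2") (auto intro!: continuous_intros)
  qed
  have c\<tau>: "continuous_on (standard_simplex 2) \<tau>" "\<tau> ` standard_simplex 2 \<subseteq> X"
    using \<tau> by (auto simp: singular_simplex_top_of_set numeral_2_eq_2)
  have cf: "continuous_on T (\<lambda>z. \<phi> (\<tau> (tri z)))"
    by (rule continuous_on_compose2[OF \<phi>(1) continuous_on_compose2[OF c\<tau>(1) ctri]])
      (use tri_in c\<tau>(2) in auto)
  have nz: "\<phi> (\<tau> (tri z)) \<noteq> 0" if "z \<in> T" for z
    using \<phi>(2) c\<tau>(2) tri_in[OF that] by blast
  obtain L where L: "continuous_on T L" "\<And>z. z \<in> T \<Longrightarrow> \<phi> (\<tau> (tri z)) = exp (L z)"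
    using continuous_logarithm_on_contractible[OF cf convex_imp_contractible[OF cT] nz] by blast
  have face: "winding_cochain \<phi> (singular_face 2 k \<tau>) = (L (e 1) - L (e 0)) / (2 * of_real pi * \<i>)"
    if e: "\<And>s. s \<in> {0..1} \<Longrightarrow> simplical_face k (edge s) = tri (e s)" "\<And>s. s \<in> {0..1} \<Longrightarrow> e s \<in> T"
      and ce: "continuous_on {0..1} e" for k e
  proof -
    have "winding_cochain \<phi> (singular_face 2 k \<tau>) = winding_number (exp \<circ> (L \<circ> e)) 0"
      unfolding winding_cochain_def
    proof (rule winding_number_cong)
      fix s :: real assume s: "0 \<le> s" "s \<le> 1"
      then have "singular_face 2 k \<tau> (edge s) = \<tau> (tri (e s))"
        using edge_in_simplex[of s] e(1)[of s] by (simp add: singular_face_def)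
      then show "\<phi> (singular_face 2 k \<tau> (edge s)) = (exp \<circ> (L \<circ> e)) s"
        using L(2) e(2)[of s] s by simp
    qed
    also have "\<dots> = (pathfinish (L \<circ> e) - pathstart (L \<circ> e)) / (2 * of_real pi * \<i>)"
    proof (rule winding_number_compose_exp)
      show "path (L \<circ> e)" unfolding path_def comp_def
        by (rule continuous_on_compose2[OF L(1) ce]) (use e(2) in auto)
    qed
    finally show ?thesis by (simp add: pathfinish_def pathstart_def)
  qed
  have f0: "winding_cochain \<phi> (singular_face 2 0 \<tau>) = (L (0, 1) - L (1, 0)) / (2 * of_real pi * \<i>)"
    by (subst face[where e = "\<lambda>s. (1 - s, s)"])
      (auto simp: simplical_face_def edge_def tri_def T_def fun_eq_iff intro!: continuous_intros)
  have f1: "winding_cochain \<phi> (singular_face 2 1 \<tau>) = (L (0, 1) - L (0, 0)) / (2 * of_real pi * \<i>)"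
    by (subst face[where e = "\<lambda>s. (0, s)"])
      (auto simp: simplical_face_def edge_def tri_def T_def fun_eq_iff intro!: continuous_intros)
  have f2: "winding_cochain \<phi> (singular_face 2 2 \<tau>) = (L (1, 0) - L (0, 0)) / (2 * of_real pi * \<i>)"
    by (subst face[where e = "\<lambda>s. (s, 0)"])
      (auto simp: simplical_face_def edge_def tri_def T_def fun_eq_iff intro!: continuous_intros)
  have "chain_boundary 2 (frag_of \<tau>) = frag_of (singular_face 2 0 \<tau>) - frag_of (singular_face 2 1 \<tau>) + frag_of (singular_face 2 2 \<tau>)"
    by (simp add: chain_boundary_of numeral_2_eq_2)
  moreover have "rat_of_chain (a - b + c) = rat_of_chain a - rat_of_chain b + rat_of_chain c" for a b c :: "'a chain"
    by (rule poly_mapping_eqI) (simp add: lookup_minus lookup_add)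
  ultimately have "rat_functional (winding_cochain \<phi>) (rat_of_chain (chain_boundary 2 (frag_of \<tau>))) =
      winding_cochain \<phi> (singular_face 2 0 \<tau>) - winding_cochain \<phi> (singular_face 2 1 \<tau>) + winding_cochain \<phi> (singular_face 2 2 \<tau>)"
    by (simp add: rat_functional_add rat_functional_diff rat_functional_frag_of)
  also have "\<dots> = 0" by (simp only: f0 f1 f2) (simp add: diff_divide_distrib)
  finally show ?thesis by (simp add: numeral_2_eq_2)
qed

text \<open>
  Since \<open>g\<close> is closed onto its image, \<open>g ` D\<close> is the quotient of the star-shaped set \<open>D\<close> in which
  every pair \<open>l y, u y\<close> is glued to one point \<open>y\<close>.
\<close>

locale glued_disc =
  fixes D :: "complex set" and g :: "complex \<Rightarrow> 'b::euclidean_space"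
    and P :: "'b set" and l u :: "'b \<Rightarrow> complex"
  assumes D: "open D" "0 \<in> D" "\<And>x. x \<in> D \<Longrightarrow> closed_segment 0 x \<subseteq> D"
    and cont: "continuous_on D g"
    and closed_map: "\<And>C. closedin (top_of_set D) C \<Longrightarrow> closedin (top_of_set (g ` D)) (g ` C)"
    and finite_P: "finite P"
    and pairs: "\<And>y. y \<in> P \<Longrightarrow> l y \<in> D \<and> u y \<in> D \<and> l y \<noteq> u y \<and> g (l y) = y \<and> g (u y) = y"
    and fibres: "\<And>x x'. x \<in> D \<Longrightarrow> x' \<in> D \<Longrightarrow> g x = g x' \<Longrightarrow> x \<noteq> x' \<Longrightarrow>
      g x \<in> P \<and> {x, x'} = {l (g x), u (g x)}"
begin

section \<open>Lifts, rays and loops in a glued disc\<close>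

abbreviation X :: "'b set" where "X \<equiv> g ` D"

text \<open>At a glued point the choice of \<open>l y\<close> is arbitrary but fixed, so endpoint
  terms are well defined; continuity can be expected only off \<open>P\<close>.\<close>

definition lift :: "'b \<Rightarrow> complex"
  where "lift y = (if y \<in> P then l y else SOME x. x \<in> D \<and> g x = y)"

lemma lift: "y \<in> X \<Longrightarrow> lift y \<in> D \<and> g (lift y) = y"
proof (cases "y \<in> P")
  case False
  assume "y \<in> X"
  then have "\<exists>x. x \<in> D \<and> g x = y" by blast
  then show ?thesis using False someI_ex[of "\<lambda>x. x \<in> D \<and> g x = y"] by (simp add: lift_def)
qed (use pairs in \<open>auto simp: lift_def\<close>)

lemma P_subset: "P \<subseteq> X" using pairs by force

lemma fibre_cases: "x \<in> D \<Longrightarrow> g x = y \<Longrightarrow> y \<in> P \<Longrightarrow> x = l y \<or> x = u y"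
  using fibres[of x "l y"] pairs[of y] by (cases "x = l y") (auto simp: doubleton_eq_iff)

lemma lift_unique: "x \<in> D \<Longrightarrow> g x \<notin> P \<Longrightarrow> lift (g x) = x"
  using lift[of "g x"] fibres[of "lift (g x)" x] by force

text \<open>A closed continuous surjection is a quotient map.\<close>

lemma continuous_descends:
  fixes h :: "'b \<Rightarrow> 'c::topological_space"
  assumes "continuous_on D (\<lambda>x. h (g x))"
  shows "continuous_on X h"
  unfolding continuous_closedin_preimage_eq
proof (intro allI impI)
  fix T :: "'c set" assume "closed T"
  then have "closedin (top_of_set D) (D \<inter> (\<lambda>x. h (g x)) -` T)"
    using assms by (auto simp: continuous_closedin_preimage_eq)
  then have "closedin (top_of_set X) (g ` (D \<inter> (\<lambda>x. h (g x)) -` T))" by (rule closed_map)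
  also have "g ` (D \<inter> (\<lambda>x. h (g x)) -` T) = X \<inter> h -` T" by auto
  finally show "closedin (top_of_set X) (X \<inter> h -` T)" .
qed

lemma continuous_lift: "continuous_on (X - P) lift"
  unfolding continuous_closedin_preimage_eq
proof (intro allI impI)
  fix T :: "complex set" assume "closed T"
  then have "closedin (top_of_set D) (D \<inter> T)" by (simp add: closedin_closed_Int)
  then have "closedin (top_of_set X) (g ` (D \<inter> T))" by (rule closed_map)
  then obtain K where K: "closed K" "g ` (D \<inter> T) = X \<inter> K"
    by (auto simp: closedin_closed)
  then have "closedin (top_of_set (X - P)) ((X - P) \<inter> K)"
    by (simp add: closedin_closed_Int)
  also have "(X - P) \<inter> K = (X - P) \<inter> g ` (D \<inter> T)" using K(2) by blast
  also have "(X - P) \<inter> g ` (D \<inter> T) = (X - P) \<inter> lift -` T"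
    using lift lift_unique by auto
  finally show "closedin (top_of_set (X - P)) ((X - P) \<inter> lift -` T)" .
qed

text \<open>Straight paths from the base point 0, available because \<open>D\<close> is star-shaped.
  They reduce any 1-simplex to its endpoints.\<close>

definition ray :: "complex \<Rightarrow> (nat \<Rightarrow> real) \<Rightarrow> complex"
  where "ray d = path_simplex (\<lambda>s. s *\<^sub>R d)"

definition ray_image :: "complex \<Rightarrow> 'b chain"
  where "ray_image d = frag_of (simplex_map 1 g (ray d))"

lemma singular_ray: "d \<in> D \<Longrightarrow> singular_simplex 1 (top_of_set D) (ray d)"
  unfolding ray_def
proof (rule singular_path_simplex)
  assume "d \<in> D"
  have "s *\<^sub>R d \<in> closed_segment 0 d" if "s \<in> {0..1}" for s
    using that by (auto simp: closed_segment_def)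
  then show "(\<lambda>s. s *\<^sub>R d) ` {0..1} \<subseteq> D" using D(3)[OF \<open>d \<in> D\<close>] by blast
qed (intro continuous_intros)

lemma ray_ends: "ray d (vertex 1) = d" "ray d (vertex 0) = 0"
  by (simp_all add: ray_def path_simplex_ends del: One_nat_def)

lemma continuous_map_g: "continuous_map (top_of_set D) (top_of_set X) g"
  using cont by (auto simp: continuous_map_in_subtopology)

lemma singular_chain_g: "singular_simplex 1 (top_of_set D) \<sigma> \<Longrightarrow> singular_chain 1 (top_of_set X) (frag_of (simplex_map 1 g \<sigma>))"
  by (simp add: singular_chain_of singular_simplex_simplex_map[OF _ continuous_map_g] del: One_nat_def)

lemma contractible_D: "contractible D"
  by (rule starlike_imp_contractible) (use D in \<open>auto simp: starlike_def\<close>)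

text \<open>Upstairs, the simplex together with the rays to its ends is a cycle in the contractible
  set \<open>D\<close>; its filling is mapped down by \<open>g\<close>.\<close>

lemma image_homologous_rays:
  assumes \<sigma>: "singular_simplex 1 (top_of_set D) \<sigma>"
  shows "homologous_rel 1 (top_of_set X) {} (frag_of (simplex_map 1 g \<sigma>))
    (ray_image (\<sigma> (vertex 1)) - ray_image (\<sigma> (vertex 0)))"
proof -
  have ends: "\<sigma> (vertex 1) \<in> D" "\<sigma> (vertex 0) \<in> D"
    using \<sigma> vertex_in_simplex[of 0 1] vertex_in_simplex[of 1 1]
    by (simp_all add: singular_simplex_top_of_set image_subset_iff)
  define c where "c = frag_of \<sigma> - (frag_of (ray (\<sigma> (vertex 1))) - frag_of (ray (\<sigma> (vertex 0))))"
  have "singular_chain 1 (top_of_set D) c"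
    unfolding c_def using \<sigma> singular_ray[OF ends(1)] singular_ray[OF ends(2)]
    by (intro singular_chain_diff) (auto simp: singular_chain_of)
  moreover have "chain_boundary 1 c = 0"
    unfolding c_def chain_boundary_diff chain_boundary_1 by (simp only: ray_ends) simp
  ultimately have "singular_relcycle 1 (top_of_set D) {} c" by (simp add: singular_cycle)
  then have "singular_relboundary 1 (top_of_set D) {} c"
    by (intro contractible_cycle_bounds) (simp_all add: contractible_D)
  then have "singular_relboundary 1 (top_of_set X) {} (chain_map 1 g c)"
    by (rule singular_relboundary_chain_map[OF _ continuous_map_g]) auto
  then show ?thesis by (simp add: homologous_rel_def c_def ray_image_def chain_map_diff del: One_nat_def)
qed

definition loop :: "'b \<Rightarrow> 'b chain"
  where "loop y = ray_image (u y) - ray_image (l y)"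

lemma loop_cycle:
  assumes "y \<in> P"
  shows "singular_relcycle 1 (top_of_set X) {} (loop y)"
proof -
  have "singular_chain 1 (top_of_set X) (loop y)"
    unfolding loop_def ray_image_def using pairs[OF assms]
    by (intro singular_chain_diff singular_chain_g singular_ray) auto
  moreover have e: "simplex_map 1 g (ray d) (vertex 1) = g d" "simplex_map 1 g (ray d) (vertex 0) = g 0" for d
    using vertex_in_simplex[of 0 1] vertex_in_simplex[of 1 1] ray_ends[of d] by (simp_all add: simplex_map_apply)
  have "chain_boundary 1 (loop y) = 0"
    unfolding loop_def ray_image_def chain_boundary_diff chain_boundary_1 e using pairs[OF assms] by simp
  ultimately show ?thesis by (simp add: singular_cycle)
qed

text \<open>Off the glued points \<open>lift\<close> is continuous, so the simplex comes from
  \<open>D\<close>.\<close>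

lemma away_from_P:
  assumes \<sigma>: "singular_simplex 1 (top_of_set X) \<sigma>" "\<sigma> ` standard_simplex 1 \<subseteq> X - P"
  shows "homologous_rel 1 (top_of_set X) {} (frag_of \<sigma>)
    (ray_image (lift (\<sigma> (vertex 1))) - ray_image (lift (\<sigma> (vertex 0))))"
proof -
  define \<sigma>' where "\<sigma>' = restrict (\<lambda>v. lift (\<sigma> v)) (standard_simplex 1)"
  have c: "continuous_on (standard_simplex 1) \<sigma>" "\<sigma> \<in> extensional (standard_simplex 1)"
    using \<sigma>(1) by (auto simp: singular_simplex_top_of_set)
  have "continuous_on (standard_simplex 1) (\<lambda>v. lift (\<sigma> v))"
    by (rule continuous_on_compose2[OF continuous_lift c(1) \<sigma>(2)])
  then have "continuous_on (standard_simplex 1) \<sigma>'"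
    by (simp add: \<sigma>'_def cong: continuous_on_cong)
  moreover have "\<sigma>' ` standard_simplex 1 \<subseteq> D" using lift \<sigma>(2) by (auto simp: \<sigma>'_def)
  ultimately have s: "singular_simplex 1 (top_of_set D) \<sigma>'"
    by (simp add: singular_simplex_top_of_set \<sigma>'_def)
  have "simplex_map 1 g \<sigma>' v = \<sigma> v" for v
  proof (cases "v \<in> standard_simplex 1")
    case True
    then have "\<sigma> v \<in> X" using \<sigma>(2) by blast
    then show ?thesis using True lift by (simp add: simplex_map_def \<sigma>'_def)
  next
    case False
    then show ?thesis using c(2) by (simp add: simplex_map_def extensional_def)
  qed
  then have "simplex_map 1 g \<sigma>' = \<sigma>" by blast
  moreover have "\<sigma>' (vertex 1) = lift (\<sigma> (vertex 1))" "\<sigma>' (vertex 0) = lift (\<sigma> (vertex 0))"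
    using vertex_in_simplex[of 0 1] vertex_in_simplex[of 1 1] by (auto simp: \<sigma>'_def)
  ultimately show ?thesis using image_homologous_rays[OF s] by simp
qed

end

context glued_disc
begin

text \<open>A bump at \<open>u y\<close>; since it takes integer values at all identified points, its exponential descends.\<close>

definition bump_radius :: "'b \<Rightarrow> real"
  where "bump_radius y = (SOME d. d > 0 \<and> (\<forall>w\<in>l ` P \<union> u ` P. w \<noteq> u y \<longrightarrow> d \<le> dist (u y) w))"

definition bump :: "'b \<Rightarrow> complex \<Rightarrow> real"
  where "bump y x = max 0 (1 - dist (u y) x / bump_radius y)"

definition circle_map :: "'b \<Rightarrow> 'b \<Rightarrow> complex"
  where "circle_map y x = exp (2 * of_real pi * \<i> * of_real (bump y (lift x)))"

lemma bump_radius: "bump_radius y > 0 \<and> (\<forall>w\<in>l ` P \<union> u ` P. w \<noteq> u y \<longrightarrow> bump_radius y \<le> dist (u y) w)"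
  unfolding bump_radius_def
  by (rule someI_ex) (rule finite_set_avoid, use finite_P in auto)

lemma bump_special:
  assumes "w \<in> l ` P \<union> u ` P"
  shows "bump y w = (if w = u y then 1 else 0)"
  using bump_radius[of y] assms by (auto simp: bump_def max_def divide_simps)

text \<open>The chosen lift may differ from \<open>x\<close> only over a glued point. There the bump
  is 0 or 1 at both preimages, and the exponential cannot tell them apart.\<close>

lemma circle_map_g:
  assumes "x \<in> D"
  shows "circle_map y (g x) = exp (2 * of_real pi * \<i> * of_real (bump y x))"
proof (cases "g x \<in> P")
  case False
  then show ?thesis using lift_unique[OF assms] by (simp add: circle_map_def)
next
  case True
  have e: "exp (2 * of_real pi * \<i> * of_real (bump y w)) = 1" if "w \<in> l ` P \<union> u ` P" for w
    using bump_special[OF that, of y] by (simp add: exp_eq_1)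
  have "lift (g x) \<in> l ` P \<union> u ` P" using True by (simp add: lift_def)
  moreover have "x \<in> l ` P \<union> u ` P" using fibre_cases[OF assms refl True] True by auto
  ultimately show ?thesis unfolding circle_map_def by (simp only: e)
qed

lemma continuous_circle_map: "continuous_on X (circle_map y)"
proof (rule continuous_descends)
  have "continuous_on D (\<lambda>x. exp (2 * of_real pi * \<i> * of_real (bump y x)))"
    unfolding bump_def using bump_radius[of y] by (intro continuous_intros) auto
  then show "continuous_on D (\<lambda>x. circle_map y (g x))"
    by (simp add: circle_map_g cong: continuous_on_cong)
qed

text \<open>Along a ray the logarithm is explicit, namely the bump itself up to
  \<open>2 * pi * \<i>\<close>. The contribution of the base point 0 cancels in loops.\<close>

lemma winding_ray:
  assumes "d \<in> D"
  shows "winding_cochain (circle_map y) (simplex_map 1 g (ray d)) = of_real (bump y d) - of_real (bump y 0)"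
proof -
  let ?L = "\<lambda>s::real. 2 * of_real pi * \<i> * complex_of_real (bump y (s *\<^sub>R d))"
  have "winding_cochain (circle_map y) (simplex_map 1 g (ray d)) = winding_number (exp \<circ> ?L) 0"
    unfolding winding_cochain_def
  proof (rule winding_number_cong)
    fix s :: real assume s: "0 \<le> s" "s \<le> 1"
    have "edge s \<in> standard_simplex 1" using edge_in_simplex s by simp
    then have "simplex_map 1 g (ray d) (edge s) = g (s *\<^sub>R d)"
      by (simp add: simplex_map_def ray_def path_simplex_def edge_def del: One_nat_def)
    moreover have "s *\<^sub>R d \<in> D" using D(3)[OF assms] s by (auto simp: closed_segment_def)
    ultimately show "circle_map y (simplex_map 1 g (ray d) (edge s)) = (exp \<circ> ?L) s"
      by (simp add: circle_map_g)
  qed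
  also have "\<dots> = (pathfinish ?L - pathstart ?L) / (2 * of_real pi * \<i>)"
  proof (rule winding_number_compose_exp)
    show "path ?L"
      unfolding path_def bump_def using bump_radius[of y] by (intro continuous_intros) auto
  qed
  also have "\<dots> = of_real (bump y d) - of_real (bump y 0)"
    by (simp add: pathfinish_def pathstart_def field_simps)
  finally show ?thesis .
qed

lemma winding_loop:
  assumes "y \<in> P" "y' \<in> P"
  shows "rat_functional (winding_cochain (circle_map y)) (rat_of_chain (loop y')) = (if y = y' then 1 else 0)"
proof -
  have "bump y (u y') = (if y = y' then 1 else 0)"
    using bump_special[of "u y'" y] assms pairs[of y] pairs[of y'] by auto
  moreover have "bump y (l y') = 0"
    using bump_special[of "l y'" y] assms pairs[of y] pairs[of y'] by auto
  ultimately show ?thesis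
    using pairs[OF assms(2)] unfolding loop_def ray_image_def
    by (simp add: rat_of_chain_diff rat_functional_diff rat_functional_frag_of winding_ray del: One_nat_def)
qed

section \<open>Neighbourhoods of the nodes and generation by loops\<close>

lemma node_radius:
  assumes y: "y \<in> P"
  obtains e where "e > 0" "cball (l y) e \<subseteq> D" "cball (u y) e \<subseteq> D" "cball (l y) e \<inter> cball (u y) e = {}"
    "\<And>x. x \<in> cball (l y) e \<union> cball (u y) e \<Longrightarrow> g x \<in> P \<Longrightarrow> x = l y \<or> x = u y"
proof -
  note p = pairs[OF y]
  obtain e1 where e1: "e1 > 0" "cball (l y) e1 \<subseteq> D" using p D(1) open_contains_cball by blast
  obtain e2 where e2: "e2 > 0" "cball (u y) e2 \<subseteq> D" using p D(1) open_contains_cball by blast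
  let ?Q = "l ` P \<union> u ` P"
  have fin: "finite ?Q" using finite_P by simp
  obtain e3 where e3: "e3 > 0" "\<And>w. w \<in> ?Q \<Longrightarrow> w \<noteq> l y \<Longrightarrow> e3 \<le> dist (l y) w"
    using finite_set_avoid[OF fin, of "l y"] by blast
  obtain e4 where e4: "e4 > 0" "\<And>w. w \<in> ?Q \<Longrightarrow> w \<noteq> u y \<Longrightarrow> e4 \<le> dist (u y) w"
    using finite_set_avoid[OF fin, of "u y"] by blast
  \<comment> \<open>A third of each separation keeps the two discs disjoint and free of the other
    glued parameters.\<close>
  define e where "e = Min {e1, e2, e3 / 3, e4 / 3}"
  have e: "e > 0" "e \<le> e1" "e \<le> e2" "e \<le> e3 / 3" "e \<le> e4 / 3"
    using e1(1) e2(1) e3(1) e4(1) by (auto simp: e_def)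
  show ?thesis
  proof (rule that[OF e(1)])
    show "cball (l y) e \<subseteq> D" "cball (u y) e \<subseteq> D" using e1(2) e2(2) e by (auto simp: subset_iff)
    have "e3 \<le> dist (l y) (u y)" using e3(2)[of "u y"] y p by auto
    then have d: "3 * e \<le> dist (l y) (u y)" using e by simp
    have "e4 \<le> dist (u y) (l y)" using e4(2)[of "l y"] y p by auto
    show "cball (l y) e \<inter> cball (u y) e = {}"
    proof (rule ccontr)
      assume "cball (l y) e \<inter> cball (u y) e \<noteq> {}"
      then obtain x where "x \<in> cball (l y) e" "x \<in> cball (u y) e" by blast
      then have "dist (l y) (u y) \<le> 2 * e"
        using dist_triangle[of "l y" "u y" x] by (simp add: dist_commute)
      then show False using d e(1) by simp
    qed
    fix x assume x: "x \<in> cball (l y) e \<union> cball (u y) e" and gx: "g x \<in> P"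
    have "x \<in> D" using x e1(2) e2(2) e by (auto simp: subset_iff)
    then have q: "x \<in> ?Q" using fibre_cases[OF _ refl gx] gx by auto
    show "x = l y \<or> x = u y"
    proof (rule ccontr)
      assume "\<not> (x = l y \<or> x = u y)"
      then have "e3 \<le> dist (l y) x" "e4 \<le> dist (u y) x" using e3(2) e4(2) q by auto
      then show False using x e e3(1) e4(1) by auto
    qed
  qed
qed

definition node_nbhd :: "'b \<Rightarrow> real \<Rightarrow> 'b set"
  where "node_nbhd y e = g ` (cball (l y) e \<union> cball (u y) e)"

definition good_radius :: "'b \<Rightarrow> real \<Rightarrow> bool"
  where "good_radius y e \<longleftrightarrow> e > 0 \<and> cball (l y) e \<subseteq> D \<and> cball (u y) e \<subseteq> D \<and>
    cball (l y) e \<inter> cball (u y) e = {} \<and>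
    (\<forall>x\<in>cball (l y) e \<union> cball (u y) e. g x \<in> P \<longrightarrow> x = l y \<or> x = u y)"

lemma ex_good_radius: "y \<in> P \<Longrightarrow> \<exists>e. good_radius y e"
  unfolding good_radius_def using node_radius[of y] by metis

text \<open>Two embedded closed discs that meet in one point. Each is an absolute retract, hence so
  is their union, and absolute retracts are contractible.\<close>

lemma contractible_node_nbhd:
  assumes y: "y \<in> P" and e: "good_radius y e"
  shows "contractible (node_nbhd y e)"
proof -
  let ?V = "cball (l y) e" and ?W = "cball (u y) e"
  have e': "e > 0" "?V \<subseteq> D" "?W \<subseteq> D" "?V \<inter> ?W = {}"
    "\<And>x. x \<in> ?V \<union> ?W \<Longrightarrow> g x \<in> P \<Longrightarrow> x = l y \<or> x = u y"
    using e by (auto simp: good_radius_def)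
  have AR: "AR (g ` cball c e)" and cl: "closed (g ` cball c e)"
    if c: "c = l y \<or> c = u y" for c
  proof -
    have sub: "cball c e \<subseteq> D" using c e' by blast
    have cg: "continuous_on (cball c e) g" using cont sub continuous_on_subset by blast
    have "inj_on g (cball c e)"
    proof (rule inj_onI, rule ccontr)
      fix x x' assume x: "x \<in> cball c e" "x' \<in> cball c e" "g x = g x'" "x \<noteq> x'"
      have "x \<in> D" using x(1) sub by blast
      moreover have "x' \<in> D" using x(2) sub by blast
      ultimately have "g x \<in> P" "g x' \<in> P" using fibres[of x x'] x by simp_all
      then have "x = l y \<or> x = u y" "x' = l y \<or> x' = u y" using e'(5)[of x] e'(5)[of x'] x c by auto
      moreover have "l y \<in> ?V" "u y \<in> ?W" using e'(1) by auto
      ultimately show False using x c e'(4) by blast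
    qed
    then have "cball c e homeomorphic g ` cball c e"
      using homeomorphic_compact[OF compact_cball cg] by blast
    then show "AR (g ` cball c e)"
      using homeomorphic_AR_iff_AR convex_imp_AR[OF convex_cball] e'(1) by (metis cball_eq_empty not_less_iff_gr_or_eq)
    show "closed (g ` cball c e)"
      by (intro compact_imp_closed compact_continuous_image cg compact_cball)
  qed
  have "g ` ?V \<inter> g ` ?W = {y}"
  proof (intro equalityI subsetI)
    fix z assume "z \<in> g ` ?V \<inter> g ` ?W"
    then obtain x x' where x: "x \<in> ?V" "x' \<in> ?W" "z = g x" "g x = g x'" by auto
    then have "x \<noteq> x'" using e'(4) by blast
    then have "g x \<in> P" using fibres[of x x'] x e' by blast
    then have "x = l y \<or> x = u y" using e'(5)[of x] x by blast
    then show "z \<in> {y}" using pairs[OF y] x by auto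
  next
    fix z assume "z \<in> {y}"
    moreover have "l y \<in> ?V" "u y \<in> ?W" using e'(1) by auto
    ultimately show "z \<in> g ` ?V \<inter> g ` ?W" using pairs[OF y] by (metis IntI image_eqI singletonD)
  qed
  moreover have "AR {y}" by (rule convex_imp_AR) auto
  ultimately have "AR (g ` ?V \<union> g ` ?W)"
    using AR_closed_Un[of "g ` ?V" "g ` ?W"] AR cl by simp
  then show ?thesis unfolding node_nbhd_def image_Un by (rule AR_imp_contractible)
qed

lemma node_nbhd_subset: "good_radius y e \<Longrightarrow> node_nbhd y e \<subseteq> X"
  by (auto simp: node_nbhd_def good_radius_def)

lemma lift_in_node:
  assumes y: "y \<in> P" and e: "good_radius y e" and x: "x \<in> node_nbhd y e"
  shows "lift x \<in> cball (l y) e \<union> cball (u y) e"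
proof -
  obtain d where d: "d \<in> cball (l y) e \<union> cball (u y) e" "x = g d" using x unfolding node_nbhd_def by blast
  have dD: "d \<in> D" using d e by (auto simp: good_radius_def)
  show ?thesis
  proof (cases "x \<in> P")
    case True
    then have "d = l y \<or> d = u y" using d e unfolding good_radius_def by blast
    then have "x = y" using d(2) pairs[OF y] by auto
    then show ?thesis using y e by (auto simp: lift_def good_radius_def)
  next
    case False
    then show ?thesis using lift_unique[OF dD] d by simp
  qed
qed

text \<open>Inside a node neighbourhood the simplex may be replaced by a path through the node
  itself. Both halves lift to segments in \<open>D\<close>; if they lie on different branches, the
  two lifts of the node contribute a loop with sign.\<close>

lemma near_node:
  assumes y: "y \<in> P" and e: "good_radius y e"
    and \<sigma>: "singular_simplex 1 (top_of_set X) \<sigma>" "\<sigma> ` standard_simplex 1 \<subseteq> node_nbhd y e"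
  shows "\<exists>k. homologous_rel 1 (top_of_set X) {} (frag_of \<sigma>)
    (ray_image (lift (\<sigma> (vertex 1))) - ray_image (lift (\<sigma> (vertex 0))) + frag_cmul k (loop y))"
proof -
  let ?N = "node_nbhd y e"
  \<comment> \<open>The preimage of the node on the branch that contains \<open>d\<close>; the
    segment from it to \<open>d\<close> stays in the same disc.\<close>
  define centre where "centre = (\<lambda>d. if d \<in> cball (l y) e then l y else u y)"
  define seg where "seg = (\<lambda>d. path_simplex (\<lambda>s. centre d + s *\<^sub>R (d - centre d)))"
  define k where "k = (\<lambda>d. simplex_map 1 g (seg d))"
  have VW: "cball (l y) e \<subseteq> D" "cball (u y) e \<subseteq> D" using e by (auto simp: good_radius_def)
  have ends: "seg d (vertex 1) = d" "seg d (vertex 0) = centre d" for d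
    by (simp_all add: seg_def path_simplex_ends del: One_nat_def)
  have kends: "k d (vertex 1) = g d" "k d (vertex 0) = g (centre d)" for d
    using vertex_in_simplex[of 0 1] vertex_in_simplex[of 1 1] ends[of d] by (simp_all add: simplex_map_apply k_def)
  have gc: "g (centre d) = y" for d using pairs[OF y] by (simp add: centre_def)
  have seg: "singular_simplex 1 (top_of_set (cball (l y) e \<union> cball (u y) e)) (seg d)"
    if d: "d \<in> cball (l y) e \<union> cball (u y) e" for d
    unfolding seg_def
  proof (rule singular_path_simplex)
    have c: "centre d = l y \<or> centre d = u y" "d \<in> cball (centre d) e" "e > 0"
      using d e by (auto simp: centre_def good_radius_def)
    have "centre d + s *\<^sub>R (d - centre d) \<in> cball (centre d) e" if "s \<in> {0..1}" for s
    proof -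
      have "norm (s *\<^sub>R (d - centre d)) \<le> 1 * norm (d - centre d)"
        unfolding norm_scaleR using that by (intro mult_right_mono) auto
      also have "\<dots> \<le> e" using c(2) by (simp add: dist_norm norm_minus_commute)
      finally show ?thesis by (simp add: dist_norm)
    qed
    then show "(\<lambda>s. centre d + s *\<^sub>R (d - centre d)) ` {0..1} \<subseteq> cball (l y) e \<union> cball (u y) e"
      using c(1) by auto
  qed (intro continuous_intros)
  have segD: "singular_simplex 1 (top_of_set D) (seg d)" if d: "d \<in> cball (l y) e \<union> cball (u y) e" for d
    using seg[OF d] VW by (auto simp: singular_simplex_top_of_set)
  have cm: "continuous_map (top_of_set (cball (l y) e \<union> cball (u y) e)) (top_of_set ?N) g"
    using continuous_on_subset[OF cont, of "cball (l y) e \<union> cball (u y) e"] VW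
    by (auto simp: continuous_map_in_subtopology node_nbhd_def)
  have kN: "singular_simplex 1 (top_of_set ?N) (k d)" if d: "d \<in> cball (l y) e \<union> cball (u y) e" for d
    unfolding k_def by (rule singular_simplex_simplex_map[OF seg[OF d] cm])
  have kX: "homologous_rel 1 (top_of_set X) {} (frag_of (k d)) (ray_image d - ray_image (centre d))"
    if d: "d \<in> cball (l y) e \<union> cball (u y) e" for d
    using image_homologous_rays[OF segD[OF d]] unfolding ends k_def .
  define d0 d1 where "d0 = lift (\<sigma> (vertex 0))" and "d1 = lift (\<sigma> (vertex 1))"
  have \<sigma>N: "singular_simplex 1 (top_of_set ?N) \<sigma>"
    using \<sigma> by (auto simp: singular_simplex_top_of_set)
  have v: "\<sigma> (vertex 0) \<in> ?N" "\<sigma> (vertex 1) \<in> ?N"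
    using \<sigma>(2) vertex_in_simplex[of 0 1] vertex_in_simplex[of 1 1] by auto
  have d01: "d0 \<in> cball (l y) e \<union> cball (u y) e" "d1 \<in> cball (l y) e \<union> cball (u y) e"
    using lift_in_node[OF y e v(1)] lift_in_node[OF y e v(2)] by (simp_all only: d0_def d1_def)
  have gd: "g d0 = \<sigma> (vertex 0)" "g d1 = \<sigma> (vertex 1)"
    using lift[of "\<sigma> (vertex 0)"] lift[of "\<sigma> (vertex 1)"] v node_nbhd_subset[OF e]
    by (auto simp: d0_def d1_def)
  define c where "c = frag_of \<sigma> - (frag_of (k d1) - frag_of (k d0))"
  have "singular_chain 1 (top_of_set ?N) c"
    unfolding c_def using \<sigma>N kN[OF d01(1)] kN[OF d01(2)]
    by (intro singular_chain_diff) (auto simp: singular_chain_of)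
  moreover have "chain_boundary 1 c = 0"
    unfolding c_def chain_boundary_diff chain_boundary_1 kends gc gd by simp
  ultimately have "singular_relcycle 1 (top_of_set ?N) {} c" by (simp add: singular_cycle)
  then have "singular_relboundary 1 (top_of_set ?N) {} c"
    by (intro contractible_cycle_bounds) (simp_all add: contractible_node_nbhd[OF y e])
  then have "singular_relboundary 1 (top_of_set X) {} c"
    using singular_boundary_mono[of ?N X 1 euclidean c] node_nbhd_subset[OF e] by blast
  then have "homologous_rel 1 (top_of_set X) {} (frag_of \<sigma>) (frag_of (k d1) - frag_of (k d0))"
    by (simp add: homologous_rel_def c_def)
  moreover have "homologous_rel 1 (top_of_set X) {} (frag_of (k d1) - frag_of (k d0))
      ((ray_image d1 - ray_image (centre d1)) - (ray_image d0 - ray_image (centre d0)))"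
    by (intro homologous_rel_diff kX d01)
  ultimately have "homologous_rel 1 (top_of_set X) {} (frag_of \<sigma>)
      ((ray_image d1 - ray_image (centre d1)) - (ray_image d0 - ray_image (centre d0)))"
    using homologous_rel_trans by blast
  \<comment> \<open>The coefficient is 0 if the path stays on one branch, and 1 or -1 according to
    the direction in which it changes branches.\<close>
  moreover have "\<exists>k. ray_image (centre d0) - ray_image (centre d1) = frag_cmul k (loop y)"
  proof -
    have "centre d = l y \<or> centre d = u y" for d by (simp add: centre_def)
    then consider "centre d0 = centre d1" | "centre d0 = u y" "centre d1 = l y" | "centre d0 = l y" "centre d1 = u y"
      by metis
    then show ?thesis
    proof cases
      case 1 then show ?thesis by (intro exI[of _ 0]) simp
    next
      case 2 then show ?thesis by (intro exI[of _ 1]) (simp add: loop_def)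
    next
      case 3 then show ?thesis by (intro exI[of _ "-1"]) (simp add: loop_def)
    qed
  qed
  then obtain n where n: "ray_image (centre d0) - ray_image (centre d1) = frag_cmul n (loop y)" by blast
  have "(ray_image d1 - ray_image (centre d1)) - (ray_image d0 - ray_image (centre d0)) =
      ray_image d1 - ray_image d0 + (ray_image (centre d0) - ray_image (centre d1))"
    by simp
  then have "(ray_image d1 - ray_image (centre d1)) - (ray_image d0 - ray_image (centre d0)) =
      ray_image d1 - ray_image d0 + frag_cmul n (loop y)"
    unfolding n .
  ultimately show ?thesis unfolding d0_def d1_def by metis
qed

lemma small_simplex:
  assumes \<rho>: "\<And>y. y \<in> P \<Longrightarrow> good_radius y (\<rho> y)"
    and \<sigma>: "singular_simplex 1 (top_of_set X) \<sigma>"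
    and small: "\<sigma> ` standard_simplex 1 \<subseteq> X - P \<or> (\<exists>y\<in>P. \<sigma> ` standard_simplex 1 \<subseteq> node_nbhd y (\<rho> y))"
  shows "\<exists>q. homologous_rel 1 (top_of_set X) {} (frag_of \<sigma>)
    (ray_image (lift (\<sigma> (vertex 1))) - ray_image (lift (\<sigma> (vertex 0))) + (\<Sum>y\<in>P. frag_cmul (q y) (loop y)))"
  using small
proof
  assume "\<sigma> ` standard_simplex 1 \<subseteq> X - P"
  then show ?thesis using away_from_P[OF \<sigma>] by (intro exI[of _ "\<lambda>_. 0"]) simp
next
  assume "\<exists>y\<in>P. \<sigma> ` standard_simplex 1 \<subseteq> node_nbhd y (\<rho> y)"
  then obtain y where y: "y \<in> P" "\<sigma> ` standard_simplex 1 \<subseteq> node_nbhd y (\<rho> y)" by blast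
  then obtain k where k: "homologous_rel 1 (top_of_set X) {} (frag_of \<sigma>)
    (ray_image (lift (\<sigma> (vertex 1))) - ray_image (lift (\<sigma> (vertex 0))) + frag_cmul k (loop y))"
    using near_node[OF y(1) \<rho>[OF y(1)] \<sigma>] by blast
  have "(\<Sum>z\<in>P. frag_cmul (if z = y then k else 0) (loop z)) = (\<Sum>z\<in>P. if z = y then frag_cmul k (loop z) else 0)"
    by (rule sum.cong) auto
  also have "\<dots> = frag_cmul k (loop y)" using y(1) finite_P by simp
  finally show ?thesis using k by (intro exI[of _ "\<lambda>z. if z = y then k else 0"]) simp
qed

text \<open>Subdivision makes every simplex avoid the nodes or stay near one of them. Each is then
  homologous to a difference of rays plus multiples of loops, and over a cycle the rays
  cancel.\<close>

lemma loops_generate: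
  assumes z: "singular_relcycle 1 (top_of_set X) {} z"
  shows "\<exists>q. homologous_rel 1 (top_of_set X) {} z (\<Sum>y\<in>P. frag_cmul (q y) (loop y))"
proof -
  obtain \<rho> where \<rho>: "\<And>y. y \<in> P \<Longrightarrow> good_radius y (\<rho> y)" using ex_good_radius by metis
  \<comment> \<open>Openness in \<open>X\<close> is obtained from the complement, since
    \<open>g\<close> is known to be closed and not to be open.\<close>
  define U where "U = (\<lambda>y. X - g ` (D - (ball (l y) (\<rho> y) \<union> ball (u y) (\<rho> y))))"
  have U_open: "openin (top_of_set X) (U y)" for y
  proof -
    have "closedin (top_of_set D) (D \<inter> - (ball (l y) (\<rho> y) \<union> ball (u y) (\<rho> y)))"
      by (intro closedin_closed_Int closed_Compl open_Un open_ball)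
    then have "closedin (top_of_set D) (D - (ball (l y) (\<rho> y) \<union> ball (u y) (\<rho> y)))"
      by (simp only: Diff_eq)
    then show ?thesis unfolding U_def using closed_map by (intro openin_diff) auto
  qed
  have U_sub: "U y \<subseteq> node_nbhd y (\<rho> y)" for y
  proof
    fix x assume "x \<in> U y"
    then obtain d where d: "d \<in> D" "x = g d" "g d \<notin> g ` (D - (ball (l y) (\<rho> y) \<union> ball (u y) (\<rho> y)))"
      by (auto simp: U_def)
    then have "d \<in> ball (l y) (\<rho> y) \<union> ball (u y) (\<rho> y)" by blast
    then have "d \<in> cball (l y) (\<rho> y) \<union> cball (u y) (\<rho> y)"
      using ball_subset_cball by blast
    then show "x \<in> node_nbhd y (\<rho> y)" using d(2) unfolding node_nbhd_def by blast
  qed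
  have y_U: "y \<in> U y" if y: "y \<in> P" for y
  proof -
    have "y \<notin> g ` (D - (ball (l y) (\<rho> y) \<union> ball (u y) (\<rho> y)))"
    proof
      assume "y \<in> g ` (D - (ball (l y) (\<rho> y) \<union> ball (u y) (\<rho> y)))"
      then obtain x where x: "x \<in> D" "g x = y" "x \<notin> ball (l y) (\<rho> y) \<union> ball (u y) (\<rho> y)" by blast
      then have "x = l y \<or> x = u y" using fibre_cases[OF x(1,2) y] by blast
      then show False using x(3) \<rho>[OF y] by (auto simp: good_radius_def)
    qed
    then show ?thesis using P_subset y by (auto simp: U_def)
  qed
  let ?C = "insert (X - P) (U ` P)"
  have "openin (top_of_set X) (X - P)"
    using finite_P by (intro openin_diff) (auto intro!: closed_subset finite_imp_closed P_subset)
  then have op: "\<And>V. V \<in> ?C \<Longrightarrow> openin (top_of_set X) V" using U_open by auto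
  have cover: "topspace (top_of_set X) \<subseteq> \<Union>?C" using y_U by auto
  obtain z' where z': "singular_relcycle 1 (top_of_set X) {} z'" "homologous_rel 1 (top_of_set X) {} z z'"
    "\<And>f. f \<in> Poly_Mapping.keys z' \<Longrightarrow> \<exists>V \<in> ?C. f \<in> standard_simplex 1 \<rightarrow> V"
    using small_homologous_rel_relcycle_exists[OF op cover z] by metis
  have all: "\<forall>\<sigma>\<in>Poly_Mapping.keys z'. \<exists>q. homologous_rel 1 (top_of_set X) {} (frag_of \<sigma>)
    (ray_image (lift (\<sigma> (vertex 1))) - ray_image (lift (\<sigma> (vertex 0))) + (\<Sum>y\<in>P. frag_cmul (q y) (loop y)))"
  proof
    fix \<sigma> assume k: "\<sigma> \<in> Poly_Mapping.keys z'"
    show "\<exists>q. homologous_rel 1 (top_of_set X) {} (frag_of \<sigma>)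
    (ray_image (lift (\<sigma> (vertex 1))) - ray_image (lift (\<sigma> (vertex 0))) + (\<Sum>y\<in>P. frag_cmul (q y) (loop y)))"
  proof (rule small_simplex[OF \<rho>])
    show "singular_simplex 1 (top_of_set X) \<sigma>"
      using z'(1) k by (auto simp: singular_cycle singular_chain_def)
    obtain V where V: "V \<in> ?C" "\<sigma> \<in> standard_simplex 1 \<rightarrow> V" using z'(3)[OF k] by blast
    then have "\<sigma> ` standard_simplex 1 \<subseteq> V" by (simp only: image_subset_iff_funcset)
    with V(1) show "\<sigma> ` standard_simplex 1 \<subseteq> X - P \<or> (\<exists>y\<in>P. \<sigma> ` standard_simplex 1 \<subseteq> node_nbhd y (\<rho> y))"
      using U_sub by blast
  qed
  qed
  from bchoice[OF all] obtain q where q: "\<forall>\<sigma>\<in>Poly_Mapping.keys z'. homologous_rel 1 (top_of_set X) {} (frag_of \<sigma>)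
    (ray_image (lift (\<sigma> (vertex 1))) - ray_image (lift (\<sigma> (vertex 0))) + (\<Sum>y\<in>P. frag_cmul (q \<sigma> y) (loop y)))" ..
  let ?c = "Poly_Mapping.lookup z'"
  \<comment> \<open>The ray terms of a simplex are a linear function of its boundary, so their
    weighted sum over the cycle is \<open>T 0 = 0\<close>. Evaluation at \<open>vertex 0\<close>
    recovers the point of a 0-simplex.\<close>
  define T where "T = frag_extend (\<lambda>f. ray_image (lift (f (vertex 0))))"
  have T_boundary: "T (chain_boundary 1 (frag_of \<sigma>)) = ray_image (lift (\<sigma> (vertex 1))) - ray_image (lift (\<sigma> (vertex 0)))" for \<sigma>
    unfolding chain_boundary_1 T_def frag_extend_diff frag_extend_of
    using vertex_in_simplex[of 0 0] by (simp add: point_simplex_def)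
  have z'_sum: "z' = (\<Sum>\<sigma>\<in>Poly_Mapping.keys z'. frag_cmul (?c \<sigma>) (frag_of \<sigma>))"
    using frag_expansion[of z'] by (simp add: frag_extend_def)
  have "chain_boundary 1 z' = (\<Sum>\<sigma>\<in>Poly_Mapping.keys z'. frag_cmul (?c \<sigma>) (chain_boundary 1 (frag_of \<sigma>)))"
    by (subst z'_sum) (simp add: chain_boundary_sum chain_boundary_cmul comp_def del: One_nat_def)
  then have "T (chain_boundary 1 z') = (\<Sum>\<sigma>\<in>Poly_Mapping.keys z'. frag_cmul (?c \<sigma>) (T (chain_boundary 1 (frag_of \<sigma>))))"
    unfolding T_def by (simp add: frag_extend_sum frag_extend_cmul comp_def del: One_nat_def)
  moreover have "chain_boundary 1 z' = 0" using z'(1) by (simp add: singular_cycle)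
  ultimately have T0: "(\<Sum>\<sigma>\<in>Poly_Mapping.keys z'. frag_cmul (?c \<sigma>) (T (chain_boundary 1 (frag_of \<sigma>)))) = 0"
    by (simp add: T_def)
  have "homologous_rel 1 (top_of_set X) {} (\<Sum>\<sigma>\<in>Poly_Mapping.keys z'. frag_cmul (?c \<sigma>) (frag_of \<sigma>))
      (\<Sum>\<sigma>\<in>Poly_Mapping.keys z'. frag_cmul (?c \<sigma>)
        (T (chain_boundary 1 (frag_of \<sigma>)) + (\<Sum>y\<in>P. frag_cmul (q \<sigma> y) (loop y))))"
    unfolding T_boundary by (intro homologous_rel_finite_sum homologous_rel_cmul bspec[OF q]) auto
  also have "(\<Sum>\<sigma>\<in>Poly_Mapping.keys z'. frag_cmul (?c \<sigma>)
        (T (chain_boundary 1 (frag_of \<sigma>)) + (\<Sum>y\<in>P. frag_cmul (q \<sigma> y) (loop y)))) =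
      (\<Sum>\<sigma>\<in>Poly_Mapping.keys z'. \<Sum>y\<in>P. frag_cmul (?c \<sigma> * q \<sigma> y) (loop y))"
    unfolding frag_cmul_distrib2 sum.distrib T0 by (simp add: frag_cmul_sum comp_def)
  also have "\<dots> = (\<Sum>y\<in>P. \<Sum>\<sigma>\<in>Poly_Mapping.keys z'. frag_cmul (?c \<sigma> * q \<sigma> y) (loop y))"
    by (rule sum.swap)
  also have "\<dots> = (\<Sum>y\<in>P. frag_cmul (\<Sum>\<sigma>\<in>Poly_Mapping.keys z'. ?c \<sigma> * q \<sigma> y) (loop y))"
    by (intro sum.cong refl poly_mapping_eqI) (simp add: lookup_sum sum_distrib_right)
  finally have fin: "homologous_rel 1 (top_of_set X) {} z' (\<Sum>y\<in>P. frag_cmul (\<Sum>\<sigma>\<in>Poly_Mapping.keys z'. ?c \<sigma> * q \<sigma> y) (loop y))"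
    using z'_sum by simp
  show ?thesis by (rule exI) (rule homologous_rel_trans[OF fin z'(2)])
qed

theorem rat_homology_dim_glued_disc: "rat_homology_dim 1 (top_of_set X) (card P)"
proof (rule rat_homology_dim_criterion[where \<gamma> = loop and \<theta> = "\<lambda>y. winding_cochain (circle_map y)"])
  show "finite P" by (rule finite_P)
  fix y \<tau> assume "singular_simplex (Suc 1) (top_of_set X) \<tau>"
  then show "rat_functional (winding_cochain (circle_map y)) (rat_of_chain (chain_boundary (Suc 1) (frag_of \<tau>))) = 0"
    by (rule winding_cochain_boundary[OF continuous_circle_map, rotated]) (simp add: circle_map_def)
qed (use loop_cycle winding_loop loops_generate in auto)

end

section \<open>Finitely determined germs are injective\<close>

lemma order_asymptotic:
  assumes g: "g holomorphic_on S" "open S" "0 \<in> S"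
    and low: "\<And>i. i < m \<Longrightarrow> (deriv ^^ i) g 0 = 0"
  shows "((\<lambda>t. g t / t ^ m) \<longlongrightarrow> (deriv ^^ m) g 0 / fact m) (at 0)"
proof -
  obtain d where d: "d > 0" "cball 0 d \<subseteq> S" using g(2,3) open_contains_cball by blast
  have hd: "(deriv ^^ i) g holomorphic_on S" for i by (rule holomorphic_higher_deriv[OF g(1,2)])
  have "compact ((deriv ^^ Suc m) g ` cball 0 d)"
    by (rule compact_continuous_image[OF continuous_on_subset[OF holomorphic_on_imp_continuous_on[OF hd] d(2)]
        compact_cball])
  then obtain B where B: "\<forall>x\<in>(deriv ^^ Suc m) g ` cball 0 d. norm x \<le> B"
    using compact_imp_bounded bounded_iff by blast
  have est: "norm (g t - (deriv ^^ m) g 0 / fact m * t ^ m) \<le> B * norm t ^ Suc m / fact m" if t: "t \<in> cball 0 d" for t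
  proof -
    have "norm ((deriv ^^ 0) g t - (\<Sum>i\<le>m. (deriv ^^ i) g 0 * (t - 0) ^ i / fact i)) \<le> B * norm (t - 0) ^ Suc m / fact m"
    proof (rule complex_Taylor[where f = "\<lambda>i. (deriv ^^ i) g" and n = m and S = "cball 0 d"])
      fix i and x :: complex assume "x \<in> cball 0 d"
      then have "((deriv ^^ i) g has_field_derivative deriv ((deriv ^^ i) g) x) (at x)"
        using holomorphic_derivI[OF hd g(2)] d(2) by blast
      then show "((deriv ^^ i) g has_field_derivative (deriv ^^ Suc i) g x) (at x within cball 0 d)"
        by (simp add: has_field_derivative_at_within)
    qed (use t d B in auto)
    moreover have "(\<Sum>i\<le>m. (deriv ^^ i) g 0 * (t - 0) ^ i / fact i) = (deriv ^^ m) g 0 / fact m * t ^ m"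
      using low by (subst sum.remove[of _ m]) (auto intro!: sum.neutral)
    ultimately show ?thesis by simp
  qed
  have "((\<lambda>t. g t / t ^ m - (deriv ^^ m) g 0 / fact m) \<longlongrightarrow> 0) (at 0)"
  proof (rule Lim_null_comparison)
    show "((\<lambda>t::complex. \<bar>B\<bar> / fact m * norm t) \<longlongrightarrow> 0) (at 0)"
      by (auto intro!: tendsto_eq_intros)
    have "\<forall>\<^sub>F t in at 0. t \<in> ball 0 d" using d(1) by (intro eventually_at_in_open') auto
    moreover have "\<forall>\<^sub>F t in at (0::complex). t \<noteq> 0" by (simp add: eventually_at_filter)
    ultimately show "\<forall>\<^sub>F t in at 0. norm (g t / t ^ m - (deriv ^^ m) g 0 / fact m) \<le> \<bar>B\<bar> / fact m * norm t"
    proof eventually_elim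
      case (elim t)
      have eq: "g t / t ^ m - (deriv ^^ m) g 0 / fact m = (g t - (deriv ^^ m) g 0 / fact m * t ^ m) / t ^ m"
        using elim by (simp add: field_simps)
      have "norm (g t - (deriv ^^ m) g 0 / fact m * t ^ m) \<le> B * norm t ^ Suc m / fact m"
        using est elim by simp
      also have "\<dots> \<le> \<bar>B\<bar> * norm t ^ Suc m / fact m"
        by (intro divide_right_mono mult_right_mono) auto
      finally have "norm (g t - (deriv ^^ m) g 0 / fact m * t ^ m) \<le> (\<bar>B\<bar> / fact m * norm t) * norm t ^ m"
        by (simp add: mult_ac)
      then show ?case unfolding eq norm_divide norm_power
        using elim by (simp add: pos_divide_le_eq)
    qed
  qed
  then show ?thesis by (simp add: LIM_zero_iff)
qed

text \<open>Near a zero of order \<open>m\<close> the function is \<open>(w * g w) ^ m\<close> with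
  \<open>g\<close> free of zeros, and \<open>T\<close> is the local inverse of
  \<open>w * g w\<close>.\<close>

lemma power_coordinate:
  assumes k: "k holomorphic_on S" "open S" "0 \<in> S" "k 0 = 0"
    and m: "m > 0" "(deriv ^^ m) k 0 \<noteq> 0" "\<And>i. i < m \<Longrightarrow> (deriv ^^ i) k 0 = 0"
  obtains T R where "R > 0" "T holomorphic_on ball 0 R" "inj_on T (ball 0 R)" "T 0 = 0"
    "T ` ball 0 R \<subseteq> S" "\<And>z. z \<in> ball 0 R \<Longrightarrow> k (T z) = z ^ m"
proof -
  obtain g d where g: "0 < d" "g holomorphic_on ball 0 d" "\<And>w. w \<in> ball 0 d \<Longrightarrow> k w - k 0 = ((w - 0) * g w) ^ m"
    "\<And>w. w \<in> ball 0 d \<Longrightarrow> g w \<noteq> 0"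
  proof (rule holomorphic_factor_order_of_zero_strong[OF k(1-3) m(1,2)])
    show "(deriv ^^ i) k 0 = 0" if "0 < i" "i < m" for i using m(3) that by blast
    fix g r assume "0 < r" "g holomorphic_on ball 0 r" "\<And>w. w \<in> ball 0 r \<Longrightarrow> k w - k 0 = ((w - 0) * g w) ^ m"
      "\<And>w. w \<in> ball 0 r \<Longrightarrow> g w \<noteq> 0"
    then show thesis by (rule that)
  qed
  obtain d' where d': "d' > 0" "ball 0 d' \<subseteq> S" using k(2,3) openE by blast
  define e where "e = min d d'"
  have e: "e > 0" "ball 0 e \<subseteq> S" "ball (0::complex) e \<subseteq> ball 0 d" using g(1) d' by (auto simp: e_def)
  define h where "h = (\<lambda>w. w * g w)"
  have hh: "h holomorphic_on ball 0 e" unfolding h_def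
    using g(2) e(3) by (intro holomorphic_intros) (auto intro: holomorphic_on_subset)
  have dg: "(g has_field_derivative deriv g 0) (at 0)"
    using holomorphic_derivI[OF g(2) open_ball] g(1) by simp
  have "(h has_field_derivative g 0) (at 0)"
    unfolding h_def using dg by (auto intro!: derivative_eq_intros)
  then have dh: "deriv h 0 \<noteq> 0" using g(4)[of 0] g(1) by (simp add: DERIV_imp_deriv)
  have e0: "0 \<in> ball (0::complex) e" using e(1) by simp
  obtain b where b: "b > 0" "ball (0::complex) b \<subseteq> ball 0 e" "open (h ` ball 0 b)" "inj_on h (ball 0 b)"
    by (rule has_complex_derivative_locally_invertible[OF hh e0 open_ball dh]) (rule that)
  have hb: "h holomorphic_on ball 0 b" using hh b(2) by (rule holomorphic_on_subset)
  obtain T where T: "T holomorphic_on h ` ball 0 b" "\<And>z. z \<in> ball 0 b \<Longrightarrow> T (h z) = z"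
    using holomorphic_has_inverse[OF hb open_ball b(4)] by metis
  have "0 \<in> h ` ball 0 b" using b(1) by (auto simp: h_def intro!: image_eqI[of _ _ 0])
  then obtain R where R: "R > 0" "ball 0 R \<subseteq> h ` ball 0 b" using b(3) openE by blast
  have inv: "T z \<in> ball 0 b \<and> h (T z) = z" if "z \<in> ball 0 R" for z
    using R(2) T(2) that by force
  show ?thesis
  proof (rule that[OF R(1)])
    show "T holomorphic_on ball 0 R" using T(1) R(2) by (rule holomorphic_on_subset)
    show "inj_on T (ball 0 R)" using inv by (metis inj_onI)
    show "T 0 = 0" using T(2)[of 0] b(1) by (simp add: h_def)
    show "T ` ball 0 R \<subseteq> S" using inv b(2) e(2) by blast
    fix z :: complex assume z: "z \<in> ball 0 R"
    then have "T z \<in> ball 0 d" using inv b(2) e(3) by blast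
    then show "k (T z) = z ^ m" using g(3)[of "T z"] inv[OF z] k(4) by (simp add: h_def)
  qed
qed

section \<open>Injectivity by perturbation beyond a finite jet\<close>

lemma map_germ_components:
  assumes "map_germ f"
  obtains R where "R > 0" "(fst \<circ> f) holomorphic_on ball 0 R" "(snd \<circ> f) holomorphic_on ball 0 R" "f 0 = 0"
proof -
  obtain U where U: "open U" "0 \<in> U" "holomorphic_map_on f U" and f0: "f 0 = 0"
    using assms unfolding map_germ_def holomorphic_near_def by blast
  obtain R where R: "R > 0" "ball 0 R \<subseteq> U" using U openE by blast
  show ?thesis
    using that[OF R(1)] holomorphic_map_on_subset[OF U(3) R(2)] f0
    by (simp add: holomorphic_map_on_curve_iff)
qed

lemma map_germ_I:
  assumes "R > 0" "(fst \<circ> f) holomorphic_on ball 0 R" "(snd \<circ> f) holomorphic_on ball 0 R" "f 0 = 0"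
  shows "map_germ f"
  unfolding map_germ_def holomorphic_near_def
  using assms by (intro conjI exI[of _ "ball 0 R"]) (auto simp: holomorphic_map_on_curve_iff)

lemma higher_deriv_power_0: "i < n \<Longrightarrow> (deriv ^^ i) (\<lambda>w::complex. w ^ n) 0 = 0"
  using higher_deriv_power[of i 0 n 0] by (simp add: power_0_left)

lemma higher_deriv_power_self: "(deriv ^^ n) (\<lambda>w::complex. w ^ n) 0 \<noteq> 0"
proof -
  have "(deriv ^^ n) (\<lambda>w::complex. w ^ n) 0 = fact n"
    using higher_deriv_power[of n 0 n 0] by (simp add: pochhammer_fact[symmetric])
  then show ?thesis by (metis fact_nonzero)
qed

lemma higher_deriv_perturb:
  assumes "g holomorphic_on ball 0 R" "R > 0"
  shows "(deriv ^^ i) (\<lambda>t. g t + c * t ^ n) 0 = (deriv ^^ i) g 0 + c * (deriv ^^ i) (\<lambda>w. w ^ n) 0"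
proof -
  have z: "(0::complex) \<in> ball 0 R" using assms(2) by simp
  have "(deriv ^^ i) (\<lambda>t. g t + c * t ^ n) 0 = (deriv ^^ i) g 0 + (deriv ^^ i) (\<lambda>t. c * t ^ n) 0"
    by (rule higher_deriv_add[OF assms(1) _ open_ball z]) (intro holomorphic_intros)
  also have "(deriv ^^ i) (\<lambda>t. c * t ^ n) 0 = c * (deriv ^^ i) (\<lambda>w. w ^ n) 0"
    by (rule higher_deriv_cmult[of _ UNIV]) (auto intro!: holomorphic_intros)
  finally show ?thesis .
qed

text \<open>
  A high power of the parameter can be added to one component so that the curve becomes injective:
  in the coordinate in which the other component is \<open>z ^ m\<close>, a double point means
  \<open>b (\<omega> z) = b z\<close> with \<open>\<omega> ^ m = 1\<close>, and an exponent congruent to 1 modulo \<open>m\<close> separates all \<open>\<omega>\<close>.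
\<close>

lemma exists_injective_germ:
  assumes a: "a holomorphic_on ball 0 R" and b: "b holomorphic_on ball 0 R" and R: "R > 0"
    and a0: "a 0 = 0" and m: "m > 0" "(deriv ^^ m) a 0 \<noteq> 0" "\<And>i. i < m \<Longrightarrow> (deriv ^^ i) a 0 = 0"
    and M: "M mod m = 1 mod m"
  obtains c \<rho> where "\<rho> > 0" "inj_on (\<lambda>t. (a t, b t + c * t ^ M)) (ball 0 \<rho>)"
proof -
  obtain T r where T: "r > 0" "T holomorphic_on ball 0 r" "inj_on T (ball 0 r)" "T 0 = 0"
    "T ` ball 0 r \<subseteq> ball 0 R" "\<And>z. z \<in> ball 0 r \<Longrightarrow> a (T z) = z ^ m"
    using power_coordinate[OF a open_ball _ a0 m] R by (metis centre_in_ball)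
  define \<Omega> where "\<Omega> = {\<omega>::complex. \<omega> ^ m = 1 \<and> \<omega> \<noteq> 1}"
  have fin: "finite \<Omega>" unfolding \<Omega>_def using m(1) finite_roots_unity[of m] by (auto elim!: finite_subset[rotated])
  have norm1: "norm \<omega> = 1" if "\<omega> \<in> \<Omega>" for \<omega>
    using that m(1) unfolding \<Omega>_def by (metis (mono_tags) mem_Collect_eq norm_ge_zero norm_one norm_power power_eq_1_iff not_gr_zero)
  define G where "G = (\<lambda>c z. b (T z) + c * T z ^ M)"
  have hG: "G c holomorphic_on ball 0 r" for c
    unfolding G_def
    using holomorphic_on_compose_gen[OF T(2) b T(5)] T(2) by (intro holomorphic_intros) (auto simp: comp_def)
  have hG\<omega>: "(\<lambda>z. G c (\<omega> * z)) holomorphic_on ball 0 r" if "\<omega> \<in> \<Omega>" for c \<omega>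
    by (rule holomorphic_on_compose_gen[where g = "G c" and f = "\<lambda>z. \<omega> * z", unfolded comp_def, OF _ hG])
      (use norm1[OF that] in \<open>auto intro!: holomorphic_intros simp: norm_mult\<close>)
  \<comment> \<open>The constants \<open>c\<close> for which the perturbed component keeps the
    symmetry under \<open>\<omega>\<close>.\<close>
  define bad where "bad = (\<lambda>\<omega>. {c. \<forall>z\<in>ball 0 r. G c (\<omega> * z) = G c z})"
  \<comment> \<open>Two bad constants would make \<open>T z ^ M\<close> invariant under
    \<open>\<omega>\<close>. The leading term at 0 then gives \<open>\<omega> ^ M = 1\<close>,
    whereas the congruence for \<open>M\<close> gives
    \<open>\<omega> ^ M = \<omega>\<close>.\<close>
  have one: "c = c'" if \<omega>: "\<omega> \<in> \<Omega>" and c: "c \<in> bad \<omega>" "c' \<in> bad \<omega>" for \<omega> c c'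
  proof (rule ccontr)
    assume "c \<noteq> c'"
    have eq: "T (\<omega> * z) ^ M = T z ^ M" if z: "z \<in> ball 0 r" for z
    proof -
      have "G c (\<omega> * z) = G c z" "G c' (\<omega> * z) = G c' z" using c z by (auto simp: bad_def)
      moreover have "(c - c') * (T (\<omega> * z) ^ M - T z ^ M) =
          (G c (\<omega> * z) - G c z) - (G c' (\<omega> * z) - G c' z)"
        by (simp add: G_def algebra_simps)
      ultimately have "(c - c') * (T (\<omega> * z) ^ M - T z ^ M) = 0" by simp
      then show ?thesis using \<open>c \<noteq> c'\<close> by simp
    qed
    have dT: "(T has_field_derivative deriv T 0) (at 0)"
      using holomorphic_derivI[OF T(2) open_ball] T(1) by simp
    have T'0: "deriv T 0 \<noteq> 0"
      using holomorphic_injective_imp_regular[OF T(2) open_ball T(3)] T(1) by simp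
    have l1: "((\<lambda>z. T z / z) \<longlongrightarrow> deriv T 0) (at 0)"
      using dT T(4) by (simp add: has_field_derivative_iff)
    have dT': "(T has_field_derivative deriv T 0) (at (\<omega> * 0))" using dT by simp
    have "((\<lambda>z. T (\<omega> * z)) has_field_derivative deriv T 0 * \<omega>) (at 0)"
      by (rule DERIV_chain2[where g = "\<lambda>z. \<omega> * z" and x = 0, OF dT']) (auto intro!: derivative_eq_intros)
    then have l2: "((\<lambda>z. T (\<omega> * z) / z) \<longlongrightarrow> deriv T 0 * \<omega>) (at 0)"
      using T(4) by (simp add: has_field_derivative_iff)
    have l3: "((\<lambda>z. (T (\<omega> * z) / z) ^ M) \<longlongrightarrow> (deriv T 0 * \<omega>) ^ M) (at 0)" by (intro tendsto_power l2)
    have "\<forall>\<^sub>F z in at 0. z \<in> ball 0 r" using T(1) by (intro eventually_at_in_open') auto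
    then have ev: "\<forall>\<^sub>F z in at 0. (T (\<omega> * z) / z) ^ M = (T z / z) ^ M"
      by eventually_elim (simp only: power_divide eq)
    have "((\<lambda>z. (T z / z) ^ M) \<longlongrightarrow> (deriv T 0 * \<omega>) ^ M) (at 0)"
      by (rule Lim_transform_eventually[OF l3 ev])
    moreover have "((\<lambda>z. (T z / z) ^ M) \<longlongrightarrow> deriv T 0 ^ M) (at 0)" by (intro tendsto_power l1)
    ultimately have "(deriv T 0 * \<omega>) ^ M = deriv T 0 ^ M"
      using tendsto_unique[OF at_neq_bot] by blast
    then have "\<omega> ^ M = 1" using T'0 by (simp add: power_mult_distrib)
    moreover have "\<omega> ^ M = \<omega>"
    proof -
      have "\<omega> ^ M = \<omega> ^ (m * (M div m) + M mod m)" by simp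
      also have "\<dots> = (\<omega> ^ m) ^ (M div m) * \<omega> ^ (1 mod m)" by (simp only: power_add power_mult M)
      also have "\<dots> = \<omega> ^ (1 mod m)" using \<omega> by (simp add: \<Omega>_def)
      \<comment> \<open>For \<open>m = 1\<close> the residue \<open>1 mod m\<close> is 0, but then
        \<open>\<Omega>\<close> is empty.\<close>
      also have "\<dots> = \<omega>" using \<omega> by (cases "m = 1") (auto simp: \<Omega>_def)
      finally show ?thesis .
    qed
    ultimately show False using \<omega> by (simp add: \<Omega>_def)
  qed
  have "finite (bad \<omega>)" if "\<omega> \<in> \<Omega>" for \<omega>
  proof (cases "bad \<omega> = {}")
    case False
    then obtain c where "c \<in> bad \<omega>" by blast
    then have "bad \<omega> \<subseteq> {c}" using one[OF that] by blast
    then show ?thesis by (rule finite_subset) simp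
  qed simp
  then have "finite (\<Union>\<omega>\<in>\<Omega>. bad \<omega>)" using fin by blast
  then obtain c where c: "c \<notin> (\<Union>\<omega>\<in>\<Omega>. bad \<omega>)" using ex_new_if_finite[OF infinite_UNIV_char_0] by blast
  \<comment> \<open>For a good \<open>c\<close> the difference is not identically 0, so its zero at
    the origin is isolated.\<close>
  have "\<exists>e>0. \<forall>z\<in>ball 0 e. z \<noteq> 0 \<longrightarrow> G c (\<omega> * z) \<noteq> G c z" if \<omega>: "\<omega> \<in> \<Omega>" for \<omega>
  proof -
    obtain \<beta> where \<beta>: "\<beta> \<in> ball 0 r" "G c (\<omega> * \<beta>) - G c \<beta> \<noteq> 0" using c \<omega> by (auto simp: bad_def)
    have h: "(\<lambda>z. G c (\<omega> * z) - G c z) holomorphic_on ball 0 r"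
      by (intro holomorphic_on_diff hG hG\<omega> \<omega>)
    obtain e where "0 < e" "ball (0::complex) e \<subseteq> ball 0 r" "\<And>z. z \<in> ball 0 e - {0} \<Longrightarrow> G c (\<omega> * z) - G c z \<noteq> 0"
    proof (rule isolated_zeros[OF h open_ball connected_ball _ _ \<beta>])
      show "0 \<in> ball (0::complex) r" using T(1) by simp
      show "G c (\<omega> * 0) - G c 0 = 0" by simp
    qed (rule that)
    then show ?thesis by (intro exI[of _ e]) auto
  qed
  then obtain E where E: "\<And>\<omega>. \<omega> \<in> \<Omega> \<Longrightarrow> E \<omega> > 0"
    "\<And>\<omega> z. \<omega> \<in> \<Omega> \<Longrightarrow> z \<in> ball 0 (E \<omega>) \<Longrightarrow> z \<noteq> 0 \<Longrightarrow> G c (\<omega> * z) \<noteq> G c z" by metis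
  define e where "e = Min (insert r (E ` \<Omega>))"
  have e: "e > 0" "e \<le> r" "\<And>\<omega>. \<omega> \<in> \<Omega> \<Longrightarrow> e \<le> E \<omega>"
    using fin T(1) E(1) by (auto simp: e_def)
  have sub: "ball 0 e \<subseteq> ball (0::complex) r" using e by auto
  have inj: "inj_on (\<lambda>t. (a t, b t + c * t ^ M)) (T ` ball 0 e)"
  proof (rule inj_onI)
    fix t t' assume "t \<in> T ` ball 0 e" "t' \<in> T ` ball 0 e"
      and eq: "(a t, b t + c * t ^ M) = (a t', b t' + c * t' ^ M)"
    then obtain z z' where z: "z \<in> ball 0 e" "t = T z" "z' \<in> ball 0 e" "t' = T z'" by blast
    have "z \<in> ball 0 r" using z(1) sub by blast
    moreover have "z' \<in> ball 0 r" using z(3) sub by blast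
    ultimately have pw: "z ^ m = z' ^ m" using eq z(2,4) T(6) by simp
    have Geq: "G c z = G c z'" using eq z by (simp add: G_def)
    have "z = z'"
    proof (rule ccontr)
      assume ne: "z \<noteq> z'"
      have "z \<noteq> 0"
      proof
        assume "z = 0"
        then have "z' ^ m = 0" using pw m(1) by (simp add: power_0_left)
        then show False using ne \<open>z = 0\<close> by simp
      qed
      have "(z' / z) ^ m = z ^ m / z ^ m" by (simp only: power_divide pw)
      then have "z' / z \<in> \<Omega>" using \<open>z \<noteq> 0\<close> ne by (auto simp: \<Omega>_def)
      then have "G c (z' / z * z) \<noteq> G c z" using E(2)[of "z' / z" z] e(3) z(1) \<open>z \<noteq> 0\<close> by force
      then show False using Geq \<open>z \<noteq> 0\<close> by simp
    qed
    then show "t = t'" using z by simp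
  qed
  have "open (T ` ball 0 e)"
    using open_mapping_thm3[OF holomorphic_on_subset[OF T(2) sub] open_ball inj_on_subset[OF T(3) sub]] .
  moreover have "0 \<in> T ` ball 0 e" using T(4) e(1) by (metis centre_in_ball image_eqI)
  ultimately obtain \<rho> where "\<rho> > 0" "ball 0 \<rho> \<subseteq> T ` ball 0 e" using openE by blast
  then show ?thesis using that inj inj_on_subset by blast
qed

text \<open>The source change is injective near 0 because it has a left inverse there. If
  \<open>g \<circ> \<phi> = \<psi> \<circ> f\<close> is injective near 0, then so is
  \<open>f\<close>.\<close>

lemma A_equivalent_injective:
  assumes "A_equivalent f g" "\<rho> > 0" "inj_on g (ball 0 \<rho>)"
  obtains \<rho>' where "\<rho>' > 0" "inj_on f (ball 0 \<rho>')"
proof -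
  obtain \<phi> \<psi> where \<phi>: "biholomorphic_germ \<phi>" and eq: "\<forall>\<^sub>F t in nhds 0. \<psi> (f t) = g (\<phi> t)"
    using assms(1) unfolding A_equivalent_def by blast
  obtain \<psi>' where \<phi>0: "\<phi> 0 = 0" "holomorphic_near \<phi> {0}" and inv: "\<forall>\<^sub>F z in nhds 0. \<psi>' (\<phi> z) = z"
    using \<phi> unfolding biholomorphic_germ_def by blast
  obtain U where U: "open U" "0 \<in> U" "holomorphic_map_on \<phi> U"
    using \<phi>0(2) unfolding holomorphic_near_def by blast
  have "isCont \<phi> 0"
    using holomorphic_map_on_imp_continuous_on[OF U(3)] U by (simp add: continuous_on_eq_continuous_at)
  then have "(\<phi> \<longlongrightarrow> 0) (nhds 0)" using \<phi>0(1) by (simp add: isCont_def tendsto_nhds_iff)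
  then have "\<forall>\<^sub>F t in nhds 0. \<phi> t \<in> ball 0 \<rho>"
    using assms(2) by (intro topological_tendstoD) auto
  then have "\<forall>\<^sub>F t in nhds 0. \<phi> t \<in> ball 0 \<rho> \<and> \<psi>' (\<phi> t) = t \<and> \<psi> (f t) = g (\<phi> t)"
    using inv eq by eventually_elim auto
  then obtain e where e: "e > 0" "\<And>t. dist t 0 < e \<Longrightarrow> \<phi> t \<in> ball 0 \<rho> \<and> \<psi>' (\<phi> t) = t \<and> \<psi> (f t) = g (\<phi> t)"
    unfolding eventually_nhds_metric by blast
  have "inj_on f (ball 0 e)"
  proof (rule inj_onI)
    fix t t' assume t: "t \<in> ball 0 e" "t' \<in> ball 0 e" "f t = f t'"
    then have "g (\<phi> t) = g (\<phi> t')" using e(2)[of t] e(2)[of t'] by (metis dist_commute mem_ball)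
    then have "\<phi> t = \<phi> t'" using assms(3) e(2)[of t] e(2)[of t'] t by (auto simp: inj_on_def dist_commute)
    then show "t = t'" using e(2)[of t] e(2)[of t'] t by (metis dist_commute mem_ball)
  qed
  then show ?thesis using that e(1) by blast
qed

lemma finitely_determined_injective:
  assumes f: "map_germ f" and fd: "finitely_determined f"
  obtains \<rho> where "\<rho> > 0" "inj_on f (ball 0 \<rho>)"
proof -
  obtain R where R: "R > 0" "(fst \<circ> f) holomorphic_on ball 0 R" "(snd \<circ> f) holomorphic_on ball 0 R" "f 0 = 0"
    using map_germ_components[OF f] by blast
  obtain k where k: "\<And>g. map_germ g \<Longrightarrow> same_jet k f g \<Longrightarrow> A_equivalent f g"
    using fd unfolding finitely_determined_def by blast
  \<comment> \<open>A first component with vanishing Taylor series has no order from which to build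
    a coordinate. In that case \<open>t ^ (k + 1)\<close> is added, which leaves the jet
    unchanged.\<close>
  define e :: complex where "e = (if \<exists>n. (deriv ^^ n) (fst \<circ> f) 0 \<noteq> 0 then 0 else 1)"
  define a where "a = (\<lambda>t. (fst \<circ> f) t + e * t ^ Suc k)"
  have ad: "(deriv ^^ i) a 0 = (deriv ^^ i) (fst \<circ> f) 0 + e * (deriv ^^ i) (\<lambda>w. w ^ Suc k) 0" for i
    unfolding a_def by (rule higher_deriv_perturb[OF R(2,1)])
  have ex_nz: "\<exists>n. (deriv ^^ n) a 0 \<noteq> 0"
  proof (cases "\<exists>n. (deriv ^^ n) (fst \<circ> f) 0 \<noteq> 0")
    case True then show ?thesis by (simp add: ad e_def)
  next
    case False
    then have fz: "(deriv ^^ Suc k) (fst \<circ> f) 0 = 0" by blast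
    have e1: "e = 1" unfolding e_def using False by (rule if_not_P)
    have "(deriv ^^ Suc k) a 0 = (deriv ^^ Suc k) (\<lambda>w. w ^ Suc k) 0"
      unfolding ad fz e1 by (simp only: add_0 mult_1)
    then have "(deriv ^^ Suc k) a 0 \<noteq> 0" using higher_deriv_power_self[of "Suc k"] by (simp only: simp_thms)
    then show ?thesis by (rule exI)
  qed
  define m where "m = (LEAST n. (deriv ^^ n) a 0 \<noteq> 0)"
  have m: "(deriv ^^ m) a 0 \<noteq> 0" "\<And>i. i < m \<Longrightarrow> (deriv ^^ i) a 0 = 0"
  proof -
    show "(deriv ^^ m) a 0 \<noteq> 0"
      using LeastI_ex[OF ex_nz] unfolding m_def .
    show "(deriv ^^ i) a 0 = 0" if "i < m" for i
      using not_less_Least[OF that[unfolded m_def]] by (simp only: not_not)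
  qed
  have a0: "a 0 = 0" using R(4) by (simp add: a_def)
  have mpos: "m > 0" using m(1) a0 by (cases m) auto
  have ha: "a holomorphic_on ball 0 R" unfolding a_def by (intro holomorphic_intros R(2))
  \<comment> \<open>The exponent is congruent to 1 modulo \<open>m\<close> and exceeds
    \<open>k\<close> because \<open>m > 0\<close>, so the second component keeps its jet as
    well.\<close>
  define M where "M = m * Suc k + 1"
  have "M mod m = 1 mod m" by (simp only: M_def mod_mult_self4)
  then obtain c \<rho> where c: "\<rho> > 0" "inj_on (\<lambda>t. (a t, (snd \<circ> f) t + c * t ^ M)) (ball 0 \<rho>)"
    using exists_injective_germ[OF ha R(3,1) a0 mpos m] by blast
  define g where "g = (\<lambda>t. (a t, (snd \<circ> f) t + c * t ^ M))"
  have g12: "fst \<circ> g = a" "snd \<circ> g = (\<lambda>t. (snd \<circ> f) t + c * t ^ M)" by (auto simp: g_def)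
  have "map_germ g"
  proof (rule map_germ_I[OF R(1)])
    show "(fst \<circ> g) holomorphic_on ball 0 R" unfolding g12 by (rule ha)
    show "(snd \<circ> g) holomorphic_on ball 0 R" unfolding g12 by (intro holomorphic_intros R(3))
    show "g 0 = 0" using R(4) a0 by (simp add: g_def zero_prod_def M_def)
  qed
  moreover have "same_jet k f g"
    unfolding same_jet_def g12
  proof (intro allI impI conjI)
    fix i assume i: "i \<le> k"
    show "(deriv ^^ i) (fst \<circ> f) 0 = (deriv ^^ i) a 0"
      using higher_deriv_power_0[of i "Suc k"] i by (simp add: ad)
    have "k < M" using mpos by (cases m) (auto simp: M_def)
    then show "(deriv ^^ i) (snd \<circ> f) 0 = (deriv ^^ i) (\<lambda>t. (snd \<circ> f) t + c * t ^ M) 0"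
      using higher_deriv_power_0[of i M] i higher_deriv_perturb[OF R(3,1), of i c M] by simp
  qed
  ultimately have "A_equivalent f g" by (rule k)
  then show ?thesis using A_equivalent_injective[OF _ c(1)] c(2) that unfolding g_def by blast
qed

section \<open>Closeness of nearby slices together with their derivatives\<close>

lemma slice_close:
  fixes G :: "complex \<times> complex \<Rightarrow> complex"
  assumes G: "holomorphic_map_on G U" and sub: "cball 0 A \<times> cball 0 A \<subseteq> U" and A: "A > 0" and \<eta>: "\<eta> > 0"
  shows "\<forall>\<^sub>F s in at 0. (\<lambda>x. G (x, s)) holomorphic_on ball 0 A \<and>
    (\<forall>x\<in>cball 0 A. norm (G (x, s) - G (x, 0)) < \<eta>) \<and>
    (\<forall>x\<in>ball 0 (A / 2). norm (deriv (\<lambda>x. G (x, s)) x - deriv (\<lambda>x. G (x, 0)) x) < \<eta>)"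
proof -
  \<comment> \<open>Cauchy's inequality on discs of radius \<open>A / 2\<close> turns
    \<open>\<eta> * A / 4\<close> into the derivative bound \<open>\<eta> / 2\<close>.\<close>
  define \<eta>' where "\<eta>' = min \<eta> (\<eta> * A / 4)"
  have \<eta>': "\<eta>' > 0" "\<eta>' \<le> \<eta>" "\<eta>' \<le> \<eta> * A / 4" using A \<eta> by (auto simp: \<eta>'_def)
  have "uniformly_continuous_on (cball 0 A \<times> cball 0 A) G"
    by (intro compact_uniformly_continuous continuous_on_subset[OF holomorphic_map_on_imp_continuous_on[OF G] sub]
      compact_Times compact_cball)
  then obtain d where d: "d > 0" "\<And>z w. z \<in> cball 0 A \<times> cball 0 A \<Longrightarrow> w \<in> cball 0 A \<times> cball 0 A \<Longrightarrow>
      dist w z < d \<Longrightarrow> dist (G w) (G z) < \<eta>'"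
    unfolding uniformly_continuous_on_def using \<eta>'(1) by metis
  have hol: "(\<lambda>x. G (x, s)) holomorphic_on ball 0 A" if "s \<in> cball 0 A" for s
    by (rule holomorphic_map_on_slice1[OF G]) (use sub that in auto)
  have main: "(\<lambda>x. G (x, s)) holomorphic_on ball 0 A \<and>
    (\<forall>x\<in>cball 0 A. norm (G (x, s) - G (x, 0)) < \<eta>) \<and>
    (\<forall>x\<in>ball 0 (A / 2). norm (deriv (\<lambda>x. G (x, s)) x - deriv (\<lambda>x. G (x, 0)) x) < \<eta>)"
    if s: "dist s 0 < min d A" for s
  proof (intro conjI ballI)
    have sA: "s \<in> cball 0 A" "0 \<in> cball (0::complex) A" using s A by auto
    show "(\<lambda>x. G (x, s)) holomorphic_on ball 0 A" by (rule hol[OF sA(1)])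
    have c: "norm (G (x, s) - G (x, 0)) < \<eta>'" if "x \<in> cball 0 A" for x
      using d(2)[of "(x, 0)" "(x, s)"] that sA s by (simp add: dist_Pair_Pair dist_norm)
    show "norm (G (x, s) - G (x, 0)) < \<eta>" if "x \<in> cball 0 A" for x using c[OF that] \<eta>'(2) by simp
    fix x :: complex assume x: "x \<in> ball 0 (A / 2)"
    have in_A: "y \<in> ball 0 A" if "y \<in> cball x (A / 2)" for y
    proof -
      have "norm y \<le> norm x + norm (y - x)" by (metis norm_triangle_sub)
      then show ?thesis using that x by (simp add: dist_norm norm_minus_commute)
    qed
    have h: "(\<lambda>x. G (x, s) - G (x, 0)) holomorphic_on ball 0 A"
      by (intro holomorphic_on_diff hol sA)
    have "norm ((deriv ^^ 1) (\<lambda>x. G (x, s) - G (x, 0)) x) \<le> fact 1 * \<eta>' / (A / 2) ^ 1"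
    proof (rule Cauchy_inequality)
      show "(\<lambda>x. G (x, s) - G (x, 0)) holomorphic_on ball x (A / 2)"
        using h by (rule holomorphic_on_subset) (use in_A in auto)
      show "continuous_on (cball x (A / 2)) (\<lambda>x. G (x, s) - G (x, 0))"
        using holomorphic_on_imp_continuous_on[OF h] by (rule continuous_on_subset) (use in_A in auto)
      fix y assume "norm (x - y) = A / 2"
      then have "y \<in> ball 0 A" using in_A[of y] by (simp add: dist_norm)
      then show "norm (G (y, s) - G (y, 0)) \<le> \<eta>'" using c[of y] by simp
    qed (use A in simp)
    also have "fact 1 * \<eta>' / (A / 2) ^ 1 \<le> \<eta> / 2" using \<eta>'(3) A by (simp add: field_simps)
    also have "\<eta> / 2 < \<eta>" using \<eta> by simp
    also have "(deriv ^^ 1) (\<lambda>x. G (x, s) - G (x, 0)) x = deriv (\<lambda>x. G (x, s)) x - deriv (\<lambda>x. G (x, 0)) x"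
      using hol[OF sA(1)] hol[OF sA(2)] x A
      by (auto intro!: deriv_diff simp: holomorphic_on_imp_differentiable_at)
    finally show "norm (deriv (\<lambda>x. G (x, s)) x - deriv (\<lambda>x. G (x, 0)) x) < \<eta>" .
  qed
  show ?thesis unfolding eventually_at using d(1) A
    by (intro exI[of _ "min d A"]) (use main in \<open>auto simp: dist_commute\<close>)
qed

section \<open>Uniqueness of the rational dimension\<close>

lemma homogeneous_system:
  fixes M :: "'u \<Rightarrow> 'e \<Rightarrow> rat"
  assumes "finite E" "finite V" "card E < card V"
  shows "\<exists>x. (\<exists>v\<in>V. x v \<noteq> 0) \<and> (\<forall>v. v \<notin> V \<longrightarrow> x v = 0) \<and> (\<forall>e\<in>E. (\<Sum>v\<in>V. x v * M v e) = 0)"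
  using assms
proof (induction E arbitrary: V M rule: finite_induct)
  case empty
  then obtain v where "v \<in> V" by force
  then show ?case by (intro exI[of _ "\<lambda>w. if w = v then 1 else 0"]) auto
next
  case (insert e E)
  show ?case
  proof (cases "\<forall>v\<in>V. M v e = 0")
    case True
    have "card E < card V" using insert by simp
    then obtain x where "\<exists>v\<in>V. x v \<noteq> 0" "\<forall>v. v \<notin> V \<longrightarrow> x v = 0" "\<forall>e\<in>E. (\<Sum>v\<in>V. x v * M v e) = 0"
      using insert.IH[OF insert.prems(1), of M] by blast
    then show ?thesis using True by (intro exI[of _ x]) auto
  next
    case False
    then obtain w where w: "w \<in> V" "M w e \<noteq> 0" by blast
    define V' where "V' = V - {w}"
    \<comment> \<open>One step of Gaussian elimination: equation \<open>e\<close> removes the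
      unknown \<open>w\<close> from the other equations.\<close>
    define M' where "M' = (\<lambda>v e'. M v e' - M v e / M w e * M w e')"
    have V': "finite V'" "card E < card V'" using insert.prems insert.hyps w by (auto simp: V'_def)
    then obtain x where x: "\<exists>v\<in>V'. x v \<noteq> 0" "\<forall>v. v \<notin> V' \<longrightarrow> x v = 0" "\<forall>e\<in>E. (\<Sum>v\<in>V'. x v * M' v e) = 0"
      using insert.IH[of V' M'] by blast
    define xw where "xw = - (\<Sum>v\<in>V'. x v * M v e) / M w e"
    define y where "y = x(w := xw)"
    have split: "(\<Sum>v\<in>V. y v * M v e') = xw * M w e' + (\<Sum>v\<in>V'. x v * M v e')" for e'
    proof -
      have "(\<Sum>v\<in>V. y v * M v e') = y w * M w e' + (\<Sum>v\<in>V'. y v * M v e')"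
        unfolding V'_def using insert.prems(1) w(1) by (rule sum.remove)
      also have "(\<Sum>v\<in>V'. y v * M v e') = (\<Sum>v\<in>V'. x v * M v e')"
        by (rule sum.cong) (auto simp: y_def V'_def)
      finally show ?thesis by (simp add: y_def)
    qed
    have "(\<Sum>v\<in>V. y v * M v e') = 0" if e': "e' \<in> insert e E" for e'
    proof (cases "e' = e")
      case True
      then show ?thesis using split[of e] w(2) by (simp add: xw_def)
    next
      case False
      then have "(\<Sum>v\<in>V'. x v * M' v e') = 0" using x(3) e' by blast
      moreover have "x v * M' v e' = x v * M v e' - x v * M v e * (M w e' / M w e)" for v
        by (simp add: M'_def algebra_simps)
      then have "(\<Sum>v\<in>V'. x v * M' v e') =
          (\<Sum>v\<in>V'. x v * M v e') - (\<Sum>v\<in>V'. x v * M v e) * (M w e' / M w e)"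
        by (simp add: sum_subtractf sum_distrib_right sum_divide_distrib)
      ultimately show ?thesis using split[of e'] by (simp add: xw_def)
    qed
    moreover have "\<exists>v\<in>V. y v \<noteq> 0" using x(1) by (auto simp: y_def V'_def)
    moreover have "\<forall>v. v \<notin> V \<longrightarrow> y v = 0" using x(2) w(1) by (auto simp: y_def V'_def)
    ultimately show ?thesis by blast
  qed
qed

lemma rat_chains_diff: "c \<in> rat_chains n X \<Longrightarrow> d \<in> rat_chains n X \<Longrightarrow> c - d \<in> rat_chains n X"
  unfolding rat_chains_def using keys_diff[of c d] by blast

lemma rat_chains_scale: "c \<in> rat_chains n X \<Longrightarrow> rat_scale q c \<in> rat_chains n X"
  unfolding rat_chains_def by (auto simp: in_keys_iff)

lemma rat_boundaries_diff: "b \<in> rat_boundaries n X \<Longrightarrow> b' \<in> rat_boundaries n X \<Longrightarrow> b - b' \<in> rat_boundaries n X"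
  unfolding rat_boundaries_def by (auto simp flip: rat_boundary_diff intro!: imageI rat_chains_diff)

lemma rat_boundaries_scale: "b \<in> rat_boundaries n X \<Longrightarrow> rat_scale q b \<in> rat_boundaries n X"
  unfolding rat_boundaries_def by (auto simp flip: rat_boundary_scale intro!: imageI rat_chains_scale)

lemma rat_boundaries_0: "0 \<in> rat_boundaries n X"
proof -
  have "rat_boundary (Suc n) 0 = 0" by (simp add: rat_boundary_def)
  then show ?thesis unfolding rat_boundaries_def rat_chains_def by (metis (mono_tags) imageI keys_zero empty_subsetI mem_Collect_eq)
qed

lemma rat_boundaries_sum:
  assumes "\<And>i. i \<in> I \<Longrightarrow> h i \<in> rat_boundaries n X"
  shows "sum h I \<in> rat_boundaries n X"
  using assms
proof (induction I rule: infinite_finite_induct)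
  case (insert i I)
  then have "h i - (0 - sum h I) \<in> rat_boundaries n X" by (intro rat_boundaries_diff rat_boundaries_0) auto
  then show ?case using insert.hyps by simp
qed (auto simp: rat_boundaries_0)

lemma rat_scale_sum_left: "rat_scale (sum h I) c = (\<Sum>i\<in>I. rat_scale (h i) c)"
  by (rule poly_mapping_eqI) (simp add: lookup_sum sum_distrib_right)

text \<open>Expressing a larger basis through a smaller one gives more unknowns than equations,
  hence a nontrivial relation modulo boundaries. It contradicts uniqueness of the coefficients of
  the zero cycle.\<close>

lemma rat_homology_dim_le:
  assumes "rat_homology_dim n X d" "rat_homology_dim n X d'"
  shows "d' \<le> d"
proof (rule ccontr)
  assume "\<not> d' \<le> d"
  from assms(1) obtain B where B0: "finite B \<and> card B = d \<and> B \<subseteq> rat_cycles n X \<and>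
    (\<forall>z\<in>rat_cycles n X. \<exists>!q. (\<forall>b. b \<notin> B \<longrightarrow> q b = 0) \<and> z - (\<Sum>b\<in>B. rat_scale (q b) b) \<in> rat_boundaries n X)"
    unfolding rat_homology_dim_def ..
  note B = conjunct1[OF B0] conjunct1[OF conjunct2[OF B0]]
  have Bq: "\<exists>q. z - (\<Sum>b\<in>B. rat_scale (q b) b) \<in> rat_boundaries n X" if "z \<in> rat_cycles n X" for z
    using B0 that by blast
  from assms(2) obtain B' where B0': "finite B' \<and> card B' = d' \<and> B' \<subseteq> rat_cycles n X \<and>
    (\<forall>z\<in>rat_cycles n X. \<exists>!q. (\<forall>b. b \<notin> B' \<longrightarrow> q b = 0) \<and> z - (\<Sum>b\<in>B'. rat_scale (q b) b) \<in> rat_boundaries n X)"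
    unfolding rat_homology_dim_def ..
  note B' = conjunct1[OF B0'] conjunct1[OF conjunct2[OF B0']] conjunct1[OF conjunct2[OF conjunct2[OF B0']]]
  have Bq': "q = q'" if "z \<in> rat_cycles n X" "\<forall>b. b \<notin> B' \<longrightarrow> q b = 0" "\<forall>b. b \<notin> B' \<longrightarrow> q' b = 0"
    "z - (\<Sum>b\<in>B'. rat_scale (q b) b) \<in> rat_boundaries n X" "z - (\<Sum>b\<in>B'. rat_scale (q' b) b) \<in> rat_boundaries n X" for z q q'
    using B0' that by blast
  have "\<forall>b'\<in>B'. \<exists>q. b' - (\<Sum>b\<in>B. rat_scale (q b) b) \<in> rat_boundaries n X"
    using Bq B'(3) by blast
  from bchoice[OF this] obtain M where
    M: "\<forall>b'\<in>B'. b' - (\<Sum>b\<in>B. rat_scale (M b' b) b) \<in> rat_boundaries n X" ..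
  have "card B < card B'" using \<open>\<not> d' \<le> d\<close> B(2) B'(2) by simp
  from homogeneous_system[OF B(1) B'(1) this, of M]
  obtain x where x: "\<exists>b\<in>B'. x b \<noteq> 0" "\<forall>b. b \<notin> B' \<longrightarrow> x b = 0" "\<forall>b\<in>B. (\<Sum>b'\<in>B'. x b' * M b' b) = 0"
    by blast
  have "(\<Sum>b'\<in>B'. rat_scale (x b') (b' - (\<Sum>b\<in>B. rat_scale (M b' b) b))) \<in> rat_boundaries n X"
    using M by (intro rat_boundaries_sum rat_boundaries_scale) blast
  also have "(\<Sum>b'\<in>B'. rat_scale (x b') (b' - (\<Sum>b\<in>B. rat_scale (M b' b) b))) =
      (\<Sum>b'\<in>B'. rat_scale (x b') b') - (\<Sum>b'\<in>B'. \<Sum>b\<in>B. rat_scale (x b' * M b' b) b)"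
    by (simp add: rat_scale_diff rat_scale_sum rat_scale_scale sum_subtractf)
  also have "(\<Sum>b'\<in>B'. \<Sum>b\<in>B. rat_scale (x b' * M b' b) b) = (\<Sum>b\<in>B. \<Sum>b'\<in>B'. rat_scale (x b' * M b' b) b)"
    by (rule sum.swap)
  also have "\<dots> = (\<Sum>b\<in>B. rat_scale (\<Sum>b'\<in>B'. x b' * M b' b) b)" by (simp add: rat_scale_sum_left)
  also have "\<dots> = 0"
  proof (rule sum.neutral, rule ballI)
    fix b assume "b \<in> B"
    then have "(\<Sum>b'\<in>B'. x b' * M b' b) = 0" using x(3) by blast
    then show "rat_scale (\<Sum>b'\<in>B'. x b' * M b' b) b = 0" by (intro poly_mapping_eqI) simp
  qed
  finally have S: "(\<Sum>b'\<in>B'. rat_scale (x b') b') \<in> rat_boundaries n X" by simp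
  have "0 - (\<Sum>b'\<in>B'. rat_scale (x b') b') \<in> rat_boundaries n X"
    by (rule rat_boundaries_diff[OF rat_boundaries_0 S])
  moreover have "0 - (\<Sum>b'\<in>B'. rat_scale 0 b') \<in> rat_boundaries n X"
  proof -
    have "rat_scale 0 b = 0" for b :: "'a rat_chain" by (rule poly_mapping_eqI) simp
    then show ?thesis by (simp add: rat_boundaries_0)
  qed
  moreover have "0 \<in> rat_cycles n X"
    by (simp add: rat_cycles_def rat_chains_def rat_boundary_def)
  ultimately have "x = (\<lambda>_. 0)" using x(2) by (intro Bq'[of 0 x "\<lambda>_. 0"]) auto
  then show False using x(1) by simp
qed

lemma rat_homology_dim_unique: "rat_homology_dim n X d \<Longrightarrow> rat_homology_dim n X d' \<Longrightarrow> d = d'"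
  by (rule antisym) (rule rat_homology_dim_le; assumption)+

section \<open>Growth of the norm along rays\<close>

definition radial_growth :: "(complex \<Rightarrow> complex \<times> complex) \<Rightarrow> complex \<Rightarrow> real"
  where "radial_growth g x = inner (fst (g x)) (x * deriv (fst \<circ> g) x) + inner (snd (g x)) (x * deriv (snd \<circ> g) x)"

text \<open>\<open>2 * radial_growth g (t * x)\<close> is \<open>t\<close> times the derivative in
  \<open>t\<close> of \<open>(norm (g (t * x)))\<^sup>2\<close>. Moving inwards from a point of the
  sublevel set, the norm does not increase until the disc of radius \<open>\<rho>\<close> is
  reached, and there \<open>small\<close> takes over.\<close>

lemma radial_growth_starlike:
  assumes g: "(fst \<circ> g) holomorphic_on ball 0 r" "(snd \<circ> g) holomorphic_on ball 0 r"
    and small: "\<And>x. x \<in> ball 0 r \<Longrightarrow> norm x < \<rho> \<Longrightarrow> g x \<in> ball 0 \<epsilon>"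
    and grow: "\<And>x. x \<in> ball 0 r \<Longrightarrow> \<rho> \<le> norm x \<Longrightarrow> radial_growth g x > 0" and \<rho>: "\<rho> > 0"
    and x: "x \<in> {x \<in> ball 0 r. g x \<in> ball 0 \<epsilon>}"
  shows "closed_segment 0 x \<subseteq> {x \<in> ball 0 r. g x \<in> ball 0 \<epsilon>}"
proof
  fix y assume "y \<in> closed_segment 0 x"
  then obtain \<tau> where \<tau>: "0 \<le> \<tau>" "\<tau> \<le> 1" "y = \<tau> *\<^sub>R x" by (auto simp: closed_segment_def)
  have in_r: "of_real t * x \<in> ball 0 r" if "0 \<le> t" "t \<le> 1" for t
  proof -
    have "norm (of_real t * x) \<le> 1 * norm x" unfolding norm_mult using that by (intro mult_right_mono) auto
    then show ?thesis using x by simp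
  qed
  have yr: "y \<in> ball 0 r" using in_r[OF \<tau>(1,2)] \<tau>(3) by (simp add: scaleR_conv_of_real)
  show "y \<in> {x \<in> ball 0 r. g x \<in> ball 0 \<epsilon>}"
  proof (cases "norm y < \<rho>")
    case True
    then show ?thesis using small yr by blast
  next
    case False
    define \<theta> where "\<theta> = (\<lambda>t::real. inner (fst (g (of_real t * x))) (fst (g (of_real t * x))) +
      inner (snd (g (of_real t * x))) (snd (g (of_real t * x))))"
    have pos: "\<tau> > 0" using False \<rho> \<tau> by (cases "\<tau> = 0") auto
    have sq: "\<theta> t = (norm (g (of_real t * x)))\<^sup>2" for t
      by (cases "g (of_real t * x)") (simp add: \<theta>_def norm_Pair power2_norm_eq_inner)
    have comp: "((\<lambda>t. inner (h (of_real t * x)) (h (of_real t * x))) has_real_derivative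
        2 * inner (h (of_real t * x)) (deriv h (of_real t * x) * x)) (at t)"
      if h: "h holomorphic_on ball 0 r" and t: "0 \<le> t" "t \<le> 1" for h :: "complex \<Rightarrow> complex" and t
    proof -
      have "((\<lambda>z. h (z * x)) has_field_derivative deriv h (of_real t * x) * x) (at (of_real t))"
        by (rule DERIV_chain2[where g = "\<lambda>z. z * x" and x = "of_real t", OF holomorphic_derivI[OF h open_ball in_r[OF t]]])
          (auto intro!: derivative_eq_intros)
      then have "((\<lambda>t. h (of_real t * x)) has_vector_derivative deriv h (of_real t * x) * x) (at t)"
        by (rule has_vector_derivative_real_field)
      then have d: "((\<lambda>t. h (of_real t * x)) has_derivative (\<lambda>v. v *\<^sub>R (deriv h (of_real t * x) * x))) (at t)"
        by (simp add: has_vector_derivative_def)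
      have "((\<lambda>t. inner (h (of_real t * x)) (h (of_real t * x))) has_derivative
          (\<lambda>v. inner (h (of_real t * x)) (v *\<^sub>R (deriv h (of_real t * x) * x)) +
            inner (v *\<^sub>R (deriv h (of_real t * x) * x)) (h (of_real t * x)))) (at t)"
        by (rule has_derivative_inner[OF d d])
      then show ?thesis
        unfolding has_field_derivative_def
        by (rule has_derivative_eq_rhs) (auto simp: fun_eq_iff inner_commute algebra_simps)
    qed
    have "\<theta> \<tau> \<le> \<theta> 1"
    proof (rule DERIV_nonneg_imp_nondecreasing[OF \<tau>(2)])
      fix t assume t: "\<tau> \<le> t" "t \<le> 1"
      have t0: "0 \<le> t" "t > 0" using t pos by auto
      let ?y = "of_real t * x"
      have "norm ?y \<ge> norm y" unfolding \<tau>(3) using t pos by (simp add: norm_mult mult_right_mono)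
      then have "radial_growth g ?y > 0" using grow[OF in_r[OF t0(1) t(2)]] False by simp
      moreover have "radial_growth g ?y = t * (inner (fst (g ?y)) (deriv (fst \<circ> g) ?y * x) + inner (snd (g ?y)) (deriv (snd \<circ> g) ?y * x))"
      proof -
        have "?y * w = t *\<^sub>R (w * x)" for w :: complex by (simp add: scaleR_conv_of_real mult_ac)
        then show ?thesis by (simp add: radial_growth_def distrib_left)
      qed
      ultimately have "0 \<le> 2 * inner (fst (g ?y)) (deriv (fst \<circ> g) ?y * x) + 2 * inner (snd (g ?y)) (deriv (snd \<circ> g) ?y * x)"
        using t0(2) by (simp add: zero_less_mult_iff)
      moreover have "(\<theta> has_real_derivative
          2 * inner (fst (g ?y)) (deriv (fst \<circ> g) ?y * x) + 2 * inner (snd (g ?y)) (deriv (snd \<circ> g) ?y * x)) (at t)"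
        unfolding \<theta>_def using DERIV_add[OF comp[OF g(1) t0(1) t(2)] comp[OF g(2) t0(1) t(2)]] by simp
      ultimately show "\<exists>y. (\<theta> has_real_derivative y) (at t) \<and> 0 \<le> y" by blast
    qed
    then have "(norm (g y))\<^sup>2 \<le> (norm (g x))\<^sup>2" unfolding sq using \<tau>(3) by (simp add: scaleR_conv_of_real)
    then have "norm (g y) \<le> norm (g x)" by (simp add: power2_le_iff_abs_le)
    then show ?thesis using yr x by auto
  qed
qed

lemma funpow_deriv_shift: "m \<ge> 1 \<Longrightarrow> (deriv ^^ (m - 1)) (deriv g) = (deriv ^^ m) g"
  by (cases m) (simp_all add: funpow_Suc_right del: funpow.simps)

lemma deriv_order_asymptotic:
  assumes g: "g holomorphic_on S" "open S" "0 \<in> S" and m: "m \<ge> 1"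
    and low: "\<And>i. i < m \<Longrightarrow> (deriv ^^ i) g 0 = 0"
  shows "((\<lambda>t. deriv g t / t ^ (m - 1)) \<longlongrightarrow> of_nat m * ((deriv ^^ m) g 0 / fact m)) (at 0)"
proof -
  have "((\<lambda>t. deriv g t / t ^ (m - 1)) \<longlongrightarrow> (deriv ^^ (m - 1)) (deriv g) 0 / fact (m - 1)) (at 0)"
  proof (rule order_asymptotic[OF holomorphic_deriv[OF g(1,2)] g(2,3)])
    fix i assume "i < m - 1"
    then have "Suc i < m" by linarith
    then have "(deriv ^^ Suc i) g 0 = 0" by (rule low)
    then show "(deriv ^^ i) (deriv g) 0 = 0" by (simp only: funpow_Suc_right comp_apply)
  qed
  moreover have "(fact m :: complex) = of_nat m * fact (m - 1)" using m by (simp add: fact_reduce)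
  ultimately show ?thesis using m unfolding funpow_deriv_shift[OF m] by simp
qed

text \<open>With leading coefficient \<open>v\<close>, \<open>f x\<close> behaves like
  \<open>v * x ^ m\<close> and \<open>x * f' x\<close> like \<open>m * v * x ^ m\<close>. Divided by
  \<open>norm x ^ (2 * m)\<close>, the growth tends to
  \<open>m * (norm v)\<^sup>2 > 0\<close>.\<close>

lemma eventually_radial_growth:
  assumes f: "(fst \<circ> f) holomorphic_on S" "(snd \<circ> f) holomorphic_on S" "open S" "0 \<in> S" and m: "m \<ge> 1"
    and low: "\<And>i. i < m \<Longrightarrow> (deriv ^^ i) (fst \<circ> f) 0 = 0 \<and> (deriv ^^ i) (snd \<circ> f) 0 = 0"
    and top: "(deriv ^^ m) (fst \<circ> f) 0 \<noteq> 0 \<or> (deriv ^^ m) (snd \<circ> f) 0 \<noteq> 0"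
  shows "\<forall>\<^sub>F x in at 0. radial_growth f x > 0"
proof -
  define v where "v h = (deriv ^^ m) h 0 / fact m" for h :: "complex \<Rightarrow> complex"
  have lim: "((\<lambda>x. inner (h x / x ^ m) (x * deriv h x / x ^ m)) \<longlongrightarrow> real m * (norm (v h))\<^sup>2) (at 0)"
    if h: "h holomorphic_on S" and lowh: "\<And>i. i < m \<Longrightarrow> (deriv ^^ i) h 0 = 0" for h
  proof -
    have h0: "((\<lambda>t. h t / t ^ m) \<longlongrightarrow> v h) (at 0)"
      unfolding v_def by (rule order_asymptotic[OF h f(3,4) lowh])
    have h1: "((\<lambda>t. deriv h t / t ^ (m - 1)) \<longlongrightarrow> of_nat m * v h) (at 0)"
      unfolding v_def by (rule deriv_order_asymptotic[OF h f(3,4) m lowh])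
    have "\<forall>\<^sub>F x in at (0::complex). x \<noteq> 0" by (simp add: eventually_at_filter)
    then have ev: "\<forall>\<^sub>F x in at 0. deriv h x / x ^ (m - 1) = x * deriv h x / x ^ m"
      by eventually_elim (use m in \<open>simp add: power_eq_if\<close>)
    have "((\<lambda>x. x * deriv h x / x ^ m) \<longlongrightarrow> of_nat m * v h) (at 0)"
      by (rule Lim_transform_eventually[OF h1 ev])
    then have "((\<lambda>x. inner (h x / x ^ m) (x * deriv h x / x ^ m)) \<longlongrightarrow> inner (v h) (of_nat m * v h)) (at 0)"
      by (rule tendsto_inner[OF h0])
    moreover have "of_nat m * v h = real m *\<^sub>R v h" by (simp add: scaleR_conv_of_real)
    ultimately show ?thesis by (simp add: power2_norm_eq_inner)
  qed
  have l1: "((\<lambda>x. inner ((fst \<circ> f) x / x ^ m) (x * deriv (fst \<circ> f) x / x ^ m)) \<longlongrightarrow> real m * (norm (v (fst \<circ> f)))\<^sup>2) (at 0)"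
    by (rule lim[OF f(1)]) (use low in blast)
  have l2: "((\<lambda>x. inner ((snd \<circ> f) x / x ^ m) (x * deriv (snd \<circ> f) x / x ^ m)) \<longlongrightarrow> real m * (norm (v (snd \<circ> f)))\<^sup>2) (at 0)"
    by (rule lim[OF f(2)]) (use low in blast)
  have "0 < real m * (norm (v (fst \<circ> f)))\<^sup>2 + real m * (norm (v (snd \<circ> f)))\<^sup>2"
    using top m by (auto simp: v_def add_pos_nonneg add_nonneg_pos)
  then have "\<forall>\<^sub>F x in at 0. 0 < inner ((fst \<circ> f) x / x ^ m) (x * deriv (fst \<circ> f) x / x ^ m)
      + inner ((snd \<circ> f) x / x ^ m) (x * deriv (snd \<circ> f) x / x ^ m)"
    by (rule order_tendstoD(1)[OF tendsto_add[OF l1 l2]])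
  then show ?thesis
  proof eventually_elim
    case (elim x)
    have "inner (k * a) (k * b) = (norm k)\<^sup>2 * inner a b" for a b k :: complex
      unfolding cmod_power2 inner_complex_def by (simp add: power2_eq_square algebra_simps)
    from this[of "inverse (x ^ m)"]
    have "inner (a / x ^ m) (b / x ^ m) = inner a b / (norm (x ^ m))\<^sup>2" for a b :: complex
      by (simp add: divide_inverse mult.commute norm_inverse power_inverse)
    then have "0 < radial_growth f x / (norm (x ^ m))\<^sup>2"
      using elim by (simp add: radial_growth_def add_divide_distrib)
    then show ?case by (auto simp: zero_less_divide_iff)
  qed
qed

section \<open>Critical points on a nodal curve\<close>

lemma holomorphic_map_on_lincomb:
  fixes F :: "'a::complex_normed_vector \<Rightarrow> complex \<times> complex"
  assumes "holomorphic_map_on F U"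
  shows "holomorphic_map_on (\<lambda>z. a * fst (F z) + b * snd (F z)) U"
  unfolding holomorphic_map_on_def
proof
  fix z assume "z \<in> U"
  then obtain D where D: "(F has_derivative D) (at z)" "\<forall>c v. D (scaleC c v) = scaleC c (D v)"
    using assms unfolding holomorphic_map_on_def by blast
  have "((\<lambda>z. a * fst (F z) + b * snd (F z)) has_derivative (\<lambda>v. a * fst (D v) + b * snd (D v))) (at z)"
    by (intro has_derivative_add has_derivative_mult_right has_derivative_fst has_derivative_snd D)
  moreover have "\<forall>c v. a * fst (D (scaleC c v)) + b * snd (D (scaleC c v)) = scaleC c (a * fst (D v) + b * snd (D v))"
    using D(2) by (simp add: scaleC_prod_def scaleC_complex_def algebra_simps)
  ultimately show "\<exists>D. ((\<lambda>z. a * fst (F z) + b * snd (F z)) has_derivative D) (at z) \<and>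
      (\<forall>c v. D (scaleC c v) = scaleC c (D v))"
    by (intro exI conjI)
qed

lemma locally_stable_on_subset:
  assumes "locally_stable_on g D" "D' \<subseteq> D"
  shows "locally_stable_on g D'"
  using assms unfolding locally_stable_on_def holomorphic_map_on_def by (meson subset_eq)

lemma double_pair_in_stratum:
  assumes st: "locally_stable_on g D'" "open D'" "D \<subseteq> D'"
    and tu: "t \<in> D" "u \<in> D" "t \<noteq> u" "g t = g u"
  shows "{x \<in> D. g x = g t} = {t, u}" "g t \<in> double_point_stratum g D"
proof -
  have in': "t \<in> D'" "u \<in> D'" using tu st(3) by auto
  show eq: "{x \<in> D. g x = g t} = {t, u}"
  proof
    show "{x \<in> D. g x = g t} \<subseteq> {t, u}"
    proof
      fix x assume "x \<in> {x \<in> D. g x = g t}"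
      then have "x \<in> D'" "g t = g x" using st(3) by auto
      then show "x \<in> {t, u}"
        using stable_imp_no_triple_point[OF st(1,2), of t u x] in' tu(3,4) by blast
    qed
  qed (use tu in auto)
  show "g t \<in> double_point_stratum g D"
    unfolding double_point_stratum_def mem_Collect_eq
    using eq tu(3) stable_imp_transverse[OF st(1,2) in' tu(3,4)] by blast
qed

text \<open>A double point has exactly two parameters, hence the factor 2. Any choice of their order
  supplies the \<open>l\<close> and \<open>u\<close> of \<open>glued_disc\<close>.\<close>

lemma node_structure:
  assumes D: "open D" "0 \<in> D" "\<And>x. x \<in> D \<Longrightarrow> closed_segment 0 x \<subseteq> D"
    and st: "locally_stable_on g D'" "open D'" "D \<subseteq> D'"
    and closed_map: "\<And>C. closedin (top_of_set D) C \<Longrightarrow> closedin (top_of_set (g ` D)) (g ` C)"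
    and fin: "finite {t \<in> D. \<exists>u\<in>D. u \<noteq> t \<and> g u = g t}"
  shows "finite (double_point_stratum g D)"
    "card {t \<in> D. \<exists>u\<in>D. u \<noteq> t \<and> g u = g t} = 2 * card (double_point_stratum g D)"
    "rat_homology_dim 1 (top_of_set (g ` D)) (card (double_point_stratum g D))"
proof -
  let ?S = "{t \<in> D. \<exists>u\<in>D. u \<noteq> t \<and> g u = g t}" and ?P = "double_point_stratum g D"
  have P_eq: "?P = g ` ?S"
  proof (intro equalityI subsetI)
    fix y assume "y \<in> ?P"
    then obtain t u where tu: "t \<noteq> u" "{x \<in> D. g x = y} = {t, u}"
      unfolding double_point_stratum_def by blast
    then have "t \<in> {x \<in> D. g x = y}" "u \<in> {x \<in> D. g x = y}" by simp_all
    then have "t \<in> ?S" "y = g t" using tu(1) by auto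
    then show "y \<in> g ` ?S" by (rule rev_image_eqI)
  next
    fix y assume "y \<in> g ` ?S"
    then obtain t u where "t \<in> D" "u \<in> D" "u \<noteq> t" "g u = g t" "y = g t" by blast
    then show "y \<in> ?P" using double_pair_in_stratum(2)[OF st, of t u] by simp
  qed
  then show finP: "finite ?P" using fin by simp
  have "\<forall>y\<in>?P. \<exists>z. fst z \<noteq> snd z \<and> {x \<in> D. g x = y} = {fst z, snd z}"
    unfolding double_point_stratum_def by force
  from bchoice[OF this] obtain z where
    z: "\<forall>y\<in>?P. fst (z y) \<noteq> snd (z y) \<and> {x \<in> D. g x = y} = {fst (z y), snd (z y)}" ..
  define l u where "l = (\<lambda>y. fst (z y))" and "u = (\<lambda>y. snd (z y))"
  have lu: "l y \<noteq> u y" "{x \<in> D. g x = y} = {l y, u y}" if "y \<in> ?P" for y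
    using z that by (auto simp: l_def u_def)
  have "?S = (\<Union>y\<in>?P. {x \<in> D. g x = y})"
  proof (intro equalityI subsetI)
    fix t assume "t \<in> ?S"
    then show "t \<in> (\<Union>y\<in>?P. {x \<in> D. g x = y})" unfolding P_eq by blast
  next
    fix t assume "t \<in> (\<Union>y\<in>?P. {x \<in> D. g x = y})"
    then obtain y where y: "y \<in> ?P" "t \<in> D" "g t = y" by blast
    have "l y \<in> D" "u y \<in> D" "g (l y) = y" "g (u y) = y" using lu(2)[OF y(1)] by auto
    then have "\<exists>u\<in>D. u \<noteq> t \<and> g u = y"
      using lu(1)[OF y(1)]
      by (cases "t = l y") (simp_all add: bexI[of _ "u y"] bexI[of _ "l y"])
    then show "t \<in> ?S" using y(2,3) by simp
  qed
  also have "card \<dots> = (\<Sum>y\<in>?P. card {x \<in> D. g x = y})"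
    by (rule card_UN_disjoint[OF finP]) (use lu(2) in simp, blast)
  also have "\<dots> = (\<Sum>y\<in>?P. 2)" by (rule sum.cong) (auto simp: lu)
  finally show "card ?S = 2 * card ?P" by simp
  have "glued_disc D g ?P l u"
  proof
    show "continuous_on D g"
      using holomorphic_map_on_imp_continuous_on[of g D'] st(1)
      by (intro continuous_on_subset[OF _ st(3)]) (simp add: locally_stable_on_def)
    show "l y \<in> D \<and> u y \<in> D \<and> l y \<noteq> u y \<and> g (l y) = y \<and> g (u y) = y" if "y \<in> ?P" for y
      using lu[OF that] by blast
    fix x x' assume x: "x \<in> D" "x' \<in> D" "g x = g x'" "x \<noteq> x'"
    note d = double_pair_in_stratum[OF st x(1,2,4,3)]
    then show "g x \<in> ?P \<and> {x, x'} = {l (g x), u (g x)}" using lu(2)[OF d(2)] by simp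
  qed (use D closed_map finP in auto)
  then show "rat_homology_dim 1 (top_of_set (g ` D)) (card ?P)"
    by (rule glued_disc.rat_homology_dim_glued_disc)
qed

lemma deriv_linear_comp:
  assumes "(fst \<circ> g) holomorphic_on D" "(snd \<circ> g) holomorphic_on D" "open D" "t \<in> D"
  shows "deriv (\<lambda>x. a * fst (g x) + b * snd (g x)) t = a * fst (curve_deriv g t) + b * snd (curve_deriv g t)"
proof -
  have "((\<lambda>x. a * (fst \<circ> g) x + b * (snd \<circ> g) x) has_field_derivative
      a * deriv (fst \<circ> g) t + b * deriv (snd \<circ> g) t) (at t)"
    by (intro DERIV_add DERIV_cmult holomorphic_derivI[OF assms(1,3,4)] holomorphic_derivI[OF assms(2,3,4)])
  then show ?thesis by (simp add: DERIV_imp_deriv curve_deriv_def comp_def)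
qed

text \<open>By the Morse conditions \<open>p\<close> is nonzero on tangent lines at nodes, so a zero
  of the derivative is the only parameter of a smooth point. Nondegeneracy makes these zeros simple,
  and the sum of orders becomes a cardinality.\<close>

lemma critical_count:
  assumes D: "open D" and st: "locally_stable_on g D'" "open D'" "D \<subseteq> D'"
    and p: "p = (\<lambda>z. a * fst z + b * snd z)"
    and morse: "stratified_morse p g D" and finP: "finite (double_point_stratum g D)"
    and Z: "finite {t \<in> D. deriv (p \<circ> g) t = 0}"
      "(\<Sum>t\<in>{t \<in> D. deriv (p \<circ> g) t = 0}. zorder (deriv (p \<circ> g)) t) = int k"
  shows "card (stratified_critical_points p g D) = card (double_point_stratum g D) + k"
proof -
  let ?Z = "{t \<in> D. deriv (p \<circ> g) t = 0}" and ?P = "double_point_stratum g D"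
  have hg': "(fst \<circ> g) holomorphic_on D'" "(snd \<circ> g) holomorphic_on D'"
    using st(1) holomorphic_map_on_curve_iff[OF st(2)] unfolding locally_stable_on_def by auto
  then have hg: "(fst \<circ> g) holomorphic_on D" "(snd \<circ> g) holomorphic_on D"
    using holomorphic_on_subset[OF hg'(1) st(3)] holomorphic_on_subset[OF hg'(2) st(3)] by auto
  have pg: "p \<circ> g = (\<lambda>x. a * fst (g x) + b * snd (g x))" by (auto simp: p)
  have hpg: "(p \<circ> g) holomorphic_on D"
    using hg unfolding pg unfolding comp_def by (intro holomorphic_intros)
  have dpg: "deriv (p \<circ> g) t = p (curve_deriv g t)" if "t \<in> D" for t
    unfolding pg using deriv_linear_comp[OF hg D that] by (simp add: p)
  have single: "{x \<in> D. g x = g t} = {t}" if t: "t \<in> ?Z" for t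
  proof -
    have "g t \<notin> ?P" using morse t dpg unfolding stratified_morse_def by auto
    then show ?thesis using double_pair_in_stratum(2)[OF st, of t] t by force
  qed
  have smooth: "smooth_critical_params p g D = ?Z"
  proof
    show "?Z \<subseteq> smooth_critical_params p g D"
    proof
      fix t assume t: "t \<in> ?Z"
      have "curve_deriv g t \<noteq> 0" using stable_imp_immersion[OF st(1,2)] t st(3) by blast
      then have "g t \<in> smooth_stratum g D" unfolding smooth_stratum_def using single[OF t] by blast
      then show "t \<in> smooth_critical_params p g D" using t unfolding smooth_critical_params_def by blast
    qed
  qed (auto simp: smooth_critical_params_def)
  have "zorder (deriv (p \<circ> g)) t = 1" if t: "t \<in> ?Z" for t
  proof (rule zorder_simple_zero[OF holomorphic_deriv[OF hpg D] D])
    show "deriv (deriv (p \<circ> g)) t \<noteq> 0" using morse t unfolding stratified_morse_def smooth by blast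
  qed (use t in auto)
  then have card_Z: "card ?Z = k" using Z(2) by simp
  have "inj_on g ?Z"
  proof (rule inj_onI)
    fix t t' assume t: "t \<in> ?Z" "t' \<in> ?Z" "g t = g t'"
    then have "t' \<in> {x \<in> D. g x = g t}" by simp
    then show "t = t'" using single[OF t(1)] by simp
  qed
  then have card_img: "card (g ` ?Z) = k" using card_Z by (simp add: card_image)
  have "?P \<inter> g ` ?Z = {}"
  proof (rule ccontr)
    assume "?P \<inter> g ` ?Z \<noteq> {}"
    then obtain t where t: "t \<in> ?Z" "g t \<in> ?P" by blast
    then show False using morse dpg unfolding stratified_morse_def by auto
  qed
  then show ?thesis
    unfolding stratified_critical_points_def smooth
    using finP Z(1) card_img by (simp add: card_Un_disjoint)
qed

text \<open>A sublevel set in a compact set: the trace on \<open>g\<close>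
  D\<open>of the compact image of\<close>K \<inter> L\<open>is\<close>g \<open>C\<close>, because
  membership in \<open>D\<close> depends within \<open>K\<close> only on the value of
  \<open>g\<close>.\<close>

lemma closed_map_of_bounded_preimage:
  fixes g :: "complex \<Rightarrow> complex \<times> complex"
  assumes D: "D = {x \<in> K. norm (g x) < \<epsilon>}" and K: "compact K" "continuous_on K g"
    and C: "closedin (top_of_set D) C"
  shows "closedin (top_of_set (g ` D)) (g ` C)"
proof -
  obtain L where L: "closed L" "C = D \<inter> L" using C by (auto simp: closedin_closed)
  have "compact (g ` (K \<inter> L))"
    using K L(1) by (intro compact_continuous_image compact_Int_closed) (auto intro: continuous_on_subset)
  then have cl: "closed (g ` (K \<inter> L))" by (rule compact_imp_closed)
  have "g ` C = g ` D \<inter> g ` (K \<inter> L)"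
  proof
    show "g ` D \<inter> g ` (K \<inter> L) \<subseteq> g ` C"
    proof
      fix y assume "y \<in> g ` D \<inter> g ` (K \<inter> L)"
      then obtain x x' where "x \<in> D" "y = g x" "x' \<in> K" "x' \<in> L" "y = g x'" by blast
      then have "x' \<in> D" "x' \<in> L" unfolding D by auto
      then show "y \<in> g ` C" using L(2) \<open>y = g x'\<close> by blast
    qed
    show "g ` C \<subseteq> g ` D \<inter> g ` (K \<inter> L)" using L(2) D by auto
  qed
  then show ?thesis using cl by (auto simp: closedin_closed)
qed

section \<open>Projected germs and their perturbations\<close>

lemma for_smallI:
  assumes "r1 > 0" "\<And>r. 0 < r \<Longrightarrow> r < r1 \<Longrightarrow> \<exists>e>0. \<forall>\<epsilon>. 0 < \<epsilon> \<and> \<epsilon> < e \<longrightarrow> (\<forall>\<^sub>F s in at 0. P r \<epsilon> s)"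
  shows "for_small P"
proof -
  have "\<forall>\<^sub>F \<epsilon> in at_right 0. \<forall>\<^sub>F s in at 0. P r \<epsilon> s" if "0 < r" "r < r1" for r
    using assms(2)[OF that] eventually_at_right[of 0 "1::real" "\<lambda>\<epsilon>. \<forall>\<^sub>F s in at 0. P r \<epsilon> s"] by auto
  then show ?thesis
    unfolding for_small_def
    using assms(1) eventually_at_right[of 0 "1::real" "\<lambda>r. \<forall>\<^sub>F \<epsilon> in at_right 0. \<forall>\<^sub>F s in at 0. P r \<epsilon> s"]
    by auto
qed

lemma for_small_mono:
  assumes "for_small P" "\<And>r \<epsilon> s. P r \<epsilon> s \<Longrightarrow> Q r \<epsilon> s"
  shows "for_small Q"
  using assms(1) unfolding for_small_def by (auto elim!: eventually_mono intro: assms(2))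

lemma for_small_conj:
  assumes "for_small P" "for_small Q"
  shows "for_small (\<lambda>r \<epsilon> s. P r \<epsilon> s \<and> Q r \<epsilon> s)"
  using assms unfolding for_small_def by (simp add: eventually_conj_iff)

lemma not_for_small_False: "\<not> for_small (\<lambda>r \<epsilon> s. False)"
  by (simp add: for_small_def eventually_False trivial_limit_at_right_real)

text \<open>The nested filters are proper, so two properties that hold for small parameters hold
  together for some choice of them.\<close>

lemma for_small_dim_unique:
  assumes "for_small (\<lambda>r \<epsilon> s. rat_homology_dim n (X r \<epsilon> s) d)" "for_small (\<lambda>r \<epsilon> s. rat_homology_dim n (X r \<epsilon> s) d')"
  shows "d = d'"
proof (rule ccontr)
  assume "d \<noteq> d'"
  then have "for_small (\<lambda>r \<epsilon> s. False)"
    using rat_homology_dim_unique by (intro for_small_mono[OF for_small_conj[OF assms]]) blast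
  then show False using not_for_small_False by blast
qed

section \<open>Topology and critical points from estimates on discs\<close>

lemma continuous_positive_bound:
  fixes h :: "complex \<Rightarrow> real"
  assumes "compact K" "continuous_on K h" "\<And>x. x \<in> K \<Longrightarrow> h x > 0"
  obtains c where "c > 0" "\<And>x. x \<in> K \<Longrightarrow> c \<le> h x"
proof (cases "K = {}")
  case False
  then obtain x where "x \<in> K" "\<forall>y\<in>K. h x \<le> h y" using continuous_attains_inf[OF assms(1) _ assms(2)] by blast
  then show ?thesis using that[of "h x"] assms(3) by blast
qed (use that[of 1] in auto)

lemma compact_annulus: "compact {x::complex. \<rho> \<le> norm x \<and> norm x \<le> r}"
proof -
  have "{x::complex. \<rho> \<le> norm x \<and> norm x \<le> r} = cball 0 r - ball 0 \<rho>" by auto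
  then show ?thesis using compact_diff[OF compact_cball open_ball] by metis
qed

text \<open>All analytic input is reduced to inequalities. Double points are counted in the
  coordinate of \<open>T\<close> and critical points in the original one; both lie in the disc of
  radius \<open>\<rho>\<close>, which is part of \<open>D\<close>.\<close>

lemma region_conclusion:
  fixes g :: "complex \<Rightarrow> complex \<times> complex"
  assumes stable: "locally_stable_on g (ball 0 A)" and r: "r < A" "0 < \<rho>" "\<rho> < r"
    and T: "inj_on T S" "ball 0 r \<subseteq> T ` S"
    and small: "\<And>x. norm x < \<rho> \<Longrightarrow> norm (g x) < \<epsilon>"
    and large: "\<And>x. r / 2 < norm x \<Longrightarrow> norm x < r \<Longrightarrow> \<epsilon> \<le> norm (g x)"
    and grow: "\<And>x. \<rho> \<le> norm x \<Longrightarrow> norm x < r \<Longrightarrow> radial_growth g x > 0"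
    and N: "N = {t \<in> S. \<exists>u\<in>S. u \<noteq> t \<and> g (T u) = g (T t)}" "finite N" "card N = K" "T ` N \<subseteq> ball 0 \<rho>"
    and p: "p = (\<lambda>z. a * fst z + b * snd z)"
    and nz: "\<And>x. \<rho> \<le> norm x \<Longrightarrow> norm x < r \<Longrightarrow> deriv (p \<circ> g) x \<noteq> 0"
    and Z: "finite {x \<in> ball 0 \<rho>. deriv (p \<circ> g) x = 0}"
      "(\<Sum>x\<in>{x \<in> ball 0 \<rho>. deriv (p \<circ> g) x = 0}. zorder (deriv (p \<circ> g)) x) = int k"
    and D: "D = {x \<in> ball 0 r. g x \<in> ball 0 \<epsilon>}"
  shows "rat_homology_dim 1 (top_of_set (g ` D)) (K div 2)"
    and "stratified_morse p g D \<Longrightarrow> card (stratified_critical_points p g D) = K div 2 + k"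
proof -
  have hg: "holomorphic_map_on g (ball 0 A)" using stable by (simp add: locally_stable_on_def)
  then have cg: "continuous_on (ball 0 A) g" by (rule holomorphic_map_on_imp_continuous_on)
  have rA: "ball (0::complex) r \<subseteq> ball 0 A" "cball (0::complex) (r / 2) \<subseteq> ball 0 A" using r by auto
  have hg': "(fst \<circ> g) holomorphic_on ball 0 r" "(snd \<circ> g) holomorphic_on ball 0 r"
    using holomorphic_map_on_subset[OF hg rA(1)] by (simp_all add: holomorphic_map_on_curve_iff)
  have "D = ball 0 r \<inter> g -` ball 0 \<epsilon>" by (auto simp: D)
  then have openD: "open D"
    using continuous_open_preimage[OF continuous_on_subset[OF cg rA(1)] open_ball open_ball] by simp
  have \<rho>D: "ball 0 \<rho> \<subseteq> D" using small r by (auto simp: D)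
  have DA: "D \<subseteq> ball 0 A" using rA(1) by (auto simp: D)
  \<comment> \<open>By \<open>large\<close> no point of \<open>D\<close> has norm above
    \<open>r / 2\<close>, so \<open>D\<close> is a sublevel set in a compact disc although it is
    defined in an open one.\<close>
  have D_cball: "D = {x \<in> cball 0 (r / 2). norm (g x) < \<epsilon>}"
  proof (intro equalityI subsetI)
    fix x assume x: "x \<in> D"
    then have "norm x \<le> r / 2" using large[of x] by (force simp: D)
    then show "x \<in> {x \<in> cball 0 (r / 2). norm (g x) < \<epsilon>}" using x by (simp add: D)
  qed (use r in \<open>auto simp: D\<close>)
  have star: "closed_segment 0 x \<subseteq> D" if "x \<in> D" for x
    unfolding D by (rule radial_growth_starlike[OF hg' _ _ r(2)]) (use small grow that in \<open>auto simp: D\<close>)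
  have D0: "0 \<in> D" using \<rho>D r(2) by auto
  have meet: "{t \<in> D. \<exists>u\<in>D. u \<noteq> t \<and> g u = g t} = T ` N"
  proof (intro equalityI subsetI)
    fix t assume "t \<in> {t \<in> D. \<exists>u\<in>D. u \<noteq> t \<and> g u = g t}"
    then obtain u where tu: "t \<in> D" "u \<in> D" "u \<noteq> t" "g u = g t" by blast
    then obtain t' u' where "t' \<in> S" "u' \<in> S" "t = T t'" "u = T u'" using T(2) unfolding D by blast
    then show "t \<in> T ` N" using tu unfolding N(1) by auto
  next
    fix y assume "y \<in> T ` N"
    then obtain t u where t: "t \<in> S" "u \<in> S" "u \<noteq> t" "g (T u) = g (T t)" "y = T t" unfolding N(1) by blast
    have "\<exists>v\<in>S. v \<noteq> t \<and> g (T v) = g (T t)" by (rule bexI[of _ u]) (use t in auto)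
    moreover have "\<exists>v\<in>S. v \<noteq> u \<and> g (T v) = g (T u)" by (rule bexI[of _ t]) (use t in auto)
    ultimately have "t \<in> N" "u \<in> N" unfolding N(1) using t(1,2) by simp_all
    then have "T t \<in> D" "T u \<in> D" using subsetD[OF \<rho>D subsetD[OF N(4) imageI]] by simp_all
    moreover have "T u \<noteq> T t" using T(1) t inj_onD by metis
    ultimately show "y \<in> {t \<in> D. \<exists>u\<in>D. u \<noteq> t \<and> g u = g t}" using t by blast
  qed
  have injN: "inj_on T N" using T(1) by (rule inj_on_subset) (auto simp: N(1))
  have finM: "finite {t \<in> D. \<exists>u\<in>D. u \<noteq> t \<and> g u = g t}" unfolding meet using N(2) by simp
  have cm: "closedin (top_of_set (g ` D)) (g ` C)" if "closedin (top_of_set D) C" for C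
    by (rule closed_map_of_bounded_preimage[OF D_cball compact_cball continuous_on_subset[OF cg rA(2)] that])
  note ns = node_structure[OF openD D0 star stable open_ball DA cm finM]
  have cardP: "card (double_point_stratum g D) = K div 2"
    using ns(2) N(3) unfolding meet card_image[OF injN] by simp
  show "rat_homology_dim 1 (top_of_set (g ` D)) (K div 2)" using ns(3) cardP by simp
  have Zeq: "{x \<in> ball 0 \<rho>. deriv (p \<circ> g) x = 0} = {x \<in> D. deriv (p \<circ> g) x = 0}"
  proof (intro equalityI subsetI)
    fix x assume x: "x \<in> {x \<in> D. deriv (p \<circ> g) x = 0}"
    then have "norm x < \<rho>" using nz[of x] by (force simp: D)
    then show "x \<in> {x \<in> ball 0 \<rho>. deriv (p \<circ> g) x = 0}" using x by simp
  qed (use \<rho>D in auto)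
  assume "stratified_morse p g D"
  from critical_count[OF openD stable open_ball DA p this ns(1) Z[unfolded Zeq]]
  show "card (stratified_critical_points p g D) = K div 2 + k" unfolding cardP .
qed

text \<open>An injective germ is not identically 0, so some Taylor coefficient survives and the
  minimum under \<open>the_enat\<close> is finite.\<close>

lemma multiplicity_germ_order:
  assumes f: "(fst \<circ> f) holomorphic_on ball 0 R" "(snd \<circ> f) holomorphic_on ball 0 R" "R > 0"
    and f0: "f 0 = 0" and inj: "inj_on f (ball 0 R)"
  obtains m where "multiplicity_germ f = m" "m \<ge> 1"
    "\<And>i. i < m \<Longrightarrow> (deriv ^^ i) (fst \<circ> f) 0 = 0 \<and> (deriv ^^ i) (snd \<circ> f) 0 = 0"
    "(deriv ^^ m) (fst \<circ> f) 0 \<noteq> 0 \<or> (deriv ^^ m) (snd \<circ> f) 0 \<noteq> 0"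
proof -
  define B where "B = (\<lambda>i. (deriv ^^ i) (fst \<circ> f) 0 \<noteq> 0 \<or> (deriv ^^ i) (snd \<circ> f) 0 \<noteq> 0)"
  have "\<exists>i. B i"
  proof (rule ccontr)
    assume "\<nexists>i. B i"
    then have z: "(deriv ^^ i) (fst \<circ> f) 0 = 0" "(deriv ^^ i) (snd \<circ> f) 0 = 0" for i by (auto simp: B_def)
    have w: "of_real (R / 2) \<in> ball (0::complex) R" using f(3) by simp
    have "(fst \<circ> f) (of_real (R / 2)) = 0" by (rule holomorphic_fun_eq_0_on_ball[OF f(1) w z(1)])
    moreover have "(snd \<circ> f) (of_real (R / 2)) = 0" by (rule holomorphic_fun_eq_0_on_ball[OF f(2) w z(2)])
    ultimately have "f (of_real (R / 2)) = f 0" unfolding f0 by (simp add: prod_eq_iff)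
    then have "of_real (R / 2) = (0::complex)" using inj_onD[OF inj _ w, of 0] f(3) by auto
    then show False using f(3) by simp
  qed
  define m where "m = (LEAST i. B i)"
  have Bm: "B m" and low: "\<And>i. i < m \<Longrightarrow> \<not> B i"
    unfolding m_def using \<open>\<exists>i. B i\<close> by (auto intro: LeastI_ex dest: not_less_Least)
  have "\<not> B 0" using f0 by (simp add: B_def)
  then have m1: "m \<ge> 1" using Bm by (cases m) auto
  have "min (vanishing_order (fst \<circ> f)) (vanishing_order (snd \<circ> f)) = enat m"
  proof (rule antisym)
    show "min (vanishing_order (fst \<circ> f)) (vanishing_order (snd \<circ> f)) \<le> enat m"
      using Bm unfolding B_def vanishing_order_def min_le_iff_disj by (auto intro: INF_lower)
    have ge: "enat m \<le> vanishing_order h" if h: "\<And>i. (deriv ^^ i) h 0 \<noteq> 0 \<Longrightarrow> B i" for h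
      unfolding vanishing_order_def
    proof (rule INF_greatest)
      fix i assume "i \<in> {k. (deriv ^^ k) h 0 \<noteq> 0}"
      then have "B i" using h by blast
      then show "enat m \<le> enat i" using low[of i] by (simp add: not_less[symmetric]) blast
    qed
    show "enat m \<le> min (vanishing_order (fst \<circ> f)) (vanishing_order (snd \<circ> f))"
      using ge[of "fst \<circ> f"] ge[of "snd \<circ> f"] by (simp add: B_def)
  qed
  then have "multiplicity_germ f = m" by (simp add: multiplicity_germ_def)
  then show ?thesis using that[of m] m1 low Bm unfolding B_def by blast
qed

text \<open>Rescaling \<open>f (t k)\<close> by the inverse of \<open>t k ^ m\<close> along
  \<open>t k = 1 / (k + 1)\<close> leaves the leading coefficient in the limit. Genericity of the
  kernel will thus apply to it.\<close>

lemma leading_coefficient_in_tangent_cone: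
  assumes f: "(fst \<circ> f) holomorphic_on S" "(snd \<circ> f) holomorphic_on S" "open S" "0 \<in> S"
    and low: "\<And>i. i < m \<Longrightarrow> (deriv ^^ i) (fst \<circ> f) 0 = 0 \<and> (deriv ^^ i) (snd \<circ> f) 0 = 0"
  shows "((deriv ^^ m) (fst \<circ> f) 0 / fact m, (deriv ^^ m) (snd \<circ> f) 0 / fact m) \<in> tangent_cone f"
proof -
  define t :: "nat \<Rightarrow> complex" where "t = (\<lambda>k. of_real (inverse (real (Suc k))))"
  have t0: "t \<longlonglongrightarrow> 0"
    using tendsto_of_real[OF LIMSEQ_inverse_real_of_nat, where 'a = complex] by (simp only: t_def of_real_0)
  have tn: "t k \<noteq> 0" for k by (simp only: t_def of_real_eq_0_iff inverse_nonzero_iff_nonzero)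
  have tl: "filterlim t (at 0) sequentially"
    unfolding filterlim_at using t0 tn by simp
  have lim: "(\<lambda>k. h (t k) / t k ^ m) \<longlonglongrightarrow> l" if "((\<lambda>x. h x / x ^ m) \<longlongrightarrow> l) (at 0)" for h l
    by (rule filterlim_compose[OF that tl])
  have l1: "(\<lambda>k. (fst \<circ> f) (t k) / t k ^ m) \<longlonglongrightarrow> (deriv ^^ m) (fst \<circ> f) 0 / fact m"
    by (rule lim[OF order_asymptotic[OF f(1,3,4)]]) (use low in blast)
  have l2: "(\<lambda>k. (snd \<circ> f) (t k) / t k ^ m) \<longlonglongrightarrow> (deriv ^^ m) (snd \<circ> f) 0 / fact m"
    by (rule lim[OF order_asymptotic[OF f(2,3,4)]]) (use low in blast)
  have "scaleC (inverse (t k ^ m)) (f (t k)) = ((fst \<circ> f) (t k) / t k ^ m, (snd \<circ> f) (t k) / t k ^ m)" for k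
    by (simp add: scaleC_prod_def scaleC_complex_def divide_inverse mult.commute)
  then show ?thesis
    unfolding tangent_cone_def mem_Collect_eq
    by (intro exI[of _ t] exI[of _ "\<lambda>k. inverse (t k ^ m)"] conjI t0) (use tendsto_Pair[OF l1 l2] in simp)
qed

locale projected_germ =
  fixes f :: "complex \<Rightarrow> complex \<times> complex" and ca cb :: complex and m :: nat and R :: real
    and T :: "complex \<Rightarrow> complex" and RT :: real
  assumes R: "R > 0" and hol_f: "(fst \<circ> f) holomorphic_on ball 0 R" "(snd \<circ> f) holomorphic_on ball 0 R"
    and f0: "f 0 = 0" and inj_f: "inj_on f (ball 0 R)" and m: "m \<ge> 1"
    and low: "\<And>i. i < m \<Longrightarrow> (deriv ^^ i) (fst \<circ> f) 0 = 0 \<and> (deriv ^^ i) (snd \<circ> f) 0 = 0"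
    and top: "ca * (deriv ^^ m) (fst \<circ> f) 0 + cb * (deriv ^^ m) (snd \<circ> f) 0 \<noteq> 0"
    and RT: "RT > 0" and T: "T holomorphic_on ball 0 RT" "inj_on T (ball 0 RT)" "T 0 = 0" "T ` ball 0 RT \<subseteq> ball 0 R"
    and T_power: "\<And>z. z \<in> ball 0 RT \<Longrightarrow> ca * fst (f (T z)) + cb * snd (f (T z)) = z ^ m"
begin

text \<open>The form \<open>Q\<close> completes \<open>P\<close> to linear coordinates of \<open>\<complex>\<^sup>2\<close>.\<close>

definition P :: "complex \<times> complex \<Rightarrow> complex" where "P z = ca * fst z + cb * snd z"
definition Q :: "complex \<times> complex \<Rightarrow> complex" where "Q z = - cnj cb * fst z + cnj ca * snd z"

lemma det_nonzero: "ca * cnj ca + cb * cnj cb \<noteq> 0"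
proof -
  have "ca * cnj ca + cb * cnj cb = of_real ((norm ca)\<^sup>2 + (norm cb)\<^sup>2)"
    by (simp only: of_real_add complex_norm_square)
  moreover have "ca \<noteq> 0 \<or> cb \<noteq> 0" using top by auto
  then have "(norm ca)\<^sup>2 + (norm cb)\<^sup>2 \<noteq> 0" by (simp add: sum_power2_eq_zero_iff)
  ultimately show ?thesis by (simp only: of_real_eq_0_iff not_False_eq_True)
qed

lemma PQ_inject: "P v = P w \<Longrightarrow> Q v = Q w \<Longrightarrow> v = w"
proof -
  assume e: "P v = P w" "Q v = Q w"
  have "(ca * cnj ca + cb * cnj cb) * (fst v - fst w) = cnj ca * (P v - P w) - cb * (Q v - Q w)"
    "(ca * cnj ca + cb * cnj cb) * (snd v - snd w) = cnj cb * (P v - P w) + ca * (Q v - Q w)"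
    by (simp_all add: P_def Q_def algebra_simps)
  then show "v = w" using e det_nonzero by (simp add: prod_eq_iff)
qed

lemma PQ_zero: "P v = 0 \<Longrightarrow> Q v = 0 \<Longrightarrow> v = 0"
  using PQ_inject[of v 0] by (simp add: P_def Q_def)

lemma PQ_scale_add: "P (scaleC \<alpha> v + scaleC \<beta> w) = \<alpha> * P v + \<beta> * P w"
  "Q (scaleC \<alpha> v + scaleC \<beta> w) = \<alpha> * Q v + \<beta> * Q w"
  by (simp_all add: P_def Q_def scaleC_prod_def scaleC_complex_def algebra_simps)

lemma PQ_independent:
  assumes ind: "\<And>\<alpha> \<beta>. scaleC \<alpha> v + scaleC \<beta> w = 0 \<Longrightarrow> \<alpha> = 0 \<and> \<beta> = 0"
  shows "P v * Q w \<noteq> P w * Q v"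
proof
  assume eq: "P v * Q w = P w * Q v"
  have "scaleC (P w) v + scaleC (- P v) w = 0" by (rule PQ_zero) (use eq in \<open>simp_all add: PQ_scale_add\<close>)
  then have P: "P v = 0" "P w = 0" using ind[of "P w" "- P v"] by auto
  have "scaleC (Q w) v + scaleC (- Q v) w = 0" by (rule PQ_zero) (use P in \<open>simp_all add: PQ_scale_add\<close>)
  then have "Q v = 0" using ind[of "Q w" "- Q v"] by auto
  then have "scaleC 1 v + scaleC 0 w = 0" by (intro PQ_zero) (use P in \<open>simp_all add: PQ_scale_add\<close>)
  then show False using ind[of 1 0] by simp
qed

text \<open>The points \<open>z\<close> and \<open>\<omega> * z\<close> have the same value of
  \<open>P\<close>, so injectivity of \<open>f\<close> must show in \<open>Q\<close>.\<close>

lemma model_branch: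
  assumes "0 < r" "5 * r \<le> RT"
  shows "model_branch (\<lambda>z. Q (f (T z))) m r"
proof
  show "m \<ge> 1" "r > 0" using m assms by auto
  have sub: "ball (0::complex) (5 * r) \<subseteq> ball 0 RT" using assms by auto
  have T': "T holomorphic_on ball 0 (5 * r)" "T ` ball 0 (5 * r) \<subseteq> ball 0 R"
    using holomorphic_on_subset[OF T(1) sub] order_trans[OF image_mono[OF sub] T(4)] by simp_all
  show "(\<lambda>z. Q (f (T z))) holomorphic_on ball 0 (5 * r)"
    unfolding Q_def
    using holomorphic_on_compose_gen[OF T'(1) hol_f(1) T'(2)] holomorphic_on_compose_gen[OF T'(1) hol_f(2) T'(2)]
    by (intro holomorphic_intros) (simp_all add: comp_def)
  fix z \<omega> :: complex assume z: "z \<in> cball 0 (3 * r)" "z \<noteq> 0" and w: "\<omega> ^ m = 1" "\<omega> \<noteq> 1"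
  have n: "norm \<omega> = 1" using power_eq_1_iff[OF w(1)] m by simp
  have zb: "z \<in> ball 0 RT" "\<omega> * z \<in> ball 0 RT" using z(1) assms n by (auto simp: norm_mult)
  show "Q (f (T (\<omega> * z))) \<noteq> Q (f (T z))"
  proof
    assume "Q (f (T (\<omega> * z))) = Q (f (T z))"
    moreover have "P (f (T (\<omega> * z))) = P (f (T z))"
      unfolding P_def T_power[OF zb(1)] T_power[OF zb(2)] by (simp add: power_mult_distrib w(1))
    ultimately have "f (T (\<omega> * z)) = f (T z)" by (rule PQ_inject[rotated])
    then have "T (\<omega> * z) = T z" by (rule inj_onD[OF inj_f]) (use subsetD[OF T(4) imageI] zb in blast)+
    then have "\<omega> * z = z" by (rule inj_onD[OF T(2)]) (use zb in auto)
    then show False using z(2) w(2) by simp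
  qed
qed

lemma deriv_T_nonzero: "t \<in> ball 0 RT \<Longrightarrow> deriv T t \<noteq> 0"
  using holomorphic_injective_imp_regular[OF T(1) open_ball T(2)] .

lemma deriv_along_T:
  assumes "h holomorphic_on ball 0 A" "t \<in> ball 0 RT" "T t \<in> ball 0 A"
  shows "deriv (\<lambda>z. h (T z)) t = deriv h (T t) * deriv T t"
proof (rule DERIV_imp_deriv)
  show "((\<lambda>z. h (T z)) has_field_derivative deriv h (T t) * deriv T t) (at t)"
    by (rule DERIV_chain2[where f = h and g = T and x = t,
        OF holomorphic_derivI[OF assms(1) open_ball assms(3)] holomorphic_derivI[OF T(1) open_ball assms(2)]])
qed

lemma deriv_PQ:
  assumes "(fst \<circ> g) holomorphic_on D" "(snd \<circ> g) holomorphic_on D" "open D" "t \<in> D"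
  shows "deriv (\<lambda>x. P (g x)) t = P (curve_deriv g t)" "deriv (\<lambda>x. Q (g x)) t = Q (curve_deriv g t)"
  unfolding P_def Q_def by (rule deriv_linear_comp[OF assms])+

text \<open>The conditions are invariant under the linear coordinates \<open>(P, Q)\<close> in the
  target and the injective coordinate \<open>T\<close> in the source: tangent vectors only acquire
  nonzero factors \<open>deriv T\<close>.\<close>

lemma nodal:
  assumes r: "0 < r" "5 * r \<le> RT" and sub: "T ` ball 0 (5 * r) \<subseteq> ball 0 A" and st: "locally_stable_on g (ball 0 A)"
  shows "model_branch.nodal r (\<lambda>z. P (g (T z))) (\<lambda>z. Q (g (T z)))"
proof -
  interpret M: model_branch "\<lambda>z. Q (f (T z))" m r by (rule model_branch[OF r])
  have h: "(fst \<circ> g) holomorphic_on ball 0 A" "(snd \<circ> g) holomorphic_on ball 0 A"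
    using st by (simp_all add: locally_stable_on_def holomorphic_map_on_curve_iff)
  have tb: "t \<in> ball 0 RT" "T t \<in> ball 0 A" if "t \<in> cball 0 (3 * r)" for t
  proof -
    have t: "t \<in> ball 0 (5 * r)" using that r by simp
    then show "T t \<in> ball 0 A" using sub by blast
    show "t \<in> ball 0 RT" using t r by simp
  qed
  have hP: "(\<lambda>x. P (g x)) holomorphic_on ball 0 A" "(\<lambda>x. Q (g x)) holomorphic_on ball 0 A"
    using h unfolding P_def Q_def comp_def by (auto intro!: holomorphic_intros)
  have d: "deriv (\<lambda>z. P (g (T z))) t = P (curve_deriv g (T t)) * deriv T t"
    "deriv (\<lambda>z. Q (g (T z))) t = Q (curve_deriv g (T t)) * deriv T t" if "t \<in> cball 0 (3 * r)" for t :: complex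
    unfolding deriv_along_T[OF hP(1) tb[OF that]] deriv_along_T[OF hP(2) tb[OF that]]
      deriv_PQ(1)[OF h open_ball tb(2)[OF that]] deriv_PQ(2)[OF h open_ball tb(2)[OF that]] by simp_all
  show ?thesis unfolding M.nodal_def
  proof (intro conjI ballI impI)
    fix t :: complex assume t: "t \<in> cball 0 (3 * r)"
    show "deriv (\<lambda>z. P (g (T z))) t \<noteq> 0 \<or> deriv (\<lambda>z. Q (g (T z))) t \<noteq> 0"
      unfolding d[OF t]
      using stable_imp_immersion[OF st open_ball tb(2)[OF t]] PQ_zero[of "curve_deriv g (T t)"]
        deriv_T_nonzero[OF tb(1)[OF t]] by simp blast
    fix u :: complex assume u: "u \<in> cball 0 (3 * r)" and e: "t \<noteq> u \<and> P (g (T u)) = P (g (T t)) \<and> Q (g (T u)) = Q (g (T t))"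
    have ne: "T t \<noteq> T u" using inj_onD[OF T(2) _ tb(1)[OF t] tb(1)[OF u]] e by blast
    have ge: "g (T t) = g (T u)" using PQ_inject e by metis
    have "P (curve_deriv g (T t)) * Q (curve_deriv g (T u)) \<noteq> P (curve_deriv g (T u)) * Q (curve_deriv g (T t))"
      by (rule PQ_independent) (rule stable_imp_transverse[OF st open_ball tb(2)[OF t] tb(2)[OF u] ne ge])
    then have "(deriv T t * deriv T u) * (P (curve_deriv g (T t)) * Q (curve_deriv g (T u)))
        \<noteq> (deriv T t * deriv T u) * (P (curve_deriv g (T u)) * Q (curve_deriv g (T t)))"
      using deriv_T_nonzero tb(1) t u by simp
    then show "deriv (\<lambda>z. P (g (T z))) t * deriv (\<lambda>z. Q (g (T z))) u \<noteq> deriv (\<lambda>z. P (g (T z))) u * deriv (\<lambda>z. Q (g (T z))) t"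
      unfolding d[OF t] d[OF u] by (simp only: mult_ac not_False_eq_True)
    fix w :: complex assume w: "w \<in> cball 0 (3 * r)" "P (g (T w)) = P (g (T t)) \<and> Q (g (T w)) = Q (g (T t))"
    have "g (T t) = g (T w)" using PQ_inject w(2) by metis
    then have "T w = T t \<or> T w = T u"
      by (rule stable_imp_no_triple_point[OF st open_ball tb(2)[OF t] tb(2)[OF u] tb(2)[OF w(1)] ge _ ne])
    then show "w = t \<or> w = u"
      using inj_onD[OF T(2) _ tb(1)[OF w(1)] tb(1)[OF t]] inj_onD[OF T(2) _ tb(1)[OF w(1)] tb(1)[OF u]] by blast
  qed
qed

end

lemma inner_mult_close:
  fixes u v p q x :: complex
  assumes "norm (u - v) \<le> \<eta>" "norm (p - q) \<le> \<eta>" "norm v \<le> M" "norm q \<le> M" "\<eta> \<le> 1" "norm x \<le> r"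
  shows "\<bar>inner u (x * p) - inner v (x * q)\<bar> \<le> \<eta> * r * (2 * M + 1)"
proof -
  have nn: "0 \<le> \<eta>" "0 \<le> M" "0 \<le> r"
    using order_trans[OF norm_ge_zero assms(1)] order_trans[OF norm_ge_zero assms(3)]
      order_trans[OF norm_ge_zero assms(6)] by simp_all
  have "norm p \<le> norm q + norm (p - q)" by (metis norm_triangle_sub)
  then have np: "norm p \<le> M + 1" using assms by linarith
  have "inner u (x * p) - inner v (x * q) = inner (u - v) (x * p) + inner v (x * (p - q))"
    by (simp add: inner_diff_left inner_diff_right right_diff_distrib)
  then have "\<bar>inner u (x * p) - inner v (x * q)\<bar> \<le> \<bar>inner (u - v) (x * p)\<bar> + \<bar>inner v (x * (p - q))\<bar>"
    by (simp only: abs_triangle_ineq)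
  also have "\<dots> \<le> norm (u - v) * norm (x * p) + norm v * norm (x * (p - q))"
    by (intro add_mono Cauchy_Schwarz_ineq2)
  also have "\<dots> \<le> \<eta> * (r * (M + 1)) + M * (r * \<eta>)"
    unfolding norm_mult using assms np nn by (intro add_mono mult_mono) auto
  also have "\<dots> = \<eta> * r * (2 * M + 1)" by (simp add: algebra_simps)
  finally show ?thesis .
qed

context projected_germ
begin

section \<open>A polydisc for the stabilisation and estimates on it\<close>

lemma holomorphic_lin_f: "(\<lambda>x. a * fst (f x) + b * snd (f x)) holomorphic_on ball 0 R"
  using hol_f unfolding comp_def by (intro holomorphic_intros)

lemma continuous_f: "continuous_on (ball 0 R) f"
  using hol_f by (intro holomorphic_map_on_imp_continuous_on) (simp add: holomorphic_map_on_curve_iff)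

lemma P_comp: "P \<circ> g = (\<lambda>x. ca * fst (g x) + cb * snd (g x))"
  by (simp add: P_def fun_eq_iff)

text \<open>A stabilisation provides stability on the source domain of one particular
  representative. The box replaces it by a full disc, which serves all later choices of
  radii.\<close>

definition box :: "(complex \<times> complex \<Rightarrow> complex \<times> complex) \<Rightarrow> real \<Rightarrow> bool"
  where "box F A \<longleftrightarrow> 0 < A \<and> A < R \<and> (\<exists>U. holomorphic_map_on F U \<and> cball 0 A \<times> cball 0 A \<subseteq> U) \<and>
    (\<forall>x\<in>cball 0 A. F (x, 0) = f x) \<and>
    (\<forall>s. 0 < norm s \<and> norm s \<le> A \<longrightarrow> locally_stable_on (\<lambda>x. F (x, s)) (ball 0 A))"

lemma box_mono:
  assumes "box F A" "0 < A'" "A' \<le> A"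
  shows "box F A'"
proof -
  have c: "cball (0::complex) A' \<subseteq> cball 0 A" "ball (0::complex) A' \<subseteq> ball 0 A" using assms(3) by auto
  obtain U where U: "holomorphic_map_on F U" "cball 0 A \<times> cball 0 A \<subseteq> U" using assms(1) unfolding box_def by blast
  have "cball 0 A' \<times> cball 0 A' \<subseteq> U" using U(2) c(1) by blast
  moreover have "locally_stable_on (\<lambda>x. F (x, s)) (ball 0 A')" if "0 < norm s" "norm s \<le> A'" for s
    using assms(1,3) that by (intro locally_stable_on_subset[OF _ c(2)]) (simp add: box_def)
  moreover have "F (x, 0) = f x" if "x \<in> cball 0 A'" for x
    using assms(1) subsetD[OF c(1) that] unfolding box_def by blast
  moreover have "A' < R" using assms(1,3) by (simp add: box_def)
  ultimately show ?thesis unfolding box_def using assms(2) U(1) by blast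
qed

text \<open>By continuity \<open>F\<close> maps a small polydisc into the given target ball, so the
  disc of radius \<open>A\<close> lies in the source domain for which stability is assumed.\<close>

lemma stabilisation_box:
  assumes "stabilisation f F"
  obtains A where "box F A"
proof -
  obtain U where U: "open U" "0 \<in> U" "holomorphic_map_on F U"
    using assms unfolding stabilisation_def holomorphic_near_def by blast
  have "\<forall>\<^sub>F x in nhds 0. F (x, 0) = f x" using assms unfolding stabilisation_def by blast
  then obtain e0 where e0: "e0 > 0" "\<And>x. dist x 0 < e0 \<Longrightarrow> F (x, 0) = f x" unfolding eventually_nhds_metric by blast
  obtain r \<epsilon> \<delta> where st: "r > 0" "\<epsilon> > 0" "\<delta> > 0"
    "\<And>s. 0 < norm s \<Longrightarrow> norm s < \<delta> \<Longrightarrow> locally_stable_on (\<lambda>x. F (x, s)) (source_dom F r \<epsilon> s)"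
    using assms unfolding stabilisation_def by blast
  have cF: "continuous_on U F" by (rule holomorphic_map_on_imp_continuous_on[OF U(3)])
  have "open (U \<inter> F -` ball 0 \<epsilon>)" by (rule continuous_open_preimage[OF cF U(1) open_ball])
  moreover have "F 0 = 0" using e0 f0 by (simp add: zero_prod_def)
  then have "0 \<in> U \<inter> F -` ball 0 \<epsilon>" using U(2) st(2) by simp
  ultimately obtain e where e: "e > 0" "ball 0 e \<subseteq> U \<inter> F -` ball 0 \<epsilon>" using openE by blast
  \<comment> \<open>Division by 4 leaves room for \<open>norm (x, s) \<le> 2 * A\<close> and for
    strict inequalities.\<close>
  define A where "A = min (min e e0) (min (min r \<delta>) R) / 4"
  have A: "A > 0" "4 * A \<le> e" "4 * A \<le> e0" "4 * A \<le> r" "4 * A \<le> \<delta>" "4 * A \<le> R"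
    using e(1) e0(1) st(1,3) R by (simp_all add: A_def)
  have sub: "cball 0 A \<times> cball 0 A \<subseteq> ball (0::complex \<times> complex) e"
  proof
    fix z :: "complex \<times> complex" assume z: "z \<in> cball 0 A \<times> cball 0 A"
    have "norm z \<le> norm (fst z) + norm (snd z)" using norm_Pair_le[of "fst z" "snd z"] by simp
    then show "z \<in> ball 0 e" using z A by (auto simp: mem_Times_iff)
  qed
  have "box F A" unfolding box_def
  proof (intro conjI allI impI ballI)
    show "\<exists>U. holomorphic_map_on F U \<and> cball 0 A \<times> cball 0 A \<subseteq> U" using U(3) sub e(2) by blast
    show "F (x, 0) = f x" if "x \<in> cball 0 A" for x using e0(2)[of x] that A by simp
    fix s :: complex assume s: "0 < norm s \<and> norm s \<le> A"
    have "ball 0 A \<subseteq> source_dom F r \<epsilon> s"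
    proof
      fix x :: complex assume x: "x \<in> ball 0 A"
      then have "(x, s) \<in> cball 0 A \<times> cball 0 A" using s by simp
      then have "(x, s) \<in> ball 0 e" by (rule subsetD[OF sub])
      then show "x \<in> source_dom F r \<epsilon> s" unfolding source_dom_def using e(2) x A by auto
    qed
    then show "locally_stable_on (\<lambda>x. F (x, s)) (ball 0 A)"
      using locally_stable_on_subset[OF st(4)[of s]] s A by simp
  qed (use A in auto)
  then show ?thesis by (rule that)
qed

lemma box_close:
  assumes box: "box F A" and \<eta>: "\<eta> > 0"
  shows "\<forall>\<^sub>F s in at 0. (\<lambda>x. a * fst (F (x, s)) + b * snd (F (x, s))) holomorphic_on ball 0 A \<and>
    (\<forall>x\<in>ball 0 (A / 2). norm (a * fst (F (x, s)) + b * snd (F (x, s)) - (a * fst (f x) + b * snd (f x))) < \<eta> \<and>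
      norm (deriv (\<lambda>x. a * fst (F (x, s)) + b * snd (F (x, s))) x - deriv (\<lambda>x. a * fst (f x) + b * snd (f x)) x) < \<eta>)"
proof -
  have A: "A > 0" and F0: "\<And>x. x \<in> cball 0 A \<Longrightarrow> F (x, 0) = f x" using box unfolding box_def by auto
  obtain U where U: "holomorphic_map_on F U" "cball 0 A \<times> cball 0 A \<subseteq> U" using box unfolding box_def by blast
  have d0: "deriv (\<lambda>x. a * fst (F (x, 0)) + b * snd (F (x, 0))) x = deriv (\<lambda>x. a * fst (f x) + b * snd (f x)) x"
    if x: "x \<in> ball 0 (A / 2)" for x
  proof (rule deriv_cong_ev)
    have "\<forall>\<^sub>F y in nhds x. y \<in> ball 0 (A / 2)" using x by (intro eventually_nhds_in_open) auto
    then show "\<forall>\<^sub>F y in nhds x. a * fst (F (y, 0)) + b * snd (F (y, 0)) = a * fst (f y) + b * snd (f y)"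
      by eventually_elim (use F0 A in simp)
  qed simp
  from slice_close[OF holomorphic_map_on_lincomb[OF U(1), of a b] U(2) A \<eta>]
  show ?thesis
  proof eventually_elim
    case (elim s)
    then show ?case using d0 F0 A by auto
  qed
qed

lemma eventually_near:
  assumes box: "box F A" and r: "0 < r" "5 * r \<le> RT" and sub: "T ` ball 0 (5 * r) \<subseteq> ball 0 (A / 2)" and \<epsilon>: "\<epsilon> > 0"
  shows "\<forall>\<^sub>F s in at 0. model_branch.near (\<lambda>z. Q (f (T z))) m r \<epsilon> (\<lambda>z. P (F (T z, s))) (\<lambda>z. Q (F (T z, s)))"
proof -
  interpret M: model_branch "\<lambda>z. Q (f (T z))" m r by (rule model_branch[OF r])
  have A: "0 < A" "A < R" using box by (auto simp: box_def)
  have sub': "cball (0::complex) (4 * r) \<subseteq> ball 0 RT" using r by auto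
  have "continuous_on (cball 0 (4 * r)) (deriv T)"
    using holomorphic_on_imp_continuous_on[OF holomorphic_deriv[OF T(1) open_ball]] sub' by (rule continuous_on_subset)
  then have "compact (deriv T ` cball 0 (4 * r))" using compact_cball by (rule compact_continuous_image)
  then obtain B where B: "B > 0" "\<forall>y\<in>deriv T ` cball 0 (4 * r). norm y \<le> B" using compact_imp_bounded bounded_pos by blast
  \<comment> \<open>In the coordinate of \<open>T\<close> derivatives are multiplied by
    \<open>deriv T\<close>, which \<open>B\<close> bounds.\<close>
  define \<eta> where "\<eta> = min \<epsilon> (\<epsilon> / B)"
  have \<eta>: "\<eta> > 0" "\<eta> \<le> \<epsilon>" "\<eta> * B \<le> \<epsilon>" using \<epsilon> B(1) by (auto simp: \<eta>_def min_def field_simps)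
  have tb: "z \<in> ball 0 RT" "T z \<in> ball 0 (A / 2)" "T z \<in> ball 0 A" "T z \<in> ball 0 R" if "z \<in> ball 0 (4 * r)" for z
  proof -
    have z: "z \<in> ball 0 (5 * r)" using that r by simp
    then show "z \<in> ball 0 RT" using r by simp
    show "T z \<in> ball 0 (A / 2)" using subsetD[OF sub imageI[OF z]] .
    then show "T z \<in> ball 0 A" "T z \<in> ball 0 R" using A by auto
  qed
  have lin: "\<forall>\<^sub>F s in at 0. (\<lambda>z. a * fst (F (T z, s)) + b * snd (F (T z, s))) holomorphic_on ball 0 (4 * r) \<and>
    (\<forall>z\<in>ball 0 (4 * r). norm (a * fst (F (T z, s)) + b * snd (F (T z, s)) - (a * fst (f (T z)) + b * snd (f (T z)))) \<le> \<epsilon> \<and>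
      norm (deriv (\<lambda>z. a * fst (F (T z, s)) + b * snd (F (T z, s))) z -
        deriv (\<lambda>z. a * fst (f (T z)) + b * snd (f (T z))) z) \<le> \<epsilon>)" for a b
    using box_close[OF box \<eta>(1), of a b]
  proof eventually_elim
    case (elim s)
    define h where "h = (\<lambda>x. a * fst (F (x, s)) + b * snd (F (x, s)))"
    define h0 where "h0 = (\<lambda>x. a * fst (f x) + b * snd (f x))"
    have hol: "h holomorphic_on ball 0 A" "h0 holomorphic_on ball 0 R"
      using elim holomorphic_lin_f by (simp_all add: h_def h0_def)
    have "\<forall>x\<in>ball 0 (A / 2). norm (h x - h0 x) < \<eta> \<and> norm (deriv h x - deriv h0 x) < \<eta>"
      using elim unfolding h_def h0_def by blast
    then have close: "norm (h x - h0 x) < \<eta>" "norm (deriv h x - deriv h0 x) < \<eta>" if "x \<in> ball 0 (A / 2)" for x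
      using that by simp_all
    have "T holomorphic_on ball 0 (4 * r)" "T ` ball 0 (4 * r) \<subseteq> ball 0 A"
      using tb(1,3) by (auto intro!: holomorphic_on_subset[OF T(1)])
    then have "h \<circ> T holomorphic_on ball 0 (4 * r)" by (rule holomorphic_on_compose_gen[OF _ hol(1)])
    then have "(\<lambda>z. h (T z)) holomorphic_on ball 0 (4 * r)" by (simp add: comp_def)
    moreover have "norm (h (T z) - h0 (T z)) \<le> \<epsilon>" if "z \<in> ball 0 (4 * r)" for z
      using close(1)[OF tb(2)[OF that]] \<eta>(2) by linarith
    moreover have "norm (deriv (\<lambda>z. h (T z)) z - deriv (\<lambda>z. h0 (T z)) z) \<le> \<epsilon>" if z: "z \<in> ball 0 (4 * r)" for z
    proof -
      have "deriv (\<lambda>z. h (T z)) z - deriv (\<lambda>z. h0 (T z)) z = (deriv h (T z) - deriv h0 (T z)) * deriv T z"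
        unfolding deriv_along_T[OF hol(1) tb(1,3)[OF z]] deriv_along_T[OF hol(2) tb(1,4)[OF z]]
        by (simp add: algebra_simps)
      also have "norm \<dots> \<le> \<eta> * B"
        unfolding norm_mult using close(2)[OF tb(2)[OF z]] B z \<eta>(1) by (intro mult_mono) auto
      finally show ?thesis using \<eta>(3) by linarith
    qed
    ultimately show ?case unfolding h_def h0_def by blast
  qed
  have dP: "deriv (\<lambda>z. P (f (T z))) z = deriv (\<lambda>z. z ^ m) z" "P (f (T z)) = z ^ m" if z: "z \<in> ball 0 (4 * r)" for z
  proof -
    have "\<forall>\<^sub>F y in nhds z. y \<in> ball 0 RT" using tb(1)[OF z] by (intro eventually_nhds_in_open) auto
    then have "\<forall>\<^sub>F y in nhds z. P (f (T y)) = y ^ m" by eventually_elim (simp add: P_def T_power)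
    then show "deriv (\<lambda>z. P (f (T z))) z = deriv (\<lambda>z. z ^ m) z" by (rule deriv_cong_ev) simp
    show "P (f (T z)) = z ^ m" using tb(1)[OF z] by (simp add: P_def T_power)
  qed
  from lin[of ca cb, folded P_def] lin[of "- cnj cb" "cnj ca", folded Q_def] show ?thesis
  proof eventually_elim
    case (elim s)
    then show ?case unfolding M.near_def using dP by simp
  qed
qed

section \<open>Zeros of the derivative of the projected germ\<close>

lemma higher_deriv_P: "(deriv ^^ i) (P \<circ> f) 0 = ca * (deriv ^^ i) (fst \<circ> f) 0 + cb * (deriv ^^ i) (snd \<circ> f) 0"
proof -
  have z: "(0::complex) \<in> ball 0 R" using R by simp
  have "(deriv ^^ i) (P \<circ> f) 0 = (deriv ^^ i) (\<lambda>x. ca * (fst \<circ> f) x + cb * (snd \<circ> f) x) 0"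
    by (simp add: P_comp)
  also have "\<dots> = (deriv ^^ i) (\<lambda>x. ca * (fst \<circ> f) x) 0 + (deriv ^^ i) (\<lambda>x. cb * (snd \<circ> f) x) 0"
    by (rule higher_deriv_add[OF _ _ open_ball z]) (intro holomorphic_intros hol_f)+
  also have "(deriv ^^ i) (\<lambda>x. ca * (fst \<circ> f) x) 0 = ca * (deriv ^^ i) (fst \<circ> f) 0"
    by (rule higher_deriv_cmult[OF hol_f(1) z open_ball])
  also have "(deriv ^^ i) (\<lambda>x. cb * (snd \<circ> f) x) 0 = cb * (deriv ^^ i) (snd \<circ> f) 0"
    by (rule higher_deriv_cmult[OF hol_f(2) z open_ball])
  finally show ?thesis .
qed

lemma higher_deriv_P_low: "i < m \<Longrightarrow> (deriv ^^ i) (P \<circ> f) 0 = 0"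
  and higher_deriv_P_top: "(deriv ^^ m) (P \<circ> f) 0 \<noteq> 0"
  using low top by (simp_all add: higher_deriv_P)

lemma holomorphic_P_f: "(P \<circ> f) holomorphic_on ball 0 R"
  unfolding P_comp by (rule holomorphic_lin_f)

lemma good_radius:
  assumes "0 < r" "r \<le> RT"
  obtains r1 where "0 < r1" "r1 \<le> R" "ball 0 r1 \<subseteq> T ` ball 0 r"
    "\<And>x. 0 < norm x \<Longrightarrow> norm x < r1 \<Longrightarrow> radial_growth f x > 0"
    "\<And>x. 0 < norm x \<Longrightarrow> norm x < r1 \<Longrightarrow> deriv (P \<circ> f) x \<noteq> 0"
proof -
  have z: "(0::complex) \<in> ball 0 R" using R by simp
  have "ball (0::complex) r \<subseteq> ball 0 RT" using assms by auto
  then have "open (T ` ball 0 r)"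
    by (intro open_mapping_thm3 open_ball holomorphic_on_subset[OF T(1)] inj_on_subset[OF T(2)])
  moreover have "0 \<in> T ` ball 0 r" using T(3) assms(1) by force
  ultimately obtain d1 where d1: "d1 > 0" "ball 0 d1 \<subseteq> T ` ball 0 r" using openE by blast
  have top': "(deriv ^^ m) (fst \<circ> f) 0 \<noteq> 0 \<or> (deriv ^^ m) (snd \<circ> f) 0 \<noteq> 0" using top by auto
  from eventually_radial_growth[OF hol_f open_ball z m low top']
  obtain d2 where d2: "d2 > 0" "\<And>x. x \<noteq> 0 \<Longrightarrow> dist x 0 < d2 \<Longrightarrow> radial_growth f x > 0"
    unfolding eventually_at by blast
  have lim: "((\<lambda>t. deriv (P \<circ> f) t / t ^ (m - 1)) \<longlongrightarrow> of_nat m * ((deriv ^^ m) (P \<circ> f) 0 / fact m)) (at 0)"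
    by (rule deriv_order_asymptotic[OF holomorphic_P_f open_ball z m higher_deriv_P_low])
  have "\<forall>\<^sub>F t in at 0. deriv (P \<circ> f) t / t ^ (m - 1) \<noteq> 0"
    by (rule tendsto_imp_eventually_ne[OF lim]) (use m higher_deriv_P_top in simp)
  then obtain d3 where d3: "d3 > 0" "\<And>x. x \<noteq> 0 \<Longrightarrow> dist x 0 < d3 \<Longrightarrow> deriv (P \<circ> f) x / x ^ (m - 1) \<noteq> 0"
    unfolding eventually_at by blast
  show ?thesis
  proof (rule that[of "min (min d1 d2) (min d3 R)"])
    fix x :: complex assume x: "0 < norm x" "norm x < min (min d1 d2) (min d3 R)"
    show "radial_growth f x > 0" using d2(2)[of x] x by simp
    show "deriv (P \<circ> f) x \<noteq> 0" using d3(2)[of x] x by auto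
  qed (use d1 d2 d3 R in auto)
qed

lemma zorder_sum:
  assumes "0 < \<rho>" "\<And>x. 0 < norm x \<Longrightarrow> norm x < \<rho> \<Longrightarrow> deriv (P \<circ> f) x \<noteq> 0"
  shows "(\<Sum>x\<in>{x \<in> ball 0 \<rho>. deriv (P \<circ> f) x = 0}. zorder (deriv (P \<circ> f)) x) = int (m - 1)"
proof (cases "m = 1")
  \<comment> \<open>For \<open>m = 1\<close> the projected germ is a coordinate and has no critical
    point; the sum is empty.\<close>
  case True
  then have "deriv (P \<circ> f) 0 \<noteq> 0" using higher_deriv_P_top by simp
  then have "deriv (P \<circ> f) x \<noteq> 0" if "x \<in> ball 0 \<rho>" for x using assms(2)[of x] that by (cases "x = 0") auto
  then have "{x \<in> ball 0 \<rho>. deriv (P \<circ> f) x = 0} = {}" by blast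
  then show ?thesis unfolding True by (simp only: sum.empty)
next
  case False
  then have "(deriv ^^ 1) (P \<circ> f) 0 = 0" using higher_deriv_P_low[of 1] m by simp
  moreover have "x = 0" if "x \<in> ball 0 \<rho>" "deriv (P \<circ> f) x = 0" for x
    using assms(2)[of x] that by (cases "x = 0") auto
  ultimately have "{x \<in> ball 0 \<rho>. deriv (P \<circ> f) x = 0} = {0}" using assms(1) by auto
  moreover have "zorder (deriv (P \<circ> f)) 0 = int (m - 1)"
  proof (rule zorder_zero_eqI[OF holomorphic_deriv[OF holomorphic_P_f open_ball] open_ball])
    show "(0::complex) \<in> ball 0 R" using R by simp
    show "(deriv ^^ nat (int (m - 1))) (deriv (P \<circ> f)) 0 \<noteq> 0"
      unfolding nat_int funpow_deriv_shift[OF m] by (rule higher_deriv_P_top)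
    fix i assume "i < nat (int (m - 1))"
    then have "(deriv ^^ Suc i) (P \<circ> f) 0 = 0" by (intro higher_deriv_P_low) simp
    then show "(deriv ^^ i) (deriv (P \<circ> f)) 0 = 0" by (simp only: funpow_Suc_right comp_apply)
  qed simp
  ultimately show ?thesis by simp
qed

text \<open>The number depends on the germ and on \<open>r0\<close>, but not on the stabilisation;
  half of the parameters are counted because they come in pairs.\<close>

definition nodes :: "real \<Rightarrow> nat"
  where "nodes r0 = model_branch.double_order (\<lambda>z. Q (f (T z))) m r0 div 2"

definition region_good :: "(complex \<times> complex \<Rightarrow> complex \<times> complex) \<Rightarrow> nat \<Rightarrow> real \<Rightarrow> real \<Rightarrow> complex \<Rightarrow> bool"
  where "region_good F k r \<epsilon> s \<longleftrightarrow> rat_homology_dim 1 (top_of_set (disentanglement F r \<epsilon> s)) k \<and>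
    (stratified_morse P (\<lambda>x. F (x, s)) (source_dom F r \<epsilon> s) \<longrightarrow>
      card (stratified_critical_points P (\<lambda>x. F (x, s)) (source_dom F r \<epsilon> s)) = k + (m - 1))"

section \<open>Choice of the radii and independence of the stabilisation\<close>

lemma continuous_radial_growth: "continuous_on (ball 0 R) (radial_growth f)"
proof -
  have "continuous_on (ball 0 R) (\<lambda>x. fst (f x))" "continuous_on (ball 0 R) (\<lambda>x. snd (f x))"
    using holomorphic_on_imp_continuous_on[OF hol_f(1)] holomorphic_on_imp_continuous_on[OF hol_f(2)]
    by (simp_all add: comp_def)
  moreover have "continuous_on (ball 0 R) (deriv (fst \<circ> f))" "continuous_on (ball 0 R) (deriv (snd \<circ> f))"
    using holomorphic_on_imp_continuous_on[OF holomorphic_deriv[OF hol_f(1) open_ball]]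
      holomorphic_on_imp_continuous_on[OF holomorphic_deriv[OF hol_f(2) open_ball]] by simp_all
  ultimately show ?thesis unfolding radial_growth_def
    by (intro continuous_on_add continuous_on_inner continuous_on_mult) (simp_all add: continuous_on_id)
qed

lemma bound_on_cball:
  assumes "r < R"
  obtains M where "M > 0" "\<And>x. x \<in> cball 0 r \<Longrightarrow> norm (fst (f x)) \<le> M \<and> norm (snd (f x)) \<le> M \<and>
    norm (deriv (fst \<circ> f) x) \<le> M \<and> norm (deriv (snd \<circ> f) x) \<le> M"
proof -
  have sub: "cball (0::complex) r \<subseteq> ball 0 R" using assms by auto
  have "\<exists>M>0. \<forall>x\<in>cball 0 r. norm (h x) \<le> M" if "h holomorphic_on ball 0 R" for h :: "complex \<Rightarrow> complex"
  proof -
    have "compact (h ` cball 0 r)"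
      by (rule compact_continuous_image[OF continuous_on_subset[OF holomorphic_on_imp_continuous_on[OF that] sub] compact_cball])
    then obtain M where "M > 0" "\<forall>y\<in>h ` cball 0 r. norm y \<le> M" using compact_imp_bounded bounded_pos by blast
    then show ?thesis by auto
  qed
  note b = this
  obtain M1 where M1: "M1 > 0" "\<forall>x\<in>cball 0 r. norm ((fst \<circ> f) x) \<le> M1" using b[OF hol_f(1)] by blast
  obtain M2 where M2: "M2 > 0" "\<forall>x\<in>cball 0 r. norm ((snd \<circ> f) x) \<le> M2" using b[OF hol_f(2)] by blast
  obtain M3 where M3: "M3 > 0" "\<forall>x\<in>cball 0 r. norm (deriv (fst \<circ> f) x) \<le> M3" using b[OF holomorphic_deriv[OF hol_f(1) open_ball]] by blast
  obtain M4 where M4: "M4 > 0" "\<forall>x\<in>cball 0 r. norm (deriv (snd \<circ> f) x) \<le> M4" using b[OF holomorphic_deriv[OF hol_f(2) open_ball]] by blast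
  show ?thesis
  proof (rule that[of "M1 + M2 + M3 + M4"])
    show "M1 + M2 + M3 + M4 > 0" using M1(1) M2(1) M3(1) M4(1) by simp
    fix x :: complex assume x: "x \<in> cball 0 r"
    have "norm (fst (f x)) \<le> M1" "norm (snd (f x)) \<le> M2" "norm (deriv (fst \<circ> f) x) \<le> M3" "norm (deriv (snd \<circ> f) x) \<le> M4"
      using M1(2) M2(2) M3(2) M4(2) x by simp_all
    then show "norm (fst (f x)) \<le> M1 + M2 + M3 + M4 \<and> norm (snd (f x)) \<le> M1 + M2 + M3 + M4 \<and>
        norm (deriv (fst \<circ> f) x) \<le> M1 + M2 + M3 + M4 \<and> norm (deriv (snd \<circ> f) x) \<le> M1 + M2 + M3 + M4"
      using M1(1) M2(1) M3(1) M4(1) by (intro conjI; linarith)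
  qed
qed

text \<open>Lower bounds for the unperturbed germ on annuli are fixed first, and \<open>s\<close> is
  then so small that no perturbation exceeds them. The branch radius \<open>r0\<close> is
  independent of \<open>r\<close> and \<open>\<epsilon>\<close>, so the number of nodes is the same
  for all of them.\<close>

lemma region:
  assumes box: "box F A" and r0: "0 < r0" "5 * r0 \<le> RT" and sub: "T ` ball 0 (5 * r0) \<subseteq> ball 0 (A / 2)"
  shows "for_small (region_good F (nodes r0))"
proof -
  interpret M: model_branch "\<lambda>z. Q (f (T z))" m r0 by (rule model_branch[OF r0])
  have A: "0 < A" "A < R" using box by (auto simp: box_def)
  have r3: "0 < 3 * r0" "3 * r0 \<le> RT" using r0 by auto
  obtain r1 where r1: "0 < r1" "r1 \<le> R" "ball 0 r1 \<subseteq> T ` ball 0 (3 * r0)"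
    "\<And>x. 0 < norm x \<Longrightarrow> norm x < r1 \<Longrightarrow> radial_growth f x > 0"
    "\<And>x. 0 < norm x \<Longrightarrow> norm x < r1 \<Longrightarrow> deriv (P \<circ> f) x \<noteq> 0"
    using good_radius[OF r3] by blast
  show ?thesis
  proof (rule for_smallI[of "min r1 (A / 2)"])
    show "min r1 (A / 2) > 0" using r1(1) A by simp
    fix r :: real assume r: "0 < r" "r < min r1 (A / 2)"
    have rR: "r < R" "r < A" "r < A / 2" "r < r1" using r A by auto
    have annulus: "{x. \<rho> \<le> norm x \<and> norm x \<le> r} \<subseteq> ball (0::complex) R" for \<rho> using rR by auto
    \<comment> \<open>Injectivity keeps \<open>f\<close> away from 0 on the outer annulus. For
      \<open>\<epsilon> < \<mu> / 2\<close> the perturbed curve leaves the ball there, since its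
      deviation from \<open>f\<close> is at most \<open>\<epsilon> / 2\<close>.\<close>
    obtain \<mu> where \<mu>: "\<mu> > 0" "\<And>x. r / 2 \<le> norm x \<Longrightarrow> norm x \<le> r \<Longrightarrow> \<mu> \<le> norm (f x)"
    proof (rule continuous_positive_bound[OF compact_annulus[of "r / 2" r], of "\<lambda>x. norm (f x)"])
      show "continuous_on {x. r / 2 \<le> norm x \<and> norm x \<le> r} (\<lambda>x. norm (f x))"
        by (intro continuous_on_norm continuous_on_subset[OF continuous_f annulus])
      show "norm (f x) > 0" if "x \<in> {x. r / 2 \<le> norm x \<and> norm x \<le> r}" for x
      proof -
        have "x \<noteq> 0" using that r(1) by auto
        then have "f x \<noteq> f 0" using inj_onD[OF inj_f, of x 0] that rR R by auto
        then show ?thesis using f0 by simp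
      qed
      fix c assume "0 < c" "\<And>x. x \<in> {x. r / 2 \<le> norm x \<and> norm x \<le> r} \<Longrightarrow> c \<le> norm (f x)"
      then show thesis by (intro that) auto
    qed
    show "\<exists>e>0. \<forall>\<epsilon>. 0 < \<epsilon> \<and> \<epsilon> < e \<longrightarrow> (\<forall>\<^sub>F s in at 0. region_good F (nodes r0) r \<epsilon> s)"
    proof (intro exI[of _ "\<mu> / 2"] conjI allI impI)
      show "0 < \<mu> / 2" using \<mu>(1) by simp
      fix \<epsilon> :: real assume \<epsilon>: "0 < \<epsilon> \<and> \<epsilon> < \<mu> / 2"
      have "isCont f 0" using continuous_f R by (simp add: continuous_on_eq_continuous_at)
      then obtain \<rho>' where \<rho>': "\<rho>' > 0" "\<And>x. dist x 0 < \<rho>' \<Longrightarrow> dist (f x) (f 0) < \<epsilon> / 2"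
        using \<epsilon> unfolding continuous_at_eps_delta by (metis half_gt_zero)
      \<comment> \<open>Inside this disc \<open>f\<close> uses only half of the target ball. Outside
        it the bounds \<open>c\<close> and \<open>d\<close> exclude turning back and critical
        points.\<close>
      define \<rho> where "\<rho> = min \<rho>' (r / 2)"
      have \<rho>: "0 < \<rho>" "\<rho> < r" "\<And>x. norm x < \<rho> \<Longrightarrow> norm (f x) < \<epsilon> / 2"
        using \<rho>'(1) r(1) \<rho>'(2) f0 by (auto simp: \<rho>_def)
      obtain c where c: "c > 0" "\<And>x. \<rho> \<le> norm x \<Longrightarrow> norm x \<le> r \<Longrightarrow> c \<le> radial_growth f x"
      proof (rule continuous_positive_bound[OF compact_annulus[of \<rho> r], of "radial_growth f"])
        show "continuous_on {x. \<rho> \<le> norm x \<and> norm x \<le> r} (radial_growth f)"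
          by (rule continuous_on_subset[OF continuous_radial_growth annulus])
        show "radial_growth f x > 0" if "x \<in> {x. \<rho> \<le> norm x \<and> norm x \<le> r}" for x
          by (rule r1(4)) (use that \<rho>(1) rR(4) in auto)
        fix c assume "0 < c" "\<And>x. x \<in> {x. \<rho> \<le> norm x \<and> norm x \<le> r} \<Longrightarrow> c \<le> radial_growth f x"
        then show thesis by (intro that) auto
      qed
      obtain d where d: "d > 0" "\<And>x. \<rho> \<le> norm x \<Longrightarrow> norm x \<le> r \<Longrightarrow> d \<le> norm (deriv (P \<circ> f) x)"
      proof (rule continuous_positive_bound[OF compact_annulus[of \<rho> r], of "\<lambda>x. norm (deriv (P \<circ> f) x)"])
        show "continuous_on {x. \<rho> \<le> norm x \<and> norm x \<le> r} (\<lambda>x. norm (deriv (P \<circ> f) x))"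
          by (intro continuous_on_norm continuous_on_subset[OF
              holomorphic_on_imp_continuous_on[OF holomorphic_deriv[OF holomorphic_P_f open_ball]] annulus])
        show "norm (deriv (P \<circ> f) x) > 0" if "x \<in> {x. \<rho> \<le> norm x \<and> norm x \<le> r}" for x
        proof -
          have "deriv (P \<circ> f) x \<noteq> 0" by (rule r1(5)) (use that \<rho>(1) rR(4) in auto)
          then show ?thesis by simp
        qed
        fix c assume "0 < c" "\<And>x. x \<in> {x. \<rho> \<le> norm x \<and> norm x \<le> r} \<Longrightarrow> c \<le> norm (deriv (P \<circ> f) x)"
        then show thesis by (intro that) auto
      qed
      obtain B where B: "B > 0" "\<And>x. x \<in> cball 0 r \<Longrightarrow> norm (fst (f x)) \<le> B \<and> norm (snd (f x)) \<le> B \<and>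
          norm (deriv (fst \<circ> f) x) \<le> B \<and> norm (deriv (snd \<circ> f) x) \<le> B"
        using bound_on_cball[OF rR(1)] by blast
      \<comment> \<open>Each component moves \<open>radial_growth\<close> by at most
        \<open>\<eta> * r * (2 * B + 1) \<le> c / 4\<close>, so half of \<open>c\<close> remains.
        The entry \<open>\<epsilon> / 4\<close> bounds the deviation of the curve by
        \<open>\<epsilon> / 2\<close>.\<close>
      define \<eta> where "\<eta> = min 1 (min (\<epsilon> / 4) (c / (4 * r * (2 * B + 1))))"
      have pos: "0 < 4 * r * (2 * B + 1)" using r(1) B(1) by simp
      have "\<eta> \<le> c / (4 * r * (2 * B + 1))" by (simp add: \<eta>_def)
      then have "\<eta> * (4 * r * (2 * B + 1)) \<le> c" using pos by (simp only: pos_le_divide_eq)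
      moreover have "\<eta> * (4 * r * (2 * B + 1)) = 4 * (\<eta> * r * (2 * B + 1))" by simp
      ultimately have \<eta>c: "4 * (\<eta> * r * (2 * B + 1)) \<le> c" by linarith
      have \<eta>: "\<eta> > 0" "\<eta> \<le> 1" "4 * \<eta> \<le> \<epsilon>" using \<epsilon> c(1) pos by (auto simp: \<eta>_def)
      have "isCont T 0"
        using holomorphic_on_imp_continuous_on[OF T(1)] RT by (simp add: continuous_on_eq_continuous_at)
      \<comment> \<open>Double points are localised in the coordinate of \<open>T\<close>;
        \<open>\<rho>2\<close> transports this to the disc of radius \<open>\<rho>\<close> in the
        original coordinate.\<close>
      then obtain \<rho>2 where \<rho>2: "\<rho>2 > 0" "\<And>z. dist z 0 < \<rho>2 \<Longrightarrow> dist (T z) (T 0) < \<rho>"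
        using \<rho>(1) unfolding continuous_at_eps_delta by metis
      obtain e1 where e1: "e1 > 0" "\<And>a b t u. M.near e1 a b \<Longrightarrow> t \<in> cball 0 (3 * r0) \<Longrightarrow> u \<in> cball 0 (3 * r0) \<Longrightarrow>
          diff_quot a t u = 0 \<Longrightarrow> diff_quot b t u = 0 \<Longrightarrow> t \<in> ball 0 \<rho>2 \<and> u \<in> ball 0 \<rho>2"
        using M.near_localised[OF \<rho>2(1)] by blast
      obtain e2 where e2: "e2 > 0" "\<And>a b. M.near e2 a b \<Longrightarrow> M.nodal a b \<Longrightarrow>
          finite (M.self_meeting a b) \<and> card (M.self_meeting a b) = M.double_order"
        using M.card_self_meeting by blast
      have e12: "min e1 e2 > 0" using e1(1) e2(1) by simp
      have "\<forall>\<^sub>F s in at (0::complex). dist s 0 < A \<and> s \<noteq> 0"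
        unfolding eventually_at using A(1) by (intro exI[of _ A]) auto
      with eventually_near[OF box r0 sub e12] box_close[OF box \<eta>(1), of 1 0] box_close[OF box \<eta>(1), of 0 1]
        box_close[OF box d(1), of ca cb]
      show "\<forall>\<^sub>F s in at 0. region_good F (nodes r0) r \<epsilon> s"
      proof eventually_elim
        case (elim s)
        define g where "g = (\<lambda>x. F (x, s))"
        have st: "locally_stable_on g (ball 0 A)" using box elim unfolding box_def g_def by auto
        have near: "M.near (min e1 e2) (\<lambda>z. P (g (T z))) (\<lambda>z. Q (g (T z)))" using elim(1) unfolding g_def .
        have xA: "x \<in> ball 0 (A / 2)" if "norm x \<le> r" for x :: complex using that rR by simp
        have k1: "norm (fst (g x) - fst (f x)) \<le> \<eta>" "norm (deriv (fst \<circ> g) x - deriv (fst \<circ> f) x) \<le> \<eta>"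
          if "norm x \<le> r" for x
          using bspec[OF conjunct2[OF elim(2)] xA[OF that]] by (simp_all add: g_def comp_def)
        have k2: "norm (snd (g x) - snd (f x)) \<le> \<eta>" "norm (deriv (snd \<circ> g) x - deriv (snd \<circ> f) x) \<le> \<eta>"
          if "norm x \<le> r" for x
          using bspec[OF conjunct2[OF elim(3)] xA[OF that]] by (simp_all add: g_def comp_def)
        have k3: "norm (deriv (P \<circ> f) x - deriv (P \<circ> g) x) < d" if "norm x \<le> r" for x
          using bspec[OF conjunct2[OF elim(4)] xA[OF that]] unfolding P_comp g_def by (simp add: norm_minus_commute)
        have hPg: "(P \<circ> g) holomorphic_on ball 0 A" using elim(4) unfolding P_comp g_def by blast
        have gf: "norm (g x - f x) \<le> \<epsilon> / 2" if "norm x \<le> r" for x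
        proof -
          have "norm (g x - f x) \<le> norm (fst (g x - f x)) + norm (snd (g x - f x))"
            using norm_Pair_le[of "fst (g x - f x)" "snd (g x - f x)"] by (simp only: prod.collapse)
          then show ?thesis using k1(1)[OF that] k2(1)[OF that] \<eta>(3) by simp
        qed
        have small: "norm (g x) < \<epsilon>" if "norm x < \<rho>" for x
        proof -
          have "norm (g x) \<le> norm (f x) + norm (g x - f x)" by (rule norm_triangle_sub)
          then show ?thesis using gf[of x] \<rho>(2,3) that by force
        qed
        have large: "\<epsilon> \<le> norm (g x)" if "r / 2 < norm x" "norm x < r" for x
        proof -
          have "norm (f x) \<le> norm (g x) + norm (f x - g x)" by (rule norm_triangle_sub)
          moreover have "norm (f x - g x) \<le> \<epsilon> / 2" using gf[of x] that by (simp add: norm_minus_commute)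
          moreover have "\<mu> \<le> norm (f x)" using \<mu>(2)[of x] that by simp
          ultimately show ?thesis using \<epsilon> by linarith
        qed
        have grow: "radial_growth g x > 0" if x: "\<rho> \<le> norm x" "norm x < r" for x
        proof -
          have xr: "norm x \<le> r" "x \<in> cball 0 r" using x by auto
          have "\<bar>inner (fst (g x)) (x * deriv (fst \<circ> g) x) - inner (fst (f x)) (x * deriv (fst \<circ> f) x)\<bar> \<le> \<eta> * r * (2 * B + 1)"
            using k1[OF xr(1)] B(2)[OF xr(2)] \<eta>(2) xr(1) by (intro inner_mult_close) auto
          moreover have "\<bar>inner (snd (g x)) (x * deriv (snd \<circ> g) x) - inner (snd (f x)) (x * deriv (snd \<circ> f) x)\<bar> \<le> \<eta> * r * (2 * B + 1)"
            using k2[OF xr(1)] B(2)[OF xr(2)] \<eta>(2) xr(1) by (intro inner_mult_close) auto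
          moreover have "c \<le> radial_growth f x" using c(2)[OF x(1) xr(1)] .
          ultimately show ?thesis using \<eta>c c(1) unfolding radial_growth_def by linarith
        qed
        let ?N = "{t \<in> cball 0 (3 * r0). \<exists>u\<in>cball 0 (3 * r0). u \<noteq> t \<and> g (T u) = g (T t)}"
        have PQ_iff: "(P v = P w \<and> Q v = Q w) = (v = w)" for v w using PQ_inject by blast
        have N: "?N = M.self_meeting (\<lambda>z. P (g (T z))) (\<lambda>z. Q (g (T z)))"
          unfolding M.self_meeting_def PQ_iff ..
        have nod: "M.nodal (\<lambda>z. P (g (T z))) (\<lambda>z. Q (g (T z)))"
        proof (rule nodal[OF r0 _ st])
          show "T ` ball 0 (5 * r0) \<subseteq> ball 0 A" by (rule order_trans[OF sub]) (use A(1) in auto)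
        qed
        have finN: "finite ?N" and cardN: "card ?N = M.double_order"
          using e2(2)[OF M.near_mono[OF near] nod] unfolding N by simp_all
        have locN: "T ` ?N \<subseteq> ball 0 \<rho>"
        proof
          fix y assume "y \<in> T ` ?N"
          then obtain t u where t: "t \<in> cball 0 (3 * r0)" "u \<in> cball 0 (3 * r0)" "u \<noteq> t" "g (T u) = g (T t)" "y = T t" by blast
          then have "diff_quot (\<lambda>z. P (g (T z))) t u = 0" "diff_quot (\<lambda>z. Q (g (T z))) t u = 0"
            by (auto simp: diff_quot_def)
          then have "t \<in> ball 0 \<rho>2" using e1(2)[OF M.near_mono[OF near] t(1,2)] by simp
          then show "y \<in> ball 0 \<rho>" using \<rho>2(2)[of t] T(3) t(5) by simp
        qed
        have S: "inj_on T (cball 0 (3 * r0))" "ball 0 r \<subseteq> T ` cball 0 (3 * r0)"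
        proof -
          show "inj_on T (cball 0 (3 * r0))" by (rule inj_on_subset[OF T(2)]) (use r0 in auto)
          have "ball (0::complex) r \<subseteq> ball 0 r1" using rR(4) by auto
          also have "\<dots> \<subseteq> T ` ball 0 (3 * r0)" by (rule r1(3))
          also have "\<dots> \<subseteq> T ` cball 0 (3 * r0)" by (rule image_mono) auto
          finally show "ball 0 r \<subseteq> T ` cball 0 (3 * r0)" .
        qed
        have hd: "deriv (P \<circ> f) holomorphic_on ball 0 r" "deriv (P \<circ> g) holomorphic_on ball 0 r"
        proof -
          have "ball (0::complex) r \<subseteq> ball 0 R" "ball (0::complex) r \<subseteq> ball 0 A" using rR by auto
          then show "deriv (P \<circ> f) holomorphic_on ball 0 r" "deriv (P \<circ> g) holomorphic_on ball 0 r"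
            using holomorphic_on_subset[OF holomorphic_deriv[OF holomorphic_P_f open_ball]]
              holomorphic_on_subset[OF holomorphic_deriv[OF hPg open_ball]] by simp_all
        qed
        have less: "norm (deriv (P \<circ> f) z - deriv (P \<circ> g) z) < norm (deriv (P \<circ> f) z)" if "\<rho> \<le> norm z" "norm z \<le> r" for z
          using k3[OF that(2)] d(2)[OF that] by linarith
        have less': "norm (deriv (P \<circ> f) z - deriv (P \<circ> g) z) < norm (deriv (P \<circ> f) z)" if "dist 0 z = \<rho>" for z
          using less[of z] that \<rho>(2) by simp
        have finZ: "finite {x \<in> ball 0 \<rho>. deriv (P \<circ> g) x = 0}"
          by (rule zero_order_sum_eq(2)[OF hd \<rho>(1,2)]) (rule less')
        have eqZ: "(\<Sum>x\<in>{x \<in> ball 0 \<rho>. deriv (P \<circ> f) x = 0}. zorder (deriv (P \<circ> f)) x) =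
            (\<Sum>x\<in>{x \<in> ball 0 \<rho>. deriv (P \<circ> g) x = 0}. zorder (deriv (P \<circ> g)) x)"
          by (rule zero_order_sum_eq(3)[OF hd \<rho>(1,2)]) (rule less')
        have nz: "deriv (P \<circ> g) x \<noteq> 0" if "\<rho> \<le> norm x" "norm x < r" for x
          using less[of x] that by auto
        have sumZ: "(\<Sum>x\<in>{x \<in> ball 0 \<rho>. deriv (P \<circ> g) x = 0}. zorder (deriv (P \<circ> g)) x) = int (m - 1)"
        proof -
          have "(\<Sum>x\<in>{x \<in> ball 0 \<rho>. deriv (P \<circ> f) x = 0}. zorder (deriv (P \<circ> f)) x) = int (m - 1)"
            by (rule zorder_sum[OF \<rho>(1)], rule r1(5)) (use \<rho>(2) rR(4) in auto)
          then show ?thesis by (rule trans[OF eqZ[symmetric]])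
        qed
        have P: "P = (\<lambda>z. ca * fst z + cb * snd z)" by (simp add: P_def fun_eq_iff)
        have D: "source_dom F r \<epsilon> s = {x \<in> ball 0 r. g x \<in> ball 0 \<epsilon>}" by (simp add: source_dom_def g_def)
        have dis: "disentanglement F r \<epsilon> s = g ` source_dom F r \<epsilon> s" by (simp add: disentanglement_def g_def)
        note concl = region_conclusion[OF st rR(2) \<rho>(1,2) S small large grow refl finN cardN locN P nz finZ sumZ D]
        show ?case
          unfolding region_good_def nodes_def dis using concl unfolding g_def by blast
      qed
    qed
  qed
qed

lemma exists_branch_radius:
  assumes "A > 0"
  obtains r0 where "0 < r0" "5 * r0 \<le> RT" "T ` ball 0 (5 * r0) \<subseteq> ball 0 A"
proof -
  have "isCont T 0"
    using holomorphic_on_imp_continuous_on[OF T(1)] RT by (simp add: continuous_on_eq_continuous_at)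
  then obtain e where e: "e > 0" "\<And>z. dist z 0 < e \<Longrightarrow> dist (T z) (T 0) < A"
    using assms unfolding continuous_at_eps_delta by metis
  show ?thesis
  proof (rule that[of "min e RT / 5"])
    show "T ` ball 0 (5 * (min e RT / 5)) \<subseteq> ball 0 A" using e(2) T(3) by auto
  qed (use e(1) RT in auto)
qed

text \<open>One branch radius that fits both boxes gives both stabilisations the same count
  \<open>nodes r0\<close>, without a proof that \<open>nodes\<close> is independent of the
  radius.\<close>

lemma common_region:
  assumes "stabilisation f F" "stabilisation f F'"
  obtains k where "for_small (region_good F k)" "for_small (region_good F' k)"
proof -
  obtain A1 A2 where A: "box F A1" "box F' A2" using stabilisation_box assms by metis
  define A where "A = min A1 A2"
  have "A > 0" "A \<le> A1" "A \<le> A2" using A by (auto simp: A_def box_def)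
  then have b: "box F A" "box F' A" and "A / 2 > 0" using box_mono A by auto
  obtain r0 where r0: "0 < r0" "5 * r0 \<le> RT" "T ` ball 0 (5 * r0) \<subseteq> ball 0 (A / 2)"
    by (rule exists_branch_radius[OF \<open>A / 2 > 0\<close>]) (rule that)
  show ?thesis by (rule that[OF region[OF b(1) r0] region[OF b(2) r0]])
qed

text \<open>The description is well defined because any stabilisation shares a count with the given
  one, and the dimension for the given one is unique.\<close>

lemma region_good_image_milnor_number:
  assumes F: "stabilisation f F"
  shows "for_small (region_good F (image_milnor_number f))"
proof -
  obtain k where k: "for_small (region_good F k)" using common_region[OF F F] by blast
  have dim: "for_small (\<lambda>r \<epsilon> s. rat_homology_dim 1 (top_of_set (disentanglement F r \<epsilon> s)) k)"
    if "for_small (region_good F k)" for F k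
    using that by (rule for_small_mono) (simp add: region_good_def)
  have "image_milnor_number f = k"
    unfolding image_milnor_number_def
  proof (rule the_equality)
    show "\<forall>F. stabilisation f F \<longrightarrow> for_small (\<lambda>r \<epsilon> s. rat_homology_dim 1 (top_of_set (disentanglement F r \<epsilon> s)) k)"
    proof (intro allI impI)
      fix F' assume "stabilisation f F'"
      then obtain k' where k': "for_small (region_good F k')" "for_small (region_good F' k')"
        using common_region[OF F] by blast
      have "k' = k" by (rule for_small_dim_unique[OF dim[OF k'(1)] dim[OF k]])
      then show "for_small (\<lambda>r \<epsilon> s. rat_homology_dim 1 (top_of_set (disentanglement F' r \<epsilon> s)) k)"
        using dim[OF k'(2)] by simp
    qed
    fix \<mu> assume "\<forall>F. stabilisation f F \<longrightarrow> for_small (\<lambda>r \<epsilon> s. rat_homology_dim 1 (top_of_set (disentanglement F r \<epsilon> s)) \<mu>)"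
    then have "for_small (\<lambda>r \<epsilon> s. rat_homology_dim 1 (top_of_set (disentanglement F r \<epsilon> s)) \<mu>)" using F by blast
    then show "\<mu> = k" by (rule for_small_dim_unique[OF _ dim[OF k]])
  qed
  then show ?thesis using k by simp
qed

end

theorem theorem3p1:
  fixes f :: "complex \<Rightarrow> complex \<times> complex"
    and F :: "complex \<times> complex \<Rightarrow> complex \<times> complex"
    and p :: "complex \<times> complex \<Rightarrow> complex"
  assumes "map_germ f"
    and "corank_one f"
    and "finitely_determined f"
    and "stabilisation f F"
    and "linear_projection p"
    and "generic_kernel f p"
  shows "for_small (\<lambda>r \<epsilon> s.
    stratified_morse p (\<lambda>x. F (x, s)) (source_dom F r \<epsilon> s) \<longrightarrow>
    card (stratified_critical_points p (\<lambda>x. F (x, s)) (source_dom F r \<epsilon> s)) =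
      image_milnor_number f + multiplicity_germ f - 1)"
proof -
  obtain a b where p: "p = (\<lambda>z. a * fst z + b * snd z)"
    using assms(5) unfolding linear_projection_def by blast
  obtain R0 where R0: "R0 > 0" "(fst \<circ> f) holomorphic_on ball 0 R0" "(snd \<circ> f) holomorphic_on ball 0 R0" and f0: "f 0 = 0"
    using map_germ_components[OF assms(1)] by blast
  obtain \<rho> where \<rho>: "\<rho> > 0" "inj_on f (ball 0 \<rho>)" using finitely_determined_injective[OF assms(1,3)] by blast
  define R where "R = min R0 \<rho>"
  have R: "R > 0" "ball (0::complex) R \<subseteq> ball 0 R0" "ball (0::complex) R \<subseteq> ball 0 \<rho>" using R0(1) \<rho>(1) by (auto simp: R_def)
  have h: "(fst \<circ> f) holomorphic_on ball 0 R" "(snd \<circ> f) holomorphic_on ball 0 R"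
    using holomorphic_on_subset[OF R0(2) R(2)] holomorphic_on_subset[OF R0(3) R(2)] by simp_all
  have inj: "inj_on f (ball 0 R)" by (rule inj_on_subset[OF \<rho>(2) R(3)])
  have z: "(0::complex) \<in> ball 0 R" using R(1) by simp
  obtain m where mult: "multiplicity_germ f = m" and m1: "m \<ge> 1"
    and low: "\<And>i. i < m \<Longrightarrow> (deriv ^^ i) (fst \<circ> f) 0 = 0 \<and> (deriv ^^ i) (snd \<circ> f) 0 = 0"
    and nz: "(deriv ^^ m) (fst \<circ> f) 0 \<noteq> 0 \<or> (deriv ^^ m) (snd \<circ> f) 0 \<noteq> 0"
    using multiplicity_germ_order[OF h R(1) f0 inj] by blast
  \<comment> \<open>Otherwise the leading coefficient, a nonzero vector of the tangent cone, would
    lie in the kernel of \<open>p\<close>. So projection does not raise the order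
    \<open>m\<close>.\<close>
  have top: "a * (deriv ^^ m) (fst \<circ> f) 0 + b * (deriv ^^ m) (snd \<circ> f) 0 \<noteq> 0"
  proof
    assume e: "a * (deriv ^^ m) (fst \<circ> f) 0 + b * (deriv ^^ m) (snd \<circ> f) 0 = 0"
    let ?v = "((deriv ^^ m) (fst \<circ> f) 0 / fact m, (deriv ^^ m) (snd \<circ> f) 0 / fact m)"
    have "?v \<in> tangent_cone f" by (rule leading_coefficient_in_tangent_cone[OF h open_ball z low])
    moreover have "p ?v = (a * (deriv ^^ m) (fst \<circ> f) 0 + b * (deriv ^^ m) (snd \<circ> f) 0) / fact m"
      by (simp add: p add_divide_distrib)
    ultimately have "?v = 0" using assms(6) e unfolding generic_kernel_def by simp
    then show False using nz by (simp add: zero_prod_def)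
  qed
  define k where "k = (\<lambda>x. a * (fst \<circ> f) x + b * (snd \<circ> f) x)"
  have hk: "k holomorphic_on ball 0 R" unfolding k_def by (intro holomorphic_intros h)
  have dk: "(deriv ^^ i) k 0 = a * (deriv ^^ i) (fst \<circ> f) 0 + b * (deriv ^^ i) (snd \<circ> f) 0" for i
  proof -
    have "(deriv ^^ i) k 0 = (deriv ^^ i) (\<lambda>x. a * (fst \<circ> f) x) 0 + (deriv ^^ i) (\<lambda>x. b * (snd \<circ> f) x) 0"
      unfolding k_def by (rule higher_deriv_add[OF _ _ open_ball z]) (intro holomorphic_intros h)+
    then show ?thesis
      by (simp only: higher_deriv_cmult[OF h(1) z open_ball] higher_deriv_cmult[OF h(2) z open_ball])
  qed
  have k0: "k 0 = 0" using f0 by (simp add: k_def)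
  have kk: "m > 0" "(deriv ^^ m) k 0 \<noteq> 0" "\<And>i. i < m \<Longrightarrow> (deriv ^^ i) k 0 = 0"
    using m1 top low by (simp_all add: dk)
  obtain T RT where T: "RT > 0" "T holomorphic_on ball 0 RT" "inj_on T (ball 0 RT)" "T 0 = 0"
    "T ` ball 0 RT \<subseteq> ball 0 R" "\<And>z. z \<in> ball 0 RT \<Longrightarrow> k (T z) = z ^ m"
  proof (rule power_coordinate[OF hk open_ball z k0 kk(1,2)])
    show "(deriv ^^ i) k 0 = 0" if "i < m" for i by (rule kk(3)[OF that])
    fix T R' assume "R' > 0" "T holomorphic_on ball 0 R'" "inj_on T (ball 0 R')" "T 0 = 0"
      "T ` ball 0 R' \<subseteq> ball 0 R" "\<And>z. z \<in> ball 0 R' \<Longrightarrow> k (T z) = z ^ m"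
    then show thesis by (rule that)
  qed
  interpret projected_germ f a b m R T RT
    by unfold_locales (use R(1) h f0 inj m1 low top T in \<open>auto simp: k_def\<close>)
  have pP: "p = P" by (simp add: p P_def fun_eq_iff)
  \<comment> \<open>The subtraction is one of natural numbers; \<open>m \<ge> 1\<close> allows
    moving the 1 from the sum to \<open>m\<close>.\<close>
  show ?thesis
    using region_good_image_milnor_number[OF assms(4)]
    by (rule for_small_mono) (use m1 in \<open>simp add: region_good_def pP mult\<close>)
qed

end
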